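(* Assume the Exponential Time Hypothesis. There is a constant $\alpha>1$ such that, with \[ \mu(n):=2^{\,o\left(\left(2^{(\log n)^{1/\alpha}}/8\right)^{1/2}\right)} \] (a time bound which is $o\bigl(2^{n^{1/(\log\log n)^C}}\bigr)$ for every constant $C\ge 1$), the minimum number of clauses and the minimum number of literals of pure Horn functions in $n$ variables cannot be approximated in time $\mu(n)$ to within factors of $O(\log n)$, even when the input is restricted to pure Horn 3-CNFs with $O(n^2)$ clauses.
   Context: Exponential Time Hypothesis (ETH): for $k\ge 3$ let $s_k$ be the infimum of all $\delta$ such that there is an $O(2^{\delta n})$-time algorithm deciding satisfiability of $k$-CNF formulas on $n$ variables; ETH states $s_k>0$ for all $k\geq 3$. A clause is pure (definite) Horn if it contains exactly one positive literal; a pure Horn CNF is a conjunction of such clauses, a 3-CNF if every clause has at most three literals; a Boolean function is pure Horn if some pure Horn CNF represents it. The number of literals of a CNF is the total number of literal occurrences. The problems: given a pure Horn 3-CNF representing a pure Horn function $h$, determine the minimum number of clauses, resp. literals, of a pure Horn (3-)CNF representation of $h$. Logarithms are base 2. *)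

theory Defs
  imports Complex_Main "HOL-Library.Landau_Symbols" "HOL-Library.Extended_Real"
begin

section \<open>CNF formulas\<close>

datatype literal = Pos nat | Neg nat

type_synonym clause = "literal list"
type_synonym cnf = "clause list"

primrec lit_var :: "literal \<Rightarrow> nat" where
  "lit_var (Pos v) = v"
| "lit_var (Neg v) = v"

primrec lit_true :: "(nat \<Rightarrow> bool) \<Rightarrow> literal \<Rightarrow> bool" where
  "lit_true a (Pos v) = a v"
| "lit_true a (Neg v) = (\<not> a v)"

text \<open>
  A clause is a set of literals and a CNF is a set of clauses. They are written as lists, because
  machines read them as words, but repetitions are excluded; otherwise the length of a CNF would
  not be bounded in terms of its number of variables. The variables are \<open>0, \<dots>, n - 1\<close>, and
  not all of them need occur.
\<close>
definition cnf_on :: "nat \<Rightarrow> cnf \<Rightarrow> bool" where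
  "cnf_on n \<phi> \<longleftrightarrow> distinct (map set \<phi>) \<and>
     (\<forall>C\<in>set \<phi>. distinct C \<and> (\<forall>l\<in>set C. lit_var l < n))"

definition is_kcnf :: "nat \<Rightarrow> cnf \<Rightarrow> bool" where
  "is_kcnf k \<phi> \<longleftrightarrow> (\<forall>C\<in>set \<phi>. length C \<le> k)"

definition cnf_fun :: "cnf \<Rightarrow> (nat \<Rightarrow> bool) \<Rightarrow> bool" where
  "cnf_fun \<phi> a \<longleftrightarrow> (\<forall>C\<in>set \<phi>. \<exists>l\<in>set C. lit_true a l)"

definition satisfiable :: "cnf \<Rightarrow> bool" where
  "satisfiable \<phi> \<longleftrightarrow> (\<exists>a. cnf_fun \<phi> a)"

definition pure_horn_clause :: "clause \<Rightarrow> bool" where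
  "pure_horn_clause C \<longleftrightarrow> (\<exists>!v. Pos v \<in> set C)"

definition pure_horn_cnf :: "cnf \<Rightarrow> bool" where
  "pure_horn_cnf \<phi> \<longleftrightarrow> (\<forall>C\<in>set \<phi>. pure_horn_clause C)"

definition num_clauses :: "cnf \<Rightarrow> nat" where
  "num_clauses \<phi> = length \<phi>"

definition num_literals :: "cnf \<Rightarrow> nat" where
  "num_literals \<phi> = (\<Sum>C\<leftarrow>\<phi>. length C)"

text \<open>
  The minimum of \<open>N\<close> over the pure Horn CNFs in the class \<open>R\<close> that represent the Boolean
  function \<open>h\<close> of \<open>n\<close> variables. It is used with \<open>R\<close> the class of all CNFs or of 3-CNFs.
\<close>
definition min_pure_horn ::
  "cnf set \<Rightarrow> (cnf \<Rightarrow> nat) \<Rightarrow> nat \<Rightarrow> ((nat \<Rightarrow> bool) \<Rightarrow> bool) \<Rightarrow> nat" where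
  "min_pure_horn R N n h =
     (LEAST m. \<exists>\<psi>\<in>R. cnf_on n \<psi> \<and> pure_horn_cnf \<psi> \<and> cnf_fun \<psi> = h \<and> N \<psi> = m)"


section \<open>Deterministic multi-tape Turing machines\<close>

text \<open>
  States are \<open>0, \<dots>, num_states - 1\<close>, where \<open>0\<close> is the start state and \<open>1\<close> the halting state.
  Tape symbols are \<open>0, \<dots>, num_syms - 1\<close>, where \<open>0\<close> is the blank and \<open>1, \<dots>, 5\<close> are used for
  input and output. Tapes are infinite in both directions. From the state and the symbols scanned,
  \<open>delta\<close> gives the new state and, for each tape, the symbol to write and the head movement.
\<close>
record tm =
  num_tapes :: nat
  num_states :: nat
  num_syms :: nat
  delta :: "nat \<Rightarrow> nat list \<Rightarrow> nat \<times> (nat \<times> int) list"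

definition wf_tm :: "tm \<Rightarrow> bool" where
  "wf_tm M \<longleftrightarrow> num_tapes M \<ge> 1 \<and> num_states M \<ge> 2 \<and> num_syms M \<ge> 6 \<and>
     (\<forall>q ss. q < num_states M \<longrightarrow> length ss = num_tapes M \<longrightarrow> (\<forall>s\<in>set ss. s < num_syms M) \<longrightarrow>
        (case delta M q ss of (q', acts) \<Rightarrow>
           q' < num_states M \<and> length acts = num_tapes M \<and>
           (\<forall>(s, d)\<in>set acts. s < num_syms M \<and> d \<in> {-1, 0, 1})))"

type_synonym tape = "(int \<Rightarrow> nat) \<times> int"
type_synonym config = "nat \<times> tape list"

fun scanned :: "tape \<Rightarrow> nat" where
  "scanned (t, p) = t p"

fun act :: "nat \<times> int \<Rightarrow> tape \<Rightarrow> tape" where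
  "act (s, d) (t, p) = (t(p := s), p + d)"

fun step :: "tm \<Rightarrow> config \<Rightarrow> config" where
  "step M (q, ts) =
     (if q = 1 then (q, ts)
      else case delta M q (map scanned ts) of (q', acts) \<Rightarrow> (q', map2 act acts ts))"

definition word_tape :: "nat list \<Rightarrow> tape" where
  "word_tape w = (\<lambda>i. if 0 \<le> i \<and> i < int (length w) then w ! nat i else 0, 0)"

definition init_config :: "tm \<Rightarrow> nat list \<Rightarrow> config" where
  "init_config M w = (0, word_tape w # replicate (num_tapes M - 1) (word_tape []))"

text \<open>
  The output is read on the last tape, from position \<open>0\<close> up to the first blank.
\<close>
definition halted_with :: "config \<Rightarrow> nat list \<Rightarrow> bool" where
  "halted_with c v \<longleftrightarrow> fst c = 1 \<and> 0 \<notin> set v \<and>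
     (\<forall>i<length v. fst (last (snd c)) (int i) = v ! i) \<and>
     fst (last (snd c)) (int (length v)) = 0"

definition outputs_within :: "tm \<Rightarrow> nat list \<Rightarrow> nat list \<Rightarrow> real \<Rightarrow> bool" where
  "outputs_within M w v T \<longleftrightarrow>
     (\<exists>t::nat. real t \<le> T \<and> halted_with ((step M ^^ t) (init_config M w)) v)"


section \<open>Encodings\<close>

text \<open>Binary numerals, least significant digit first, with symbol 1 for 0 and symbol 2 for 1.\<close>
fun bin :: "nat \<Rightarrow> nat list" where
  "bin n = (if n = 0 then [] else (if odd n then 2 else 1) # bin (n div 2))"

declare bin.simps [simp del]

primrec enc_lit :: "literal \<Rightarrow> nat list" where
  "enc_lit (Pos v) = 3 # bin v"
| "enc_lit (Neg v) = 4 # bin v"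

definition enc_cnf :: "nat \<Rightarrow> cnf \<Rightarrow> nat list" where
  "enc_cnf n \<phi> = bin n @ concat (map (\<lambda>C. 5 # concat (map enc_lit C)) \<phi>)"


section \<open>The Exponential Time Hypothesis\<close>

definition decides_ksat_in :: "tm \<Rightarrow> nat \<Rightarrow> (nat \<Rightarrow> real) \<Rightarrow> bool" where
  "decides_ksat_in M k T \<longleftrightarrow>
     (\<forall>n \<phi>. cnf_on n \<phi> \<and> is_kcnf k \<phi> \<longrightarrow>
        outputs_within M (enc_cnf n \<phi>) (if satisfiable \<phi> then [2] else [1]) (T n))"

text \<open>The infimum is taken in the extended reals, so that it needs no side conditions.\<close>
definition sat_exponent :: "nat \<Rightarrow> ereal" where
  "sat_exponent k =
     (INF \<delta>\<in>{\<delta>::real. \<exists>M T. wf_tm M \<and> T \<in> O(\<lambda>n. 2 powr (\<delta> * real n)) \<and> decides_ksat_in M k T}.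
        ereal \<delta>)"

definition ETH :: bool where
  "ETH \<longleftrightarrow> (\<forall>k\<ge>3. sat_exponent k > 0)"


section \<open>Approximation\<close>

text \<open>
  \<open>I\<close> is the class of admissible inputs, \<open>opt n \<phi>\<close> the quantity to be approximated, \<open>f\<close> the
  approximation factor and \<open>T\<close> the time bound, the latter two as functions of the number of
  variables.
\<close>
definition approximates_in ::
  "tm \<Rightarrow> (nat \<Rightarrow> cnf \<Rightarrow> bool) \<Rightarrow> (nat \<Rightarrow> cnf \<Rightarrow> nat) \<Rightarrow> (nat \<Rightarrow> real) \<Rightarrow> (nat \<Rightarrow> real) \<Rightarrow> bool" where
  "approximates_in M I opt f T \<longleftrightarrow>
     (\<forall>n \<phi>. I n \<phi> \<longrightarrow>
        (\<exists>v. outputs_within M (enc_cnf n \<phi>) (bin v) (T n) \<and>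
             opt n \<phi> \<le> v \<and> real v \<le> f n * real (opt n \<phi>)))"

definition horn_3cnf_input :: "real \<Rightarrow> nat \<Rightarrow> cnf \<Rightarrow> bool" where
  "horn_3cnf_input K n \<phi> \<longleftrightarrow> cnf_on n \<phi> \<and> pure_horn_cnf \<phi> \<and> is_kcnf 3 \<phi> \<and>
     real (num_clauses \<phi>) \<le> K * real n ^ 2"

text \<open>The class of time bounds denoted by a power of two with a little-o exponent.\<close>
definition mu :: "real \<Rightarrow> (nat \<Rightarrow> real) set" where
  "mu \<alpha> = {\<lambda>n. 2 powr \<tau> n | \<tau>.
     \<tau> \<in> o(\<lambda>n. (2 powr (log 2 (real n) powr (1 / \<alpha>)) / 8) powr (1 / 2))}"

end

theory Submission
  imports Defs "HOL-Real_Asymp.Real_Asymp" "HOL-Computational_Algebra.Computational_Algebra"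
    "HOL-Number_Theory.Cong"
begin

text \<open>
  For large \<open>\<alpha>\<close> the time bound at \<open>2 ^ poly (log n)\<close> is still \<open>2 ^ o(n)\<close>, so a reduction from 3-SAT
  may blow up \<open>n\<close> variables to \<open>2 ^ poly (log n)\<close> many, and no PCP theorem is needed. Put
  \<open>l = O(log n)\<close>, place the Boolean variables on the cube inside \<open>GF(p) ^ l\<close> for a prime
  \<open>p\<close> polynomial in \<open>l\<close>, and attach to every point a list of values, at most \<open>A = l ^ 5\<close> on
  average. The lists are pruned: a value at \<open>y\<close> survives a round if for every triple \<open>(a, b, c)\<close> some
  polynomial on the flat through \<open>y, a, b, c\<close> takes it at \<open>y\<close>, takes surviving values elsewhere,
  and falsifies no clause whose variables lie at \<open>a, b, c\<close>. The multilinear extension of a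
  satisfying assignment survives with lists of length 1. Conversely, if something survives
  \<open>2 A + 3\<close> rounds, then in some round the maximal length of the lists does not drop; at a point
  where the maximum is attained, the surviving polynomials on a flat are determined by their value
  at that point, and fixing this value glues them to a satisfying assignment.

  Pruning is monotone, so it is computed by a definite Horn formula in which sets of pairs of a
  point and a value imply further pairs. Many selector variables that imply all these pairs make
  the size of a smallest representation proportional to the least number of pairs that generate the
  others, which is the least total length of lists that survive. This gives a gap of
  \<open>l ^ 5 / 8\<close>, whereas the logarithm of the number of variables is \<open>O(l ^ 4)\<close>.
\<close>


section \<open>Low-degree functions and list pruning\<close>

text \<open>The lists are short only on average, so a single list may start out long. One round
  already cuts every list to \<open>2 * A\<close>: a longer one would force lists longer than
  \<open>2 * A\<close> at most points of every line through its point, while some line has average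
  at most \<open>A\<close>. From there the maximal length can drop at most \<open>2 * A\<close>
  times, hence a number of rounds linear in \<open>A\<close>. The exponent \<alpha> = 10 comes from
  \<open>log N \<le> 15 * l ^ 4 \<le> l ^ 5\<close>: the assumed algorithm then takes at most 2 to
  the power \<open>2 powr sqrt l\<close> steps, which is subexponential in \<open>n\<close> as
  \<open>l = O(log n)\<close>. The reduction itself may take any time 2 ^ polylog(n), so machines
  with unary registers are fast enough. On the Horn side the obstacle is that a small representation
  may consist of clauses unrelated to the given ones. Only clauses with exactly one selector among
  their premises are counted; their heads must generate all pairs, whatever else the formula
  contains.\<close>

lemma poly_zero_mod_prime:
  fixes P :: "int poly" and p :: int
  assumes "prime p" "degree P \<le> d" "finite B" "card B > d" "B \<subseteq> {0..<p}"
    and "\<And>s. s \<in> B \<Longrightarrow> p dvd poly P s"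
  shows "p dvd poly P s"
  using assms(2-)
proof (induction d arbitrary: P B s)
  case 0
  then obtain b where "b \<in> B" by fastforce
  then have "p dvd poly P b" using 0 by auto
  moreover obtain c where "P = [:c:]" using 0(1) degree_0_id by (metis le_zero_eq degree_eq_zeroE)
  ultimately show ?case by simp
next
  case (Suc d)
  then obtain r where r: "r \<in> B" by fastforce
  \<comment> \<open>Root counting over the field of residues: \<open>P\<close> minus its value at
    \<open>r\<close> is divisible by \<open>x - r\<close>, and modulo \<open>p\<close> the factor
    \<open>s - r\<close> is invertible for every other \<open>s\<close> in \<open>B\<close>.\<close>
  let ?Q = "synthetic_div P r"
  have P: "poly P x = (x - r) * poly ?Q x + poly P r" for x
    using arg_cong[OF synthetic_div_correct'[of r P], of "\<lambda>q. poly q x"] by (simp add: algebra_simps)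
  have "p dvd poly ?Q x" for x
  proof (rule Suc.IH[of ?Q "B - {r}"])
    show "degree ?Q \<le> d" using Suc.prems(1) by (simp add: degree_synthetic_div)
    show "d < card (B - {r})" using Suc.prems(2,3) r by simp
    fix s assume s: "s \<in> B - {r}"
    then have "p dvd poly P s" "p dvd poly P r" using Suc.prems(5) r by auto
    then have "p dvd (s - r) * poly ?Q s" using P[of s] by (metis dvd_add_left_iff)
    moreover have "\<not> p dvd s - r"
    proof
      assume "p dvd s - r"
      moreover have "s \<in> {0..<p}" "r \<in> {0..<p}" using s r Suc.prems(4) by auto
      then have "\<bar>s - r\<bar> < p" by auto
      ultimately show False using s by (metis abs_dvd_iff dvd_imp_le_int DiffE abs_ge_self eq_iff_diff_eq_0 insertI1 linorder_not_le order_trans)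
    qed
    ultimately show "p dvd poly ?Q s" using assms(1) prime_dvd_multD by blast
  qed (use Suc.prems in auto)
  then show ?case using P[of s] Suc.prems(5)[OF r] by simp
qed

text \<open>The equation makes \<open>f s\<close> the reduced representative, so equality of two
  values is the same as congruence modulo \<open>p\<close>.\<close>

definition low_degree :: "nat \<Rightarrow> nat \<Rightarrow> (nat \<Rightarrow> nat) \<Rightarrow> bool" where
  "low_degree p d f \<longleftrightarrow> (\<exists>a::nat \<Rightarrow> int. \<forall>s<p. int (f s) = (\<Sum>i\<le>d. a i * int s ^ i) mod int p)"

text \<open>With more than \<open>d\<close> agreements the difference of the two integer polynomials
  would vanish modulo \<open>p\<close> at too many points, hence also at \<open>s0\<close>.\<close>

lemma card_agree_low_degree:
  assumes p: "prime p" and "low_degree p d f" "low_degree p d g" and s0: "s0 < p" "f s0 \<noteq> g s0"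
  shows "card {s. s < p \<and> f s = g s} \<le> d"
proof (rule ccontr)
  assume gt: "\<not> ?thesis"
  obtain a where a: "\<forall>s<p. int (f s) = (\<Sum>i\<le>d. a i * int s ^ i) mod int p"
    using assms(2) by (auto simp: low_degree_def)
  obtain b where b: "\<forall>s<p. int (g s) = (\<Sum>i\<le>d. b i * int s ^ i) mod int p"
    using assms(3) by (auto simp: low_degree_def)
  define P where "P = (\<Sum>i\<le>d. monom (a i - b i) i)"
  have P: "poly P x = (\<Sum>i\<le>d. a i * x ^ i) - (\<Sum>i\<le>d. b i * x ^ i)" for x
    by (simp add: P_def poly_sum poly_monom left_diff_distrib sum_subtractf)
  have eq: "f s = g s \<longleftrightarrow> int p dvd poly P (int s)" if "s < p" for s
  proof -
    have "f s = g s \<longleftrightarrow> int (f s) = int (g s)" by simp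
    also have "\<dots> \<longleftrightarrow> int p dvd poly P (int s)"
      using a b that by (simp add: P mod_eq_dvd_iff)
    finally show ?thesis .
  qed
  let ?B = "int ` {s. s < p \<and> f s = g s}"
  have "int p dvd poly P (int s0)"
  proof (rule poly_zero_mod_prime[of "int p" P d ?B])
    show "degree P \<le> d" unfolding P_def
      by (intro degree_sum_le) (auto intro: order_trans[OF degree_monom_le])
    show "d < card ?B" using gt by (simp add: card_image)
  qed (use p eq in auto)
  then show False using eq s0 by simp
qed

section \<open>Agreement and separation in three variables\<close>

definition low_degree3 :: "nat \<Rightarrow> nat \<Rightarrow> (nat \<Rightarrow> nat \<Rightarrow> nat \<Rightarrow> nat) \<Rightarrow> bool" where
  "low_degree3 p d f \<longleftrightarrow> (\<forall>s<p. \<forall>t<p. low_degree p d (f s t) \<and> low_degree p d (\<lambda>x. f s x t) \<and>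
     low_degree p d (\<lambda>x. f x s t))"

definition differ :: "nat \<Rightarrow> (nat \<Rightarrow> nat \<Rightarrow> nat \<Rightarrow> nat) \<Rightarrow> (nat \<Rightarrow> nat \<Rightarrow> nat \<Rightarrow> nat) \<Rightarrow> bool" where
  "differ p f g \<longleftrightarrow> (\<exists>s<p. \<exists>t<p. \<exists>u<p. f s t u \<noteq> g s t u)"

definition cube :: "nat \<Rightarrow> (nat \<times> nat \<times> nat) set" where
  "cube p = {..<p} \<times> {..<p} \<times> {..<p}"

text \<open>A counting form of the Schwartz-Zippel lemma. Starting from a point of disagreement, the
  coordinates are replaced one at a time; a point of agreement is charged to a replacement that
  turns disagreement into agreement. Such a replacement moves along an axis on which the functions
  differ, so each of the three accounts for at most \<open>d * p ^ 2\<close> points.\<close>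

lemma card_agree_low_degree3:
  assumes p: "prime p" and f: "low_degree3 p d f" and g: "low_degree3 p d g" and "differ p f g"
  shows "card {(s, t, u) \<in> cube p. f s t u = g s t u} \<le> 3 * d * p ^ 2"
proof -
  obtain s0 t0 u0 where z: "s0 < p" "t0 < p" "u0 < p" "f s0 t0 u0 \<noteq> g s0 t0 u0"
    using assms(4) by (auto simp: differ_def)
  let ?A1 = "{s. s < p \<and> f s t0 u0 = g s t0 u0} \<times> {..<p} \<times> {..<p}"
  let ?A2 = "SIGMA s:{..<p}. (if f s t0 u0 \<noteq> g s t0 u0 then {t. t < p \<and> f s t u0 = g s t u0} else {}) \<times> {..<p}"
  let ?A3 = "SIGMA s:{..<p}. SIGMA t:{..<p}. (if f s t u0 \<noteq> g s t u0 then {u. u < p \<and> f s t u = g s t u} else {})"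
  have sub: "{(s, t, u) \<in> cube p. f s t u = g s t u} \<subseteq> ?A1 \<union> ?A2 \<union> ?A3"
    by (auto simp: cube_def split: if_splits)
  have 1: "card {s. s < p \<and> f s t0 u0 = g s t0 u0} \<le> d"
    using card_agree_low_degree[OF p, of d "\<lambda>x. f x t0 u0" "\<lambda>x. g x t0 u0" s0] f g z
    by (auto simp: low_degree3_def)
  have 2: "card (if f s t0 u0 \<noteq> g s t0 u0 then {t. t < p \<and> f s t u0 = g s t u0} else {}) \<le> d" if "s < p" for s
    using card_agree_low_degree[OF p, of d "\<lambda>x. f s x u0" "\<lambda>x. g s x u0" t0] f g z that
    by (auto simp: low_degree3_def)
  have 3: "card (if f s t u0 \<noteq> g s t u0 then {u. u < p \<and> f s t u = g s t u} else {}) \<le> d" if "s < p" "t < p" for s t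
    using card_agree_low_degree[OF p, of d "f s t" "g s t" u0] f g z that
    by (auto simp: low_degree3_def)
  have c1: "card ?A1 \<le> d * (p * p)" using 1 by (simp add: card_cartesian_product)
  have "card ?A2 = (\<Sum>s<p. card (if f s t0 u0 \<noteq> g s t0 u0 then {t. t < p \<and> f s t u0 = g s t u0} else {}) * p)"
    by (subst card_SigmaI) (auto simp: card_cartesian_product)
  also have "\<dots> \<le> (\<Sum>s<p. d * p)" by (intro sum_mono mult_right_mono 2) auto
  finally have c2: "card ?A2 \<le> d * (p * p)" by (simp add: ac_simps)
  have "card ?A3 = (\<Sum>s<p. \<Sum>t<p. card (if f s t u0 \<noteq> g s t u0 then {u. u < p \<and> f s t u = g s t u} else {}))"
    by (subst card_SigmaI; (subst card_SigmaI)?) auto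
  also have "\<dots> \<le> (\<Sum>s<p. \<Sum>t<p. d)" by (intro sum_mono 3) auto
  finally have c3: "card ?A3 \<le> d * (p * p)" by (simp add: ac_simps)
  have "card {(s, t, u) \<in> cube p. f s t u = g s t u} \<le> card (?A1 \<union> ?A2 \<union> ?A3)"
    by (intro card_mono[OF _ sub]) auto
  also have "\<dots> \<le> card ?A1 + card ?A2 + card ?A3"
    by (meson add_le_mono card_Un_le order_refl order_trans)
  also have "\<dots> \<le> d * (p * p) + d * (p * p) + d * (p * p)" by (intro add_mono c1 c2 c3)
  also have "\<dots> = 3 * d * p ^ 2" by (simp add: power2_eq_square)
  finally show ?thesis .
qed

text \<open>A union bound: at most \<open>K ^ 2\<close> pairs, each agreeing on at most
  \<open>3 * d * p ^ 2\<close> points, cannot cover the \<open>p ^ 3\<close> points of the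
  cube.\<close>

lemma separating_argument:
  assumes p: "prime p" and "finite C" "card C \<le> K" and K: "3 * d * K ^ 2 < p"
    and C: "\<And>f. f \<in> C \<Longrightarrow> low_degree3 p d f" "\<And>f g. f \<in> C \<Longrightarrow> g \<in> C \<Longrightarrow> f \<noteq> g \<Longrightarrow> differ p f g"
  shows "\<exists>s<p. \<exists>t<p. \<exists>u<p. inj_on (\<lambda>f. f s t u) C"
proof -
  let ?I = "{(f, g). f \<in> C \<and> g \<in> C \<and> f \<noteq> g}"
  let ?B = "\<lambda>(f, g). {(s, t, u) \<in> cube p. f s t u = g s t u}"
  have fin: "finite ?I" by (rule finite_subset[of _ "C \<times> C"]) (use assms in auto)
  have "card ?I \<le> card (C \<times> C)" by (rule card_mono) (use assms in auto)
  also have "\<dots> \<le> K ^ 2" using assms(3) by (simp add: card_cartesian_product power2_eq_square mult_mono)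
  finally have cI: "card ?I \<le> K ^ 2" .
  have "card (\<Union>i\<in>?I. ?B i) \<le> (\<Sum>i\<in>?I. card (?B i))" by (rule card_UN_le[OF fin])
  also have "\<dots> \<le> (\<Sum>i\<in>?I. 3 * d * p ^ 2)"
    by (intro sum_mono) (use card_agree_low_degree3[OF p] C in auto)
  also have "\<dots> \<le> K ^ 2 * (3 * d * p ^ 2)" using cI by simp
  also have "\<dots> = (3 * d * K ^ 2) * p ^ 2" by simp
  also have "\<dots> < p * p ^ 2" using K p by (simp add: prime_gt_0_nat)
  also have "\<dots> = card (cube p)" by (simp add: cube_def card_cartesian_product power2_eq_square)
  finally have "card (\<Union>i\<in>?I. ?B i) < card (cube p)" .
  moreover have "finite (\<Union>i\<in>?I. ?B i)"
    by (rule finite_subset[of _ "cube p"]) (auto simp: cube_def)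
  ultimately have "\<not> cube p \<subseteq> (\<Union>i\<in>?I. ?B i)" by (meson card_mono linorder_not_less)
  then obtain x where x: "x \<in> cube p" "x \<notin> (\<Union>i\<in>?I. ?B i)" by blast
  obtain s t u where stu: "x = (s, t, u)" by (cases x)
  then have "inj_on (\<lambda>f. f s t u) C" using x by (auto simp: inj_on_def)
  then show ?thesis using x(1) stu by (auto simp: cube_def)
qed

text \<open>The abstract geometry behind the pruning: \<open>pt y a b c\<close> parametrises the
  flat through four points and \<open>F\<close> holds the polynomials on flats.
  \<open>pt_axis\<close> and \<open>F_axis\<close> say that an axis of a flat is the line given by
  the degenerate flat through \<open>y, a, y, y\<close>, and that a polynomial may be restricted to
  it. \<open>pt_bij\<close> says that for a uniformly chosen \<open>a\<close> every position of the
  line other than \<open>y\<close> is uniformly distributed.\<close>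

locale list_pruning =
  fixes p d A X :: nat and F :: "(nat \<Rightarrow> nat \<Rightarrow> nat \<Rightarrow> nat) set"
    and pt :: "nat \<Rightarrow> nat \<Rightarrow> nat \<Rightarrow> nat \<Rightarrow> nat \<Rightarrow> nat \<Rightarrow> nat \<Rightarrow> nat"
    and ok :: "(nat \<Rightarrow> nat \<Rightarrow> nat \<Rightarrow> nat) \<Rightarrow> nat \<Rightarrow> nat \<Rightarrow> nat \<Rightarrow> bool"
    and S :: "nat \<Rightarrow> nat set"
  assumes prime_p: "prime p" and p_large: "3 * d * (2 * A + 1) ^ 2 + 1 < p"
    and X_pos: "X > 0"
    and F_low: "f \<in> F \<Longrightarrow> low_degree3 p d f"
    and F_axis: "f \<in> F \<Longrightarrow> \<exists>g\<in>F. \<forall>s<p. \<forall>t<p. \<forall>u<p. g s t u = f s 0 0"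
      "f \<in> F \<Longrightarrow> \<exists>g\<in>F. \<forall>s<p. \<forall>t<p. \<forall>u<p. g s t u = f 0 s 0"
      "f \<in> F \<Longrightarrow> \<exists>g\<in>F. \<forall>s<p. \<forall>t<p. \<forall>u<p. g s t u = f 0 0 s"
    and pt_less: "\<lbrakk>y < X; a < X; b < X; c < X; s < p; t < p; u < p\<rbrakk> \<Longrightarrow> pt y a b c s t u < X"
    and pt_axis: "\<lbrakk>y < X; a < X; b < X; c < X; s < p; t < p; u < p\<rbrakk> \<Longrightarrow> pt y a b c s 0 0 = pt y a y y s t u"
      "\<lbrakk>y < X; a < X; b < X; c < X; s < p; t < p; u < p\<rbrakk> \<Longrightarrow> pt y a b c 0 s 0 = pt y b y y s t u"
      "\<lbrakk>y < X; a < X; b < X; c < X; s < p; t < p; u < p\<rbrakk> \<Longrightarrow> pt y a b c 0 0 s = pt y c y y s t u"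
    and pt_bij: "\<lbrakk>y < X; 0 < s; s < p\<rbrakk> \<Longrightarrow> bij_betw (\<lambda>a. pt y a y y s 0 0) {..<X} {..<X}"
    and S_finite: "x < X \<Longrightarrow> finite (S x)"
    and S_sum: "(\<Sum>x<X. card (S x)) \<le> A * X"
begin

section \<open>Lengths of the surviving lists\<close>

definition fits :: "(nat \<Rightarrow> nat set) \<Rightarrow> nat \<Rightarrow> nat \<Rightarrow> nat \<Rightarrow> nat \<Rightarrow> (nat \<Rightarrow> nat \<Rightarrow> nat \<Rightarrow> nat) \<Rightarrow> bool" where
  "fits L y a b c f \<longleftrightarrow> f \<in> F \<and> (\<forall>s<p. \<forall>t<p. \<forall>u<p. f s t u \<in> L (pt y a b c s t u))"

fun Pl :: "nat \<Rightarrow> nat \<Rightarrow> nat set" where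
  "Pl 0 y = S y"
| "Pl (Suc n) y = {v \<in> Pl n y. \<forall>a<X. \<forall>b<X. \<forall>c<X. \<exists>f. fits (Pl n) y a b c f \<and> ok f a b c \<and> f 0 0 0 = v}"

lemma p_pos: "p > 0" using prime_p prime_gt_0_nat by blast

lemma Pl_finite: "x < X \<Longrightarrow> finite (Pl n x)"
  by (induction n) (auto simp: S_finite)

lemma Pl_Suc_subset: "Pl (Suc n) x \<subseteq> Pl n x"
  by auto

text \<open>If \<open>K = 2 * A + 1\<close> values survived at \<open>y\<close>, they would extend
  to \<open>K\<close> functions along every line through \<open>y\<close>. Any two of these agree at
  no more than \<open>d\<close> positions, so at most positions of the line the starting list has
  \<open>K\<close> elements, against an average of \<open>A\<close> on a suitable line.\<close>

lemma Pl_1_card: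
  assumes y: "y < X"
  shows "card (Pl 1 y) \<le> 2 * A"
proof (rule ccontr)
  assume large: "\<not> card (Pl 1 y) \<le> 2 * A"
  define K where "K = 2 * A + 1"
  have "K \<le> card (Pl 1 y)" using large by (simp add: K_def)
  then obtain V where V: "V \<subseteq> Pl 1 y" "card V = K"
    by (metis obtain_subset_with_card_n)
  have finV: "finite V" using V Pl_finite[OF y] finite_subset by blast
  \<comment> \<open>Averaging over the direction: by \<open>pt_bij\<close> each position
    \<open>s > 0\<close> runs through all points as \<open>a\<close> does, so all lines together
    carry \<open>p - 1\<close> times the total length of the lists.\<close>
  have "\<exists>a<X. (\<Sum>s=1..<p. card (S (pt y a y y s 0 0))) \<le> (p - 1) * A"
  proof (rule ccontr)
    assume *: "\<not> ?thesis"
    have "(\<Sum>a<X. (p - 1) * A) < (\<Sum>a<X. \<Sum>s=1..<p. card (S (pt y a y y s 0 0)))"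
      by (rule sum_strict_mono) (use * X_pos in \<open>auto simp: not_le\<close>)
    also have "\<dots> = (\<Sum>s=1..<p. \<Sum>a<X. card (S (pt y a y y s 0 0)))" by (rule sum.swap)
    also have "\<dots> = (\<Sum>s=1..<p. \<Sum>x<X. card (S x))"
      by (intro sum.cong refl sum.reindex_bij_betw[OF pt_bij[OF y]]) auto
    also have "\<dots> \<le> (p - 1) * (A * X)" using S_sum by simp
    finally show False by (simp add: ac_simps)
  qed
  then obtain a where a: "a < X" "(\<Sum>s=1..<p. card (S (pt y a y y s 0 0))) \<le> (p - 1) * A" by blast
  have "\<forall>v\<in>V. \<exists>f. fits S y a y y f \<and> f 0 0 0 = v"
    using V(1) a y by (auto simp: fits_def) blast
  then obtain \<phi> where \<phi>: "\<And>v. v \<in> V \<Longrightarrow> fits S y a y y (\<phi> v) \<and> \<phi> v 0 0 0 = v" by metis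
  let ?g = "\<lambda>v s. \<phi> v s 0 0"
  let ?I = "{(v, v'). v \<in> V \<and> v' \<in> V \<and> v \<noteq> v'}"
  let ?B = "\<lambda>(v, v'). {s. s < p \<and> ?g v s = ?g v' s}"
  have fin: "finite ?I" by (rule finite_subset[of _ "V \<times> V"]) (use finV in auto)
  have "card ?I \<le> card (V \<times> V)" by (rule card_mono) (use finV in auto)
  then have cI: "card ?I \<le> K ^ 2" using V(2) by (simp add: card_cartesian_product power2_eq_square)
  have Bd: "card (?B i) \<le> d" if iI: "i \<in> ?I" for i
  proof -
    obtain v v' where i: "i = (v, v')" "v \<in> V" "v' \<in> V" "v \<noteq> v'" using iI by auto
    have "low_degree p d (?g v)" "low_degree p d (?g v')"
      using \<phi> i F_low p_pos by (auto simp: fits_def low_degree3_def)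
    then show ?thesis using card_agree_low_degree[OF prime_p, of d "?g v" "?g v'" 0] \<phi> i p_pos by auto
  qed
  let ?U = "\<Union>i\<in>?I. ?B i"
  have "card ?U \<le> (\<Sum>i\<in>?I. card (?B i))" by (rule card_UN_le[OF fin])
  also have "\<dots> \<le> (\<Sum>i\<in>?I. d)" by (intro sum_mono Bd)
  also have "\<dots> \<le> K ^ 2 * d" using cI by simp
  finally have cU: "card ?U \<le> K ^ 2 * d" .
  let ?Go = "{1..<p} - ?U"
  have "card ?Go \<ge> (p - 1) - K ^ 2 * d"
    using diff_card_le_card_Diff[of ?U "{1..<p}"] cU fin by (fastforce simp: finite_UN)
  then have G: "K * ((p - 1) - K ^ 2 * d) \<le> K * card ?Go" by simp
  also have "\<dots> = (\<Sum>s\<in>?Go. K)" by simp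
  also have "\<dots> \<le> (\<Sum>s\<in>?Go. card (S (pt y a y y s 0 0)))"
  proof (rule sum_mono)
    fix s assume s: "s \<in> ?Go"
    have "inj_on (\<lambda>v. ?g v s) V" using s by (auto simp: inj_on_def)
    then have "K = card ((\<lambda>v. ?g v s) ` V)" using V(2) by (simp add: card_image)
    also have "\<dots> \<le> card (S (pt y a y y s 0 0))"
      by (rule card_mono) (use \<phi> s p_pos y a S_finite pt_less in \<open>auto simp: fits_def\<close>)
    finally show "K \<le> card (S (pt y a y y s 0 0))" .
  qed
  also have "\<dots> \<le> (\<Sum>s=1..<p. card (S (pt y a y y s 0 0)))" by (rule sum_mono2) auto
  also have "\<dots> \<le> (p - 1) * A" by (rule a(2))
  finally have *: "K * ((p - 1) - K ^ 2 * d) \<le> (p - 1) * A" .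
  \<comment> \<open>The number \<open>q\<close> below bounds from below how many positions
    \<open>s > 0\<close> separate all \<open>K\<close> functions. As \<open>p\<close> is large, this
    is at least half of \<open>p - 1\<close>, and then \<open>K = 2 * A + 1\<close> exceeds twice
    the average by enough.\<close>
  have pl: "3 * (K ^ 2 * d) < p - 1" using p_large by (simp add: K_def ac_simps)
  define q where "q = (p - 1) - K ^ 2 * d"
  have "p - 1 \<le> 2 * q" "q > 0" using pl by (auto simp: q_def)
  then have "A * (p - 1) \<le> A * (2 * q)" by (intro mult_left_mono) auto
  then have "A * (p - 1) + q \<le> K * q" by (simp add: K_def algebra_simps)
  then show False using *[folded q_def] \<open>q > 0\<close> mult.commute[of A "p - 1"] by linarith
qed

lemma Pl_antimono: "m \<le> n \<Longrightarrow> Pl n x \<subseteq> Pl m x"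
  by (induction n) (use Pl_Suc_subset in \<open>fastforce simp: le_Suc_eq simp del: Pl.simps\<close>)+

text \<open>The other \<open>M - 1\<close> values at \<open>y\<close> also extend to the flat.
  Together with two different functions through the same value this makes \<open>M + 1\<close>
  different functions, and at a separating point they would need a list longer than the maximum
  \<open>M\<close>.\<close>

lemma fits_unique:
  assumes y: "y < X" and abc: "a < X" "b < X" "c < X"
    and M: "card (Pl (Suc n) y) = M" "M \<le> 2 * A" "\<And>x. x < X \<Longrightarrow> card (Pl n x) \<le> M"
    and f: "fits (Pl n) y a b c f" and g: "fits (Pl n) y a b c g"
    and v: "f 0 0 0 = g 0 0 0" "f 0 0 0 \<in> Pl (Suc n) y"
  shows "\<not> differ p f g"
proof
  assume df: "differ p f g"
  define V where "V = Pl (Suc n) y - {f 0 0 0}"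
  have finP: "finite (Pl (Suc n) y)" by (rule Pl_finite[OF y])
  have "\<exists>h. fits (Pl n) y a b c h \<and> h 0 0 0 = v" if "v \<in> V" for v
  proof -
    have "v \<in> Pl (Suc n) y" using that by (simp add: V_def)
    then have "\<forall>a<X. \<forall>b<X. \<forall>c<X. \<exists>h. fits (Pl n) y a b c h \<and> ok h a b c \<and> h 0 0 0 = v" by simp
    then show ?thesis using abc by blast
  qed
  then obtain \<phi> where \<phi>: "\<And>v. v \<in> V \<Longrightarrow> fits (Pl n) y a b c (\<phi> v) \<and> \<phi> v 0 0 0 = v" by metis
  let ?C = "insert f (insert g (\<phi> ` V))"
  have fitC: "fits (Pl n) y a b c h" if "h \<in> ?C" for h using that f g \<phi> by auto
  have inj: "inj_on \<phi> V" by (metis \<phi> inj_onI)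
  have "card V = M - 1" "M > 0" using M(1) v(2) finP card_gt_0_iff by (auto simp: V_def simp del: Pl.simps)
  moreover have "finite V" using finP by (simp add: V_def del: Pl.simps)
  moreover have \<phi>_ne: "\<phi> v 0 0 0 \<noteq> f 0 0 0" if "v \<in> V" for v
    using \<phi>[OF that] that unfolding V_def by (metis Diff_iff singletonI)
  then have "f \<notin> \<phi> ` V" "g \<notin> \<phi> ` V" using v(1) by force+
  moreover have "f \<noteq> g" using df by (auto simp: differ_def)
  ultimately have cC: "finite ?C" "card ?C = M + 1" using card_image[OF inj] by auto
  have dif: "differ p h k" if "h \<in> ?C" "k \<in> ?C" "h \<noteq> k" for h k
  proof (cases "h 0 0 0 = k 0 0 0")
    case True
    then have "{h, k} = {f, g}" using that v(1) \<phi> \<phi>_ne by (auto; metis)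
    then show ?thesis using df unfolding differ_def by (metis doubleton_eq_iff)
  next
    case False
    then show ?thesis using p_pos by (auto simp: differ_def)
  qed
  have "3 * d * (2 * A + 1) ^ 2 < p" using p_large by simp
  then obtain s t u where stu: "s < p" "t < p" "u < p" "inj_on (\<lambda>h. h s t u) ?C"
    using separating_argument[OF prime_p cC(1), of "2 * A + 1" d] cC(2) M(2) F_low fitC dif
    by (auto simp: fits_def)
  have "M + 1 = card ((\<lambda>h. h s t u) ` ?C)" using card_image[OF stu(4)] cC(2) by simp
  also have "\<dots> \<le> card (Pl n (pt y a b c s t u))"
  proof (rule card_mono)
    show "(\<lambda>h. h s t u) ` ?C \<subseteq> Pl n (pt y a b c s t u)"
      using fitC stu unfolding fits_def by blast
  qed (use Pl_finite pt_less y abc stu in auto)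
  also have "\<dots> \<le> M" by (rule M(3)) (use pt_less y abc stu in auto)
  finally show False by simp
qed

text \<open>The maximal length never increases and is at most \<open>2 * A\<close> after one round,
  so it cannot drop in each of the \<open>2 * A + 1\<close> rounds that follow.\<close>

lemma ex_stable_level:
  assumes "Pl (2 * A + 3) x0 \<noteq> {}" "x0 < X"
  shows "\<exists>n y. y < X \<and> card (Pl (Suc n) y) > 0 \<and> card (Pl (Suc n) y) \<le> 2 * A \<and>
    (\<forall>x<X. card (Pl n x) \<le> card (Pl (Suc n) y))"
proof -
  define M where "M n = Max ((\<lambda>x. card (Pl n x)) ` {..<X})" for n
  have Mge: "card (Pl n x) \<le> M n" if "x < X" for n x
    unfolding M_def using that by (intro Max_ge) auto
  have Mex: "\<exists>y<X. M n = card (Pl n y)" for n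
  proof -
    have "M n \<in> (\<lambda>x. card (Pl n x)) ` {..<X}" unfolding M_def using X_pos by (intro Max_in) auto
    then show ?thesis by auto
  qed
  have mono: "M (Suc n) \<le> M n" for n
  proof -
    obtain y where y: "y < X" "M (Suc n) = card (Pl (Suc n) y)" using Mex by blast
    have "card (Pl (Suc n) y) \<le> card (Pl n y)"
      by (rule card_mono[OF Pl_finite[OF y(1)] Pl_Suc_subset])
    then show ?thesis using Mge[OF y(1), of n] y(2) by linarith
  qed
  have M1: "M 1 \<le> 2 * A" using Mex[of 1] Pl_1_card by fastforce
  have "\<exists>n. 1 \<le> n \<and> n < 2 * A + 2 \<and> M (Suc n) = M n"
  proof (rule ccontr)
    assume *: "\<not> ?thesis"
    have "M (Suc k) + k \<le> 2 * A" if "k \<le> 2 * A + 1" for k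
      using that
    proof (induction k)
      case (Suc k)
      have "M (Suc (Suc k)) \<noteq> M (Suc k)" using * Suc.prems by auto
      then have "M (Suc (Suc k)) < M (Suc k)" using mono[of "Suc k"] by linarith
      then show ?case using Suc by simp
    qed (use M1 in simp)
    from this[of "2 * A + 1"] show False by simp
  qed
  then obtain n where n: "1 \<le> n" "n < 2 * A + 2" "M (Suc n) = M n" by blast
  obtain y where y: "y < X" "M (Suc n) = card (Pl (Suc n) y)" using Mex by blast
  have "Pl (2 * A + 3) x0 \<subseteq> Pl (Suc n) x0" using n(2) by (intro Pl_antimono) simp
  then have "Pl (Suc n) x0 \<noteq> {}" using assms(1) by blast
  then have "card (Pl (Suc n) x0) > 0" using Pl_finite[OF assms(2)] card_gt_0_iff by blast
  then have pos: "M (Suc n) > 0" using Mge[OF assms(2), of "Suc n"] by linarith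
  have "M n \<le> 2 * A" using n(1)
  proof (induction n rule: dec_induct)
    case (step k) then show ?case using mono[of k] by linarith
  qed (rule M1)
  then show ?thesis using y n(3) pos Mge[of _ n] by (intro exI[of _ n] exI[of _ y]) (simp del: Pl.simps)
qed

text \<open>At the point \<open>y\<close> of a stable level fix a surviving value \<open>v\<close>.
  On each line through \<open>y\<close> there is exactly one surviving function with value
  \<open>v\<close> at \<open>y\<close>; \<open>G a\<close> is its value at \<open>a\<close>. A
  surviving function on the flat through \<open>y, a, b, c\<close> with value \<open>v\<close>
  restricts on its three axes to these functions, so it takes the values of \<open>G\<close> at
  \<open>a, b, c\<close>, and it passes \<open>ok\<close> because the pruning demands this.\<close>

theorem global_function:
  assumes "Pl (2 * A + 3) x0 \<noteq> {}" "x0 < X"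
  shows "\<exists>G. \<forall>a<X. \<forall>b<X. \<forall>c<X. \<exists>f\<in>F. ok f a b c \<and> f 1 0 0 = G a \<and> f 0 1 0 = G b \<and> f 0 0 1 = G c"
proof -
  obtain n y where y: "y < X" "card (Pl (Suc n) y) > 0" "card (Pl (Suc n) y) \<le> 2 * A"
    "\<forall>x<X. card (Pl n x) \<le> card (Pl (Suc n) y)" using ex_stable_level[OF assms] by blast
  obtain v where v: "v \<in> Pl (Suc n) y" using y(2) by (metis card.empty ex_in_conv less_numeral_extra(3))
  have p1: "1 < p" using prime_p prime_gt_1_nat by blast
  have ext: "\<exists>f. fits (Pl n) y a b c f \<and> ok f a b c \<and> f 0 0 0 = v" if "a < X" "b < X" "c < X" for a b c
    using v that by auto
  then have "\<exists>e. fits (Pl n) y a y y e \<and> e 0 0 0 = v" if "a < X" for a using that y(1) by blast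
  then obtain e where e: "\<And>a. a < X \<Longrightarrow> fits (Pl n) y a y y (e a) \<and> e a 0 0 0 = v" by metis
  have uniq: "g s t u = e a s t u"
    if "a < X" "fits (Pl n) y a y y g" "g 0 0 0 = v" "s < p" "t < p" "u < p" for a g s t u
    using fits_unique[of y a y y n "card (Pl (Suc n) y)" g "e a"] that e[OF that(1)] y v
    by (auto simp: differ_def simp del: Pl.simps)
  have "\<exists>f\<in>F. ok f a b c \<and> f 1 0 0 = e a 1 0 0 \<and> f 0 1 0 = e b 1 0 0 \<and> f 0 0 1 = e c 1 0 0"
    if abc: "a < X" "b < X" "c < X" for a b c
  proof -
    obtain f where f: "fits (Pl n) y a b c f" "ok f a b c" "f 0 0 0 = v" using ext[OF abc] by blast
    have fF: "f \<in> F" and fin: "\<And>s t u. s < p \<Longrightarrow> t < p \<Longrightarrow> u < p \<Longrightarrow> f s t u \<in> Pl n (pt y a b c s t u)"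
      using f(1) by (auto simp: fits_def)
    obtain g where g: "g \<in> F" "\<And>s t u. s < p \<Longrightarrow> t < p \<Longrightarrow> u < p \<Longrightarrow> g s t u = f s 0 0" using F_axis(1)[OF fF] by blast
    have "fits (Pl n) y a y y g"
      unfolding fits_def
    proof (intro conjI allI impI)
      fix s t u assume stu: "s < p" "t < p" "u < p"
      show "g s t u \<in> Pl n (pt y a y y s t u)"
        using g(2)[OF stu] fin[of s 0 0] pt_axis(1)[OF y(1) abc stu] stu p_pos by simp
    qed (rule g(1))
    then have 1: "f 1 0 0 = e a 1 0 0" using uniq[of a g 1 0 0] g(2)[of 1 0 0] g(2)[of 0 0 0] f(3) abc p1 by simp
    obtain g where g: "g \<in> F" "\<And>s t u. s < p \<Longrightarrow> t < p \<Longrightarrow> u < p \<Longrightarrow> g s t u = f 0 s 0" using F_axis(2)[OF fF] by blast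
    have "fits (Pl n) y b y y g"
      unfolding fits_def
    proof (intro conjI allI impI)
      fix s t u assume stu: "s < p" "t < p" "u < p"
      show "g s t u \<in> Pl n (pt y b y y s t u)"
        using g(2)[OF stu] fin[of 0 s 0] pt_axis(2)[OF y(1) abc stu] stu p_pos by simp
    qed (rule g(1))
    then have 2: "f 0 1 0 = e b 1 0 0" using uniq[of b g 1 0 0] g(2)[of 1 0 0] g(2)[of 0 0 0] f(3) abc p1 by simp
    obtain g where g: "g \<in> F" "\<And>s t u. s < p \<Longrightarrow> t < p \<Longrightarrow> u < p \<Longrightarrow> g s t u = f 0 0 s" using F_axis(3)[OF fF] by blast
    have "fits (Pl n) y c y y g"
      unfolding fits_def
    proof (intro conjI allI impI)
      fix s t u assume stu: "s < p" "t < p" "u < p"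
      show "g s t u \<in> Pl n (pt y c y y s t u)"
        using g(2)[OF stu] fin[of 0 0 s] pt_axis(3)[OF y(1) abc stu] stu p_pos by simp
    qed (rule g(1))
    then have 3: "f 0 0 1 = e c 1 0 0" using uniq[of c g 1 0 0] g(2)[of 1 0 0] g(2)[of 0 0 0] f(3) abc p1 by simp
    show ?thesis using fF f(2) 1 2 3 by blast
  qed
  then show ?thesis by (intro exI[of _ "\<lambda>a. e a 1 0 0"]) blast
qed

end


section \<open>A prime between a number and its square\<close>

text \<open>Row by row in Leibniz' harmonic triangle, whose entries are the numbers
  \<open>1 / (m * (n choose m))\<close>: an entry is the difference of the one above and the one to the right.\<close>
lemma mult_binomial_dvd_Lcm:
  assumes "1 \<le> m" "m \<le> n"
  shows "m * (n choose m) dvd Lcm {1..n}"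
  using assms
proof (induction n arbitrary: m)
  case (Suc n)
  define d where "d = Lcm {1..Suc n}"
  have dvd: "Lcm {1..n} dvd d" unfolding d_def by (rule Lcm_subset) auto
  have "1 \<le> m \<Longrightarrow> m \<le> Suc n \<Longrightarrow> m * (Suc n choose m) dvd d"
  proof (induction "Suc n - m" arbitrary: m)
    case 0
    then have "m = Suc n" by simp
    then show ?case unfolding d_def by (simp add: dvd_Lcm)
  next
    case (Suc k)
    then have mn: "m \<le> n" by simp
    have "m * (n choose m) dvd d" using Suc.prems(1) mn \<open>\<And>m. 1 \<le> m \<Longrightarrow> m \<le> n \<Longrightarrow> m * (n choose m) dvd Lcm {1..n}\<close> dvd dvd_trans by blast
    then obtain a where a: "d = m * (n choose m) * a" by (elim dvdE)
    have "Suc m * (Suc n choose Suc m) dvd d" using Suc.hyps(1)[of "Suc m"] Suc.hyps(2) mn by simp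
    then obtain b where b: "d = Suc m * (Suc n choose Suc m) * b" by (elim dvdE)
    have b': "d = Suc n * (n choose m) * b" using b by (simp only: Suc_times_binomial)
    have abs: "(Suc n - m) * (Suc n choose m) = Suc n * (n choose m)"
      using binomial_absorb_comp[of "Suc n" m] by simp
    \<comment> \<open>The triangle identity says that \<open>d / (m * (Suc n choose m))\<close> is
      the difference of \<open>a = d / (m * (n choose m))\<close> and
      \<open>b = d / (Suc m * (Suc n choose Suc m))\<close>, hence an integer. The factor
      \<open>q\<close> avoids the fractions.\<close>
    define q where "q = int (Suc n - m)"
    have q: "q = int (Suc n) - int m" "q > 0" using mn by (auto simp: q_def)
    have "q * (int m * int (Suc n choose m) * (int a - int b)) = int m * (q * int (Suc n choose m)) * (int a - int b)" by simp
    also have "q * int (Suc n choose m) = int (Suc n) * int (n choose m)"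
      unfolding q_def using abs by (metis of_nat_mult)
    also have "int m * (int (Suc n) * int (n choose m)) * (int a - int b) =
        int (Suc n) * int (m * (n choose m) * a) - int m * int (Suc n * (n choose m) * b)"
      by (simp add: algebra_simps)
    also have "\<dots> = q * int d" using a b' q(1) by (simp only: left_diff_distrib)
    finally have "int d = int (m * (Suc n choose m)) * (int a - int b)" using q(2) by simp
    then have "int (m * (Suc n choose m)) dvd int d" by (metis dvd_triv_left)
    then show ?case by (simp only: int_dvd_int_iff)
  qed
  then show ?case using Suc.prems unfolding d_def by blast
qed simp

text \<open>The multiplicity of a prime in a least common multiple is its multiplicity in one of the
  members, so \<open>p ^ k\<close> divides one of the numbers up to \<open>n\<close>.\<close>

lemma prime_power_dvd_Lcm_le:
  assumes "prime (p::nat)" "p ^ k dvd Lcm {1..n}" "n \<ge> 1"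
  shows "p ^ k \<le> n"
  using assms(3,2)
proof (induction n rule: dec_induct)
  case base
  then show ?case by auto
next
  case (step n)
  have "{1..Suc n} = insert (Suc n) {1..n}" by auto
  then have L: "Lcm {1..Suc n} = lcm (Suc n) (Lcm {1..n})" by (simp only: Lcm_insert)
  have nz: "Lcm {1..n} \<noteq> 0" by (auto simp: Lcm_0_iff_nat)
  have "k \<le> multiplicity p (lcm (Suc n) (Lcm {1..n}))"
    using step.prems assms(1) nz unfolding L by (subst (asm) power_dvd_iff_le_multiplicity) auto
  then have "k \<le> max (multiplicity p (Suc n)) (multiplicity p (Lcm {1..n}))"
    using nz assms(1) by (subst (asm) multiplicity_lcm) auto
  then have "p ^ k dvd Suc n \<or> p ^ k dvd Lcm {1..n}"
    by (auto simp: max_def multiplicity_dvd' split: if_splits)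
  then show ?case using step.IH dvd_imp_le[of "p ^ k" "Suc n"] by auto
qed

text \<open>Each prime power in the factorisation is at most \<open>n\<close>, and there are no more
  of them than primes up to \<open>n\<close>.\<close>

lemma Lcm_le_power:
  fixes n :: nat
  assumes "n \<ge> 1"
  shows "Lcm {1..n} \<le> n ^ card {p. prime p \<and> p \<le> n}"
proof -
  let ?d = "Lcm {1..n}"
  have nz: "?d \<noteq> 0" by (auto simp: Lcm_0_iff_nat)
  have sub: "prime_factors ?d \<subseteq> {p. prime p \<and> p \<le> n}"
    using prime_power_dvd_Lcm_le[of _ 1 n] assms by (auto simp: prime_factors_dvd)
  have "?d = (\<Prod>p\<in>prime_factors ?d. p ^ multiplicity p ?d)"
    by (intro prime_factorization_nat) (metis gr0I nz)
  also have "\<dots> \<le> (\<Prod>p\<in>prime_factors ?d. n)"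
    by (intro prod_mono) (auto intro!: prime_power_dvd_Lcm_le multiplicity_dvd assms)
  also have "\<dots> = n ^ card (prime_factors ?d)" by simp
  also have "\<dots> \<le> n ^ card {p. prime p \<and> p \<le> n}"
    using assms by (intro power_increasing card_mono sub) auto
  finally show ?thesis .
qed

text \<open>Chebyshev's argument. Without such a prime there are at most \<open>X\<close> primes up
  to \<open>X ^ 2\<close>, so the least common multiple of the numbers up to \<open>X ^ 2\<close>
  would be at most \<open>X ^ (2 * X)\<close>. But it is a multiple of
  \<open>m * ((2 * m) choose m)\<close>, which is of order \<open>2 ^ (X ^ 2)\<close> for
  \<open>m\<close> half of \<open>X ^ 2\<close>.\<close>

lemma prime_between_square:
  fixes X :: nat
  assumes "X \<ge> 16"
  shows "\<exists>p. prime p \<and> X < p \<and> p \<le> X ^ 2"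
proof (rule ccontr)
  assume no: "\<not> ?thesis"
  define m where "m = X ^ 2 div 2"
  have X2: "X ^ 2 \<ge> 16 * 16" using assms power_mono[of 16 X 2] by simp
  then have m: "1 \<le> m" "2 * m \<le> X ^ 2" "X ^ 2 \<le> 2 * m + 1" by (auto simp: m_def)
  have "{p. prime p \<and> p \<le> 2 * m} \<subseteq> {1..X}" 
  proof
    fix p assume "p \<in> {p. prime p \<and> p \<le> 2 * m}"
    then have "prime p" "p \<le> X ^ 2" using m(2) by auto
    then show "p \<in> {1..X}" using no prime_ge_1_nat[of p] by (meson atLeastAtMost_iff not_le)
  qed
  then have "card {p. prime p \<and> p \<le> 2 * m} \<le> X" using card_mono[of "{1..X}"] by fastforce
  then have "(2 * m) ^ card {p. prime p \<and> p \<le> 2 * m} \<le> (2 * m) ^ X" using m(1) by (intro power_increasing) auto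
  then have d: "Lcm {1..2 * m} \<le> (2 * m) ^ X" using Lcm_le_power[of "2 * m"] m(1) by linarith
  have "Lcm {1..2 * m} > 0" by (rule gr0I) (auto simp: Lcm_0_iff_nat)
  moreover have "m * ((2 * m) choose m) dvd Lcm {1..2 * m}" by (rule mult_binomial_dvd_Lcm[OF m(1)]) simp
  ultimately have "m * ((2 * m) choose m) \<le> Lcm {1..2 * m}" by (intro dvd_imp_le)
  moreover have "4 ^ m \<le> 2 * (m * ((2 * m) choose m))"
  proof -
    have "real (4 ^ m) / (2 * real m) \<le> real ((2 * m) choose m)"
      using central_binomial_lower_bound[of m] m(1) by simp
    then have "real (4 ^ m) \<le> real (2 * (m * ((2 * m) choose m)))" using m(1) by (simp add: field_simps)
    then show ?thesis by (simp only: of_nat_le_iff)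
  qed
  ultimately have "(4::nat) ^ m \<le> 2 * (2 * m) ^ X" using d by linarith
  also have "\<dots> \<le> 2 * (X ^ 2) ^ X" using m(2) by (intro mult_left_mono power_mono) auto
  finally have A: "(4::nat) ^ m \<le> 2 * (X ^ 2) ^ X" .
  \<comment> \<open>For \<open>X = 16\<close> both sides equal \<open>2 ^ 16\<close>; this is where
    the bound 16 comes from.\<close>
  have "X ^ 4 \<le> 2 ^ X" using assms
  proof (induction X rule: dec_induct)
    case (step n)
    have "(Suc n) ^ 4 = n ^ 4 + 4 * n ^ 3 + 6 * n ^ 2 + 4 * n + 1" by (simp add: eval_nat_numeral algebra_simps)
    also have "\<dots> \<le> n ^ 4 + n ^ 4"
    proof -
      have "16 * n ^ 3 \<le> n * n ^ 3" using step(1) by (intro mult_right_mono) auto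
      moreover have "n * n ^ 3 = n ^ 4" by (simp add: eval_nat_numeral)
      moreover have "n ^ 2 \<le> n ^ 3" "n \<le> n ^ 3" "1 \<le> n ^ 3"
        using step(1) power_increasing[of 2 3 n] power_increasing[of 1 3 n] by auto
      ultimately show ?thesis by linarith
    qed
    also have "\<dots> \<le> 2 ^ Suc n" using step(3) by simp
    finally show ?case .
  qed simp
  then have "(X ^ 4) ^ X \<le> (2 ^ X) ^ X" by (rule power_mono) simp
  moreover have "2 * X * 2 = 4 * X" by simp
  ultimately have B: "((X ^ 2) ^ X) ^ 2 \<le> 2 ^ (X ^ 2)"
    by (simp only: power_mult[symmetric] power2_eq_square[of X, symmetric])
  have "((4::nat) ^ m) ^ 2 \<le> (2 * (X ^ 2) ^ X) ^ 2" by (rule power_mono[OF A]) simp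
  also have "\<dots> \<le> 4 * 2 ^ (X ^ 2)" using B by (simp add: power_mult_distrib)
  also have "\<dots> \<le> 4 * 2 ^ (2 * m + 1)" using m(3) by (intro mult_left_mono power_increasing) auto
  also have "\<dots> = 2 ^ (2 * m + 3)" by (simp add: power_add)
  finally have "((2 ^ 2) ^ m) ^ 2 \<le> (2::nat) ^ (2 * m + 3)" by simp
  moreover have "2 * m * 2 = 4 * m" by simp
  ultimately have "(2::nat) ^ (4 * m) \<le> 2 ^ (2 * m + 3)" by (simp only: power_mult[symmetric])
  then have "4 * m \<le> 2 * m + 3" by (subst (asm) power_increasing_iff) simp_all
  then show False using X2 m(3) by linarith
qed


section \<open>Points, planes and polynomials coded by digits\<close>

definition dig :: "nat \<Rightarrow> nat \<Rightarrow> nat \<Rightarrow> nat" where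
  "dig p x k = x div p ^ k mod p"

lemma digit_sum_less: "(\<And>k. k < l \<Longrightarrow> e k < p) \<Longrightarrow> (\<Sum>k<l. p ^ k * e k) < (p::nat) ^ l"
proof (induction l)
  case (Suc l)
  have "(\<Sum>k<l. p ^ k * e k) < p ^ l" using Suc by simp
  moreover have "p ^ l * e l + p ^ l \<le> p ^ l * p"
  proof -
    have "p ^ l * Suc (e l) \<le> p ^ l * p" using Suc.prems[of l] by (intro mult_left_mono) auto
    then show ?thesis by (simp add: add.commute)
  qed
  ultimately show ?case by (simp add: mult.commute)
qed simp

lemma dig_digit_sum: "(\<And>k. k < l \<Longrightarrow> e k < p) \<Longrightarrow> j < l \<Longrightarrow> dig p (\<Sum>k<l. p ^ k * e k) j = e j"
proof (induction l arbitrary: e j)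
  case (Suc l)
  have p: "p > 0" using Suc.prems(1)[of 0] by simp
  have eq: "(\<Sum>k<Suc l. p ^ k * e k) = e 0 + p * (\<Sum>k<l. p ^ k * e (Suc k))"
    by (simp add: sum.lessThan_Suc_shift sum_distrib_left mult.assoc del: sum.lessThan_Suc)
  have e0: "e 0 < p" using Suc.prems(1)[of 0] by simp
  show ?case
  proof (cases j)
    case 0
    then show ?thesis unfolding eq dig_def using e0 by simp
  next
    case (Suc j')
    have "(e 0 + p * (\<Sum>k<l. p ^ k * e (Suc k))) div p = (\<Sum>k<l. p ^ k * e (Suc k))" using p e0 by simp
    then have "dig p (e 0 + p * (\<Sum>k<l. p ^ k * e (Suc k))) (Suc j') = dig p (\<Sum>k<l. p ^ k * e (Suc k)) j'"
      by (simp add: dig_def div_mult2_eq)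
    also have "\<dots> = e (Suc j')" using Suc.IH[of "\<lambda>k. e (Suc k)" j'] Suc.prems \<open>j = Suc j'\<close> by simp
    finally show ?thesis unfolding eq using \<open>j = Suc j'\<close> by simp
  qed
qed simp

lemma sum_digits: "x < p ^ l \<Longrightarrow> (\<Sum>k<l. p ^ k * dig p x k) = x"
proof (induction l arbitrary: x)
  case (Suc l)
  have p: "p > 0" using Suc.prems by (cases p) auto
  have "x div p < p ^ l" using Suc.prems p by (simp add: less_mult_imp_div_less mult.commute)
  then have IH: "(\<Sum>k<l. p ^ k * dig p (x div p) k) = x div p" by (rule Suc.IH)
  have "(\<Sum>k<Suc l. p ^ k * dig p x k) = dig p x 0 + p * (\<Sum>k<l. p ^ k * dig p x (Suc k))"
    by (simp add: sum.lessThan_Suc_shift sum_distrib_left mult.assoc del: sum.lessThan_Suc)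
  also have "(\<Sum>k<l. p ^ k * dig p x (Suc k)) = (\<Sum>k<l. p ^ k * dig p (x div p) k)"
    by (simp add: dig_def div_mult2_eq)
  finally show ?case using IH by (simp add: dig_def)
qed simp

lemma dig_eqI: "x < p ^ l \<Longrightarrow> y < p ^ l \<Longrightarrow> (\<And>k. k < l \<Longrightarrow> dig p x k = dig p y k) \<Longrightarrow> x = y"
  by (metis (no_types, lifting) sum_digits sum.cong lessThan_iff)

text \<open>Integer polynomials of degree at most \<open>d\<close> in each variable separately. They
  serve to show that a function along a flat is given by \<open>Suc l ^ 3\<close> coefficients, the
  amount that one code can hold.\<close>

inductive poly_span :: "nat \<Rightarrow> (nat \<Rightarrow> nat \<Rightarrow> nat \<Rightarrow> int) \<Rightarrow> bool" for d where
  span_mono: "i \<le> d \<Longrightarrow> j \<le> d \<Longrightarrow> k \<le> d \<Longrightarrow> poly_span d (\<lambda>s t u. a * (int s ^ i * (int t ^ j * int u ^ k)))"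
| span_add: "poly_span d f \<Longrightarrow> poly_span d g \<Longrightarrow> poly_span d (\<lambda>s t u. f s t u + g s t u)"

lemma span_scale: "poly_span d f \<Longrightarrow> poly_span d (\<lambda>s t u. b * f s t u)"
proof (induction rule: poly_span.induct)
  case (span_mono i j k a)
  then show ?case using poly_span.span_mono[of i d j k "b * a"] by (simp add: mult.assoc)
next
  case (span_add f g)
  then show ?case using poly_span.span_add[of d "\<lambda>s t u. b * f s t u"] by (simp add: distrib_left)
qed

lemma span_const: "poly_span d (\<lambda>s t u. a)"
  using span_mono[of 0 d 0 0 a] by simp

lemma span_sum: "poly_span d (\<lambda>s t u. \<Sum>v<(n::nat). f v s t u)" if "\<And>v. v < n \<Longrightarrow> poly_span d (f v)"
  using that by (induction n) (simp_all add: span_const span_add)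

text \<open>An affine factor raises the degree in each variable by at most one, so a product with
  one such factor per digit has degree at most the number of digits.\<close>

lemma span_mult_affine:
  assumes "poly_span d f"
  shows "poly_span (Suc d) (\<lambda>s t u. (e0 + e1 * int s + e2 * int t + e3 * int u) * f s t u)"
  using assms
proof (induction rule: poly_span.induct)
  case (span_mono i j k a)
  have "poly_span (Suc d) (\<lambda>s t u. ((e0 * a) * (int s ^ i * (int t ^ j * int u ^ k)) + (e1 * a) * (int s ^ Suc i * (int t ^ j * int u ^ k)))
     + ((e2 * a) * (int s ^ i * (int t ^ Suc j * int u ^ k)) + (e3 * a) * (int s ^ i * (int t ^ j * int u ^ Suc k))))"
    by (intro span_add poly_span.span_mono) (use span_mono in auto)
  then show ?case by (simp add: algebra_simps)
next
  case (span_add f g)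
  from poly_span.span_add[OF span_add.IH] show ?case by (simp add: distrib_left)
qed

lemma span_coeffs:
  assumes "poly_span d f"
  shows "\<exists>c. \<forall>s t u. f s t u = (\<Sum>i<Suc d. \<Sum>j<Suc d. \<Sum>k<Suc d. c i j k * (int s ^ i * (int t ^ j * int u ^ k)))"
  using assms
proof (induction rule: poly_span.induct)
  case (span_mono i j k a)
  let ?c = "\<lambda>i' j' k'. if i' = i \<and> j' = j \<and> k' = k then a else 0"
  have "a * (int s ^ i * (int t ^ j * int u ^ k)) =
     (\<Sum>i'<Suc d. \<Sum>j'<Suc d. \<Sum>k'<Suc d. ?c i' j' k' * (int s ^ i' * (int t ^ j' * int u ^ k')))" for s t u
  proof -
    have "?c i' j' k' * (int s ^ i' * (int t ^ j' * int u ^ k')) =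
      (if k' = k then if j' = j then if i' = i then a * (int s ^ i * (int t ^ j * int u ^ k)) else 0 else 0 else 0)" for i' j' k'
      by auto
    then show ?thesis using span_mono by (simp only:) (simp add: sum.delta del: sum.lessThan_Suc)
  qed
  then show ?case by (intro exI[of _ ?c] allI)
next
  case (span_add f g)
  then obtain c c' where c: "\<forall>s t u. f s t u = (\<Sum>i<Suc d. \<Sum>j<Suc d. \<Sum>k<Suc d. c i j k * (int s ^ i * (int t ^ j * int u ^ k)))"
    "\<forall>s t u. g s t u = (\<Sum>i<Suc d. \<Sum>j<Suc d. \<Sum>k<Suc d. c' i j k * (int s ^ i * (int t ^ j * int u ^ k)))" by blast
  show ?case
    by (rule exI[of _ "\<lambda>i j k. c i j k + c' i j k"])
      (simp only: c distrib_right sum.distrib, simp)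
qed

lemma mixed_radix_less: "i < L \<Longrightarrow> q < K \<Longrightarrow> i + L * q < L * (K::nat)"
proof -
  assume "i < L" "q < K"
  then have "i + L * q < L * Suc q" "L * Suc q \<le> L * K" by (simp, intro mult_le_mono2, simp)
  then show ?thesis by linarith
qed

lemma mixed_radix: "i < L \<Longrightarrow> (i + L * q) mod L = (i::nat)" "i < L \<Longrightarrow> (i + L * q) div L = q"
  by simp_all

locale prime_digits =
  fixes p l :: nat
  assumes prime_p: "prime p"
begin

lemma p_gt: "p > 1" "p > 0" using prime_p prime_gt_1_nat prime_gt_0_nat by blast+

text \<open>Digitwise \<open>y + s (a - y) + t (b - y) + u (c - y)\<close> modulo \<open>p\<close>. The summand \<open>3 * p\<close> keeps the
  truncated subtraction exact for \<open>s, t, u < p\<close>.\<close>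
definition pt :: "nat \<Rightarrow> nat \<Rightarrow> nat \<Rightarrow> nat \<Rightarrow> nat \<Rightarrow> nat \<Rightarrow> nat \<Rightarrow> nat" where
  "pt y a b c s t u = (\<Sum>k<l. p ^ k * ((dig p y k * (1 + 3 * p - s - t - u) + s * dig p a k + t * dig p b k + u * dig p c k) mod p))"

text \<open>The digits of \<open>f\<close> are the coefficients of a polynomial in three variables.\<close>
definition fev :: "nat \<Rightarrow> nat \<Rightarrow> nat \<Rightarrow> nat \<Rightarrow> nat" where
  "fev f s t u = (\<Sum>i<Suc l. \<Sum>j<Suc l. \<Sum>k<Suc l. dig p f (i + Suc l * (j + Suc l * k)) * (s ^ i * (t ^ j * u ^ k))) mod p"

definition fnum :: nat where "fnum = p ^ (Suc l ^ 3)"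

definition Fs :: "(nat \<Rightarrow> nat \<Rightarrow> nat \<Rightarrow> nat) set" where
  "Fs = fev ` {..<fnum}"

lemma pt_less: "pt y a b c s t u < p ^ l"
  unfolding pt_def by (rule digit_sum_less) (use p_gt in auto)

lemma dig_pt: "k < l \<Longrightarrow> dig p (pt y a b c s t u) k =
    (dig p y k * (1 + 3 * p - s - t - u) + s * dig p a k + t * dig p b k + u * dig p c k) mod p"
  unfolding pt_def by (rule dig_digit_sum) (use p_gt in auto)

text \<open>The equalities hold before reduction modulo \<open>p\<close>: on the degenerate flat the
  point \<open>y\<close> occurs three times, and its weights add up to its weight on the
  line.\<close>

lemma pt_axis:
  assumes "s < p" "t < p" "u < p"
  shows "pt y a b c s 0 0 = pt y a y y s t u" "pt y a b c 0 s 0 = pt y b y y s t u" "pt y a b c 0 0 s = pt y c y y s t u"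
proof -
  define q where "q = 1 + 3 * p - s - t - u"
  have "1 + 3 * p - s = q + t + u" using assms by (simp add: q_def)
  then have "z * (1 + 3 * p - s) + s * x = z * q + s * x + t * z + u * z" for x z
    by (simp only:) (simp add: algebra_simps)
  then have *: "z * (1 + 3 * p - s) + s * x = z * (1 + 3 * p - s - t - u) + s * x + t * z + u * z" for x z
    unfolding q_def .
  show "pt y a b c s 0 0 = pt y a y y s t u" "pt y a b c 0 s 0 = pt y b y y s t u" "pt y a b c 0 0 s = pt y c y y s t u"
    unfolding pt_def by (simp_all only: diff_zero mult_zero_left add_0_right *)
qed

text \<open>In each digit the map is affine in the digit of \<open>a\<close> with slope
  \<open>s\<close>, which is invertible modulo \<open>p\<close>.\<close>

lemma pt_bij:
  assumes s: "0 < s" "s < p"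
  shows "bij_betw (\<lambda>a. pt y a y y s 0 0) {..<p ^ l} {..<p ^ l}"
proof -
  have "inj_on (\<lambda>a. pt y a y y s 0 0) {..<p ^ l}"
  proof (rule inj_onI)
    fix a a' assume a: "a \<in> {..<p ^ l}" "a' \<in> {..<p ^ l}" and eq: "pt y a y y s 0 0 = pt y a' y y s 0 0"
    show "a = a'"
    proof (rule dig_eqI[of _ p l])
      fix k assume k: "k < l"
      have "[dig p y k * (1 + 3 * p - s) + s * dig p a k = dig p y k * (1 + 3 * p - s) + s * dig p a' k] (mod p)"
        using dig_pt[OF k, of y a y y s 0 0] dig_pt[OF k, of y a' y y s 0 0] eq by (simp add: cong_def)
      then have "[s * dig p a k = s * dig p a' k] (mod p)" by (simp add: cong_add_lcancel_nat)
      moreover have "coprime s p" using s prime_p by (metis coprime_commute nat_dvd_not_less prime_imp_coprime)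
      ultimately have "[dig p a k = dig p a' k] (mod p)" by (simp add: cong_mult_lcancel_nat)
      then show "dig p a k = dig p a' k" by (simp add: cong_def dig_def)
    qed (use a in auto)
  qed
  moreover have "(\<lambda>a. pt y a y y s 0 0) ` {..<p ^ l} \<subseteq> {..<p ^ l}" using pt_less by auto
  ultimately show ?thesis by (simp add: bij_betw_def endo_inj_surj)
qed

text \<open>The code has the coefficients, reduced modulo \<open>p\<close>, as its digits; the
  position of a digit lists the three exponents in base \<open>Suc l\<close>.\<close>

lemma fev_coeffs: "\<exists>f<fnum. \<forall>s t u. fev f s t u = (\<Sum>i<Suc l. \<Sum>j<Suc l. \<Sum>k<Suc l. c i j k * (s ^ i * (t ^ j * u ^ k))) mod p"
proof -
  let ?L = "Suc l"
  define e where "e n = c (n mod ?L) (n div ?L mod ?L) (n div ?L div ?L) mod p" for n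
  define f where "f = (\<Sum>n<?L ^ 3. p ^ n * e n)"
  have ep: "e n < p" for n using p_gt by (simp add: e_def)
  have f: "f < fnum" unfolding f_def fnum_def by (rule digit_sum_less) (rule ep)
  have d: "dig p f (i + ?L * (j + ?L * k)) = c i j k mod p" if "i < ?L" "j < ?L" "k < ?L" for i j k
  proof -
    have "i + ?L * (j + ?L * k) < ?L * (?L * ?L)" using that by (intro mixed_radix_less)
    then have "i + ?L * (j + ?L * k) < ?L ^ 3" by (simp only: power3_eq_cube mult.assoc)
    then have "dig p f (i + ?L * (j + ?L * k)) = e (i + ?L * (j + ?L * k))"
      unfolding f_def by (rule dig_digit_sum[OF ep])
    then show ?thesis unfolding e_def mixed_radix[OF that(1)] mixed_radix[OF that(2)] by simp
  qed
  have "fev f s t u = (\<Sum>i<?L. \<Sum>j<?L. \<Sum>k<?L. c i j k * (s ^ i * (t ^ j * u ^ k))) mod p" for s t u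
  proof -
    have "[(\<Sum>i<?L. \<Sum>j<?L. \<Sum>k<?L. dig p f (i + ?L * (j + ?L * k)) * (s ^ i * (t ^ j * u ^ k))) =
       (\<Sum>i<?L. \<Sum>j<?L. \<Sum>k<?L. c i j k * (s ^ i * (t ^ j * u ^ k)))] (mod p)"
    proof (intro cong_sum cong_mult cong_refl)
      fix i j k assume "i \<in> {..<?L}" "j \<in> {..<?L}" "k \<in> {..<?L}"
      then show "[dig p f (i + ?L * (j + ?L * k)) = c i j k] (mod p)" using d by (simp add: cong_def)
    qed
    then show ?thesis by (simp only: fev_def cong_def)
  qed
  then show ?thesis using f by blast
qed

text \<open>With two variables set to 0 only the coefficients of the pure powers of the third
  remain. Placed at the exponents \<open>(i, 0, 0)\<close> they form a polynomial that ignores its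
  last two arguments.\<close>

lemma Fs_axis:
  assumes "f \<in> Fs"
  shows "\<exists>g\<in>Fs. \<forall>s t u. g s t u = f s 0 0" "\<exists>g\<in>Fs. \<forall>s t u. g s t u = f 0 s 0" "\<exists>g\<in>Fs. \<forall>s t u. g s t u = f 0 0 s"
proof -
  let ?L = "Suc l"
  obtain n where n: "f = fev n" using assms by (auto simp: Fs_def)
  define c where "c i j k = dig p n (i + ?L * (j + ?L * k))" for i j k
  have f: "f s t u = (\<Sum>i<?L. \<Sum>j<?L. \<Sum>k<?L. c i j k * (s ^ i * (t ^ j * u ^ k))) mod p" for s t u
    unfolding n fev_def c_def ..
  have z: "(\<Sum>j<?L. g j * (0::nat) ^ j) = g 0" for g
    by (simp add: sum.lessThan_Suc_shift del: sum.lessThan_Suc)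
  have ax: "\<exists>g\<in>Fs. \<forall>s t u. g s t u = (\<Sum>i<?L. a i * s ^ i) mod p" for a :: "nat \<Rightarrow> nat"
  proof -
    obtain m where m: "m < fnum" "\<And>s t u. fev m s t u = (\<Sum>i<?L. \<Sum>j<?L. \<Sum>k<?L. (if j = 0 \<and> k = 0 then a i else 0) * (s ^ i * (t ^ j * u ^ k))) mod p"
      using fev_coeffs[of "\<lambda>i j k. if j = 0 \<and> k = 0 then a i else 0"] by blast
    have "(\<Sum>i<?L. \<Sum>j<?L. \<Sum>k<?L. (if j = 0 \<and> k = 0 then a i else 0) * (s ^ i * (t ^ j * u ^ k))) = (\<Sum>i<?L. a i * s ^ i)" for s t u
      by (intro sum.cong refl) (simp add: sum.lessThan_Suc_shift del: sum.lessThan_Suc)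
    then show ?thesis using m by (intro bexI[of _ "fev m"]) (auto simp: Fs_def)
  qed
  have "f s 0 0 = (\<Sum>i<?L. c i 0 0 * s ^ i) mod p" for s
    unfolding f by (simp add: sum.lessThan_Suc_shift del: sum.lessThan_Suc)
  then show "\<exists>g\<in>Fs. \<forall>s t u. g s t u = f s 0 0" using ax[of "\<lambda>i. c i 0 0"] by simp
  have "f 0 s 0 = (\<Sum>i<?L. c 0 i 0 * s ^ i) mod p" for s
    unfolding f by (subst sum.lessThan_Suc_shift) (simp add: sum.lessThan_Suc_shift[where n = l] del: sum.lessThan_Suc)
  then show "\<exists>g\<in>Fs. \<forall>s t u. g s t u = f 0 s 0" using ax[of "\<lambda>i. c 0 i 0"] by simp
  have "f 0 0 s = (\<Sum>i<?L. c 0 0 i * s ^ i) mod p" for s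
    unfolding f by (subst sum.lessThan_Suc_shift, subst sum.lessThan_Suc_shift) (simp del: sum.lessThan_Suc)
  then show "\<exists>g\<in>Fs. \<forall>s t u. g s t u = f 0 0 s" using ax[of "\<lambda>i. c 0 0 i"] by simp
qed

lemma Fs_low_degree3:
  assumes "f \<in> Fs"
  shows "low_degree3 p l f"
proof -
  let ?L = "Suc l"
  obtain n where n: "f = fev n" using assms by (auto simp: Fs_def)
  define c where "c i j k = int (dig p n (i + ?L * (j + ?L * k)))" for i j k
  have f: "int (f s t u) = (\<Sum>i<?L. \<Sum>j<?L. \<Sum>k<?L. c i j k * (int s ^ i * (int t ^ j * int u ^ k))) mod int p" for s t u
    unfolding n fev_def c_def by (simp add: zmod_int del: sum.lessThan_Suc)
  have lw: "low_degree p l h" if "\<And>s. int (h s) = (\<Sum>i<?L. a i * int s ^ i) mod int p" for h a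
    unfolding low_degree_def lessThan_Suc_atMost[symmetric] using that by blast
  have sw: "(\<Sum>i<n. \<Sum>j<n. \<Sum>k<n. g i j k) = (\<Sum>k<n. \<Sum>i<n. \<Sum>j<n. g i j k)" for g :: "nat \<Rightarrow> nat \<Rightarrow> nat \<Rightarrow> int" and n
  proof -
    have "(\<Sum>i<n. \<Sum>j<n. \<Sum>k<n. g i j k) = (\<Sum>i<n. \<Sum>k<n. \<Sum>j<n. g i j k)"
      by (intro sum.cong refl sum.swap)
    also have "\<dots> = (\<Sum>k<n. \<Sum>i<n. \<Sum>j<n. g i j k)" by (rule sum.swap)
    finally show ?thesis .
  qed
  have "low_degree p l (\<lambda>x. f x s t)" for s t
    by (rule lw[of _ "\<lambda>i. \<Sum>j<?L. \<Sum>k<?L. c i j k * (int s ^ j * int t ^ k)"])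
      (simp add: f sum_distrib_right sum_distrib_left mult_ac del: sum.lessThan_Suc)
  moreover have "low_degree p l (\<lambda>x. f s x t)" for s t
    by (rule lw[of _ "\<lambda>j. \<Sum>i<?L. \<Sum>k<?L. c i j k * (int s ^ i * int t ^ k)"], subst f, subst sum.swap)
      (simp add: sum_distrib_right sum_distrib_left mult_ac del: sum.lessThan_Suc)
  moreover have "low_degree p l (f s t)" for s t
    by (rule lw[of _ "\<lambda>k. \<Sum>i<?L. \<Sum>j<?L. c i j k * (int s ^ i * int t ^ j)"], subst f, subst sw)
      (simp add: sum_distrib_right sum_distrib_left mult_ac del: sum.lessThan_Suc)
  ultimately show ?thesis by (auto simp: low_degree3_def)
qed

section \<open>Vertices of the cube and multilinear extension\<close>

definition vpt :: "nat \<Rightarrow> nat" where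
  "vpt v = (\<Sum>k<l. p ^ k * of_bool (odd (v div 2 ^ k)))"

lemma vpt_less: "vpt v < p ^ l"
  unfolding vpt_def by (rule digit_sum_less) (use p_gt in auto)

lemma dig_vpt: "k < l \<Longrightarrow> dig p (vpt v) k = of_bool (odd (v div 2 ^ k))"
  unfolding vpt_def by (rule dig_digit_sum) (use p_gt in auto)

text \<open>The multilinear extension of \<open>\<alpha>\<close> from the cube \<open>{0, 1} ^ l\<close>, modulo \<open>p\<close>.\<close>
definition mext :: "(nat \<Rightarrow> bool) \<Rightarrow> nat \<Rightarrow> nat" where
  "mext \<alpha> x = nat ((\<Sum>v<2 ^ l. of_bool (\<alpha> v) *
     (\<Prod>k<l. if odd (v div 2 ^ k) then int (dig p x k) else 1 - int (dig p x k))) mod int p)"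

lemma mext_less: "mext \<alpha> x < p"
  unfolding mext_def using p_gt by (simp add: nat_less_iff)

text \<open>At a vertex every factor is 0 or 1, and the product belonging to \<open>v'\<close> is 1
  only for \<open>v' = v\<close>, since different numbers below \<open>2 ^ l\<close> differ in a
  binary digit.\<close>

lemma mext_vpt:
  assumes "v < 2 ^ l"
  shows "mext \<alpha> (vpt v) = of_bool (\<alpha> v)"
proof -
  let ?P = "\<lambda>v'. \<Prod>k<l. if odd (v' div 2 ^ k) then int (dig p (vpt v) k) else 1 - int (dig p (vpt v) k)"
  have "?P v' = of_bool (v' = v)" if v': "v' < 2 ^ l" for v'
  proof (cases "v' = v")
    case True
    then show ?thesis by (intro trans[OF prod.neutral]) (auto simp: dig_vpt)
  next
    case False
    then obtain k where k: "k < l" "dig 2 v' k \<noteq> dig 2 v k" using dig_eqI[OF v' assms] by blast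
    then have "odd (v' div 2 ^ k) \<noteq> odd (v div 2 ^ k)" by (auto simp: dig_def mod2_eq_if split: if_splits)
    then have "\<exists>k<l. (if odd (v' div 2 ^ k) then int (dig p (vpt v) k) else 1 - int (dig p (vpt v) k)) = 0"
      using k(1) dig_vpt by (intro exI[of _ k]) auto
    then have "?P v' = 0" by (intro prod_zero) (simp, blast)
    then show ?thesis using False by simp
  qed
  then have "(\<Sum>v'<2 ^ l. of_bool (\<alpha> v') * ?P v') = (\<Sum>v'<2 ^ l. if v' = v then of_bool (\<alpha> v) else 0)"
    by (intro sum.cong) auto
  then have "(\<Sum>v'<2 ^ l. of_bool (\<alpha> v') * ?P v') = of_bool (\<alpha> v)" using assms by simp
  then show ?thesis unfolding mext_def using p_gt by auto
qed

text \<open>Along a flat each digit is affine in \<open>s, t, u\<close> modulo \<open>p\<close>, so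
  a product of \<open>l\<close> digits or complements of digits has degree at most \<open>l\<close>
  in each parameter. This is the reason for the degree bound \<open>l\<close> on flats.\<close>

lemma mext_pt: "\<exists>g\<in>Fs. \<forall>s<p. \<forall>t<p. \<forall>u<p. g s t u = mext \<alpha> (pt y a b c s t u)"
proof -
  let ?aff = "\<lambda>(v::nat) k s t u. if odd (v div 2 ^ k)
    then int (dig p y k) + (int (dig p a k) - int (dig p y k)) * int s + (int (dig p b k) - int (dig p y k)) * int t + (int (dig p c k) - int (dig p y k)) * int u
    else (1 - int (dig p y k)) + (int (dig p y k) - int (dig p a k)) * int s + (int (dig p y k) - int (dig p b k)) * int t + (int (dig p y k) - int (dig p c k)) * int u"
  have prod: "poly_span m (\<lambda>s t u. \<Prod>k<m. ?aff v k s t u)" for m v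
  proof (induction m)
    case 0 show ?case using span_const[of 0 1] by simp
  next
    case (Suc m)
    have eq: "(\<lambda>s t u. \<Prod>k<Suc m. ?aff v k s t u) = (\<lambda>s t u. ?aff v m s t u * (\<Prod>k<m. ?aff v k s t u))"
      by (intro ext) (simp only: prod.lessThan_Suc mult.commute)
    show ?case
    proof (cases "odd (v div 2 ^ m)")
      case True
      show ?thesis unfolding eq unfolding if_P[OF True] by (rule span_mult_affine[OF Suc])
    next
      case False
      show ?thesis unfolding eq unfolding if_not_P[OF False] by (rule span_mult_affine[OF Suc])
    qed
  qed
  let ?h = "\<lambda>s t u. \<Sum>v<2 ^ l. of_bool (\<alpha> v) * (\<Prod>k<l. ?aff v k s t u)"
  have "poly_span l ?h" by (intro span_sum span_scale prod)
  then obtain cf where cf: "\<And>s t u. ?h s t u = (\<Sum>i<Suc l. \<Sum>j<Suc l. \<Sum>k<Suc l. cf i j k * (int s ^ i * (int t ^ j * int u ^ k)))"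
    using span_coeffs by blast
  obtain f where f: "f < fnum" "\<And>s t u. fev f s t u = (\<Sum>i<Suc l. \<Sum>j<Suc l. \<Sum>k<Suc l. nat (cf i j k mod int p) * (s ^ i * (t ^ j * u ^ k))) mod p"
    using fev_coeffs[of "\<lambda>i j k. nat (cf i j k mod int p)"] by blast
  have "fev f s t u = mext \<alpha> (pt y a b c s t u)" if stu: "s < p" "t < p" "u < p" for s t u
  proof -
    have pp: "int p > 0" using p_gt by simp
    have c1: "[int (\<Sum>i<Suc l. \<Sum>j<Suc l. \<Sum>k<Suc l. nat (cf i j k mod int p) * (s ^ i * (t ^ j * u ^ k))) = ?h s t u] (mod int p)"
      unfolding cf of_nat_sum of_nat_mult of_nat_power
      by (intro cong_sum cong_mult cong_refl) (use pp in \<open>simp add: cong_def\<close>)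
    have c2: "[?h s t u = (\<Sum>v<2 ^ l. of_bool (\<alpha> v) *
       (\<Prod>k<l. if odd (v div 2 ^ k) then int (dig p (pt y a b c s t u) k) else 1 - int (dig p (pt y a b c s t u) k)))] (mod int p)"
    proof (intro cong_sum cong_mult cong_refl cong_prod)
      fix v k assume "k \<in> {..<l}"
      then have k: "k < l" by simp
      define yk where "yk = int (dig p y k)"
      define ak where "ak = int (dig p a k)"
      define bk where "bk = int (dig p b k)"
      define ck where "ck = int (dig p c k)"
      have sub: "int (1 + 3 * p - s - t - u) = 1 + 3 * int p - int s - int t - int u" using stu by simp
      have "int (dig p (pt y a b c s t u) k) = (yk * (1 + 3 * int p - int s - int t - int u) + int s * ak + int t * bk + int u * ck) mod int p"
        unfolding dig_pt[OF k] zmod_int of_nat_add of_nat_mult sub yk_def ak_def bk_def ck_def ..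
      \<comment> \<open>The summand \<open>3 * p\<close>, present only to keep the subtraction on
        naturals exact, disappears modulo \<open>p\<close>.\<close>
      also have "yk * (1 + 3 * int p - int s - int t - int u) + int s * ak + int t * bk + int u * ck =
          (yk + (ak - yk) * int s + (bk - yk) * int t + (ck - yk) * int u) + int p * (3 * yk)"
        by (simp add: algebra_simps)
      finally have D: "[yk + (ak - yk) * int s + (bk - yk) * int t + (ck - yk) * int u = int (dig p (pt y a b c s t u) k)] (mod int p)"
        by (simp add: cong_def)
      have "[1 - (yk + (ak - yk) * int s + (bk - yk) * int t + (ck - yk) * int u) = 1 - int (dig p (pt y a b c s t u) k)] (mod int p)"
        by (intro cong_diff cong_refl D)
      moreover have "1 - (yk + (ak - yk) * int s + (bk - yk) * int t + (ck - yk) * int u) =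
         (1 - yk) + (yk - ak) * int s + (yk - bk) * int t + (yk - ck) * int u" by (simp add: algebra_simps)
      ultimately show "[?aff v k s t u = (if odd (v div 2 ^ k) then int (dig p (pt y a b c s t u) k) else 1 - int (dig p (pt y a b c s t u) k))] (mod int p)"
        using D unfolding yk_def ak_def bk_def ck_def by simp
    qed
    have "int (fev f s t u) = (\<Sum>v<2 ^ l. of_bool (\<alpha> v) *
       (\<Prod>k<l. if odd (v div 2 ^ k) then int (dig p (pt y a b c s t u) k) else 1 - int (dig p (pt y a b c s t u) k))) mod int p"
      using cong_trans[OF c1 c2] by (simp only: f(2) zmod_int cong_def)
    then show ?thesis unfolding mext_def by (metis nat_int)
  qed
  then show ?thesis using f(1) by (intro bexI[of _ "fev f"]) (auto simp: Fs_def)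
qed

end


section \<open>Pure Horn representations of rule systems\<close>

lemma distinct_concat_map_upt:
  assumes "\<And>i. i < n \<Longrightarrow> distinct (f i)"
    and "\<And>i j. i < n \<Longrightarrow> j < n \<Longrightarrow> i \<noteq> j \<Longrightarrow> set (f i) \<inter> set (f j) = {}"
  shows "distinct (concat (map f [0..<n]))"
  using assms by (induction n) (auto simp: less_Suc_eq, blast+)

text \<open>Equal premises encode a rule with one premise; its literal is written once because
  \<open>cnf_on\<close> forbids repetitions.\<close>

definition rule_clause :: "nat \<Rightarrow> nat \<Rightarrow> nat \<Rightarrow> clause" where
  "rule_clause b c h = (if b = c then [Neg b, Pos h] else [Neg b, Neg c, Pos h])"

text \<open>Nested loops over all triples, in the form in which a machine can print the clauses one
  after the other while testing \<open>R\<close>.\<close>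

definition rules_cnf :: "nat \<Rightarrow> (nat \<Rightarrow> nat \<Rightarrow> nat \<Rightarrow> bool) \<Rightarrow> cnf" where
  "rules_cnf D R = concat (map (\<lambda>b. concat (map (\<lambda>c. concat (map (\<lambda>h.
     if R b c h then [rule_clause b c h] else []) [0..<D])) [0..<D])) [0..<D])"

text \<open>The \<open>r\<close> selectors are interchangeable. In any representation each needs
  clauses of its own whose heads generate everything, so the cost of a generating set is multiplied
  by \<open>r\<close> and outweighs the rules once \<open>r\<close> is large.\<close>

definition selectors_cnf :: "nat \<Rightarrow> nat \<Rightarrow> nat set \<Rightarrow> cnf" where
  "selectors_cnf D r S = concat (map (\<lambda>k. concat (map (\<lambda>u.
     if u \<in> S then [[Neg (D + k), Pos u]] else []) [0..<D])) [0..<r])"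

definition horn_cnf :: "nat \<Rightarrow> nat \<Rightarrow> (nat \<Rightarrow> nat \<Rightarrow> nat \<Rightarrow> bool) \<Rightarrow> nat set \<Rightarrow> cnf" where
  "horn_cnf D r R S = rules_cnf D R @ selectors_cnf D r S"

inductive_set closure_of :: "(nat \<Rightarrow> nat \<Rightarrow> nat \<Rightarrow> bool) \<Rightarrow> nat set \<Rightarrow> nat set"
  for R :: "nat \<Rightarrow> nat \<Rightarrow> nat \<Rightarrow> bool" and X :: "nat set" where
  closure_base: "x \<in> X \<Longrightarrow> x \<in> closure_of R X"
| closure_step: "b \<in> closure_of R X \<Longrightarrow> c \<in> closure_of R X \<Longrightarrow> R b c h \<Longrightarrow> h \<in> closure_of R X"

text \<open>\<open>R_asym\<close> admits only one order of two different premises, so different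
  rules have different sets of literals. \<open>R_fun\<close> limits the number of rules to
  \<open>2 * D ^ 2\<close>, which is comparable to the number of selectors chosen later.\<close>

locale rule_system =
  fixes D r :: nat and R :: "nat \<Rightarrow> nat \<Rightarrow> nat \<Rightarrow> bool" and P :: "nat set"
  assumes R_less: "R b c h \<Longrightarrow> b < D \<and> c < D \<and> h < D"
    and R_head: "R b c h \<Longrightarrow> h \<noteq> b \<and> h \<noteq> c"
    and R_asym: "R b c h \<Longrightarrow> b \<noteq> c \<Longrightarrow> \<not> R c b h'"
    and R_fun: "R b c h \<Longrightarrow> R b c h' \<Longrightarrow> b \<noteq> c \<Longrightarrow> h = h'"
    and P_less: "P \<subseteq> {..<D}"
begin

lemma set_rules_cnf: "set (rules_cnf D R) = {rule_clause b c h | b c h. R b c h}"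
  unfolding rules_cnf_def using R_less by (auto split: if_splits) fastforce+

lemma set_selectors_cnf: "S \<subseteq> P \<Longrightarrow> set (selectors_cnf D r S) = {[Neg (D + k), Pos u] | k u. k < r \<and> u \<in> S}"
  unfolding selectors_cnf_def using P_less by (auto split: if_splits)

lemma rule_clause_inj:
  assumes "set (rule_clause b c h) = set (rule_clause b' c' h')" "R b c h" "R b' c' h'"
  shows "b = b' \<and> c = c' \<and> h = h'"
proof -
  have h: "h = h'" using assms(1) by (auto simp: rule_clause_def split: if_splits)
  have "{v. Neg v \<in> set (rule_clause b c h)} = {b, c}" "{v. Neg v \<in> set (rule_clause b' c' h')} = {b', c'}"
    by (auto simp: rule_clause_def)
  then have "{b, c} = {b', c'}" using assms(1) by simp
  then have "b = b' \<and> c = c' \<or> b = c' \<and> c = b'" by (auto simp: doubleton_eq_iff)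
  then show ?thesis using h assms R_asym by metis
qed

lemma distinct_rules_cnf: "distinct (rules_cnf D R)"
  unfolding rules_cnf_def
  by (intro distinct_concat_map_upt) (auto split: if_splits dest: rule_clause_inj[OF arg_cong[of _ _ set]])

lemma distinct_selectors_cnf: "distinct (selectors_cnf D r S)"
  unfolding selectors_cnf_def
  by (intro distinct_concat_map_upt) (auto split: if_splits)

lemma cnf_on_horn_cnf:
  assumes "S \<subseteq> P"
  shows "cnf_on (D + r) (horn_cnf D r R S)"
proof -
  have disj: "rule_clause b c h \<noteq> [Neg (D + k), Pos u]" "set (rule_clause b c h) \<noteq> {Neg (D + k), Pos u}" if "R b c h" for b c h k u
  proof -
    have "Neg b \<in> set (rule_clause b c h)" by (simp add: rule_clause_def)
    moreover have "Neg b \<notin> {Neg (D + k), Pos u}" using R_less[OF that] by auto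
    ultimately show "set (rule_clause b c h) \<noteq> {Neg (D + k), Pos u}" by blast
    then show "rule_clause b c h \<noteq> [Neg (D + k), Pos u]" by auto
  qed
  have "inj_on set (set (horn_cnf D r R S))"
    unfolding horn_cnf_def set_append set_rules_cnf set_selectors_cnf[OF assms]
  proof (rule inj_onI)
    fix x y assume x: "x \<in> {rule_clause b c h |b c h. R b c h} \<union> {[Neg (D + k), Pos u] |k u. k < r \<and> u \<in> S}"
      and y: "y \<in> {rule_clause b c h |b c h. R b c h} \<union> {[Neg (D + k), Pos u] |k u. k < r \<and> u \<in> S}"
      and eq: "set x = set y"
    consider (rr) b c h b' c' h' where "x = rule_clause b c h" "R b c h" "y = rule_clause b' c' h'" "R b' c' h'"
      | (rs) b c h k u where "x = rule_clause b c h" "R b c h" "y = [Neg (D + k), Pos u]"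
      | (sr) b c h k u where "y = rule_clause b c h" "R b c h" "x = [Neg (D + k), Pos u]"
      | (ss) k u k' u' where "x = [Neg (D + k), Pos u]" "y = [Neg (D + k'), Pos u']"
      using x y by blast
    then show "x = y"
    proof cases
      case rr then show ?thesis using rule_clause_inj eq by metis
    next
      case rs
      have "set (rule_clause b c h) = {Neg (D + k), Pos u}" using eq rs(1,3) by simp
      then show ?thesis using disj(2)[OF rs(2)] by blast
    next
      case sr
      have "set (rule_clause b c h) = {Neg (D + k), Pos u}" using eq sr(1,3) by simp
      then show ?thesis using disj(2)[OF sr(2)] by blast
    next
      case ss then show ?thesis using eq by (auto simp: doubleton_eq_iff)
    qed
  qed
  moreover have "distinct (horn_cnf D r R S)"
    unfolding horn_cnf_def distinct_append set_rules_cnf set_selectors_cnf[OF assms]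
    using distinct_rules_cnf distinct_selectors_cnf disj(1) by blast
  ultimately have "distinct (map set (horn_cnf D r R S))" by (simp add: distinct_map)
  moreover have "distinct C \<and> (\<forall>l\<in>set C. lit_var l < D + r)" if "C \<in> set (horn_cnf D r R S)" for C
  proof -
    show ?thesis using that assms P_less unfolding horn_cnf_def set_append set_rules_cnf set_selectors_cnf[OF assms]
    proof (elim UnE CollectE exE conjE)
      fix b c h assume "C = rule_clause b c h" "R b c h"
      then show ?thesis using R_less[of b c h] by (auto simp: rule_clause_def)
    next
      fix k u assume "C = [Neg (D + k), Pos u]" "k < r" "u \<in> S"
      then show ?thesis using assms P_less by auto
    qed
  qed
  ultimately show ?thesis unfolding cnf_on_def by blast
qed

lemma pure_horn_horn_cnf: "S \<subseteq> P \<Longrightarrow> pure_horn_cnf (horn_cnf D r R S)"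
  unfolding pure_horn_cnf_def pure_horn_clause_def horn_cnf_def set_append set_rules_cnf
  by (auto simp: set_selectors_cnf rule_clause_def)

lemma is_3cnf_horn_cnf: "S \<subseteq> P \<Longrightarrow> is_kcnf 3 (horn_cnf D r R S)"
  unfolding is_kcnf_def horn_cnf_def set_append set_rules_cnf
  by (auto simp: set_selectors_cnf rule_clause_def)

text \<open>Rules with one premise are counted by premise and head, rules with two premises by the
  premises alone, as these determine the head.\<close>

lemma length_rules_cnf: "length (rules_cnf D R) \<le> 2 * D ^ 2"
proof -
  let ?A = "(\<lambda>(b, h). rule_clause b b h) ` ({..<D} \<times> {..<D})"
  let ?B = "(\<lambda>(b, c). rule_clause b c (THE h. R b c h)) ` ({..<D} \<times> {..<D})"
  have "set (rules_cnf D R) \<subseteq> ?A \<union> ?B"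
  proof
    fix C assume "C \<in> set (rules_cnf D R)"
    then obtain b c h where C: "C = rule_clause b c h" "R b c h" by (auto simp: set_rules_cnf)
    show "C \<in> ?A \<union> ?B"
    proof (cases "b = c")
      case True
      then have "C = (\<lambda>(b, h). rule_clause b b h) (b, h)" using C(1) by simp
      moreover have "(b, h) \<in> {..<D} \<times> {..<D}" using R_less[OF C(2)] by simp
      ultimately show ?thesis by blast
    next
      case False
      then have "(THE h. R b c h) = h" by (metis the_equality C(2) R_fun)
      then have "C = (\<lambda>(b, c). rule_clause b c (THE h. R b c h)) (b, c)" using C(1) by simp
      moreover have "(b, c) \<in> {..<D} \<times> {..<D}" using R_less[OF C(2)] by simp
      ultimately show ?thesis by blast
    qed
  qed
  then have "card (set (rules_cnf D R)) \<le> card (?A \<union> ?B)" by (intro card_mono) auto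
  also have "\<dots> \<le> card ?A + card ?B" by (rule card_Un_le)
  also have "\<dots> \<le> D ^ 2 + D ^ 2"
    by (intro add_mono order_trans[OF card_image_le]) (auto simp: card_cartesian_product power2_eq_square)
  finally show ?thesis using distinct_card[OF distinct_rules_cnf] by simp
qed

lemma length_selectors_cnf:
  assumes "S \<subseteq> P"
  shows "length (selectors_cnf D r S) \<le> r * card S"
proof -
  have fin: "finite S" by (rule finite_subset[OF order_trans[OF assms P_less]]) simp
  have "set (selectors_cnf D r S) = (\<lambda>(k, u). [Neg (D + k), Pos u]) ` ({..<r} \<times> S)"
    unfolding set_selectors_cnf[OF assms] by auto
  then have "card (set (selectors_cnf D r S)) \<le> card ({..<r} \<times> S)"
    by (metis card_image_le finite_cartesian_product finite_lessThan fin)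
  then show ?thesis using distinct_card[OF distinct_selectors_cnf] by (simp add: card_cartesian_product)
qed

lemma num_clauses_horn_cnf:
  assumes "S \<subseteq> P"
  shows "num_clauses (horn_cnf D r R S) \<le> 2 * D ^ 2 + r * card S"
  using length_rules_cnf length_selectors_cnf[OF assms] by (simp add: num_clauses_def horn_cnf_def)

lemma num_literals_horn_cnf:
  assumes "S \<subseteq> P"
  shows "num_literals (horn_cnf D r R S) \<le> 6 * D ^ 2 + 2 * (r * card S)"
proof -
  have le: "(\<Sum>C\<leftarrow>\<phi>. length C) \<le> k * length \<phi>" if "\<forall>C\<in>set \<phi>. length C \<le> k" for \<phi> :: cnf and k
    using that by (induction \<phi>) auto
  have "(\<Sum>C\<leftarrow>rules_cnf D R. length C) \<le> 3 * length (rules_cnf D R)"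
    by (rule le) (auto simp: set_rules_cnf rule_clause_def)
  moreover have "(\<Sum>C\<leftarrow>selectors_cnf D r S. length C) \<le> 2 * length (selectors_cnf D r S)"
    by (rule le) (auto simp: set_selectors_cnf[OF assms])
  ultimately show ?thesis using length_rules_cnf length_selectors_cnf[OF assms]
    by (simp add: num_literals_def horn_cnf_def)
qed

section \<open>The represented function and its smallest representations\<close>

lemma cnf_fun_horn_cnf:
  assumes "S \<subseteq> P"
  shows "cnf_fun (horn_cnf D r R S) a \<longleftrightarrow> (\<forall>b c h. R b c h \<longrightarrow> a b \<longrightarrow> a c \<longrightarrow> a h) \<and>
    (\<forall>k<r. \<forall>u\<in>S. a (D + k) \<longrightarrow> a u)"
proof -
  have 1: "(\<exists>l\<in>set (rule_clause b c h). lit_true a l) \<longleftrightarrow> (a b \<longrightarrow> a c \<longrightarrow> a h)" for b c h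
    by (auto simp: rule_clause_def)
  have "cnf_fun (horn_cnf D r R S) a \<longleftrightarrow>
     (\<forall>C\<in>{rule_clause b c h | b c h. R b c h}. \<exists>l\<in>set C. lit_true a l) \<and>
     (\<forall>C\<in>{[Neg (D + k), Pos u] | k u. k < r \<and> u \<in> S}. \<exists>l\<in>set C. lit_true a l)"
    unfolding cnf_fun_def horn_cnf_def set_append set_rules_cnf set_selectors_cnf[OF assms] by blast
  also have "(\<forall>C\<in>{rule_clause b c h | b c h. R b c h}. \<exists>l\<in>set C. lit_true a l) \<longleftrightarrow>
      (\<forall>b c h. R b c h \<longrightarrow> a b \<longrightarrow> a c \<longrightarrow> a h)"
    using 1 by blast
  also have "(\<forall>C\<in>{[Neg (D + k), Pos u] | k u. k < r \<and> u \<in> S}. \<exists>l\<in>set C. lit_true a l) \<longleftrightarrow>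
      (\<forall>k<r. \<forall>u\<in>S. a (D + k) \<longrightarrow> a u)" by fastforce
  finally show ?thesis .
qed

text \<open>A selector that sets \<open>S\<close> also sets whatever the rules derive from
  \<open>S\<close>, hence all of \<open>P\<close>; so listing a generating set suffices.\<close>

lemma cnf_fun_generating:
  assumes "S \<subseteq> P" "P \<subseteq> closure_of R S"
  shows "cnf_fun (horn_cnf D r R S) = cnf_fun (horn_cnf D r R P)"
proof
  fix a
  have "a u" if a: "\<forall>b c h. R b c h \<longrightarrow> a b \<longrightarrow> a c \<longrightarrow> a h" "\<forall>u\<in>S. a u" and u: "u \<in> P" for u
  proof -
    have "u \<in> closure_of R S" using u assms by auto
    then show ?thesis by induction (use a in auto)
  qed
  then show "cnf_fun (horn_cnf D r R S) a = cnf_fun (horn_cnf D r R P) a"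
    using assms(1) unfolding cnf_fun_horn_cnf[OF assms(1)] cnf_fun_horn_cnf[OF order.refl] by blast
qed

text \<open>For each selector, \<open>T k\<close> collects the clauses of \<psi> with
  \<open>D + k\<close> as their only selector premise. These sets are disjoint, and the heads of
  \<open>T k\<close> among the first \<open>D\<close> variables generate \<open>P\<close>: otherwise
  the closure of these heads, together with the selector, satisfies all clauses of \<psi> but not
  the function.\<close>

lemma num_clauses_lower_bound:
  assumes \<psi>: "cnf_on (D + r) \<psi>" "pure_horn_cnf \<psi>" "cnf_fun \<psi> = cnf_fun (horn_cnf D r R P)"
    and \<kappa>: "\<And>X. X \<subseteq> {..<D} \<Longrightarrow> P \<subseteq> closure_of R X \<Longrightarrow> \<kappa> \<le> card X"
  shows "r * \<kappa> \<le> num_clauses \<psi>"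
proof -
  define T where "T k = {C \<in> set \<psi>. {j. j \<ge> D \<and> Neg j \<in> set C} = {D + k}}" for k
  define hd where "hd C = (THE v. Pos v \<in> set C)" for C
  have hd: "Pos v \<in> set C \<longleftrightarrow> v = hd C" if "C \<in> set \<psi>" for C v
  proof -
    have "\<exists>!v. Pos v \<in> set C" using \<psi>(2) that by (auto simp: pure_horn_cnf_def pure_horn_clause_def)
    then show ?thesis unfolding hd_def using theI'[of "\<lambda>v. Pos v \<in> set C"] by blast
  qed
  have "\<kappa> \<le> card (T k)" if k: "k < r" for k
  proof -
    define X where "X = hd ` T k \<inter> {..<D}"
    have "P \<subseteq> closure_of R X"
    proof (rule ccontr)
      assume nsub: "\<not> P \<subseteq> closure_of R X"
      \<comment> \<open>The selector \<open>D + k\<close> is set, but not all of \<open>P\<close>;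
        hence the function is false here and some clause of \<psi> must fail.\<close>
      define a where "a v \<longleftrightarrow> v \<in> closure_of R X \<or> v = D + k" for v
      have clD: "v < D" if "v \<in> closure_of R X" for v
        using that by induction (use R_less in \<open>auto simp: X_def\<close>)
      obtain u where "u \<in> P" "u \<notin> closure_of R X" using nsub by blast
      then have "\<not> a u" using P_less by (auto simp: a_def)
      then have "\<not> cnf_fun (horn_cnf D r R P) a"
        using k \<open>u \<in> P\<close> by (auto simp: cnf_fun_horn_cnf a_def)
      then have "\<not> cnf_fun \<psi> a" by (simp add: \<psi>(3))
      then obtain C where C: "C \<in> set \<psi>" "\<And>l. l \<in> set C \<Longrightarrow> \<not> lit_true a l" by (auto simp: cnf_fun_def)
      have neg: "a v" if "Neg v \<in> set C" for v using C(2)[OF that] by simp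
      have "\<not> a (hd C)" using C(2)[of "Pos (hd C)"] hd[OF C(1)] by simp
      show False
      proof (cases "Neg (D + k) \<in> set C")
        case True
        have "x = D + k" if "D \<le> x" "Neg x \<in> set C" for x
          using neg[OF that(2)] clD[of x] that(1) by (auto simp: a_def)
        then have "{j. j \<ge> D \<and> Neg j \<in> set C} = {D + k}" using True by auto
        then have CT: "C \<in> T k" using C(1) by (simp add: T_def)
        show False
        proof (cases "hd C < D")
          case True
          then have "hd C \<in> X" using CT by (auto simp: X_def)
          then show False using \<open>\<not> a (hd C)\<close> closure_base by (auto simp: a_def)
        next
          case False
          \<comment> \<open>The head is a different selector. Setting all circuit variables and the
            single selector \<open>D + k\<close> satisfies the function, but it would violate such a
            clause.\<close>
          define b where "b v \<longleftrightarrow> v < D \<or> v = D + k" for v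
          have "cnf_fun (horn_cnf D r R P) b"
            using R_less P_less by (auto simp: cnf_fun_horn_cnf b_def)
          then have "cnf_fun \<psi> b" by (simp add: \<psi>(3))
          then obtain l where l: "l \<in> set C" "lit_true b l" using C(1) by (auto simp: cnf_fun_def)
          show False
          proof (cases l)
            case (Pos v)
            then have "v = hd C" using l hd[OF C(1)] by simp
            then show False using l Pos False \<open>\<not> a (hd C)\<close> by (auto simp: a_def b_def)
          next
            case (Neg v)
            then show False using l neg[of v] clD by (auto simp: a_def b_def)
          qed
        qed
      next
        case False
        \<comment> \<open>A clause without \<open>D + k\<close> among its premises fails at the
          closed set alone as well, where no selector is set and the function is true.\<close>
        define b where "b v \<longleftrightarrow> v \<in> closure_of R X" for v
        have "cnf_fun (horn_cnf D r R P) b"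
          using clD by (auto simp: cnf_fun_horn_cnf b_def intro: closure_step)
        then have "cnf_fun \<psi> b" by (simp add: \<psi>(3))
        then obtain l where l: "l \<in> set C" "lit_true b l" using C(1) by (auto simp: cnf_fun_def)
        show False
        proof (cases l)
          case (Pos v)
          then show False using l C(2)[OF l(1)] by (auto simp: a_def b_def)
        next
          case (Neg v)
          then show False using l neg[of v] False by (auto simp: a_def b_def)
        qed
      qed
    qed
    then have "\<kappa> \<le> card X" by (intro \<kappa>) (auto simp: X_def)
    also have "\<dots> \<le> card (hd ` T k)" by (intro card_mono) (auto simp: X_def T_def)
    also have "\<dots> \<le> card (T k)" by (rule card_image_le) (simp add: T_def)
    finally show ?thesis .
  qed
  then have "r * \<kappa> \<le> (\<Sum>k<r. card (T k))"
    using sum_mono[of "{..<r}" "\<lambda>_. \<kappa>" "\<lambda>k. card (T k)"] by simp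
  also have "\<dots> = card (\<Union>k<r. T k)"
    by (rule card_UN_disjoint[symmetric]) (auto simp: T_def)
  also have "\<dots> \<le> card (set \<psi>)" by (intro card_mono) (auto simp: T_def)
  also have "\<dots> \<le> num_clauses \<psi>" by (simp add: num_clauses_def card_length)
  finally show ?thesis .
qed

lemma num_clauses_le_num_literals: "pure_horn_cnf \<psi> \<Longrightarrow> num_clauses \<psi> \<le> num_literals \<psi>"
proof (induction \<psi>)
  case (Cons C \<psi>)
  then have "C \<noteq> []" by (auto simp: pure_horn_cnf_def pure_horn_clause_def)
  then have "length C \<ge> 1" by (cases C) auto
  then show ?case using Cons by (auto simp: num_clauses_def num_literals_def pure_horn_cnf_def)
qed (simp add: num_clauses_def num_literals_def)

lemma min_pure_horn_upper_bound:
  assumes "S \<subseteq> P" "P \<subseteq> closure_of R S"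
    and "Q \<in> {UNIV, {\<psi>. is_kcnf 3 \<psi>}}" "N \<in> {num_clauses, num_literals}"
  shows "min_pure_horn Q N (D + r) (cnf_fun (horn_cnf D r R P)) \<le> 6 * D ^ 2 + 2 * (r * card S)"
proof -
  let ?\<psi> = "horn_cnf D r R S"
  have "?\<psi> \<in> Q" using assms(3) is_3cnf_horn_cnf[OF assms(1)] by auto
  then have "min_pure_horn Q N (D + r) (cnf_fun (horn_cnf D r R P)) \<le> N ?\<psi>"
    unfolding min_pure_horn_def
    using cnf_on_horn_cnf[OF assms(1)] pure_horn_horn_cnf[OF assms(1)] cnf_fun_generating[OF assms(1,2)]
    by (intro Least_le) blast
  also have "\<dots> \<le> num_literals ?\<psi>"
    using assms(4) num_clauses_le_num_literals[OF pure_horn_horn_cnf[OF assms(1)]] by auto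
  also have "\<dots> \<le> 6 * D ^ 2 + 2 * (r * card S)" by (rule num_literals_horn_cnf[OF assms(1)])
  finally show ?thesis .
qed

lemma min_pure_horn_lower_bound:
  assumes \<kappa>: "\<And>X. X \<subseteq> {..<D} \<Longrightarrow> P \<subseteq> closure_of R X \<Longrightarrow> \<kappa> \<le> card X"
    and "Q \<in> {UNIV, {\<psi>. is_kcnf 3 \<psi>}}" "N \<in> {num_clauses, num_literals}"
  shows "r * \<kappa> \<le> min_pure_horn Q N (D + r) (cnf_fun (horn_cnf D r R P))"
proof -
  let ?h = "cnf_fun (horn_cnf D r R P)"
  have "\<exists>m. \<exists>\<psi>\<in>Q. cnf_on (D + r) \<psi> \<and> pure_horn_cnf \<psi> \<and> cnf_fun \<psi> = ?h \<and> N \<psi> = m"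
    using assms(2) is_3cnf_horn_cnf[OF order.refl] cnf_on_horn_cnf[OF order.refl] pure_horn_horn_cnf[OF order.refl]
    by (intro exI bexI[of _ "horn_cnf D r R P"]) auto
  from LeastI_ex[OF this] obtain \<psi> where \<psi>: "cnf_on (D + r) \<psi>" "pure_horn_cnf \<psi>" "cnf_fun \<psi> = ?h"
    "N \<psi> = min_pure_horn Q N (D + r) ?h" unfolding min_pure_horn_def by blast
  have "r * \<kappa> \<le> num_clauses \<psi>" by (rule num_clauses_lower_bound[OF \<psi>(1-3) \<kappa>])
  also have "\<dots> \<le> N \<psi>" using assms(3) num_clauses_le_num_literals[OF \<psi>(2)] by auto
  finally show ?thesis using \<psi>(4) by simp
qed

end


section \<open>The pruning circuit as a rule system\<close>

text \<open>The variables of the circuit: in copy \<open>s\<close>, \<open>node_D\<close> says that the value \<open>v\<close> at the point \<open>y\<close>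
  survives \<open>\<tau>\<close> tests, where a round consists of one test for each triple \<open>\<theta>\<close>, and \<open>node_A\<close> says
  that up to the parameter \<open>j\<close> the polynomial \<open>f\<close> on the flat through \<open>y\<close> and \<open>\<theta>\<close> takes values
  that survive \<open>t\<close> rounds.\<close>
definition node_P :: "nat \<Rightarrow> nat" where
  "node_P s = 3 * s"

definition node_D :: "nat \<Rightarrow> nat \<Rightarrow> nat \<Rightarrow> nat \<Rightarrow> nat \<Rightarrow> nat" where
  "node_D Q s y v \<tau> = 3 * (s + Q * (y + Q * (v + Q * \<tau>))) + 1"

definition node_A :: "nat \<Rightarrow> nat \<Rightarrow> nat \<Rightarrow> nat \<Rightarrow> nat \<Rightarrow> nat \<Rightarrow> nat \<Rightarrow> nat" where
  "node_A Q s t y \<theta> f j = 3 * (s + Q * (t + Q * (y + Q * (\<theta> + Q * (f + Q * j))))) + 2"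

text \<open>There is one copy \<open>s\<close> of the pruning circuit for every pair of a point and a value, and its
  output is the variable of this pair. So selecting a gate is never better than selecting the
  pair its copy belongs to, and a set of variables generates all of them only if it corresponds
  to lists of values that survive the pruning.\<close>
definition rule_of :: "nat \<Rightarrow> nat \<Rightarrow> nat \<Rightarrow> nat \<Rightarrow> nat \<Rightarrow> (nat \<Rightarrow> nat \<Rightarrow> nat \<Rightarrow> nat) \<Rightarrow>
    (nat \<Rightarrow> nat \<Rightarrow> nat) \<Rightarrow> (nat \<Rightarrow> nat \<Rightarrow> bool) \<Rightarrow> nat \<Rightarrow> nat \<Rightarrow> nat \<Rightarrow> bool" where
  "rule_of p X E R Q ptj fj okc b c h \<longleftrightarrow>
    (\<exists>s<p * X. \<exists>y<X. \<exists>v<p. b = node_P (y * p + v) \<and> c = b \<and> h = node_D Q s y v 0) \<or>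
    (\<exists>s<p * X. \<exists>t<R. \<exists>y<X. \<exists>\<theta><E. \<exists>f<Q.
       b = node_D Q s (ptj y \<theta> 0) (fj f 0) (t * E) \<and> c = b \<and> h = node_A Q s t y \<theta> f 0) \<or>
    (\<exists>s<p * X. \<exists>t<R. \<exists>y<X. \<exists>\<theta><E. \<exists>f<Q. \<exists>j<p * p * p - 1.
       b = node_A Q s t y \<theta> f j \<and> c = node_D Q s (ptj y \<theta> (Suc j)) (fj f (Suc j)) (t * E) \<and>
       h = node_A Q s t y \<theta> f (Suc j)) \<or>
    (\<exists>s<p * X. \<exists>t<R. \<exists>y<X. \<exists>\<theta><E. \<exists>f<Q. okc f \<theta> \<and>
       b = node_A Q s t y \<theta> f (p * p * p - 1) \<and> c = node_D Q s y (fj f 0) (t * E + \<theta>) \<and>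
       h = node_D Q s y (fj f 0) (Suc (t * E + \<theta>))) \<or>
    (\<exists>s<p * X. \<exists>v<p. b = node_D Q s 0 v (R * E) \<and> c = b \<and> h = node_P s) \<or>
    (\<exists>s<p * X. \<exists>y<X. \<exists>v<p. \<exists>\<tau><Suc (R * E). b = node_P s \<and> c = b \<and> h = node_D Q s y v \<tau>) \<or>
    (\<exists>s<p * X. \<exists>t<R. \<exists>y<X. \<exists>\<theta><E. \<exists>f<Q. \<exists>j<p * p * p.
       b = node_P s \<and> c = b \<and> h = node_A Q s t y \<theta> f j)"

lemma mixed_radix_eq: "a + Q * b = a' + Q * b' \<longleftrightarrow> a = a' \<and> b = b'" if "a < Q" "a' < (Q::nat)"
  using mixed_radix[OF that(1), of b] mixed_radix[OF that(2), of b'] by metis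

text \<open>\<open>chk\<close> stands for the local test of three values at three points.
  \<open>Q_large\<close> keeps all indices, and the number of tests in all rounds, below the radix
  of the node codes, which is the number of polynomials on a flat.\<close>

locale circuit = prime_digits p l for p l +
  fixes A :: nat and chk :: "nat \<Rightarrow> nat \<Rightarrow> nat \<Rightarrow> nat \<Rightarrow> nat \<Rightarrow> nat \<Rightarrow> bool"
  assumes p_large: "3 * l * (2 * A + 1) ^ 2 + 1 < p" and A_less: "A < p"
    and Q_large: "(2 * A + 3) * (p ^ l * p ^ l * p ^ l) < p ^ (Suc l ^ 3)" "p * p ^ l \<le> p ^ (Suc l ^ 3)"
      "p * p * p \<le> p ^ (Suc l ^ 3)"
begin

definition X :: nat where "X = p ^ l"
definition E :: nat where "E = X * X * X"
definition R :: nat where "R = 2 * A + 3"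

definition fj :: "nat \<Rightarrow> nat \<Rightarrow> nat" where
  "fj f j = fev f (j mod p) (j div p mod p) (j div p div p mod p)"

definition ptj :: "nat \<Rightarrow> nat \<Rightarrow> nat \<Rightarrow> nat" where
  "ptj y \<theta> j = pt y (\<theta> mod X) (\<theta> div X mod X) (\<theta> div X div X mod X) (j mod p) (j div p mod p) (j div p div p mod p)"

definition okc :: "nat \<Rightarrow> nat \<Rightarrow> bool" where
  "okc f \<theta> \<longleftrightarrow> chk (\<theta> mod X) (\<theta> div X mod X) (\<theta> div X div X mod X) (fev f 1 0 0) (fev f 0 1 0) (fev f 0 0 1)"

abbreviation "Q \<equiv> fnum"
abbreviation "Rule \<equiv> rule_of p X E R Q ptj fj okc"

lemma X_pos: "X > 0" using p_gt by (simp add: X_def)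
lemma E_pos: "E > 0" using X_pos by (simp add: E_def)

lemma Q_gt: "R * E < Q" "p * X \<le> Q" "p * p * p \<le> Q" "X \<le> Q" "R \<le> Q" "E \<le> Q" "p \<le> Q" "3 \<le> Q"
proof -
  show RE: "R * E < Q" "p * X \<le> Q" "p * p * p \<le> Q"
    using Q_large by (simp_all add: R_def E_def X_def fnum_def)
  have "X \<le> p * X" "p \<le> p * X" using p_gt X_pos by auto
  then show "X \<le> Q" "p \<le> Q" using RE by linarith+
  have "R \<le> R * E" "E \<le> R * E" using E_pos by (auto simp: R_def)
  then show "R \<le> Q" "E \<le> Q" using RE by linarith+
  then show "3 \<le> Q" by (simp add: R_def)
qed

lemma Q_intros: "s < p * X \<Longrightarrow> s < Q" "t < R \<Longrightarrow> t < Q" "y < X \<Longrightarrow> y < Q" "\<theta> < E \<Longrightarrow> \<theta> < Q"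
    "j < p * p * p \<Longrightarrow> j < Q" "v < p \<Longrightarrow> v < Q" "\<tau> < Suc (R * E) \<Longrightarrow> \<tau> < Q"
  using Q_gt by linarith+

lemma fj_less: "fj f j < p" using p_gt by (simp add: fj_def fev_def)
lemma ptj_less: "ptj y \<theta> j < X" unfolding ptj_def X_def by (rule pt_less)

lemma fj_Q: "fj f j < Q" using fj_less Q_intros by blast
lemma ptj_Q: "ptj y \<theta> j < Q" using ptj_less Q_intros by blast

lemma node_distinct: "node_P s \<noteq> node_D Q' s' y v \<tau>" "node_P s \<noteq> node_A Q' s' t y \<theta> f j"
    "node_D Q' s y v \<tau> \<noteq> node_A Q'' s' t y' \<theta> f j"
    "node_D Q' s' y v \<tau> \<noteq> node_P s" "node_A Q' s' t y \<theta> f j \<noteq> node_P s"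
    "node_A Q'' s' t y' \<theta> f j \<noteq> node_D Q' s y v \<tau>"
  unfolding node_P_def node_D_def node_A_def by presburger+

lemma triple_eq: "3 * a + 1 = 3 * b + 1 \<longleftrightarrow> a = b" "3 * a + 2 = 3 * b + 2 \<longleftrightarrow> a = b" for a b :: nat
  by auto

lemma node_P_eq: "node_P s = node_P s' \<longleftrightarrow> s = s'"
  by (simp add: node_P_def)

lemma node_D_eq:
  assumes "s < Q" "y < Q" "v < Q" "s' < Q" "y' < Q" "v' < Q"
  shows "node_D Q s y v \<tau> = node_D Q s' y' v' \<tau>' \<longleftrightarrow> s = s' \<and> y = y' \<and> v = v' \<and> \<tau> = \<tau>'"
  unfolding node_D_def triple_eq using assms by (simp only: mixed_radix_eq)

lemma node_A_eq:
  assumes "s < Q" "t < Q" "y < Q" "\<theta> < Q" "f < Q" "s' < Q" "t' < Q" "y' < Q" "\<theta>' < Q" "f' < Q"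
  shows "node_A Q s t y \<theta> f j = node_A Q s' t' y' \<theta>' f' j' \<longleftrightarrow>
    s = s' \<and> t = t' \<and> y = y' \<and> \<theta> = \<theta>' \<and> f = f' \<and> j = j'"
  unfolding node_A_def triple_eq using assms by (simp only: mixed_radix_eq)

text \<open>Six digits in base \<open>Q\<close> and the factor 3, which is at most \<open>Q\<close>:
  this is the origin of the \<open>Q ^ 7\<close> variables of the rule system.\<close>

lemma node_A_less:
  assumes "s < Q" "t < Q" "y < Q" "\<theta> < Q" "f < Q" "j < Q"
  shows "node_A Q s t y \<theta> f j < Q ^ 7"
proof -
  have "s + Q * (t + Q * (y + Q * (\<theta> + Q * (f + Q * j)))) < Q * (Q * (Q * (Q * (Q * Q))))"
    by (intro mixed_radix_less assms)
  then have "2 + 3 * (s + Q * (t + Q * (y + Q * (\<theta> + Q * (f + Q * j))))) < 3 * (Q * (Q * (Q * (Q * (Q * Q)))))"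
    by (rule mixed_radix_less[rotated]) simp
  also have "\<dots> \<le> Q * (Q * (Q * (Q * (Q * (Q * Q)))))" using Q_gt(8) by (intro mult_right_mono) auto
  finally show ?thesis by (simp add: node_A_def eval_nat_numeral)
qed

lemma node_P_less: "s < p * X \<Longrightarrow> node_P s < Q ^ 7"
proof -
  assume s: "s < p * X"
  have "node_P s \<le> node_A Q s 0 0 0 0 0" by (simp add: node_P_def node_A_def)
  also have "\<dots> < Q ^ 7" using Q_intros(1)[OF s] Q_gt(8) by (intro node_A_less) auto
  finally show ?thesis .
qed

lemma node_D_less: "s < Q \<Longrightarrow> y < Q \<Longrightarrow> v < Q \<Longrightarrow> \<tau> < Q \<Longrightarrow> node_D Q s y v \<tau> < Q ^ 7"
proof -
  assume *: "s < Q" "y < Q" "v < Q" "\<tau> < Q"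
  have "node_D Q s y v \<tau> \<le> node_A Q s y v \<tau> 0 0" by (simp add: node_A_def node_D_def)
  also have "\<dots> < Q ^ 7" using * Q_gt(8) by (intro node_A_less) auto
  finally show ?thesis .
qed

lemma tE_less: "t < R \<Longrightarrow> \<theta> < E \<Longrightarrow> t * E + \<theta> < R * E"
  using mixed_radix_less[of \<theta> E t R] by (simp add: mult.commute add.commute)

text \<open>The roles of the rules: \<open>R1\<close> loads a pair into every copy;
  \<open>R2\<close> and \<open>R3\<close> form the conjunction along a flat one point at a time, so
  that two premises suffice; \<open>R4\<close> lets a value pass a test on the strength of one
  suitable polynomial; \<open>R5\<close> outputs the pair of the copy if any value at the point 0
  passes all tests; \<open>R6\<close> and \<open>R7\<close> let a pair imply all gates of its own
  copy.\<close>

lemma rule_cases: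
  assumes "Rule b c h"
  obtains (R1) s y v where "s < p * X" "y < X" "v < p" "b = node_P (y * p + v)" "c = b" "h = node_D Q s y v 0"
  | (R2) s t y \<theta> f where "s < p * X" "t < R" "y < X" "\<theta> < E" "f < Q"
      "b = node_D Q s (ptj y \<theta> 0) (fj f 0) (t * E)" "c = b" "h = node_A Q s t y \<theta> f 0"
  | (R3) s t y \<theta> f j where "s < p * X" "t < R" "y < X" "\<theta> < E" "f < Q" "Suc j < p * p * p"
      "b = node_A Q s t y \<theta> f j" "c = node_D Q s (ptj y \<theta> (Suc j)) (fj f (Suc j)) (t * E)" "h = node_A Q s t y \<theta> f (Suc j)"
  | (R4) s t y \<theta> f where "s < p * X" "t < R" "y < X" "\<theta> < E" "f < Q" "okc f \<theta>"
       "b = node_A Q s t y \<theta> f (p * p * p - 1)" "c = node_D Q s y (fj f 0) (t * E + \<theta>)"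
       "h = node_D Q s y (fj f 0) (Suc (t * E + \<theta>))"
  | (R5) s v where "s < p * X" "v < p" "b = node_D Q s 0 v (R * E)" "c = b" "h = node_P s"
  | (R6) s y v \<tau> where "s < p * X" "y < X" "v < p" "\<tau> < Suc (R * E)" "b = node_P s" "c = b" "h = node_D Q s y v \<tau>"
  | (R7) s t y \<theta> f j where "s < p * X" "t < R" "y < X" "\<theta> < E" "f < Q" "j < p * p * p" "b = node_P s" "c = b" "h = node_A Q s t y \<theta> f j"
  using assms unfolding rule_of_def less_diff_conv Suc_eq_plus1[symmetric] by (elim disjE exE conjE) blast+

definition Ps :: "nat set" where "Ps = node_P ` {..<p * X}"

lemma ppp: "p * p * p > 1" "p * p * p - 1 < p * p * p"
proof -
  have "2 * 2 * 2 \<le> p * p * p" using p_gt by (intro mult_mono) auto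
  then show "p * p * p > 1" "p * p * p - 1 < p * p * p" by linarith+
qed

lemma rule_less:
  assumes "Rule b c h"
  shows "b < Q ^ 7 \<and> c < Q ^ 7 \<and> h < Q ^ 7"
  using assms
proof (cases rule: rule_cases)
  case (R1 s y v)
  have "y * p + v < p * X" using mixed_radix_less[of v p y X] R1 by (simp add: ac_simps)
  then show ?thesis unfolding R1(4-6)
    using Q_gt(8) Q_intros(1)[OF R1(1)] Q_intros(3)[OF R1(2)] Q_intros(6)[OF R1(3)] by (simp add: node_P_less node_D_less)
next
  case (R2 s t y \<theta> f)
  have "t * E < Q" using tE_less[OF R2(2) E_pos] Q_gt(1) by linarith
  then show ?thesis unfolding R2(6-8)
    using Q_gt(8) R2(5) Q_intros(1)[OF R2(1)] Q_intros(2)[OF R2(2)] Q_intros(3)[OF R2(3)] Q_intros(4)[OF R2(4)]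
    by (simp add: node_A_less node_D_less ptj_Q fj_Q)
next
  case (R3 s t y \<theta> f j)
  have "t * E < Q" using tE_less[OF R3(2) E_pos] Q_gt(1) by linarith
  moreover have "j < Q" "Suc j < Q" using R3(6) Q_gt(3) by linarith+
  ultimately show ?thesis unfolding R3(7-9)
    using R3(5) Q_intros(1)[OF R3(1)] Q_intros(2)[OF R3(2)] Q_intros(3)[OF R3(3)] Q_intros(4)[OF R3(4)]
    by (simp add: node_A_less node_D_less ptj_Q fj_Q)
next
  case (R4 s t y \<theta> f)
  have "t * E + \<theta> < Q" "Suc (t * E + \<theta>) < Q" using tE_less[OF R4(2,4)] Q_gt(1) by linarith+
  moreover have "p * p * p - 1 < Q" using ppp Q_gt(3) by linarith
  ultimately show ?thesis unfolding R4(7-9)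
    using R4(5) Q_intros(1)[OF R4(1)] Q_intros(2)[OF R4(2)] Q_intros(3)[OF R4(3)] Q_intros(4)[OF R4(4)]
    by (simp add: node_A_less node_D_less fj_Q)
next
  case (R5 s v)
  then show ?thesis unfolding R5(3-5)
    using Q_gt(1,8) Q_intros(1)[OF R5(1)] Q_intros(6)[OF R5(2)] by (simp add: node_P_less node_D_less)
next
  case (R6 s y v \<tau>)
  then show ?thesis unfolding R6(5-7)
    using Q_intros(1)[OF R6(1)] Q_intros(3)[OF R6(2)] Q_intros(6)[OF R6(3)] Q_intros(7)[OF R6(4)] by (simp add: node_P_less node_D_less)
next
  case (R7 s t y \<theta> f j)
  then show ?thesis unfolding R7(7-9)
    using R7(5) Q_intros(1)[OF R7(1)] Q_intros(2)[OF R7(2)] Q_intros(3)[OF R7(3)] Q_intros(4)[OF R7(4)] Q_intros(5)[OF R7(6)]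
    by (simp add: node_P_less node_A_less)
qed

text \<open>Two different premises are always a \<open>node_A\<close> followed by a
  \<open>node_D\<close>, and the former determines the head. Asymmetry and uniqueness of the head
  both follow from this.\<close>

lemma rule_two_bodies:
  assumes "Rule b c h" "b \<noteq> c"
  shows "\<exists>s t y \<theta> f j. s < Q \<and> t < Q \<and> y < Q \<and> \<theta> < Q \<and> f < Q \<and> b = node_A Q s t y \<theta> f j \<and>
     (\<exists>y v \<tau>. c = node_D Q s y v \<tau>) \<and>
     h = (if Suc j < p * p * p then node_A Q s t y \<theta> f (Suc j) else node_D Q s y (fj f 0) (Suc (t * E + \<theta>)))"
  using assms(1)
proof (cases rule: rule_cases)
  case (R3 s t y \<theta> f j)
  have ex: "\<exists>y v \<tau>. c = node_D Q s y v \<tau>" using R3(8) by blast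
  show ?thesis
    by (rule exI[of _ s], rule exI[of _ t], rule exI[of _ y], rule exI[of _ \<theta>], rule exI[of _ f], rule exI[of _ j],
        intro conjI, rule Q_intros(1)[OF R3(1)], rule Q_intros(2)[OF R3(2)], rule Q_intros(3)[OF R3(3)],
        rule Q_intros(4)[OF R3(4)], rule R3(5), rule R3(7), rule ex, simp only: R3(6) if_True R3(9))
next
  case (R4 s t y \<theta> f)
  have ex: "\<exists>y v \<tau>. c = node_D Q s y v \<tau>" using R4(8) by blast
  have ns: "\<not> Suc (p * p * p - 1) < p * p * p" using ppp by linarith
  show ?thesis
    by (rule exI[of _ s], rule exI[of _ t], rule exI[of _ y], rule exI[of _ \<theta>], rule exI[of _ f], rule exI[of _ "p * p * p - 1"],
        intro conjI, rule Q_intros(1)[OF R4(1)], rule Q_intros(2)[OF R4(2)], rule Q_intros(3)[OF R4(3)],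
        rule Q_intros(4)[OF R4(4)], rule R4(5), rule R4(7), rule ex, simp only: ns if_False R4(9))
qed (use assms(2) in \<open>blast+\<close>)

sublocale rule_system "Q ^ 7" r Rule Ps for r
proof
  fix b c h h'
  show "Rule b c h \<Longrightarrow> b < Q ^ 7 \<and> c < Q ^ 7 \<and> h < Q ^ 7" by (rule rule_less)
  show "h \<noteq> b \<and> h \<noteq> c" if "Rule b c h" using that
  proof (cases rule: rule_cases)
    case (R3 s t y \<theta> f j)
    then have "h \<noteq> b" using node_A_eq[of s t y \<theta> f s t y \<theta> f "Suc j" j] Q_intros(1-4) by auto
    then show ?thesis using R3 node_distinct by auto
  next
    case (R4 s t y \<theta> f)
    then have "h \<noteq> c" using node_D_eq[of s y "fj f 0" s y "fj f 0"] Q_intros(1-4) fj_Q by auto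
    then show ?thesis using R4 node_distinct by auto
  qed (use node_distinct in auto)
  show "\<not> Rule c b h'" if "Rule b c h" "b \<noteq> c"
    using rule_two_bodies[OF that] rule_two_bodies[of c b h'] that(2) node_distinct by metis
  show "h = h'" if r: "Rule b c h" "Rule b c h'" "b \<noteq> c"
  proof -
    obtain s t y \<theta> f j where 1: "s < Q" "t < Q" "y < Q" "\<theta> < Q" "f < Q" "b = node_A Q s t y \<theta> f j"
      "h = (if Suc j < p * p * p then node_A Q s t y \<theta> f (Suc j) else node_D Q s y (fj f 0) (Suc (t * E + \<theta>)))"
      using rule_two_bodies[OF r(1,3)] by blast
    obtain s' t' y' \<theta>' f' j' where 2: "s' < Q" "t' < Q" "y' < Q" "\<theta>' < Q" "f' < Q" "b = node_A Q s' t' y' \<theta>' f' j'"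
      "h' = (if Suc j' < p * p * p then node_A Q s' t' y' \<theta>' f' (Suc j') else node_D Q s' y' (fj f' 0) (Suc (t' * E + \<theta>')))"
      using rule_two_bodies[OF r(2,3)] by blast
    show ?thesis using node_A_eq[OF 1(1-5) 2(1-5), of j j'] 1 2 by auto
  qed
  show "Ps \<subseteq> {..<Q ^ 7}" using node_P_less by (auto simp: Ps_def)
qed

section \<open>Generating sets and surviving lists\<close>

lemma rule_intros:
  "s < p * X \<Longrightarrow> y < X \<Longrightarrow> v < p \<Longrightarrow> Rule (node_P (y * p + v)) (node_P (y * p + v)) (node_D Q s y v 0)"
  "s < p * X \<Longrightarrow> t < R \<Longrightarrow> y < X \<Longrightarrow> \<theta> < E \<Longrightarrow> f < Q \<Longrightarrow>
    Rule (node_D Q s (ptj y \<theta> 0) (fj f 0) (t * E)) (node_D Q s (ptj y \<theta> 0) (fj f 0) (t * E)) (node_A Q s t y \<theta> f 0)"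
  "s < p * X \<Longrightarrow> t < R \<Longrightarrow> y < X \<Longrightarrow> \<theta> < E \<Longrightarrow> f < Q \<Longrightarrow> j < p * p * p - 1 \<Longrightarrow>
    Rule (node_A Q s t y \<theta> f j) (node_D Q s (ptj y \<theta> (Suc j)) (fj f (Suc j)) (t * E)) (node_A Q s t y \<theta> f (Suc j))"
  "s < p * X \<Longrightarrow> t < R \<Longrightarrow> y < X \<Longrightarrow> \<theta> < E \<Longrightarrow> f < Q \<Longrightarrow> okc f \<theta> \<Longrightarrow>
    Rule (node_A Q s t y \<theta> f (p * p * p - 1)) (node_D Q s y (fj f 0) (t * E + \<theta>)) (node_D Q s y (fj f 0) (Suc (t * E + \<theta>)))"
  "s < p * X \<Longrightarrow> v < p \<Longrightarrow> Rule (node_D Q s 0 v (R * E)) (node_D Q s 0 v (R * E)) (node_P s)"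
  unfolding rule_of_def
  subgoal by (rule disjI1, intro exI conjI; (assumption | rule refl))
  subgoal by (rule disjI2, rule disjI1, intro exI conjI; (assumption | rule refl))
  subgoal by (rule disjI2, rule disjI2, rule disjI1, intro exI conjI; (assumption | rule refl))
  subgoal by (rule disjI2, rule disjI2, rule disjI2, rule disjI1, intro exI conjI; (assumption | rule refl))
  subgoal by (rule disjI2, rule disjI2, rule disjI2, rule disjI2, rule disjI1, intro exI conjI; (assumption | rule refl))
  done

lemma ptj_0: "y < X \<Longrightarrow> ptj y \<theta> 0 = y"
proof (rule dig_eqI[of _ p l])
  assume y: "y < X"
  then show "y < p ^ l" by (simp add: X_def)
  show "ptj y \<theta> 0 < p ^ l" using ptj_less by (simp add: X_def)
  fix k assume k: "k < l"
  have "(dig p y k * (1 + 3 * p)) mod p = dig p y k" by (simp add: dig_def algebra_simps) 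
  then show "dig p (ptj y \<theta> 0) k = dig p y k" unfolding ptj_def using dig_pt[OF k] by simp
qed

text \<open>The pairs \<open>(y, G y)\<close> generate all others, and there is one for each point.
  In every copy these values pass all tests, because \<open>ext\<close> supplies a polynomial
  through values of \<open>G\<close> for each flat; in the end the value at point 0 triggers the
  output of the copy.\<close>

lemma generating_set:
  assumes G: "\<And>y. y < X \<Longrightarrow> G y < p"
    and ext: "\<And>y \<theta>. y < X \<Longrightarrow> \<theta> < E \<Longrightarrow> \<exists>f<Q. okc f \<theta> \<and> (\<forall>j<p * p * p. fj f j = G (ptj y \<theta> j))"
  shows "\<exists>S\<subseteq>Ps. Ps \<subseteq> closure_of Rule S \<and> card S \<le> X"
proof -
  define S where "S = (\<lambda>y. node_P (y * p + G y)) ` {..<X}"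
  let ?cl = "closure_of Rule S"
  have idx: "y * p + G y < p * X" if "y < X" for y
    using mixed_radix_less[OF G[OF that] that] by (simp add: ac_simps)
  have D: "\<forall>y<X. node_D Q s y (G y) \<tau> \<in> ?cl" if s: "s < p * X" and \<tau>: "\<tau> \<le> R * E" for s \<tau>
    using \<tau>
  \<comment> \<open>A test compares with the lists at the beginning of its round, that is at
    \<open>t * E\<close>, and not only at the preceding test; so the induction has to reach back
    further than one step.\<close>
  proof (induction \<tau> rule: less_induct)
    case (less \<tau>)
    show ?case
    proof (intro allI impI)
      fix y assume y: "y < X"
      show "node_D Q s y (G y) \<tau> \<in> ?cl"
      proof (cases \<tau>)
        case 0
        have "node_P (y * p + G y) \<in> ?cl" using y by (intro closure_base) (auto simp: S_def)
        moreover have "Rule (node_P (y * p + G y)) (node_P (y * p + G y)) (node_D Q s y (G y) 0)"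
          using s y G[OF y] by (rule rule_intros(1))
        ultimately show ?thesis unfolding 0 using closure_step by blast
      next
        case (Suc \<tau>')
        define t where "t = \<tau>' div E"
        define \<theta> where "\<theta> = \<tau>' mod E"
        have \<theta>: "\<theta> < E" using E_pos by (simp add: \<theta>_def)
        have \<tau>': "\<tau>' = t * E + \<theta>" unfolding t_def \<theta>_def by (rule div_mult_mod_eq[symmetric])
        have t: "t < R" using Suc less.prems E_pos unfolding t_def by (simp add: less_mult_imp_div_less)
        obtain f where f: "f < Q" "okc f \<theta>" "\<And>j. j < p * p * p \<Longrightarrow> fj f j = G (ptj y \<theta> j)"
          using ext[OF y \<theta>] by blast
        have base: "node_D Q s (ptj y \<theta> j) (fj f j) (t * E) \<in> ?cl" if "j < p * p * p" for j
        proof -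
          have "t * E < \<tau>" "t * E \<le> R * E" using Suc \<tau>' less.prems by linarith+
          then have "\<forall>y<X. node_D Q s y (G y) (t * E) \<in> ?cl" by (rule less.IH)
          then show ?thesis unfolding f(3)[OF that] using ptj_less by blast
        qed
        have A: "node_A Q s t y \<theta> f j \<in> ?cl" if "j < p * p * p" for j
          using that
        proof (induction j)
          case 0
          have "Rule (node_D Q s (ptj y \<theta> 0) (fj f 0) (t * E)) (node_D Q s (ptj y \<theta> 0) (fj f 0) (t * E)) (node_A Q s t y \<theta> f 0)"
            using s t y \<theta> f(1) by (rule rule_intros(2))
          then show ?case by (rule closure_step[OF base[OF 0] base[OF 0]])
        next
          case (Suc j)
          have "j < p * p * p - 1" using Suc.prems by linarith
          then have "Rule (node_A Q s t y \<theta> f j) (node_D Q s (ptj y \<theta> (Suc j)) (fj f (Suc j)) (t * E)) (node_A Q s t y \<theta> f (Suc j))"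
            by (rule rule_intros(3)[OF s t y \<theta> f(1)])
          moreover have "node_A Q s t y \<theta> f j \<in> ?cl" using Suc by simp
          ultimately show ?case using closure_step[OF _ base[OF Suc.prems]] by blast
        qed
        have f0: "fj f 0 = G y" using f(3)[of 0] p_gt ptj_0[OF y] by simp
        have "Rule (node_A Q s t y \<theta> f (p * p * p - 1)) (node_D Q s y (fj f 0) (t * E + \<theta>)) (node_D Q s y (fj f 0) (Suc (t * E + \<theta>)))"
          by (rule rule_intros(4)[OF s t y \<theta> f(1,2)])
        moreover have "node_D Q s y (fj f 0) (t * E + \<theta>) \<in> ?cl"
          using less.IH[of \<tau>'] Suc less.prems y f0 \<tau>' by simp
        ultimately show ?thesis using closure_step[OF A[OF ppp(2)]] unfolding Suc \<tau>' f0 by blast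
      qed
    qed
  qed
  have "node_P s \<in> ?cl" if s: "s < p * X" for s
  proof -
    have "node_D Q s 0 (G 0) (R * E) \<in> ?cl" using D[OF s order.refl] X_pos by blast
    moreover have "Rule (node_D Q s 0 (G 0) (R * E)) (node_D Q s 0 (G 0) (R * E)) (node_P s)"
      by (rule rule_intros(5)[OF s G[OF X_pos]])
    ultimately show ?thesis using closure_step by blast
  qed
  then have "Ps \<subseteq> ?cl" by (auto simp: Ps_def)
  moreover have "S \<subseteq> Ps" using idx by (auto simp: S_def Ps_def)
  moreover have "card S \<le> X" unfolding S_def using card_image_le[of "{..<X}"] by fastforce
  ultimately show ?thesis by blast
qed

text \<open>The copies that contain an element of \<open>Y\<close>, read as pairs, make up the lists
  \<open>S\<close>; there are at most \<open>A * X\<close> of them. Any other copy derives only what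
  the pruning of \<open>S\<close> justifies. If nothing survived at point 0, no further pair would
  be derived, contradicting \<open>A < p\<close>; so something survives and
  \<open>global_function\<close> applies.\<close>

lemma generating_set_large:
  assumes X': "finite Y" "Ps \<subseteq> closure_of Rule Y" "card Y \<le> A * X"
  shows "\<exists>G. \<forall>a<X. \<forall>b<X. \<forall>c<X. chk a b c (G a) (G b) (G c)"
proof -
  define I where "I = {s. s < p * X \<and> (node_P s \<in> Y \<or> (\<exists>y<X. \<exists>v<p. \<exists>\<tau><Suc (R * E). node_D Q s y v \<tau> \<in> Y) \<or>
    (\<exists>t<R. \<exists>y<X. \<exists>\<theta><E. \<exists>f<Q. \<exists>j<p * p * p. node_A Q s t y \<theta> f j \<in> Y))}"
  define S where "S y = {v. v < p \<and> y * p + v \<in> I}" for y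
  have finI: "finite I" by (rule finite_subset[of _ "{..<p * X}"]) (auto simp: I_def)
  \<comment> \<open>This reads the index of the copy off a node: codes divisible by 3 are pairs, and
    in the others the copy is the lowest digit in base \<open>Q\<close>.\<close>
  let ?cp = "\<lambda>n. if n mod 3 = 0 then n div 3 else n div 3 mod Q"
  have "I \<subseteq> ?cp ` Y"
  proof
    fix s assume s: "s \<in> I"
    then have sQ: "s < Q" using Q_intros(1) by (auto simp: I_def)
    have cp: "?cp (node_P s) = s" "?cp (node_D Q s y v \<tau>) = s" "?cp (node_A Q s t y \<theta> f j) = s" for y v \<tau> t \<theta> f j
    proof -
      have "(3 * a + 1) mod 3 \<noteq> 0" "(3 * a + 1) div 3 = a" "(3 * a + 2) mod 3 \<noteq> 0" "(3 * a + 2) div 3 = a" for a :: nat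
        by presburger+
      then show "?cp (node_P s) = s" "?cp (node_D Q s y v \<tau>) = s" "?cp (node_A Q s t y \<theta> f j) = s"
        unfolding node_P_def node_D_def node_A_def by (simp_all only: mixed_radix[OF sQ] if_False) simp
    qed
    have "\<exists>n. n \<in> Y \<and> ?cp n = s" using s unfolding I_def
      by (elim CollectE conjE disjE exE) (use cp in blast)+
    then obtain n where "n \<in> Y" "?cp n = s" by blast
    then show "s \<in> ?cp ` Y" by (intro image_eqI[of _ _ n]) simp_all
  qed
  then have cI: "card I \<le> card Y" using X'(1) by (meson card_image_le card_mono finite_imageI order_trans)
  have "(\<Sum>y<X. card (S y)) = card (SIGMA y:{..<X}. S y)" by (subst card_SigmaI) (auto simp: S_def)
  also have "\<dots> \<le> card I"
  proof (rule card_inj_on_le[of "\<lambda>(y, v). y * p + v"])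
    show "inj_on (\<lambda>(y, v). y * p + v) (SIGMA y:{..<X}. S y)"
      using mixed_radix_eq[of _ p] by (auto simp: inj_on_def S_def mult.commute add.commute)
  qed (use finI in \<open>auto simp: S_def\<close>)
  finally have Ssum: "(\<Sum>y<X. card (S y)) \<le> A * X" using cI X'(3) by linarith
  define ok where "ok f a b c = chk a b c (f 1 0 0) (f 0 1 0) (f 0 0 1)" for f :: "nat \<Rightarrow> nat \<Rightarrow> nat \<Rightarrow> nat" and a b c
  interpret L: list_pruning p l A X Fs pt ok S
  proof
    show "prime p" by (rule prime_p)
    show "3 * l * (2 * A + 1)\<^sup>2 + 1 < p" by (rule p_large)
    show "0 < X" by (rule X_pos)
    show "(\<Sum>x<X. card (S x)) \<le> A * X" by (rule Ssum)
    show "finite (S x)" for x by (simp add: S_def)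
  next
    fix f assume f: "f \<in> Fs"
    show "low_degree3 p l f" by (rule Fs_low_degree3[OF f])
    show "\<exists>g\<in>Fs. \<forall>s<p. \<forall>t<p. \<forall>u<p. g s t u = f s 0 0" "\<exists>g\<in>Fs. \<forall>s<p. \<forall>t<p. \<forall>u<p. g s t u = f 0 s 0"
      "\<exists>g\<in>Fs. \<forall>s<p. \<forall>t<p. \<forall>u<p. g s t u = f 0 0 s" using Fs_axis[OF f] by blast+
  next
    fix y a b c s t u assume *: "s < p" "t < p" "u < p"
    show "pt y a b c s t u < X" unfolding X_def by (rule pt_less)
    show "pt y a b c s 0 0 = pt y a y y s t u" "pt y a b c 0 s 0 = pt y b y y s t u" "pt y a b c 0 0 s = pt y c y y s t u"
      by (rule pt_axis[OF *])+
  next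
    fix y s :: nat assume "0 < s" "s < p"
    then show "bij_betw (\<lambda>a. pt y a y y s 0 0) {..<X} {..<X}" unfolding X_def by (rule pt_bij)
  qed
  \<comment> \<open>The survival test as the circuit performs it, with the triple, the parameters
    and the polynomial replaced by their codes.\<close>
  define ex where "ex t y \<theta> v \<longleftrightarrow> (\<exists>f<Q. okc f \<theta> \<and> fj f 0 = v \<and> (\<forall>j<p * p * p. fj f j \<in> L.Pl t (ptj y \<theta> j)))" for t y \<theta> v
  have Pl_Suc: "v \<in> L.Pl (Suc t) y" if v: "v \<in> L.Pl t y" "\<And>\<theta>. \<theta> < E \<Longrightarrow> ex t y \<theta> v" for t y v
  proof -
    have "\<exists>f. L.fits (L.Pl t) y a b c f \<and> ok f a b c \<and> f 0 0 0 = v" if abc: "a < X" "b < X" "c < X" for a b c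
    proof -
      define \<theta> where "\<theta> = a + X * (b + X * c)"
      have \<theta>: "\<theta> < E" unfolding \<theta>_def E_def mult.assoc using abc by (intro mixed_radix_less)
      have d: "\<theta> mod X = a" "\<theta> div X mod X = b" "\<theta> div X div X mod X = c"
        unfolding \<theta>_def using mixed_radix[OF abc(1)] mixed_radix[OF abc(2)] abc(3) by simp_all
      obtain f where f: "f < Q" "okc f \<theta>" "fj f 0 = v" "\<And>j. j < p * p * p \<Longrightarrow> fj f j \<in> L.Pl t (ptj y \<theta> j)"
        using v(2)[OF \<theta>] unfolding ex_def by blast
      have "fev f s t' u \<in> L.Pl t (pt y a b c s t' u)" if stu: "s < p" "t' < p" "u < p" for s t' u
      proof -
        let ?j = "s + p * (t' + p * u)"
        have j: "?j < p * p * p" unfolding mult.assoc using stu by (intro mixed_radix_less)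
        have "?j mod p = s" "?j div p mod p = t'" "?j div p div p mod p = u"
          using mixed_radix[OF stu(1)] mixed_radix[OF stu(2)] stu(3) by simp_all
        then show ?thesis using f(4)[OF j] unfolding fj_def ptj_def d by simp
      qed
      then have "L.fits (L.Pl t) y a b c (fev f)" unfolding L.fits_def using f(1) by (auto simp: Fs_def)
      moreover have "ok (fev f) a b c" using f(2) unfolding okc_def ok_def d .
      moreover have "fev f 0 0 0 = v" using f(3) by (simp add: fj_def)
      ultimately show ?thesis by blast
    qed
    then show ?thesis using v(1) by simp
  qed
  \<comment> \<open>The value has survived \<open>\<tau> div E\<close> complete rounds and the first
    \<open>\<tau> mod E\<close> tests of the current one.\<close>
  define tD where "tD y v \<tau> \<longleftrightarrow> v \<in> L.Pl (\<tau> div E) y \<and> (\<forall>\<theta><\<tau> mod E. ex (\<tau> div E) y \<theta> v)" for y v \<tau>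
  define tA where "tA t y \<theta> f j \<longleftrightarrow> (\<forall>i\<le>j. fj f i \<in> L.Pl t (ptj y \<theta> i))" for t y \<theta> f j
  \<comment> \<open>The invariant of forward chaining: in copies outside \<open>I\<close> every
    derived gate tells the truth about the pruning of \<open>S\<close> and the pair itself is not
    derived; in copies from \<open>I\<close> anything may be derived.\<close>
  define Mo where "Mo n \<longleftrightarrow> (\<forall>s<p * X. n = node_P s \<longrightarrow> s \<in> I) \<and>
    (\<forall>s<p * X. \<forall>y<X. \<forall>v<p. \<forall>\<tau><Suc (R * E). n = node_D Q s y v \<tau> \<longrightarrow> s \<in> I \<or> tD y v \<tau>) \<and>
    (\<forall>s<p * X. \<forall>t<R. \<forall>y<X. \<forall>\<theta><E. \<forall>f<Q. \<forall>j<p * p * p. n = node_A Q s t y \<theta> f j \<longrightarrow> s \<in> I \<or> tA t y \<theta> f j)" for n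
  have MoP: "Mo (node_P s) \<longleftrightarrow> s \<in> I" if "s < p * X" for s
    unfolding Mo_def using that node_distinct by (auto simp: node_P_eq)
  have MoD: "Mo (node_D Q s y v \<tau>) \<longleftrightarrow> s \<in> I \<or> tD y v \<tau>" if "s < p * X" "y < X" "v < p" "\<tau> < Suc (R * E)" for s y v \<tau>
  proof -
    have "node_D Q s y v \<tau> = node_D Q s' y' v' \<tau>' \<longleftrightarrow> s = s' \<and> y = y' \<and> v = v' \<and> \<tau> = \<tau>'"
      if "s' < p * X" "y' < X" "v' < p" for s' y' v' \<tau>'
      using that \<open>s < p * X\<close> \<open>y < X\<close> \<open>v < p\<close> Q_intros by (intro node_D_eq) auto
    then show ?thesis unfolding Mo_def using that node_distinct by (auto; blast)
  qed
  have MoA: "Mo (node_A Q s t y \<theta> f j) \<longleftrightarrow> s \<in> I \<or> tA t y \<theta> f j" if "s < p * X" "t < R" "y < X" "\<theta> < E" "f < Q" "j < p * p * p" for s t y \<theta> f j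
  proof -
    have "node_A Q s t y \<theta> f j = node_A Q s' t' y' \<theta>' f' j' \<longleftrightarrow> s = s' \<and> t = t' \<and> y = y' \<and> \<theta> = \<theta>' \<and> f = f' \<and> j = j'"
      if "s' < p * X" "t' < R" "y' < X" "\<theta>' < E" "f' < Q" for s' t' y' \<theta>' f' j'
      using that \<open>s < p * X\<close> \<open>y < X\<close> \<open>t < R\<close> \<open>\<theta> < E\<close> \<open>f < Q\<close> Q_intros by (intro node_A_eq) auto
    then show ?thesis unfolding Mo_def using that node_distinct by (auto; blast)
  qed
  have tDE: "tD y v (t * E) \<longleftrightarrow> v \<in> L.Pl t y" for y v t using E_pos by (simp add: tD_def)
  have accept: "L.Pl R 0 \<noteq> {}"
  proof (rule ccontr)
    assume "\<not> L.Pl R 0 \<noteq> {}"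
    then have rej: "L.Pl R 0 = {}" by simp
    have "Mo n" if "n \<in> closure_of Rule Y" for n
      using that
    proof induction
      case (closure_base n)
      then show ?case unfolding Mo_def I_def by blast
    next
      case (closure_step b c h)
      from closure_step.hyps(3) show ?case
      proof (cases rule: rule_cases)
        case (R1 s y v)
        have "y * p + v < p * X" using mixed_radix_less[of v p y X] R1 by (simp add: ac_simps)
        then have "y * p + v \<in> I" using closure_step.IH(1) MoP R1(4) by simp
        then have "tD y v 0" using R1 tDE[of y v 0] by (simp add: S_def)
        then show ?thesis using MoD[of s y v 0] R1 by simp
      next
        case (R2 s t y \<theta> f)
        have "t * E < Suc (R * E)" using tE_less[OF R2(2) E_pos] by linarith
        then have "s \<in> I \<or> tD (ptj y \<theta> 0) (fj f 0) (t * E)"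
          using closure_step.IH(1) MoD[OF R2(1) ptj_less fj_less] R2(6) by simp
        then show ?thesis using MoA[OF R2(1-5), of 0] R2(8) p_gt tDE by (auto simp: tA_def)
      next
        case (R3 s t y \<theta> f j)
        have "t * E < Suc (R * E)" using tE_less[OF R3(2) E_pos] by linarith
        then have 1: "s \<in> I \<or> tD (ptj y \<theta> (Suc j)) (fj f (Suc j)) (t * E)"
          using closure_step.IH(2) MoD[OF R3(1) ptj_less fj_less] R3(8) by simp
        have 2: "s \<in> I \<or> tA t y \<theta> f j" using closure_step.IH(1) MoA[OF R3(1-5), of j] R3(6,7) by simp
        show ?thesis using MoA[OF R3(1-6)] R3(9) 1 2 tDE by (auto simp: tA_def le_Suc_eq)
      next
        case (R4 s t y \<theta> f)
        have \<tau>: "t * E + \<theta> < R * E" by (rule tE_less[OF R4(2,4)])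
        have 1: "s \<in> I \<or> tD y (fj f 0) (t * E + \<theta>)"
          using closure_step.IH(2) MoD[OF R4(1,3) fj_less, of "t * E + \<theta>"] R4(8) \<tau> by simp
        have 2: "s \<in> I \<or> tA t y \<theta> f (p * p * p - 1)" using closure_step.IH(1) MoA[OF R4(1-5) ppp(2)] R4(7) by simp
        have "tD y (fj f 0) (Suc (t * E + \<theta>))" if "s \<notin> I"
        proof -
          have div: "(t * E + \<theta>) div E = t" "(t * E + \<theta>) mod E = \<theta>" using R4(4) by simp_all
          have d: "fj f 0 \<in> L.Pl t y" "\<forall>\<theta>'<\<theta>. ex t y \<theta>' (fj f 0)" using 1 that unfolding tD_def div by auto
          have "fj f j \<in> L.Pl t (ptj y \<theta> j)" if "j < p * p * p" for j
            using 2 \<open>s \<notin> I\<close> that unfolding tA_def by auto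
          then have "ex t y \<theta> (fj f 0)" unfolding ex_def using R4(5,6) by blast
          then have all: "\<forall>\<theta>'<Suc \<theta>. ex t y \<theta>' (fj f 0)" using d(2) by (auto simp: less_Suc_eq)
          show ?thesis
          proof (cases "Suc \<theta> < E")
            case True
            have "Suc (t * E + \<theta>) div E = t" "Suc (t * E + \<theta>) mod E = Suc \<theta>"
              using mixed_radix[OF True, of t] by (simp_all add: ac_simps)
            then show ?thesis unfolding tD_def using d(1) all by simp
          next
            case False
            then have E: "E = Suc \<theta>" using R4(4) by simp
            \<comment> \<open>This was the last test of the round, so the value passes into the
              lists of the next round.\<close>
            have eq: "Suc (t * E + \<theta>) = Suc t * E" using E by simp
            show ?thesis unfolding eq tDE by (rule Pl_Suc[OF d(1)]) (use all E in auto)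
          qed
        qed
        then show ?thesis using MoD[OF R4(1,3) fj_less, of "Suc (t * E + \<theta>)"] R4(9) \<tau> by auto
      next
        case (R5 s v)
        have "s \<in> I \<or> tD 0 v (R * E)" using closure_step.IH(1) MoD[OF R5(1) X_pos R5(2), of "R * E"] R5(3) by simp
        then have "s \<in> I" using rej tDE by simp
        then show ?thesis using MoP[OF R5(1)] R5(5) by simp
      next
        case (R6 s y v \<tau>)
        then show ?thesis using closure_step.IH(1) MoP[OF R6(1)] MoD[OF R6(1-4)] by simp
      next
        case (R7 s t y \<theta> f j)
        then show ?thesis using closure_step.IH(1) MoP[OF R7(1)] MoA[OF R7(1-6)] by simp
      qed
    qed
    \<comment> \<open>All \<open>p * X\<close> pairs are derived, so all of them would have to lie
      in \<open>I\<close>, which has at most \<open>A * X\<close> elements.\<close>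
    then have "s \<in> I" if "s < p * X" for s using X'(2) MoP[OF that] that by (auto simp: Ps_def)
    then have "{..<p * X} \<subseteq> I" by auto
    then have "p * X \<le> card I" using card_mono[OF finI, of "{..<p * X}"] by simp
    then have "p * X \<le> A * X" using cI X'(3) by linarith
    then show False using A_less X_pos by simp
  qed
  obtain G where G: "\<And>a b c. a < X \<Longrightarrow> b < X \<Longrightarrow> c < X \<Longrightarrow> \<exists>f\<in>Fs. ok f a b c \<and> f 1 0 0 = G a \<and> f 0 1 0 = G b \<and> f 0 0 1 = G c"
    using L.global_function[of 0] accept X_pos unfolding R_def by blast
  then show ?thesis unfolding ok_def by (intro exI[of _ G]) (metis (no_types, lifting))
qed

end


section \<open>Programs for Turing machines\<close>

datatype com = Skip
  | Act "(nat \<Rightarrow> nat) \<Rightarrow> nat \<Rightarrow> nat \<times> int"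
  | Seq com com
  | Cond "(nat \<Rightarrow> nat) \<Rightarrow> bool" com com
  | While "(nat \<Rightarrow> nat) \<Rightarrow> bool" com

text \<open>Tapes are indexed by all natural numbers, so that the number of tapes stays open until
  compilation; \<open>wf_com\<close> then ensures that nothing depends on tapes beyond the chosen
  number.\<close>

type_synonym tapes = "nat \<Rightarrow> tape"

abbreviation scan :: "tapes \<Rightarrow> nat \<Rightarrow> nat" where
  "scan ts \<equiv> (\<lambda>i. scanned (ts i))"

abbreviation idle :: "(nat \<Rightarrow> nat) \<Rightarrow> nat \<Rightarrow> nat \<times> int" where
  "idle \<equiv> (\<lambda>\<sigma> i. (\<sigma> i, 0))"

definition do_act :: "((nat \<Rightarrow> nat) \<Rightarrow> nat \<Rightarrow> nat \<times> int) \<Rightarrow> tapes \<Rightarrow> tapes" where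
  "do_act f ts = (\<lambda>i. act (f (scan ts) i) (ts i))"

inductive exec :: "com \<Rightarrow> tapes \<Rightarrow> nat \<Rightarrow> tapes \<Rightarrow> bool" where
  exec_Skip: "exec Skip ts 0 ts"
| exec_Act: "exec (Act f) ts 1 (do_act f ts)"
| exec_Seq: "exec c ts t ts' \<Longrightarrow> exec d ts' t' ts'' \<Longrightarrow> exec (Seq c d) ts (t + t' + 1) ts''"
| exec_CondT: "b (scan ts) \<Longrightarrow> exec c ts t ts' \<Longrightarrow> exec (Cond b c d) ts (t + 1) ts'"
| exec_CondF: "\<not> b (scan ts) \<Longrightarrow> exec d ts t ts' \<Longrightarrow> exec (Cond b c d) ts (t + 1) ts'"
| exec_WhileF: "\<not> b (scan ts) \<Longrightarrow> exec (While b c) ts 1 ts"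
| exec_WhileT: "b (scan ts) \<Longrightarrow> exec c ts t ts' \<Longrightarrow> exec (While b c) ts' t' ts'' \<Longrightarrow>
    exec (While b c) ts (t + t' + 2) ts''"

text \<open>The control states of the machine are the programs that remain to be executed; only finitely
  many of them are reachable.\<close>

fun next_com :: "com \<Rightarrow> (nat \<Rightarrow> nat) \<Rightarrow> com \<times> (nat \<Rightarrow> nat \<times> int)" where
  "next_com Skip \<sigma> = (Skip, idle \<sigma>)"
| "next_com (Act f) \<sigma> = (Skip, f \<sigma>)"
| "next_com (Seq c d) \<sigma> =
     (if c = Skip then (d, idle \<sigma>) else (Seq (fst (next_com c \<sigma>)) d, snd (next_com c \<sigma>)))"
| "next_com (Cond b c d) \<sigma> = (if b \<sigma> then c else d, idle \<sigma>)"
| "next_com (While b c) \<sigma> = (if b \<sigma> then Seq c (While b c) else Skip, idle \<sigma>)"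

fun reach :: "com \<Rightarrow> com set" where
  "reach Skip = {Skip}"
| "reach (Act f) = {Act f, Skip}"
| "reach (Seq c d) = (\<lambda>c'. Seq c' d) ` reach c \<union> reach d"
| "reach (Cond b c d) = {Cond b c d} \<union> reach c \<union> reach d"
| "reach (While b c) = {While b c, Skip} \<union> (\<lambda>c'. Seq c' (While b c)) ` reach c"

lemma finite_reach: "finite (reach c)"
  by (induction c) auto

lemma self_in_reach: "c \<in> reach c"
  by (induction c) auto

lemma Skip_in_reach: "Skip \<in> reach c"
  by (induction c) auto

lemma next_com_in_reach: "c' \<in> reach c \<Longrightarrow> fst (next_com c' \<sigma>) \<in> reach c"
proof (induction c arbitrary: c')
  case (Seq c d)
  show ?case
  proof (cases "c' \<in> reach d")
    case True
    then show ?thesis using Seq by auto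
  next
    case False
    then obtain e where "c' = Seq e d" "e \<in> reach c" using Seq.prems by auto
    then show ?thesis using Seq.IH(1)[of e] self_in_reach[of d] by auto
  qed
next
  case (Cond b c d)
  then show ?case using self_in_reach[of c] self_in_reach[of d] by auto
next
  case (While b c)
  show ?case
  proof (cases "c' \<in> {While b c, Skip}")
    case True
    then show ?thesis using self_in_reach[of c] by auto
  next
    case False
    then obtain e where "c' = Seq e (While b c)" "e \<in> reach c" using While.prems by auto
    then show ?thesis using While.IH[of e] by auto
  qed
qed auto

section \<open>Single steps of programs\<close>

definition com_step :: "com \<times> tapes \<Rightarrow> com \<times> tapes" where
  "com_step = (\<lambda>(c, ts). if c = Skip then (c, ts)
     else (fst (next_com c (scan ts)), \<lambda>i. act (snd (next_com c (scan ts)) i) (ts i)))"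

lemma act_idle [simp]: "act (scanned T, 0) T = T"
  by (cases T) simp

lemma com_step_Seq: "c \<noteq> Skip \<Longrightarrow>
    com_step (Seq c d, ts) = (Seq (fst (com_step (c, ts))) d, snd (com_step (c, ts)))"
  by (simp add: com_step_def)

text \<open>\<open>Skip\<close> is a fixed point of \<open>com_step\<close>, so \<open>c\<close> may
  have finished before step \<open>t\<close>; hence the inequality.\<close>

lemma com_steps_Seq:
  assumes "(com_step ^^ t) (c, ts) = (Skip, ts')"
  shows "\<exists>t'\<le>t. (com_step ^^ t') (Seq c d, ts) = (Seq Skip d, ts')"
  using assms
proof (induction t arbitrary: c ts)
  case (Suc t)
  show ?case
  proof (cases "c = Skip")
    case True
    have "(com_step ^^ n) (Skip, ts) = (Skip, ts)" for n
      by (induction n) (auto simp: com_step_def)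
    then have "ts = ts'" using Suc.prems True by (metis prod.inject)
    then show ?thesis using True by (intro exI[of _ 0]) auto
  next
    case False
    have "(com_step ^^ t) (com_step (c, ts)) = (Skip, ts')"
      using Suc.prems by (simp add: funpow_swap1)
    then obtain t' where "t' \<le> t"
      "(com_step ^^ t') (Seq (fst (com_step (c, ts))) d, snd (com_step (c, ts))) = (Seq Skip d, ts')"
      using Suc.IH[of "fst (com_step (c, ts))" "snd (com_step (c, ts))"] by auto
    then show ?thesis using com_step_Seq[OF False]
      by (intro exI[of _ "Suc t'"]) (simp add: funpow_swap1)
  qed
qed auto

lemma com_steps_trans:
  assumes "\<exists>t1\<le>T1. (com_step ^^ t1) x = y" "\<exists>t2\<le>T2. (com_step ^^ t2) y = z" "T1 + T2 \<le> T"
  shows "\<exists>t\<le>T. (com_step ^^ t) x = z"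
proof -
  obtain t1 t2 where "t1 \<le> T1" "(com_step ^^ t1) x = y" "t2 \<le> T2" "(com_step ^^ t2) y = z"
    using assms by blast
  then show ?thesis using assms(3)
    by (intro exI[of _ "t2 + t1"]) (simp add: funpow_add)
qed

lemma com_step_once: "com_step x = y \<Longrightarrow> \<exists>t\<le>1. (com_step ^^ t) x = y"
  by (intro exI[of _ 1]) simp

lemma exec_com_steps: "exec c ts t ts' \<Longrightarrow> \<exists>t'\<le>t. (com_step ^^ t') (c, ts) = (Skip, ts')"
proof (induction rule: exec.induct)
  case (exec_Act f ts)
  show ?case by (rule com_step_once) (simp add: com_step_def do_act_def)
next
  case (exec_Seq c ts t ts' d t' ts'')
  have 1: "\<exists>k\<le>t. (com_step ^^ k) (Seq c d, ts) = (Seq Skip d, ts')"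
    using exec_Seq.IH(1) com_steps_Seq by (meson order_trans)
  have 2: "\<exists>k\<le>1. (com_step ^^ k) (Seq Skip d, ts') = (d, ts')"
    by (rule com_step_once) (simp add: com_step_def)
  show ?case
    by (rule com_steps_trans[OF com_steps_trans[OF 1 2 order.refl] exec_Seq.IH(2)]) simp
next
  case (exec_CondT b ts c t ts' d)
  have "\<exists>k\<le>1. (com_step ^^ k) (Cond b c d, ts) = (c, ts)"
    by (rule com_step_once) (use exec_CondT in \<open>simp add: com_step_def\<close>)
  then show ?case by (rule com_steps_trans[OF _ exec_CondT.IH]) simp
next
  case (exec_CondF b ts d t ts' c)
  have "\<exists>k\<le>1. (com_step ^^ k) (Cond b c d, ts) = (d, ts)"
    by (rule com_step_once) (use exec_CondF in \<open>simp add: com_step_def\<close>)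
  then show ?case by (rule com_steps_trans[OF _ exec_CondF.IH]) simp
next
  case (exec_WhileF b ts c)
  show ?case by (rule com_step_once) (use exec_WhileF in \<open>simp add: com_step_def\<close>)
next
  case (exec_WhileT b ts c t ts' t' ts'')
  let ?W = "While b c"
  have 1: "\<exists>k\<le>1. (com_step ^^ k) (?W, ts) = (Seq c ?W, ts)"
    by (rule com_step_once) (use exec_WhileT in \<open>simp add: com_step_def\<close>)
  have 2: "\<exists>k\<le>t. (com_step ^^ k) (Seq c ?W, ts) = (Seq Skip ?W, ts')"
    using exec_WhileT.IH(1) com_steps_Seq by (meson order_trans)
  have 3: "\<exists>k\<le>1. (com_step ^^ k) (Seq Skip ?W, ts') = (?W, ts')"
    by (rule com_step_once) (simp add: com_step_def)
  show ?case
    by (rule com_steps_trans[OF com_steps_trans[OF com_steps_trans[OF 1 2 order.refl] 3 order.refl]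
          exec_WhileT.IH(2)]) simp
qed auto

section \<open>Well-formed programs and their machines\<close>

definition agree :: "nat \<Rightarrow> (nat \<Rightarrow> nat) \<Rightarrow> (nat \<Rightarrow> nat) \<Rightarrow> bool" where
  "agree k \<sigma> \<sigma>' \<longleftrightarrow> (\<forall>i<k. \<sigma> i = \<sigma>' i)"

fun wf_com :: "nat \<Rightarrow> nat \<Rightarrow> com \<Rightarrow> bool" where
  "wf_com k s Skip = True"
| "wf_com k s (Act f) =
     ((\<forall>\<sigma> \<sigma>'. agree k \<sigma> \<sigma>' \<longrightarrow> (\<forall>i<k. f \<sigma> i = f \<sigma>' i)) \<and>
      (\<forall>\<sigma>. (\<forall>i<k. \<sigma> i < s) \<longrightarrow> (\<forall>i<k. fst (f \<sigma> i) < s \<and> snd (f \<sigma> i) \<in> {-1, 0, 1})))"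
| "wf_com k s (Seq c d) = (wf_com k s c \<and> wf_com k s d)"
| "wf_com k s (Cond b c d) =
     ((\<forall>\<sigma> \<sigma>'. agree k \<sigma> \<sigma>' \<longrightarrow> b \<sigma> = b \<sigma>') \<and> wf_com k s c \<and> wf_com k s d)"
| "wf_com k s (While b c) = ((\<forall>\<sigma> \<sigma>'. agree k \<sigma> \<sigma>' \<longrightarrow> b \<sigma> = b \<sigma>') \<and> wf_com k s c)"

lemma wf_com_reach: "wf_com k s c \<Longrightarrow> c' \<in> reach c \<Longrightarrow> wf_com k s c'"
proof (induction c arbitrary: c')
  case (Seq c d)
  have wf: "wf_com k s c" "wf_com k s d" using Seq.prems(1) by simp_all
  show ?case
  proof (cases "c' \<in> reach d")
    case True
    then show ?thesis using Seq.IH(2) wf by blast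
  next
    case False
    then obtain e where "c' = Seq e d" "e \<in> reach c" using Seq.prems(2) by auto
    then show ?thesis using Seq.IH(1) wf by simp
  qed
next
  case (Cond b c d)
  have "wf_com k s c" "wf_com k s d" using Cond.prems(1) by simp_all
  then show ?case using Cond.prems Cond.IH[of c'] by (metis Un_iff reach.simps(4) singletonD)
next
  case (While b c)
  show ?case
  proof (cases "c' \<in> {While b c, Skip}")
    case True
    then show ?thesis using While.prems(1) by (metis insertE singletonD wf_com.simps(1))
  next
    case False
    then obtain e where "c' = Seq e (While b c)" "e \<in> reach c" using While.prems(2) by auto
    moreover have "wf_com k s c" using While.prems(1) by simp
    ultimately show ?thesis using While.IH[of e] While.prems(1) by (simp only: wf_com.simps)
  qed
qed auto

lemma next_com_agree:
  "wf_com k s c \<Longrightarrow> agree k \<sigma> \<sigma>' \<Longrightarrow>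
    fst (next_com c \<sigma>) = fst (next_com c \<sigma>') \<and> (\<forall>i<k. snd (next_com c \<sigma>) i = snd (next_com c \<sigma>') i)"
proof (induction c)
  case (Cond b c d)
  then have "b \<sigma> = b \<sigma>'" by auto
  then show ?case using Cond.prems(2) by (simp add: agree_def)
next
  case (While b c)
  then have "b \<sigma> = b \<sigma>'" by auto
  then show ?case using While.prems(2) by (simp add: agree_def)
qed (auto simp: agree_def)

lemma next_com_acts:
  "wf_com k s c \<Longrightarrow> \<forall>i<k. \<sigma> i < s \<Longrightarrow> i < k \<Longrightarrow>
    fst (snd (next_com c \<sigma>) i) < s \<and> snd (snd (next_com c \<sigma>) i) \<in> {-1, 0, 1}"
  by (induction c) auto

definition com_tm :: "nat \<Rightarrow> nat \<Rightarrow> (com \<Rightarrow> nat) \<Rightarrow> com \<Rightarrow> tm" where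
  "com_tm k s \<nu> c = \<lparr>num_tapes = k, num_states = card (reach c), num_syms = s,
     delta = (\<lambda>q ss. let r = next_com (the_inv_into (reach c) \<nu> q) (\<lambda>i. if i < k then ss ! i else 0)
        in (\<nu> (fst r), map (snd r) [0..<k]))\<rparr>"

text \<open>Machines start in state 0 and halt in state 1, so the whole program and
  \<open>Skip\<close> need these two numbers and have to be different.\<close>

lemma ex_state_numbering:
  assumes "c \<noteq> Skip"
  shows "\<exists>\<nu>. bij_betw \<nu> (reach c) {..<card (reach c)} \<and> \<nu> c = 0 \<and> \<nu> Skip = 1"
proof -
  let ?A = "reach c - {c, Skip}"
  obtain g where g: "bij_betw g ?A {0..<card ?A}"
    using ex_bij_betw_finite_nat[of ?A] finite_reach by blast
  have card: "card (reach c) = card ?A + 2"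
  proof -
    have "reach c = insert c (insert Skip ?A)" using self_in_reach Skip_in_reach by auto
    then have "card (reach c) = card (insert c (insert Skip ?A))" by simp
    also have "\<dots> = card ?A + 2" using assms finite_reach by (subst card_insert_disjoint; simp)+
    finally show ?thesis .
  qed
  define \<nu> where "\<nu> x = (if x = c then 0 else if x = Skip then 1 else g x + 2)" for x
  have "inj_on \<nu> (reach c)"
  proof (rule inj_onI)
    fix x y assume "x \<in> reach c" "y \<in> reach c" "\<nu> x = \<nu> y"
    then show "x = y" using bij_betw_imp_inj_on[OF g] assms
      unfolding \<nu>_def by (auto split: if_splits dest: inj_onD)
  qed
  moreover have "\<nu> ` reach c \<subseteq> {..<card (reach c)}"
  proof
    fix y assume "y \<in> \<nu> ` reach c"
    then obtain x where x: "x \<in> reach c" "y = \<nu> x" by auto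
    show "y \<in> {..<card (reach c)}"
    proof (cases "x \<in> ?A")
      case True
      then have "g x < card ?A" using g by (auto simp: bij_betw_def)
      then show ?thesis using card x True by (auto simp: \<nu>_def)
    next
      case False
      then show ?thesis using x card by (auto simp: \<nu>_def)
    qed
  qed
  ultimately have "bij_betw \<nu> (reach c) {..<card (reach c)}"
    by (simp add: bij_betw_def card_subset_eq card_image)
  then show ?thesis using assms by (intro exI[of _ \<nu>]) (auto simp: \<nu>_def)
qed

definition tapes_list :: "nat \<Rightarrow> tapes \<Rightarrow> tape list" where
  "tapes_list k ts = map ts [0..<k]"

lemma wf_com_tm:
  assumes "wf_com k s c" "k \<ge> 1" "s \<ge> 6" "c \<noteq> Skip"
    and bij: "bij_betw \<nu> (reach c) {..<card (reach c)}"
  shows "wf_tm (com_tm k s \<nu> c)"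
proof -
  have "{c, Skip} \<subseteq> reach c" using self_in_reach Skip_in_reach by auto
  then have "card (reach c) \<ge> 2" using card_mono[OF finite_reach, of "{c, Skip}" c] assms(4) by simp
  moreover have "case delta (com_tm k s \<nu> c) q ss of (q', acts) \<Rightarrow>
           q' < card (reach c) \<and> length acts = k \<and>
           (\<forall>(s', d)\<in>set acts. s' < s \<and> d \<in> {-1, 0, 1})"
    if q: "q < card (reach c)" and ss: "length ss = k" "\<forall>s'\<in>set ss. s' < s" for q ss
  proof -
    let ?c = "the_inv_into (reach c) \<nu> q"
    have c: "?c \<in> reach c" using the_inv_into_into[OF bij_betw_imp_inj_on[OF bij], of q "reach c"] q bij
      by (auto simp: bij_betw_def)
    let ?\<sigma> = "\<lambda>i. if i < k then ss ! i else 0"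
    have \<sigma>: "\<forall>i<k. ?\<sigma> i < s" using ss by auto
    have "\<nu> (fst (next_com ?c ?\<sigma>)) < card (reach c)"
      using next_com_in_reach[OF c] bij by (auto simp: bij_betw_def)
    then show ?thesis
      using next_com_acts[OF wf_com_reach[OF assms(1) c] \<sigma>]
      by (auto simp: com_tm_def Let_def case_prod_beta)
  qed
  ultimately show ?thesis using assms by (auto simp: wf_tm_def com_tm_def)
qed

lemma step_com_tm:
  assumes "wf_com k s c" and bij: "bij_betw \<nu> (reach c) {..<card (reach c)}" and "\<nu> Skip = 1"
    and c': "c' \<in> reach c"
  shows "step (com_tm k s \<nu> c) (\<nu> c', tapes_list k ts) =
    (\<nu> (fst (com_step (c', ts))), tapes_list k (snd (com_step (c', ts))))"
proof (cases "c' = Skip")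
  case False
  have inj: "inj_on \<nu> (reach c)" using bij by (rule bij_betw_imp_inj_on)
  have ne: "\<nu> c' \<noteq> 1" using inj_onD[OF inj, of c' Skip] c' Skip_in_reach assms(3) False by auto
  let ?ss = "map scanned (tapes_list k ts)"
  let ?\<sigma> = "\<lambda>i. if i < k then ?ss ! i else 0"
  have ag: "agree k (scan ts) ?\<sigma>" by (auto simp: agree_def tapes_list_def)
  have nx: "fst (next_com c' ?\<sigma>) = fst (next_com c' (scan ts))"
    "\<forall>i<k. snd (next_com c' ?\<sigma>) i = snd (next_com c' (scan ts)) i"
    using next_com_agree[OF wf_com_reach[OF assms(1) c'] ag] by auto
  have "map2 act (map (snd (next_com c' ?\<sigma>)) [0..<k]) (tapes_list k ts) =
    tapes_list k (\<lambda>i. act (snd (next_com c' (scan ts)) i) (ts i))"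
    using nx(2) by (intro nth_equalityI) (auto simp: tapes_list_def)
  then show ?thesis using False ne nx(1)
    by (simp add: com_tm_def Let_def the_inv_into_f_f[OF inj c'] com_step_def)
qed (simp add: com_step_def assms(3))

lemma steps_com_tm:
  assumes "wf_com k s c" and bij: "bij_betw \<nu> (reach c) {..<card (reach c)}" and "\<nu> Skip = 1"
    and "c' \<in> reach c"
  shows "(step (com_tm k s \<nu> c) ^^ t) (\<nu> c', tapes_list k ts) =
    (\<nu> (fst ((com_step ^^ t) (c', ts))), tapes_list k (snd ((com_step ^^ t) (c', ts))))
    \<and> fst ((com_step ^^ t) (c', ts)) \<in> reach c"
proof (induction t)
  case (Suc t)
  obtain d us where x: "(com_step ^^ t) (c', ts) = (d, us)" by force
  have "fst (com_step (d, us)) \<in> reach c"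
    using Suc x next_com_in_reach[of d c] by (auto simp: com_step_def)
  then show ?case using Suc x step_com_tm[OF assms(1-3), of d us] by simp
qed (use assms in auto)

lemma com_compilation:
  assumes "wf_com k s c" "k \<ge> 1" "s \<ge> 6" "c \<noteq> Skip"
  shows "\<exists>M. wf_tm M \<and> (\<forall>w t ts' v.
     exec c (\<lambda>i. word_tape (if i = 0 then w else [])) t ts' \<and> 0 \<notin> set v \<and>
     (\<forall>i<length v. fst (ts' (k - 1)) (int i) = v ! i) \<and> fst (ts' (k - 1)) (int (length v)) = 0 \<longrightarrow>
     outputs_within M w v (real t))"
proof -
  obtain \<nu> where \<nu>: "bij_betw \<nu> (reach c) {..<card (reach c)}" "\<nu> c = 0" "\<nu> Skip = 1"
    using ex_state_numbering[OF assms(4)] by blast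
  let ?M = "com_tm k s \<nu> c"
  have "outputs_within ?M w v (real t)"
    if ex: "exec c (\<lambda>i. word_tape (if i = 0 then w else [])) t ts'" and v: "0 \<notin> set v"
      "\<forall>i<length v. fst (ts' (k - 1)) (int i) = v ! i" "fst (ts' (k - 1)) (int (length v)) = 0"
    for w t ts' v
  proof -
    let ?ts = "\<lambda>i. word_tape (if i = 0 then w else [])"
    obtain t' where t': "t' \<le> t" "(com_step ^^ t') (c, ?ts) = (Skip, ts')"
      using exec_com_steps[OF ex] by blast
    have init: "init_config ?M w = (\<nu> c, tapes_list k ?ts)"
      unfolding init_config_def tapes_list_def
      using \<nu>(2) assms(2) by (auto simp: com_tm_def intro!: nth_equalityI simp: nth_Cons split: nat.splits)
    have "(step ?M ^^ t') (init_config ?M w) = (1, tapes_list k ts')"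
      using steps_com_tm[OF assms(1) \<nu>(1,3) self_in_reach, of t' ?ts] t' init \<nu>(3) by simp
    moreover have "last (tapes_list k ts') = ts' (k - 1)"
      using assms(2) by (auto simp: tapes_list_def last_map)
    ultimately have "halted_with ((step ?M ^^ t') (init_config ?M w)) v"
      using v by (simp add: halted_with_def)
    then show ?thesis unfolding outputs_within_def using t'(1) by (intro exI[of _ t']) auto
  qed
  then show ?thesis using wf_com_tm[OF assms \<nu>(1)] by blast
qed


section \<open>Register expressions\<close>

definition run :: "com \<Rightarrow> tapes \<Rightarrow> nat \<Rightarrow> tapes \<Rightarrow> bool" where
  "run c ts T ts' \<longleftrightarrow> (\<exists>t\<le>T. exec c ts t ts')"

lemma run_mono: "run c ts T ts' \<Longrightarrow> T \<le> T' \<Longrightarrow> ts' = ts'' \<Longrightarrow> run c ts T' ts''"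
  unfolding run_def using order_trans by blast

lemma run_Skip: "run Skip ts T ts"
  unfolding run_def using exec_Skip by blast

lemma run_Act: "do_act f ts = ts' \<Longrightarrow> run (Act f) ts 1 ts'"
  unfolding run_def using exec_Act by blast

lemma run_Seq: "run c ts T ts' \<Longrightarrow> run d ts' T' ts'' \<Longrightarrow> run (Seq c d) ts (T + T' + 1) ts''"
  unfolding run_def by (meson add_le_mono exec_Seq order_refl)

lemma run_Cond: "(b (scan ts) \<Longrightarrow> run c ts T ts') \<Longrightarrow> (\<not> b (scan ts) \<Longrightarrow> run d ts T ts') \<Longrightarrow>
    run (Cond b c d) ts (T + 1) ts'"
proof (cases "b (scan ts)")
  case True
  assume "b (scan ts) \<Longrightarrow> run c ts T ts'"
  then obtain t where "t \<le> T" "exec c ts t ts'" using True by (auto simp: run_def)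
  then show ?thesis using exec_CondT[of b ts c t ts' d] True unfolding run_def by (intro exI[of _ "t + 1"]) auto
next
  case False
  assume "\<not> b (scan ts) \<Longrightarrow> run d ts T ts'"
  then obtain t where "t \<le> T" "exec d ts t ts'" using False by (auto simp: run_def)
  then show ?thesis using exec_CondF[of b ts d t ts' c] False unfolding run_def by (intro exI[of _ "t + 1"]) auto
qed

lemma run_While:
  assumes "\<And>i. i < n \<Longrightarrow> b (scan (S i))" "\<And>i. i < n \<Longrightarrow> run c (S i) (T i) (S (Suc i))"
    and "\<not> b (scan (S n))"
  shows "run (While b c) (S 0) ((\<Sum>i<n. T i + 2) + 1) (S n)"
  using assms
proof (induction n arbitrary: S T)
  case 0
  then show ?case unfolding run_def using exec_WhileF[of b "S 0" c] by auto
next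
  case (Suc n)
  have IH: "run (While b c) (S (Suc 0)) ((\<Sum>i<n. T (Suc i) + 2) + 1) (S (Suc n))"
    using Suc.IH[of "\<lambda>i. S (Suc i)" "\<lambda>i. T (Suc i)"] Suc.prems by auto
  obtain t where t: "t \<le> T 0" "exec c (S 0) t (S (Suc 0))"
    using Suc.prems(2)[of 0] by (auto simp: run_def)
  obtain t' where t': "t' \<le> (\<Sum>i<n. T (Suc i) + 2) + 1" "exec (While b c) (S (Suc 0)) t' (S (Suc n))"
    using IH by (auto simp: run_def)
  have "exec (While b c) (S 0) (t + t' + 2) (S (Suc n))"
    using exec_WhileT[OF _ t(2) t'(2)] Suc.prems(1)[of 0] by simp
  moreover have "t + t' + 2 \<le> (\<Sum>i<Suc n. T i + 2) + 1"
    using t(1) t'(1) by (simp add: sum.lessThan_Suc_shift del: sum.lessThan_Suc)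
  ultimately show ?case unfolding run_def by blast
qed

definition mv :: "nat \<Rightarrow> int \<Rightarrow> com" where
  "mv r d = Act (\<lambda>\<sigma> i. (\<sigma> i, if i = r then d else 0))"

lemma run_mv: "run (mv r d) ts 1 (ts(r := (fst (ts r), snd (ts r) + d)))"
proof -
  have "act (scanned T, d) T = (fst T, snd T + d)" for T by (cases T) simp
  then show ?thesis unfolding mv_def by (intro run_Act) (auto simp: do_act_def fun_eq_iff)
qed

text \<open>A register is a tape with a mark at position 0; its value is the position of the head.\<close>
definition reg :: "nat \<Rightarrow> tape" where
  "reg v = ((\<lambda>i. if i = 0 then 1 else 0), int v)"

lemma scanned_reg [simp]: "scanned (reg v) = (if v = 0 then 1 else 0)"
  by (simp add: reg_def)

text \<open>Primitive recursion over the natural numbers with de Bruijn variables and random access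
  to the input word. In the last argument of \<open>RRec\<close> variable 0 is the loop index and
  variable 1 the accumulator.\<close>

datatype rexp = RVar nat | RZero | RSuc rexp | RIn nat rexp | RLen | RRec rexp rexp rexp

abbreviation push :: "nat \<Rightarrow> (nat \<Rightarrow> nat) \<Rightarrow> nat \<Rightarrow> nat" where
  "push \<equiv> case_nat"

definition symbol_at :: "nat list \<Rightarrow> nat \<Rightarrow> nat" where
  "symbol_at w i = (if i < length w then w ! i else 0)"

fun eval :: "rexp \<Rightarrow> nat list \<Rightarrow> (nat \<Rightarrow> nat) \<Rightarrow> nat" where
  "eval (RVar i) w x = x i"
| "eval RZero w x = 0"
| "eval (RSuc e) w x = Suc (eval e w x)"
| "eval (RIn c e) w x = of_bool (symbol_at w (eval e w x) = c)"
| "eval RLen w x = length w"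
| "eval (RRec n a b) w x = rec_nat (eval a w x) (\<lambda>i r. eval b w (push i (push r x))) (eval n w x)"

text \<open>Upper bounds for the running time of the compiled expressions. The constants are those
  of copying, moving and clearing a unary register and of walking along the input.\<close>

fun cost :: "rexp \<Rightarrow> nat list \<Rightarrow> (nat \<Rightarrow> nat) \<Rightarrow> nat" where
  "cost (RVar i) w x = 12 * x i + 3"
| "cost RZero w x = 0"
| "cost (RSuc e) w x = cost e w x + 2"
| "cost (RIn c e) w x = cost e w x + 12 * eval e w x + 10"
| "cost RLen w x = 12 * length w + 3"
| "cost (RRec n a b) w x =
     (let r = rec_nat (eval a w x) (\<lambda>i r. eval b w (push i (push r x))) in
      cost a w x + cost n w x + (\<Sum>i<eval n w x. cost b w (push i (push (r i) x)) + 3 * r i + 5 * r (Suc i) + 12)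
      + 3 * eval n w x + 6)"

fun closed_rexp :: "nat \<Rightarrow> rexp \<Rightarrow> bool" where
  "closed_rexp m (RVar i) = (i < m)"
| "closed_rexp m RZero = True"
| "closed_rexp m (RSuc e) = closed_rexp m e"
| "closed_rexp m (RIn c e) = closed_rexp m e"
| "closed_rexp m RLen = True"
| "closed_rexp m (RRec n a b) = (closed_rexp m n \<and> closed_rexp m a \<and> closed_rexp (m + 2) b)"

text \<open>Registers occupy the tapes from \<open>rb\<close> on. Tape 0 holds the input and tape 1
  the word being written; a larger \<open>rb\<close> leaves room for the tapes of a simulated
  machine.\<close>

locale registers =
  fixes rb :: nat
  assumes rb: "rb \<ge> 2"
begin

definition inc :: "nat \<Rightarrow> com" where "inc r = mv (rb + r) 1"
definition dec :: "nat \<Rightarrow> com" where "dec r = mv (rb + r) (-1)"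
definition nonzero :: "nat \<Rightarrow> (nat \<Rightarrow> nat) \<Rightarrow> bool" where "nonzero r \<sigma> \<longleftrightarrow> \<sigma> (rb + r) \<noteq> 1"

lemma run_inc: "ts (rb + r) = reg v \<Longrightarrow> run (inc r) ts 1 (ts(rb + r := reg (Suc v)))"
  unfolding inc_def using run_mv[of "rb + r" 1 ts] by (simp add: reg_def add.commute)

lemma run_dec: "ts (rb + r) = reg (Suc v) \<Longrightarrow> run (dec r) ts 1 (ts(rb + r := reg v))"
  unfolding dec_def using run_mv[of "rb + r" "-1" ts] by (simp add: reg_def)

definition clear :: "nat \<Rightarrow> com" where
  "clear r = While (nonzero r) (dec r)"

definition move :: "nat \<Rightarrow> nat \<Rightarrow> com" where
  "move r s = While (nonzero r) (Seq (dec r) (inc s))"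

text \<open>Reading a unary register empties it, so a second copy is made in the register
  \<open>Suc s\<close> and moved back.\<close>

definition copy :: "nat \<Rightarrow> nat \<Rightarrow> com" where
  "copy r s = Seq (While (nonzero r) (Seq (dec r) (Seq (inc s) (inc (Suc s))))) (move (Suc s) r)"

lemma run_clear:
  assumes "ts (rb + r) = reg v"
  shows "run (clear r) ts (3 * v + 1) (ts(rb + r := reg 0))"
proof -
  let ?S = "\<lambda>i. ts(rb + r := reg (v - i))"
  have "run (clear r) (?S 0) ((\<Sum>i<v. 1 + 2) + 1) (?S v)"
    unfolding clear_def
  proof (rule run_While)
    fix i assume "i < v"
    then have "v - i = Suc (v - Suc i)" by simp
    then show "run (dec r) (?S i) 1 (?S (Suc i))"
      using run_dec[of "?S i" r "v - Suc i"] by simp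
  qed (auto simp: nonzero_def)
  moreover have "?S 0 = ts" using assms by auto
  ultimately have "run (clear r) ts ((\<Sum>i<v. 1 + 2) + 1) (?S v)" by simp
  then show ?thesis by (rule run_mono) auto
qed

lemma run_move:
  assumes "ts (rb + r) = reg v" "ts (rb + s) = reg u" "r \<noteq> s"
  shows "run (move r s) ts (5 * v + 1) (ts(rb + r := reg 0, rb + s := reg (u + v)))"
proof -
  let ?S = "\<lambda>i. ts(rb + r := reg (v - i), rb + s := reg (u + i))"
  have "run (move r s) (?S 0) ((\<Sum>i<v. (1 + 1 + 1) + 2) + 1) (?S v)"
    unfolding move_def
  proof (rule run_While)
    fix i assume "i < v"
    then have v: "v - i = Suc (v - Suc i)" by simp
    have 1: "run (dec r) (?S i) 1 (ts(rb + r := reg (v - Suc i), rb + s := reg (u + i)))"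
      using run_dec[of "?S i" r "v - Suc i"] v assms(3) by (simp add: fun_upd_twist)
    have 2: "run (inc s) (ts(rb + r := reg (v - Suc i), rb + s := reg (u + i))) 1 (?S (Suc i))"
      using run_inc[of "ts(rb + r := reg (v - Suc i), rb + s := reg (u + i))" s "u + i"] by simp
    show "run (Seq (dec r) (inc s)) (?S i) (1 + 1 + 1) (?S (Suc i))"
      by (rule run_Seq[OF 1 2])
  qed (use assms in \<open>auto simp: nonzero_def\<close>)
  moreover have "?S 0 = ts" using assms by auto
  ultimately have "run (move r s) ts ((\<Sum>i<v. (1 + 1 + 1) + 2) + 1) (?S v)" by simp
  then show ?thesis by (rule run_mono) auto
qed

lemma run_copy:
  assumes "ts (rb + r) = reg v" "ts (rb + s) = reg 0" "ts (rb + Suc s) = reg 0" "r < s"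
  shows "run (copy r s) ts (12 * v + 3) (ts(rb + s := reg v))"
proof -
  let ?S = "\<lambda>i. ts(rb + r := reg (v - i), rb + s := reg i, rb + Suc s := reg i)"
  let ?c = "Seq (dec r) (Seq (inc s) (inc (Suc s)))"
  have "run (While (nonzero r) ?c) (?S 0) ((\<Sum>i<v. (1 + (1 + 1 + 1) + 1) + 2) + 1) (?S v)"
  proof (rule run_While)
    fix i assume "i < v"
    then have v: "v - i = Suc (v - Suc i)" by simp
    have 1: "run (dec r) (?S i) 1 (ts(rb + r := reg (v - Suc i), rb + s := reg i, rb + Suc s := reg i))" (is "run _ _ _ ?B")
      using run_dec[of "?S i" r "v - Suc i"] v assms(4) by (simp add: fun_upd_twist)
    have 2: "run (inc s) ?B 1 (?B(rb + s := reg (Suc i)))"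
      by (rule run_inc) simp
    have 3: "run (inc (Suc s)) (?B(rb + s := reg (Suc i))) 1 (?S (Suc i))"
      using run_inc[of "?B(rb + s := reg (Suc i))" "Suc s" i] by (simp add: fun_upd_twist)
    show "run ?c (?S i) (1 + (1 + 1 + 1) + 1) (?S (Suc i))"
      by (rule run_Seq[OF 1 run_Seq[OF 2 3]])
  qed (use assms in \<open>auto simp: nonzero_def\<close>)
  moreover have "?S 0 = ts" using assms by auto
  ultimately have "run (While (nonzero r) ?c) ts ((\<Sum>i<v. (1 + (1 + 1 + 1) + 1) + 2) + 1) (?S v)" by simp
  then have 1: "run (While (nonzero r) ?c) ts (7 * v + 1) (?S v)" by (rule run_mono) auto
  have 2: "run (move (Suc s) r) (?S v) (5 * v + 1) ((?S v)(rb + Suc s := reg 0, rb + r := reg (0 + v)))"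
    by (rule run_move) (use assms in auto)
  have "(?S v)(rb + Suc s := reg 0, rb + r := reg (0 + v)) = ts(rb + s := reg v)"
    using assms by (auto simp: fun_eq_iff)
  then show ?thesis unfolding copy_def using run_Seq[OF 1 2] by (auto elim: run_mono)
qed

text \<open>\<open>\<pi>\<close> sends variables to registers, and \<open>j\<close> is the lowest
  free register, which receives the result. For \<open>RRec\<close> the registers \<open>j\<close>
  to \<open>j + 3\<close> hold the accumulator, the countdown, the index and the result of the
  body.\<close>

fun comp_rexp :: "(nat \<Rightarrow> nat) \<Rightarrow> nat \<Rightarrow> rexp \<Rightarrow> com" where
  "comp_rexp \<pi> j (RVar i) = copy (\<pi> i) j"
| "comp_rexp \<pi> j RZero = Skip"
| "comp_rexp \<pi> j (RSuc e) = Seq (comp_rexp \<pi> j e) (inc j)"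
| "comp_rexp \<pi> j (RIn c e) = Seq (comp_rexp \<pi> j e)
     (Seq (While (nonzero j) (Seq (dec j) (Seq (inc (Suc j)) (mv 0 1))))
     (Seq (Cond (\<lambda>\<sigma>. \<sigma> 0 = c) (inc j) Skip)
          (While (nonzero (Suc j)) (Seq (dec (Suc j)) (mv 0 (-1))))))"
| "comp_rexp \<pi> j RLen =
     Seq (While (\<lambda>\<sigma>. \<sigma> 0 \<noteq> 0) (Seq (inc j) (Seq (inc (Suc j)) (mv 0 1))))
         (While (nonzero (Suc j)) (Seq (dec (Suc j)) (mv 0 (-1))))"
| "comp_rexp \<pi> j (RRec n a b) = Seq (comp_rexp \<pi> j a) (Seq (comp_rexp \<pi> (j + 1) n)
     (Seq (While (nonzero (j + 1)) (Seq (comp_rexp (push (j + 2) (push j \<pi>)) (j + 3) b)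
        (Seq (clear j) (Seq (move (j + 3) j) (Seq (dec (j + 1)) (inc (j + 2)))))))
     (clear (j + 2))))"

definition ready :: "(nat \<Rightarrow> nat) \<Rightarrow> nat \<Rightarrow> nat \<Rightarrow> (nat \<Rightarrow> nat) \<Rightarrow> nat list \<Rightarrow> tapes \<Rightarrow> bool" where
  "ready \<pi> m j x w ts \<longleftrightarrow> (\<forall>i<m. \<pi> i < j \<and> ts (rb + \<pi> i) = reg (x i)) \<and>
     (\<forall>i\<ge>j. ts (rb + i) = reg 0) \<and> ts 0 = word_tape w"

lemma ready_zero:
  assumes "ready \<pi> m j x w ts"
  shows "ts 0 = word_tape w" "ts (rb + j) = reg 0" "ts (Suc (rb + j)) = reg 0"
    "ts (Suc (Suc (rb + j))) = reg 0" "ts (rb + (j + 3)) = reg 0"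
proof -
  have "ts (rb + i) = reg 0" if "i \<ge> j" for i using assms that by (auto simp: ready_def)
  from this[of j] this[of "Suc j"] this[of "Suc (Suc j)"] this[of "j + 3"]
  show "ts (rb + j) = reg 0" "ts (Suc (rb + j)) = reg 0"
    "ts (Suc (Suc (rb + j))) = reg 0" "ts (rb + (j + 3)) = reg 0" by simp_all
  show "ts 0 = word_tape w" using assms by (simp add: ready_def)
qed

definition rtape :: "nat list \<Rightarrow> nat \<Rightarrow> tape" where
  "rtape w i = (fst (word_tape w), int i)"

lemma scanned_rtape [simp]: "scanned (rtape w i) = symbol_at w i"
  by (simp add: rtape_def word_tape_def symbol_at_def)

lemma rtape_0: "rtape w 0 = word_tape w"
  by (simp add: rtape_def word_tape_def)

lemma run_right: "ts 0 = rtape w i \<Longrightarrow> run (mv 0 1) ts 1 (ts(0 := rtape w (Suc i)))"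
  using run_mv[of 0 1 ts] by (simp add: rtape_def add.commute)

lemma run_left: "ts 0 = rtape w (Suc i) \<Longrightarrow> run (mv 0 (-1)) ts 1 (ts(0 := rtape w i))"
  using run_mv[of 0 "-1" ts] by (simp add: rtape_def)

lemma run_rewind:
  assumes "ts (rb + r) = reg v" "ts 0 = rtape w v"
  shows "run (While (nonzero r) (Seq (dec r) (mv 0 (-1)))) ts (5 * v + 1) (ts(rb + r := reg 0, 0 := word_tape w))"
proof -
  let ?S = "\<lambda>i. ts(rb + r := reg (v - i), 0 := rtape w (v - i))"
  let ?c = "Seq (dec r) (mv 0 (-1))"
  have "run (While (nonzero r) ?c) (?S 0) ((\<Sum>i<v. (1 + 1 + 1) + 2) + 1) (?S v)"
  proof (rule run_While)
    fix i assume "i < v"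
    then have v: "v - i = Suc (v - Suc i)" by simp
    have 1: "run (dec r) (?S i) 1 (ts(rb + r := reg (v - Suc i), 0 := rtape w (v - i)))" (is "run _ _ _ ?B")
      using run_dec[of "?S i" r "v - Suc i"] v rb by (simp add: fun_upd_twist)
    have 2: "run (mv 0 (-1)) ?B 1 (?S (Suc i))"
      using run_left[of ?B w "v - Suc i"] v by simp
    show "run ?c (?S i) (1 + 1 + 1) (?S (Suc i))"
      by (rule run_Seq[OF 1 2])
  qed (use rb in \<open>auto simp: nonzero_def\<close>)
  moreover have "?S 0 = ts" using assms by auto
  ultimately have "run (While (nonzero r) ?c) ts ((\<Sum>i<v. (1 + 1 + 1) + 2) + 1) (?S v)" by simp
  then show ?thesis by (rule run_mono) (auto simp: rtape_0)
qed

definition set_reg :: "nat \<Rightarrow> nat \<Rightarrow> tapes \<Rightarrow> tapes" where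
  "set_reg j v ts = ts(rb + j := reg v)"

text \<open>Register \<open>j\<close> is the only tape that changes in the end. In particular all
  registers above it are 0 again and the input head is back at the start, which is what allows calls
  to be nested.\<close>

lemma run_comp_rexp':
  "closed_rexp m e \<Longrightarrow> ready \<pi> m j x w ts \<Longrightarrow> 0 \<notin> set w \<Longrightarrow>
    run (comp_rexp \<pi> j e) ts (cost e w x) (set_reg j (eval e w x) ts)"
proof (induction e arbitrary: \<pi> m j x ts)
  case (RVar i)
  then have "ts (rb + \<pi> i) = reg (x i)" "ts (rb + j) = reg 0" "ts (rb + Suc j) = reg 0" "\<pi> i < j"
    unfolding ready_def by (auto simp del: add_Suc_right)
  then show ?case using run_copy[of ts "\<pi> i" "x i" j] by (simp only: eval.simps cost.simps comp_rexp.simps set_reg_def)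
next
  case RZero
  have "ts(rb + j := reg 0) = ts" using ready_zero[OF RZero(2)] by (auto simp: fun_eq_iff)
  then show ?case unfolding comp_rexp.simps by (intro run_mono[OF run_Skip]) (auto simp: set_reg_def)
next
  case (RSuc e)
  have 1: "run (comp_rexp \<pi> j e) ts (cost e w x) (ts(rb + j := reg (eval e w x)))"
    by (rule RSuc.IH[OF RSuc.prems(1)[unfolded closed_rexp.simps] RSuc.prems(2,3), unfolded set_reg_def])
  show ?case
    unfolding comp_rexp.simps
    by (rule run_mono[OF run_Seq[OF 1 run_inc[of _ j "eval e w x"]]]) (auto simp: set_reg_def fun_eq_iff)
next
  case (RIn c e)
  let ?v = "eval e w x"
  have 1: "run (comp_rexp \<pi> j e) ts (cost e w x) (ts(rb + j := reg ?v))"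
    by (rule RIn.IH[OF RIn.prems(1)[unfolded closed_rexp.simps] RIn.prems(2,3), unfolded set_reg_def])
  let ?S = "\<lambda>i. ts(rb + j := reg (?v - i), rb + Suc j := reg i, 0 := rtape w i)"
  let ?c = "Seq (dec j) (Seq (inc (Suc j)) (mv 0 1))"
  have "run (While (nonzero j) ?c) (?S 0) ((\<Sum>i<?v. (1 + (1 + 1 + 1) + 1) + 2) + 1) (?S ?v)"
  proof (rule run_While)
    fix i assume "i < ?v"
    then have v: "?v - i = Suc (?v - Suc i)" by simp
    have 1: "run (dec j) (?S i) 1 (ts(rb + j := reg (?v - Suc i), rb + Suc j := reg i, 0 := rtape w i))" (is "run _ _ _ ?B")
      by (rule run_mono[OF run_dec[of "?S i" j "?v - Suc i"]]) (use v rb in \<open>auto simp: fun_eq_iff\<close>)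
    have 2: "run (inc (Suc j)) ?B 1 (ts(rb + j := reg (?v - Suc i), rb + Suc j := reg (Suc i), 0 := rtape w i))" (is "run _ _ _ ?D")
      by (rule run_mono[OF run_inc[of ?B "Suc j" i]]) (use rb in \<open>auto simp: fun_eq_iff\<close>)
    have 3: "run (mv 0 1) ?D 1 (?S (Suc i))"
      by (rule run_mono[OF run_right[of ?D w i]]) (auto simp: fun_eq_iff)
    show "run ?c (?S i) (1 + (1 + 1 + 1) + 1) (?S (Suc i))"
      by (rule run_Seq[OF 1 run_Seq[OF 2 3]])
  qed (use rb in \<open>auto simp: nonzero_def\<close>)
  moreover have "?S 0 = ts(rb + j := reg ?v)"
    using ready_zero[OF RIn.prems(2)] rb by (auto simp: fun_eq_iff rtape_0)
  ultimately have "run (While (nonzero j) ?c) (ts(rb + j := reg ?v)) ((\<Sum>i<?v. (1 + (1 + 1 + 1) + 1) + 2) + 1) (?S ?v)"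
    by simp
  then have 2: "run (While (nonzero j) ?c) (ts(rb + j := reg ?v)) (7 * ?v + 1) (?S ?v)"
    by (rule run_mono) auto
  let ?U = "(?S ?v)(rb + j := reg (of_bool (symbol_at w ?v = c)))"
  have 3: "run (Cond (\<lambda>\<sigma>. \<sigma> 0 = c) (inc j) Skip) (?S ?v) (1 + 1) ?U"
  proof (rule run_Cond)
    assume "scan (?S ?v) 0 = c"
    then have "symbol_at w ?v = c" by simp
    then show "run (inc j) (?S ?v) 1 ?U" using run_inc[of "?S ?v" j 0] rb by auto
  next
    assume "scan (?S ?v) 0 \<noteq> c"
    then have "symbol_at w ?v \<noteq> c" by simp
    then have "?U = ?S ?v" using rb by (auto simp: fun_eq_iff)
    then show "run Skip (?S ?v) 1 ?U" using run_Skip by simp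
  qed
  have 4: "run (While (nonzero (Suc j)) (Seq (dec (Suc j)) (mv 0 (-1)))) ?U (5 * ?v + 1)
      (?U(rb + Suc j := reg 0, 0 := word_tape w))"
    by (rule run_rewind) (use rb in auto)
  have "?U(rb + Suc j := reg 0, 0 := word_tape w) = ts(rb + j := reg (of_bool (symbol_at w ?v = c)))"
    using ready_zero[OF RIn.prems(2)] rb by (auto simp: fun_eq_iff)
  then show ?case unfolding comp_rexp.simps
    by (intro run_mono[OF run_Seq[OF 1 run_Seq[OF 2 run_Seq[OF 3 4]]]]) (auto simp: set_reg_def)
next
  case RLen
  let ?v = "length w"
  let ?S = "\<lambda>i. ts(rb + j := reg i, rb + Suc j := reg i, 0 := rtape w i)"
  let ?c = "Seq (inc j) (Seq (inc (Suc j)) (mv 0 1))"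
  have "run (While (\<lambda>\<sigma>. \<sigma> 0 \<noteq> 0) ?c) (?S 0) ((\<Sum>i<?v. (1 + (1 + 1 + 1) + 1) + 2) + 1) (?S ?v)"
  proof (rule run_While)
    fix i assume i: "i < ?v"
    then show "scan (?S i) 0 \<noteq> 0" using RLen.prems(3) by (auto simp: symbol_at_def) (metis gr0I nth_mem)
    have 1: "run (inc j) (?S i) 1 (ts(rb + j := reg (Suc i), rb + Suc j := reg i, 0 := rtape w i))" (is "run _ _ _ ?B")
      by (rule run_mono[OF run_inc[of "?S i" j i]]) (use rb in \<open>auto simp: fun_eq_iff\<close>)
    have 2: "run (inc (Suc j)) ?B 1 (ts(rb + j := reg (Suc i), rb + Suc j := reg (Suc i), 0 := rtape w i))" (is "run _ _ _ ?D")
      by (rule run_mono[OF run_inc[of ?B "Suc j" i]]) (use rb in \<open>auto simp: fun_eq_iff\<close>)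
    have 3: "run (mv 0 1) ?D 1 (?S (Suc i))"
      by (rule run_mono[OF run_right[of ?D w i]]) (auto simp: fun_eq_iff)
    show "run ?c (?S i) (1 + (1 + 1 + 1) + 1) (?S (Suc i))"
      by (rule run_Seq[OF 1 run_Seq[OF 2 3]])
  qed (auto simp: symbol_at_def)
  moreover have "?S 0 = ts"
    using ready_zero[OF RLen.prems(2)] rb by (auto simp: fun_eq_iff rtape_0)
  ultimately have "run (While (\<lambda>\<sigma>. \<sigma> 0 \<noteq> 0) ?c) ts ((\<Sum>i<?v. (1 + (1 + 1 + 1) + 1) + 2) + 1) (?S ?v)"
    by simp
  then have 2: "run (While (\<lambda>\<sigma>. \<sigma> 0 \<noteq> 0) ?c) ts (7 * ?v + 1) (?S ?v)"
    by (rule run_mono) auto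
  have 4: "run (While (nonzero (Suc j)) (Seq (dec (Suc j)) (mv 0 (-1)))) (?S ?v) (5 * ?v + 1)
      ((?S ?v)(rb + Suc j := reg 0, 0 := word_tape w))"
    by (rule run_rewind) (use rb in auto)
  have "(?S ?v)(rb + Suc j := reg 0, 0 := word_tape w) = ts(rb + j := reg ?v)"
    using ready_zero[OF RLen.prems(2)] rb by (auto simp: fun_eq_iff)
  then show ?case unfolding comp_rexp.simps
    by (intro run_mono[OF run_Seq[OF 2 4]]) (auto simp: set_reg_def)
next
  case (RRec n a b)
  let ?n = "eval n w x"
  define r where "r = rec_nat (eval a w x) (\<lambda>i r. eval b w (push i (push r x)))"
  have r_Suc: "r (Suc i) = eval b w (push i (push (r i) x))" for i by (simp add: r_def)
  have 1: "run (comp_rexp \<pi> j a) ts (cost a w x) (ts(rb + j := reg (r 0)))"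
    unfolding r_def using RRec.IH(2)[OF _ RRec.prems(2,3)] RRec.prems(1) unfolding set_reg_def closed_rexp.simps rec_nat_0_imp[OF refl] by blast
  have "ready \<pi> m (j + 1) x w (ts(rb + j := reg (r 0)))"
    using RRec.prems rb by (auto simp: ready_def)
  then have 2: "run (comp_rexp \<pi> (j + 1) n) (ts(rb + j := reg (r 0))) (cost n w x)
      (ts(rb + j := reg (r 0), rb + (j + 1) := reg ?n))"
    using RRec.IH(1)[OF _ _ RRec.prems(3)] RRec.prems(1) unfolding set_reg_def closed_rexp.simps by blast
  let ?S = "\<lambda>i. ts(rb + j := reg (r i), rb + (j + 1) := reg (?n - i), rb + (j + 2) := reg i)"
  let ?c = "Seq (comp_rexp (push (j + 2) (push j \<pi>)) (j + 3) b)
        (Seq (clear j) (Seq (move (j + 3) j) (Seq (dec (j + 1)) (inc (j + 2)))))"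
  let ?T = "\<lambda>i. cost b w (push i (push (r i) x)) + (3 * r i + 1 + (5 * r (Suc i) + 1 + (1 + 1 + 1) + 1) + 1) + 1"
  have "run (While (nonzero (j + 1)) ?c) (?S 0) ((\<Sum>i<?n. ?T i + 2) + 1) (?S ?n)"
  proof (rule run_While)
    fix i assume "i < ?n"
    then have v: "?n - i = Suc (?n - Suc i)" by simp
    have rdy: "ready (push (j + 2) (push j \<pi>)) (m + 2) (j + 3) (push i (push (r i) x)) w (?S i)"
      using RRec.prems(2) rb unfolding ready_def
      by (fastforce split: nat.splits simp: less_Suc_eq_0_disj fun_upd_def)
    have 1: "run (comp_rexp (push (j + 2) (push j \<pi>)) (j + 3) b) (?S i) (cost b w (push i (push (r i) x)))
        ((?S i)(rb + (j + 3) := reg (r (Suc i))))" (is "run _ _ _ ?B")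
      using RRec.IH(3)[OF _ rdy RRec.prems(3)] RRec.prems(1) unfolding r_Suc set_reg_def closed_rexp.simps by blast
    have 2: "run (clear j) ?B (3 * r i + 1) (?B(rb + j := reg 0))"
      by (rule run_clear) simp
    have 3: "run (move (j + 3) j) (?B(rb + j := reg 0)) (5 * r (Suc i) + 1)
       (?B(rb + j := reg 0, rb + (j + 3) := reg 0, rb + j := reg (0 + r (Suc i))))"
      using run_move[of "?B(rb + j := reg 0)" "j + 3" "r (Suc i)" j 0] by simp
    have eq: "?B(rb + j := reg 0, rb + (j + 3) := reg 0, rb + j := reg (0 + r (Suc i))) = (?S i)(rb + j := reg (r (Suc i)))"
      using ready_zero[OF RRec.prems(2)] by (auto simp: fun_eq_iff)
    have 4: "run (dec (j + 1)) ((?S i)(rb + j := reg (r (Suc i)))) 1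
       ((?S i)(rb + j := reg (r (Suc i)), rb + (j + 1) := reg (?n - Suc i)))"
      by (rule run_dec) (use v in simp)
    have 5: "run (inc (j + 2)) ((?S i)(rb + j := reg (r (Suc i)), rb + (j + 1) := reg (?n - Suc i))) 1 (?S (Suc i))"
      by (rule run_mono[OF run_inc[of _ "j + 2" i]]) (auto simp: fun_eq_iff)
    show "run ?c (?S i) (?T i) (?S (Suc i))"
      by (rule run_Seq[OF 1 run_Seq[OF 2 run_Seq[OF 3[unfolded eq] run_Seq[OF 4 5]]]])
  qed (auto simp: nonzero_def)
  moreover have "?S 0 = ts(rb + j := reg (r 0), rb + (j + 1) := reg ?n)"
    using ready_zero[OF RRec.prems(2)] by (auto simp: fun_eq_iff)
  ultimately have 3: "run (While (nonzero (j + 1)) ?c) (ts(rb + j := reg (r 0), rb + (j + 1) := reg ?n))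
      ((\<Sum>i<?n. ?T i + 2) + 1) (?S ?n)" by simp
  have 4: "run (clear (j + 2)) (?S ?n) (3 * ?n + 1) ((?S ?n)(rb + (j + 2) := reg 0))"
    by (rule run_clear) simp
  have "(?S ?n)(rb + (j + 2) := reg 0) = ts(rb + j := reg (r ?n))"
    using ready_zero[OF RRec.prems(2)] by (auto simp: fun_eq_iff)
  moreover have "cost a w x + (cost n w x + ((\<Sum>i<?n. ?T i + 2) + 1 + (3 * ?n + 1) + 1) + 1) + 1 \<le> cost (RRec n a b) w x"
  proof -
    have "(\<Sum>i<?n. ?T i + 2) \<le> (\<Sum>i<?n. cost b w (push i (push (r i) x)) + 3 * r i + 5 * r (Suc i) + 12)"
      by (rule sum_mono) simp
    then show ?thesis unfolding cost.simps Let_def r_def[symmetric] by linarith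
  qed
  ultimately show ?case unfolding comp_rexp.simps
    by (intro run_mono[OF run_Seq[OF 1 run_Seq[OF 2 run_Seq[OF 3 4]]]]) (simp_all add: r_def set_reg_def fun_eq_iff)
qed

lemmas run_comp_rexp = run_comp_rexp'[unfolded set_reg_def]

end


section \<open>Word expressions\<close>

text \<open>Words are written symbol by symbol under nested loops and never held in registers;
  \<open>WFor\<close> binds its index as variable 0.\<close>

datatype wexp = WNil | WSym nat | WSeq wexp wexp | WFor rexp wexp

fun weval :: "wexp \<Rightarrow> nat list \<Rightarrow> (nat \<Rightarrow> nat) \<Rightarrow> nat list" where
  "weval WNil w x = []"
| "weval (WSym c) w x = [c]"
| "weval (WSeq e f) w x = weval e w x @ weval f w x"
| "weval (WFor n e) w x = concat (map (\<lambda>i. weval e w (push i x)) [0..<eval n w x])"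

fun wcost :: "wexp \<Rightarrow> nat list \<Rightarrow> (nat \<Rightarrow> nat) \<Rightarrow> nat" where
  "wcost WNil w x = 0"
| "wcost (WSym c) w x = 1"
| "wcost (WSeq e f) w x = wcost e w x + wcost f w x + 1"
| "wcost (WFor n e) w x = cost n w x + (\<Sum>i<eval n w x. wcost e w (push i x) + 6) + 3 * eval n w x + 4"

fun closed_wexp :: "nat \<Rightarrow> wexp \<Rightarrow> bool" where
  "closed_wexp m WNil = True"
| "closed_wexp m (WSym c) = True"
| "closed_wexp m (WSeq e f) = (closed_wexp m e \<and> closed_wexp m f)"
| "closed_wexp m (WFor n e) = (closed_rexp m n \<and> closed_wexp (m + 1) e)"

text \<open>In unary a value cannot exceed the time spent on building it, so a bound on the cost
  also bounds the value.\<close>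

lemma eval_le_cost: "eval e w x \<le> cost e w x"
proof (induction e arbitrary: x)
  case (RRec n a b)
  let ?r = "rec_nat (eval a w x) (\<lambda>i r. eval b w (push i (push r x)))"
  show ?case
  proof (cases "eval n w x")
    case 0
    then show ?thesis using RRec.IH(2)[of x] by (simp add: Let_def)
  next
    case (Suc k)
    have "?r (Suc k) \<le> cost b w (push k (push (?r k) x)) + 3 * ?r k + 5 * ?r (Suc k) + 12" by simp
    also have "\<dots> \<le> (\<Sum>i<eval n w x. cost b w (push i (push (?r i) x)) + 3 * ?r i + 5 * ?r (Suc i) + 12)"
      by (rule member_le_sum[of k]) (auto simp: Suc)
    finally show ?thesis using Suc by (simp add: Let_def)
  qed
qed (auto simp: le_SucI)

lemma length_weval_le_wcost: "length (weval e w x) \<le> wcost e w x"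
proof (induction e arbitrary: x)
  case (WFor n e)
  have "length (weval (WFor n e) w x) = (\<Sum>i<eval n w x. length (weval e w (push i x)))"
    by (simp add: length_concat comp_def sum_list_sum_nth atLeast0LessThan)
  also have "\<dots> \<le> (\<Sum>i<eval n w x. wcost e w (push i x) + 6)"
    by (rule sum_mono) (simp add: WFor trans_le_add1)
  finally show ?case by simp
qed (auto simp: add_mono le_SucI)

definition otape :: "nat list \<Rightarrow> tape" where
  "otape u = (fst (word_tape u), int (length u))"

lemma otape_Nil: "otape [] = word_tape []"
  by (simp add: otape_def word_tape_def)

lemma otape_snoc: "act (c, 1) (otape u) = otape (u @ [c])"
  by (auto simp: otape_def word_tape_def fun_eq_iff nth_append)

context registers begin

text \<open>Register 0 counts the emitted symbols, so that the output head can later be brought back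
  to the beginning. This is why \<open>wready\<close> keeps variables and results in registers from
  1 on.\<close>

definition emit :: "nat \<Rightarrow> com" where
  "emit c = Act (\<lambda>\<sigma> i. if i = 1 then (c, 1) else (\<sigma> i, if i = rb then 1 else 0))"

fun comp_wexp :: "(nat \<Rightarrow> nat) \<Rightarrow> nat \<Rightarrow> wexp \<Rightarrow> com" where
  "comp_wexp \<pi> j WNil = Skip"
| "comp_wexp \<pi> j (WSym c) = emit c"
| "comp_wexp \<pi> j (WSeq e f) = Seq (comp_wexp \<pi> j e) (comp_wexp \<pi> j f)"
| "comp_wexp \<pi> j (WFor n e) = Seq (comp_rexp \<pi> j n)
     (Seq (While (nonzero j) (Seq (comp_wexp (push (j + 1) \<pi>) (j + 2) e) (Seq (dec j) (inc (j + 1)))))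
          (clear (j + 1)))"

definition wres :: "nat list \<Rightarrow> tapes \<Rightarrow> tapes" where
  "wres u ts = ts(1 := otape u, rb := reg (length u))"

definition wready :: "(nat \<Rightarrow> nat) \<Rightarrow> nat \<Rightarrow> nat \<Rightarrow> (nat \<Rightarrow> nat) \<Rightarrow> nat list \<Rightarrow> tapes \<Rightarrow> bool" where
  "wready \<pi> m j x w ts \<longleftrightarrow> j \<ge> 1 \<and> (\<forall>i<m. \<pi> i \<ge> 1) \<and> ready \<pi> m j x w ts"

lemma wready_wres: "wready \<pi> m j x w ts \<Longrightarrow> wready \<pi> m j x w (wres u ts)"
  using rb by (fastforce simp: wready_def ready_def wres_def)

lemma run_comp_wexp:
  "closed_wexp m e \<Longrightarrow> wready \<pi> m j x w ts \<Longrightarrow> 0 \<notin> set w \<Longrightarrow>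
    run (comp_wexp \<pi> j e) (wres u ts) (wcost e w x) (wres (u @ weval e w x) ts)"
proof (induction e arbitrary: \<pi> m j x ts u)
  case WNil
  then show ?case using run_Skip by simp
next
  case (WSym c)
  have "act (scanned T, 1) T = (fst T, snd T + 1)" for T by (cases T) simp
  then have "run (emit c) (wres u ts) 1 (wres (u @ [c]) ts)"
    unfolding emit_def using rb
    by (intro run_Act) (auto simp: do_act_def fun_eq_iff wres_def otape_snoc reg_def)
  then show ?case by simp
next
  case (WSeq e f)
  have 1: "run (comp_wexp \<pi> j e) (wres u ts) (wcost e w x) (wres (u @ weval e w x) ts)"
    using WSeq.IH(1)[OF _ WSeq.prems(2,3)] WSeq.prems(1) by simp
  have 2: "run (comp_wexp \<pi> j f) (wres (u @ weval e w x) ts) (wcost f w x) (wres ((u @ weval e w x) @ weval f w x) ts)"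
    using WSeq.IH(2)[OF _ WSeq.prems(2,3)] WSeq.prems(1) unfolding closed_wexp.simps by blast
  show ?case using run_Seq[OF 1 2] by simp
next
  case (WFor n e)
  let ?n = "eval n w x"
  let ?u = "\<lambda>i. u @ concat (map (\<lambda>i. weval e w (push i x)) [0..<i])"
  have rdy: "ready \<pi> m j x w (wres u ts)" using wready_wres[OF WFor.prems(2)] by (simp add: wready_def)
  have j: "j \<ge> 1" using WFor.prems(2) by (simp add: wready_def)
  have 1: "run (comp_rexp \<pi> j n) (wres u ts) (cost n w x) ((wres u ts)(rb + j := reg ?n))"
    using run_comp_rexp[OF _ rdy WFor.prems(3)] WFor.prems(1) unfolding closed_wexp.simps by blast
  let ?ts = "\<lambda>i. ts(rb + j := reg (?n - i), rb + (j + 1) := reg i)"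
  let ?S = "\<lambda>i. wres (?u i) (?ts i)"
  let ?c = "Seq (comp_wexp (push (j + 1) \<pi>) (j + 2) e) (Seq (dec j) (inc (j + 1)))"
  let ?T = "\<lambda>i. wcost e w (push i x) + (1 + 1 + 1) + 1"
  have "run (While (nonzero j) ?c) (?S 0) ((\<Sum>i<?n. ?T i + 2) + 1) (?S ?n)"
  proof (rule run_While)
    fix i assume "i < ?n"
    then have v: "?n - i = Suc (?n - Suc i)" by simp
    have "wready (push (j + 1) \<pi>) (m + 1) (j + 2) (push i x) w (?ts i)"
    proof -
      have p: "\<pi> k \<ge> 1" "\<pi> k < j" "ts (rb + \<pi> k) = reg (x k)" if "k < m" for k
        using WFor.prems(2) that by (auto simp: wready_def ready_def)
      have z: "ts (rb + k) = reg 0" if "k \<ge> j" for k using WFor.prems(2) that by (auto simp: wready_def ready_def)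
      have A: "1 \<le> push (j + 1) \<pi> k \<and> push (j + 1) \<pi> k < j + 2 \<and> ?ts i (rb + push (j + 1) \<pi> k) = reg (push i x k)" if "k < m + 1" for k
      proof (cases k)
        case (Suc k')
        then show ?thesis using p[of k'] that by simp
      qed simp
      have B: "?ts i (rb + k) = reg 0" if "k \<ge> j + 2" for k using z[of k] that by simp
      have "?ts i 0 = word_tape w" using WFor.prems(2) rb by (auto simp: wready_def ready_def)
      then show ?thesis unfolding wready_def ready_def using A B by (simp only: le_add2 one_add_one[symmetric] add.assoc[symmetric]) simp
    qed
    then have 1: "run (comp_wexp (push (j + 1) \<pi>) (j + 2) e) (?S i) (wcost e w (push i x))
        (wres (?u i @ weval e w (push i x)) (?ts i))"
      using WFor.IH[OF _ _ WFor.prems(3)] WFor.prems(1) unfolding closed_wexp.simps by blast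
    have u: "?u i @ weval e w (push i x) = ?u (Suc i)" by simp
    have 2: "run (dec j) (wres (?u (Suc i)) (?ts i)) 1 ((wres (?u (Suc i)) (?ts i))(rb + j := reg (?n - Suc i)))"
      by (rule run_dec) (use v j rb in \<open>auto simp: wres_def\<close>)
    have 3: "run (inc (j + 1)) ((wres (?u (Suc i)) (?ts i))(rb + j := reg (?n - Suc i))) 1 (?S (Suc i))"
      by (rule run_mono[OF run_inc[of _ "j + 1" i]]) (use j rb in \<open>auto simp: wres_def fun_eq_iff\<close>)
    show "run ?c (?S i) (?T i) (?S (Suc i))"
      by (rule run_Seq[OF 1[unfolded u] run_Seq[OF 2 3]])
  qed (use j rb in \<open>auto simp: nonzero_def wres_def\<close>)
  moreover have "?S 0 = (wres u ts)(rb + j := reg ?n)"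
    using ready_zero[of \<pi> m j x w ts] WFor.prems(2) j rb by (auto simp: wres_def fun_eq_iff wready_def)
  ultimately have 2: "run (While (nonzero j) ?c) ((wres u ts)(rb + j := reg ?n)) ((\<Sum>i<?n. ?T i + 2) + 1) (?S ?n)" by simp
  have 3: "run (clear (j + 1)) (?S ?n) (3 * ?n + 1) ((?S ?n)(rb + (j + 1) := reg 0))"
    by (rule run_clear) (use rb j in \<open>auto simp: wres_def\<close>)
  have "(?S ?n)(rb + (j + 1) := reg 0) = wres (u @ weval (WFor n e) w x) ts"
    using ready_zero[of \<pi> m j x w ts] WFor.prems(2) j rb by (auto simp: wres_def fun_eq_iff wready_def)
  moreover have "cost n w x + ((\<Sum>i<?n. ?T i + 2) + 1 + (3 * ?n + 1) + 1) + 1 \<le> wcost (WFor n e) w x"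
  proof -
    have "(\<Sum>i<?n. ?T i + 2) \<le> (\<Sum>i<?n. wcost e w (push i x) + 6)" by (rule sum_mono) simp
    then show ?thesis unfolding wcost.simps by linarith
  qed
  ultimately show ?case unfolding comp_wexp.simps
    by (intro run_mono[OF run_Seq[OF 1 run_Seq[OF 2 3]]])
qed

end

text \<open>The numbers of tapes and symbols are fixed only once for the complete program, as any
  sufficiently large numbers.\<close>

definition ev_wf :: "com \<Rightarrow> bool" where
  "ev_wf c \<longleftrightarrow> (\<exists>K S. \<forall>k\<ge>K. \<forall>s\<ge>S. wf_com k s c)"

lemma ev_wf_intros:
  "ev_wf Skip"
  "ev_wf c \<Longrightarrow> ev_wf d \<Longrightarrow> ev_wf (Seq c d)"
  "ev_wf c \<Longrightarrow> ev_wf d \<Longrightarrow> (\<And>\<sigma> \<sigma>'. agree k \<sigma> \<sigma>' \<Longrightarrow> b \<sigma> = b \<sigma>') \<Longrightarrow> ev_wf (Cond b c d)"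
  "ev_wf c \<Longrightarrow> (\<And>\<sigma> \<sigma>'. agree k \<sigma> \<sigma>' \<Longrightarrow> b \<sigma> = b \<sigma>') \<Longrightarrow> ev_wf (While b c)"
proof -
  show "ev_wf Skip" by (simp add: ev_wf_def)
  have comb: "\<exists>K S. \<forall>k\<ge>K. \<forall>s\<ge>S. wf_com k s c \<and> wf_com k s d \<and> k \<ge> k0"
    if "ev_wf c" "ev_wf d" for c d and k0 :: nat
  proof -
    obtain K S where 1: "\<forall>k\<ge>K. \<forall>s\<ge>S. wf_com k s c" using \<open>ev_wf c\<close> by (auto simp: ev_wf_def)
    obtain K' S' where 2: "\<forall>k\<ge>K'. \<forall>s\<ge>S'. wf_com k s d" using \<open>ev_wf d\<close> by (auto simp: ev_wf_def)
    show ?thesis using 1 2 by (intro exI[of _ "max k0 (max K K')"] exI[of _ "max S S'"]) auto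
  qed
  have ag: "agree k \<sigma> \<sigma>'" if "agree k' \<sigma> \<sigma>'" "k' \<ge> k" for k k' and \<sigma> \<sigma>' :: "nat \<Rightarrow> nat"
    using that by (auto simp: agree_def)
  show "ev_wf c \<Longrightarrow> ev_wf d \<Longrightarrow> ev_wf (Seq c d)"
    using comb[of c d 0] unfolding ev_wf_def by (metis wf_com.simps(3))
  show "ev_wf (Cond b c d)" if "ev_wf c" "ev_wf d" "\<And>\<sigma> \<sigma>'. agree k \<sigma> \<sigma>' \<Longrightarrow> b \<sigma> = b \<sigma>'"
    using comb[OF that(1,2), of k] that(3) ag unfolding ev_wf_def wf_com.simps by meson
  show "ev_wf (While b c)" if "ev_wf c" "\<And>\<sigma> \<sigma>'. agree k \<sigma> \<sigma>' \<Longrightarrow> b \<sigma> = b \<sigma>'"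
    using comb[OF that(1,1), of k] that(2) ag unfolding ev_wf_def wf_com.simps by meson
qed

lemma ev_wf_mv: "d \<in> {-1, 0, 1} \<Longrightarrow> ev_wf (mv r d)"
  unfolding ev_wf_def mv_def by (auto simp: agree_def)

context registers begin

lemma nonzero_agree: "agree (Suc (rb + r)) \<sigma> \<sigma>' \<Longrightarrow> nonzero r \<sigma> = nonzero r \<sigma>'"
  by (simp add: nonzero_def agree_def)

lemma scan_agree: "agree (Suc 0) \<sigma> \<sigma>' \<Longrightarrow> (\<sigma> 0 = c) = (\<sigma>' 0 = c)" "agree (Suc 0) \<sigma> \<sigma>' \<Longrightarrow> (\<sigma> 0 \<noteq> c) = (\<sigma>' 0 \<noteq> c)"
  by (simp_all add: agree_def)

lemma ev_wf_basic: "ev_wf (inc r)" "ev_wf (dec r)" "ev_wf (clear r)" "ev_wf (move r s)" "ev_wf (copy r s)" "ev_wf (emit c)"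
proof -
  show i: "ev_wf (inc r)" and d: "ev_wf (dec r)" for r unfolding inc_def dec_def by (simp_all add: ev_wf_mv)
  show "ev_wf (clear r)" unfolding clear_def by (intro ev_wf_intros(4)[OF d nonzero_agree])
  show m: "ev_wf (move r s)" for r s unfolding move_def by (intro ev_wf_intros(4)[OF _ nonzero_agree] ev_wf_intros(2) i d)
  show "ev_wf (copy r s)" unfolding copy_def
    by (intro ev_wf_intros(4)[OF _ nonzero_agree] ev_wf_intros(2) i d m)
  show "ev_wf (emit c)" unfolding ev_wf_def emit_def
    by (intro exI[of _ 0] exI[of _ "Suc c"]) (auto simp: agree_def)
qed

lemma ev_wf_comp_rexp: "ev_wf (comp_rexp \<pi> j e)"
proof (induction e arbitrary: \<pi> j)
  case (RIn c e)
  show ?case unfolding comp_rexp.simps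
    by (intro ev_wf_intros(2) ev_wf_intros(4)[OF _ nonzero_agree] ev_wf_intros(3)[OF _ _ scan_agree(1)] RIn
        ev_wf_basic ev_wf_intros(1) ev_wf_mv) auto
next
  case RLen
  show ?case unfolding comp_rexp.simps
    by (intro ev_wf_intros(2) ev_wf_intros(4)[OF _ nonzero_agree] ev_wf_intros(4)[OF _ scan_agree(2)]
        ev_wf_basic ev_wf_mv) auto
next
  case (RRec n a b)
  show ?case unfolding comp_rexp.simps
    by (intro ev_wf_intros(2) ev_wf_intros(4)[OF _ nonzero_agree] RRec ev_wf_basic)
qed (simp_all add: ev_wf_intros ev_wf_basic)

lemma ev_wf_comp_wexp: "ev_wf (comp_wexp \<pi> j e)"
proof (induction e arbitrary: \<pi> j)
  case (WFor n e)
  show ?case unfolding comp_wexp.simps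
    by (intro ev_wf_intros(2) ev_wf_intros(4)[OF _ nonzero_agree] WFor ev_wf_basic ev_wf_comp_rexp)
qed (simp_all add: ev_wf_intros ev_wf_basic)

end


section \<open>Running a machine on a computed word\<close>

locale simulation =
  fixes M :: tm
  assumes wf_M: "wf_tm M"
begin

abbreviation "m \<equiv> num_tapes M"

sublocale registers "m + 3"
  by unfold_locales simp

abbreviation "rb \<equiv> m + 3"

lemma m_pos: "m \<ge> 1" using wf_M by (simp add: wf_tm_def)

text \<open>Tapes 1 to m are those of M, tape m + 2 holds its state, and tape m + 1 records the moves of
  its output head, so that this head can be brought back to position 0.\<close>

definition sim_act :: "(nat \<Rightarrow> nat) \<Rightarrow> nat \<Rightarrow> nat \<times> int" where
  "sim_act \<sigma> i = (let r = delta M (\<sigma> (m + 2)) (map (\<lambda>j. \<sigma> (Suc j)) [0..<m]) in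
     if \<sigma> (m + 2) < num_states M \<and> (\<forall>s\<in>set (map (\<lambda>j. \<sigma> (Suc j)) [0..<m]). s < num_syms M) then
       (if 1 \<le> i \<and> i \<le> m then snd r ! (i - 1)
        else if i = m + 2 then (fst r, 0)
        else if i = m + 1 then (nat (snd (snd r ! (m - 1)) + 2), 1)
        else (\<sigma> i, 0))
     else (\<sigma> i, 0))"

definition sim_loop :: com where
  "sim_loop = While (\<lambda>\<sigma>. \<sigma> (m + 2) \<noteq> 1) (Act sim_act)"

definition good :: "config \<Rightarrow> bool" where
  "good c \<longleftrightarrow> fst c < num_states M \<and> length (snd c) = m \<and> (\<forall>T\<in>set (snd c). \<forall>z. fst T z < num_syms M)"

definition sim_tapes :: "tapes \<Rightarrow> config \<Rightarrow> nat list \<Rightarrow> tapes" where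
  "sim_tapes ts c h = (\<lambda>i. if 1 \<le> i \<and> i \<le> m then snd c ! (i - 1)
     else if i = m + 2 then ((\<lambda>z. if z = 0 then fst c else 0), 0)
     else if i = m + 1 then otape h else ts i)"

lemma wf_delta:
  assumes "q < num_states M" "length ss = m" "\<forall>s\<in>set ss. s < num_syms M"
  shows "case delta M q ss of (q', acts) \<Rightarrow> q' < num_states M \<and> length acts = m \<and>
    (\<forall>(s, d)\<in>set acts. s < num_syms M \<and> d \<in> {-1, 0, 1})"
  using wf_M assms unfolding wf_tm_def by simp

lemma scanned_good: "good c \<Longrightarrow> T \<in> set (snd c) \<Longrightarrow> scanned T < num_syms M"
  by (cases T) (fastforce simp: good_def)

lemma delta_good:
  assumes "good c"
  shows "\<exists>q' acts. delta M (fst c) (map scanned (snd c)) = (q', acts) \<and> q' < num_states M \<and>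
    length acts = m \<and> (\<forall>(s, d)\<in>set acts. s < num_syms M \<and> d \<in> {-1, 0, 1})"
proof -
  have s: "\<forall>s\<in>set (map scanned (snd c)). s < num_syms M"
    using scanned_good[OF assms] by auto
  have "fst c < num_states M" "length (map scanned (snd c)) = m" using assms by (auto simp: good_def)
  then have "case delta M (fst c) (map scanned (snd c)) of (q', acts) \<Rightarrow>
           q' < num_states M \<and> length acts = m \<and> (\<forall>(s, d)\<in>set acts. s < num_syms M \<and> d \<in> {-1, 0, 1})"
    by (rule wf_delta[OF _ _ s])
  then show ?thesis by (auto split: prod.splits)
qed

lemma good_step:
  assumes "good c"
  shows "good (step M c)"
proof (cases "fst c = 1")
  case True then show ?thesis using assms by (cases c) simp
next
  case False
  obtain q' acts where d: "delta M (fst c) (map scanned (snd c)) = (q', acts)" "q' < num_states M"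
    "length acts = m" "\<forall>(s, d)\<in>set acts. s < num_syms M \<and> d \<in> {-1, 0, 1}"
    using delta_good[OF assms] by blast
  have st: "step M c = (q', map2 act acts (snd c))" using False d(1) by (cases c) simp
  have "fst (act a T) z < num_syms M" if "a \<in> set acts" "T \<in> set (snd c)" for a T z
  proof -
    obtain s e where a: "a = (s, e)" by force
    obtain f q where T: "T = (f, q)" by force
    have "s < num_syms M" using d(4) that(1) a by auto
    moreover have "f z < num_syms M" using assms that(2) T unfolding good_def by (metis fst_conv)
    ultimately show ?thesis using a T by simp
  qed
  moreover have "\<exists>a\<in>set acts. \<exists>T'\<in>set (snd c). T = act a T'" if "T \<in> set (map2 act acts (snd c))" for T
    using that by (auto simp del: act.simps) (metis set_zip_leftD set_zip_rightD)
  ultimately have "\<forall>T\<in>set (map2 act acts (snd c)). \<forall>z. fst T z < num_syms M" by blast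
  then show ?thesis using st d assms by (auto simp: good_def)
qed

definition out_pos :: "config \<Rightarrow> int" where
  "out_pos c = snd (last (snd c))"

lemma sim_step:
  assumes "good c" "fst c \<noteq> 1"
  shows "do_act sim_act (sim_tapes ts c h) = sim_tapes ts (step M c) (h @ [nat (out_pos (step M c) - out_pos c + 2)])"
    and "out_pos (step M c) - out_pos c \<in> {-1, 0, 1}"
proof -
  obtain q' acts where d: "delta M (fst c) (map scanned (snd c)) = (q', acts)" "q' < num_states M"
    "length acts = m" "\<forall>(s, d)\<in>set acts. s < num_syms M \<and> d \<in> {-1, 0, 1}"
    using delta_good[OF assms(1)] by blast
  have len: "length (snd c) = m" using assms(1) by (simp add: good_def)
  have st: "step M c = (q', map2 act acts (snd c))" using assms(2) d(1) by (cases c) simp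
  have "last (map2 act acts (snd c)) = act (acts ! (m - 1)) (snd c ! (m - 1))"
    using m_pos d(3) len by (subst last_conv_nth) auto
  moreover have "last (snd c) = snd c ! (m - 1)" using m_pos len by (subst last_conv_nth) auto
  moreover have "snd (act a T) = snd T + snd a" for a T by (cases a; cases T) simp
  ultimately have pos: "out_pos (step M c) - out_pos c = snd (acts ! (m - 1))"
    by (simp add: out_pos_def st)
  have "acts ! (m - 1) \<in> set acts" using m_pos d(3) by simp
  then show "out_pos (step M c) - out_pos c \<in> {-1, 0, 1}" using d(4) pos by fastforce
  let ?\<sigma> = "scan (sim_tapes ts c h)"
  have map\<sigma>: "map (\<lambda>j. ?\<sigma> (Suc j)) [0..<m] = map scanned (snd c)"
    by (rule nth_equalityI) (auto simp: sim_tapes_def len)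
  have q: "?\<sigma> (m + 2) = fst c" by (simp add: sim_tapes_def)
  have good': "fst c < num_states M" "\<forall>s\<in>set (map scanned (snd c)). s < num_syms M"
    using scanned_good[OF assms(1)] assms(1) by (auto simp: good_def)
  have sa: "sim_act ?\<sigma> i = (if 1 \<le> i \<and> i \<le> m then acts ! (i - 1)
        else if i = m + 2 then (q', 0)
        else if i = m + 1 then (nat (snd (acts ! (m - 1)) + 2), 1)
        else (?\<sigma> i, 0))" for i
    unfolding sim_act_def map\<sigma> q d(1) Let_def using good' by simp
  show "do_act sim_act (sim_tapes ts c h) = sim_tapes ts (step M c) (h @ [nat (out_pos (step M c) - out_pos c + 2)])"
  proof
    fix i
    show "do_act sim_act (sim_tapes ts c h) i = sim_tapes ts (step M c) (h @ [nat (out_pos (step M c) - out_pos c + 2)]) i"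
      unfolding do_act_def sa pos unfolding sim_tapes_def st using d(3) len
      by (auto simp: otape_snoc fun_eq_iff)
  qed
qed

definition cfg :: "nat list \<Rightarrow> nat \<Rightarrow> config" where
  "cfg u t = (step M ^^ t) (init_config M u)"

text \<open>The moves -1, 0, 1 are stored as 1, 2, 3, so that the blank 0 marks the beginning of the
  record when it is read backwards.\<close>

definition hist :: "nat list \<Rightarrow> nat \<Rightarrow> nat list" where
  "hist u t = map (\<lambda>i. nat (out_pos (cfg u (Suc i)) - out_pos (cfg u i) + 2)) [0..<t]"

lemma good_cfg:
  assumes "\<forall>s\<in>set u. s < 6"
  shows "good (cfg u t)"
proof (induction t)
  case 0
  have ns: "num_syms M \<ge> 6" "num_states M \<ge> 2" using wf_M by (auto simp: wf_tm_def)
  then have "fst (word_tape u) z < num_syms M" for z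
    using assms by (auto simp: word_tape_def) (metis nat_less_iff nth_mem order_less_le_trans)
  moreover have "fst (word_tape []) z < num_syms M" for z using ns by (simp add: word_tape_def)
  ultimately show ?case using ns m_pos by (auto simp: good_def cfg_def init_config_def)
next
  case (Suc t) then show ?case using good_step by (simp add: cfg_def)
qed

lemma cfg_halted: "t \<le> t' \<Longrightarrow> fst (cfg u t) = 1 \<Longrightarrow> cfg u t' = cfg u t"
proof (induction t' rule: dec_induct)
  case (step n)
  then show ?case by (cases "cfg u t") (auto simp: cfg_def)
qed simp

lemma run_sim_loop:
  assumes u: "\<forall>s\<in>set u. s < 6" and t: "\<And>i. i < t \<Longrightarrow> fst (cfg u i) \<noteq> 1" "fst (cfg u t) = 1"
  shows "run sim_loop (sim_tapes ts (cfg u 0) []) (3 * t + 1) (sim_tapes ts (cfg u t) (hist u t))"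
proof -
  let ?S = "\<lambda>i. sim_tapes ts (cfg u i) (hist u i)"
  have "run sim_loop (?S 0) ((\<Sum>i<t. 1 + 2) + 1) (?S t)"
    unfolding sim_loop_def
  proof (rule run_While)
    fix i assume i: "i < t"
    show "scan (?S i) (m + 2) \<noteq> 1" using t(1)[OF i] by (simp add: sim_tapes_def)
    show "run (Act sim_act) (?S i) 1 (?S (Suc i))"
      using sim_step(1)[OF good_cfg[OF u] t(1)[OF i], of ts "hist u i"]
      by (intro run_Act) (simp add: hist_def cfg_def)
  qed (use t(2) in \<open>simp add: sim_tapes_def\<close>)
  moreover have "?S 0 = sim_tapes ts (cfg u 0) []" by (simp add: hist_def)
  ultimately have "run sim_loop (sim_tapes ts (cfg u 0) []) ((\<Sum>i<t. 1 + 2) + 1) (?S t)" by simp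
  then show ?thesis by (rule run_mono) auto
qed

text \<open>The simulated machine may overwrite any cell, so no mark on its tape can show position
  0. Instead the recorded moves are undone from the last to the first: a symbol \<open>d + 2\<close>
  is answered by the move \<open>-d\<close>.\<close>

definition replay :: com where
  "replay = Seq (mv (m + 1) (-1)) (While (\<lambda>\<sigma>. \<sigma> (m + 1) \<noteq> 0)
     (Act (\<lambda>\<sigma> i. (\<sigma> i, if i = m then (if \<sigma> (m + 1) \<in> {1, 2, 3} then 2 - int (\<sigma> (m + 1)) else 0)
        else if i = m + 1 then -1 else 0))))"

lemma run_replay:
  assumes u: "\<forall>s\<in>set u. s < 6" and t: "\<And>i. i < t \<Longrightarrow> fst (cfg u i) \<noteq> 1"
    and ts: "ts (m + 1) = otape (hist u t)" "ts m = (c, out_pos (cfg u t))"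
  shows "run replay ts (3 * t + 3) (ts(m + 1 := (fst (otape (hist u t)), -1), m := (c, 0)))"
proof -
  let ?h = "fst (otape (hist u t))"
  have pos0: "out_pos (cfg u 0) = 0"
    using m_pos by (simp add: out_pos_def cfg_def init_config_def word_tape_def)
  have h: "?h (int i) = nat (out_pos (cfg u (Suc i)) - out_pos (cfg u i) + 2)" if "i < t" for i
    using that by (simp add: otape_def word_tape_def hist_def)
  have d: "out_pos (cfg u (Suc i)) - out_pos (cfg u i) \<in> {-1, 0, 1}" if "i < t" for i
    using sim_step(2)[OF good_cfg[OF u] t[OF that]] by (simp add: cfg_def)
  let ?S = "\<lambda>k. ts(m + 1 := (?h, int t - 1 - int k), m := (c, out_pos (cfg u (t - k))))"
  have 1: "run (mv (m + 1) (-1)) ts 1 (?S 0)"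
    by (rule run_mono[OF run_mv]) (use ts in \<open>auto simp: otape_def hist_def fun_eq_iff\<close>)
  let ?f = "\<lambda>\<sigma> i. (\<sigma> i, if i = m then (if \<sigma> (m + 1) \<in> {1, 2, 3} then 2 - int (\<sigma> (m + 1)) else 0)
        else if i = m + 1 then -1 else 0)"
  have 2: "run (While (\<lambda>\<sigma>. \<sigma> (m + 1) \<noteq> 0) (Act ?f)) (?S 0) ((\<Sum>k<t. 1 + 2) + 1) (?S t)"
  proof (rule run_While)
    fix k assume k: "k < t"
    define i where "i = t - Suc k"
    have i: "i < t" "int t - 1 - int k = int i" "t - k = Suc i" "t - Suc k = i" "int t - 1 - int (Suc k) = int i - 1"
      using k by (auto simp: i_def)
    have sc: "scan (?S k) (m + 1) = nat (out_pos (cfg u (Suc i)) - out_pos (cfg u i) + 2)"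
      using h[OF i(1)] i(2) by simp
    show "scan (?S k) (m + 1) \<noteq> 0" using sc d[OF i(1)] by auto
    have mem: "scan (?S k) (m + 1) \<in> {1, 2, 3}" using sc d[OF i(1)] by auto
    have mv: "2 - int (scan (?S k) (m + 1)) = out_pos (cfg u i) - out_pos (cfg u (Suc i))"
      unfolding sc using d[OF i(1)] by auto
    have Sk: "?S k = ts(m + 1 := (?h, int i), m := (c, out_pos (cfg u (Suc i))))" (is "_ = ?U")
      using i(2,3) by simp
    have SSk: "?S (Suc k) = ts(m + 1 := (?h, int i - 1), m := (c, out_pos (cfg u i)))"
      using i(4,5) by simp
    have A: "act (scanned T, e) T = (fst T, snd T + e)" for T :: tape and e by (cases T) simp
    have f: "?f (scan ?U) = (\<lambda>j. (scan ?U j, if j = m then out_pos (cfg u i) - out_pos (cfg u (Suc i))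
        else if j = m + 1 then -1 else 0))"
      using mem mv unfolding Sk by (intro ext) presburger
    have "do_act ?f ?U = ts(m + 1 := (?h, int i - 1), m := (c, out_pos (cfg u i)))"
      unfolding do_act_def f A by (auto simp: fun_eq_iff)
    then show "run (Act ?f) (?S k) 1 (?S (Suc k))" unfolding Sk SSk by (rule run_Act)
  qed (simp add: otape_def word_tape_def)
  have "?S t = ts(m + 1 := (?h, -1), m := (c, 0))" using pos0 by simp
  then show ?thesis unfolding replay_def
    by (intro run_mono[OF run_Seq[OF 1 2]]) auto
qed

text \<open>The output and register 2 are used up in parallel. The head ends on a blank exactly if
  the output is no longer than the register allows; equal lengths also end on a blank.\<close>

definition compare :: com where
  "compare = While (\<lambda>\<sigma>. \<sigma> m \<noteq> 0 \<and> nonzero 2 \<sigma>) (Seq (dec 2) (mv m 1))"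

lemma run_compare:
  assumes "ts (rb + 2) = reg E" "ts m = (c, 0)" and v: "0 \<notin> set v" "\<forall>i<length v. c (int i) = v ! i" "c (int (length v)) = 0"
  shows "\<exists>n. run compare ts (5 * E + 1) (ts(rb + 2 := reg (E - n), m := (c, int n))) \<and> (c (int n) = 0 \<longleftrightarrow> length v \<le> E)"
proof (intro exI conjI)
  define n where "n = min (length v) E"
  have c: "c (int i) \<noteq> 0" if "i < length v" for i using v that by (metis nth_mem)
  let ?S = "\<lambda>i. ts(rb + 2 := reg (E - i), m := (c, int i))"
  have "run compare (?S 0) ((\<Sum>i<n. (1 + 1 + 1) + 2) + 1) (?S n)"
    unfolding compare_def
  proof (rule run_While)
    fix i assume i: "i < n"
    then show "scan (?S i) m \<noteq> 0 \<and> nonzero 2 (scan (?S i))"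
      using c by (auto simp: nonzero_def n_def)
    have E: "E - i = Suc (E - Suc i)" using i by (auto simp: n_def)
    have 1: "run (dec 2) (?S i) 1 ((?S i)(rb + 2 := reg (E - Suc i)))"
      by (rule run_dec) (use E in simp)
    have 2: "run (mv m 1) ((?S i)(rb + 2 := reg (E - Suc i))) 1 (?S (Suc i))"
      by (rule run_mono[OF run_mv]) (auto simp: fun_eq_iff)
    show "run (Seq (dec 2) (mv m 1)) (?S i) (1 + 1 + 1) (?S (Suc i))" by (rule run_Seq[OF 1 2])
  qed (use v(3) in \<open>auto simp: n_def min_def nonzero_def\<close>)
  moreover have "?S 0 = ts" using assms by auto
  ultimately have "run compare ts ((\<Sum>i<n. (1 + 1 + 1) + 2) + 1) (?S n)" by simp
  then show "run compare ts (5 * E + 1) (?S n)" by (rule run_mono) (auto simp: n_def)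
  show "c (int n) = 0 \<longleftrightarrow> length v \<le> E"
    using c[of n] v(3) by (auto simp: n_def min_def)
qed

definition init_marks :: com where
  "init_marks = Act (\<lambda>\<sigma> i. (if i \<ge> rb then 1 else \<sigma> i, 0))"

definition rewind :: com where
  "rewind = While (nonzero 0) (Seq (dec 0) (mv 1 (-1)))"

lemma run_rewind_output:
  assumes "ts rb = reg (length u)" "ts 1 = otape u"
  shows "run rewind ts (5 * length u + 1) (ts(rb := reg 0, 1 := word_tape u))"
proof -
  let ?n = "length u"
  let ?S = "\<lambda>i. ts(rb := reg (?n - i), 1 := (fst (word_tape u), int (?n - i)))"
  have "run rewind (?S 0) ((\<Sum>i<?n. (1 + 1 + 1) + 2) + 1) (?S ?n)"
    unfolding rewind_def
  proof (rule run_While)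
    fix i assume "i < ?n"
    then have E: "?n - i = Suc (?n - Suc i)" by simp
    have 1: "run (dec 0) (?S i) 1 ((?S i)(rb + 0 := reg (?n - Suc i)))"
      by (rule run_dec) (use E in simp)
    have 2: "run (mv 1 (-1)) ((?S i)(rb + 0 := reg (?n - Suc i))) 1 (?S (Suc i))"
      by (rule run_mono[OF run_mv]) (use E in \<open>auto simp: fun_eq_iff\<close>)
    show "run (Seq (dec 0) (mv 1 (-1))) (?S i) (1 + 1 + 1) (?S (Suc i))" by (rule run_Seq[OF 1 2])
  qed (auto simp: nonzero_def)
  moreover have "?S 0 = ts" using assms by (auto simp: otape_def)
  ultimately have "run rewind ts ((\<Sum>i<?n. (1 + 1 + 1) + 2) + 1) (?S ?n)" by simp
  then show ?thesis by (rule run_mono) (auto simp: word_tape_def)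
qed

text \<open>The output tape is a register with value 0, whose mark 1 at position 0 already reads as
  the output \<open>[1]\<close>; only the positive answer has to write.\<close>

definition answer :: "nat \<Rightarrow> com" where
  "answer out = Cond (\<lambda>\<sigma>. \<sigma> m = 0) (Act (\<lambda>\<sigma> i. (if i = out then 2 else \<sigma> i, 0))) Skip"

definition machine :: "wexp \<Rightarrow> rexp \<Rightarrow> nat \<Rightarrow> com" where
  "machine \<omega> e out = Seq (Seq init_marks (Seq (comp_wexp (\<lambda>_. 1) 2 \<omega>) (Seq rewind (Seq sim_loop (Seq replay
     (Seq (comp_rexp (\<lambda>_. 1) 2 e) compare)))))) (answer out)"

lemma ev_wf_machine: "\<exists>K S. \<forall>k\<ge>K. \<forall>s\<ge>S. \<forall>out. wf_com k s (machine \<omega> e out)"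
proof -
  have ag: "agree (Suc i) \<sigma> \<sigma>' \<Longrightarrow> \<sigma> i = \<sigma>' i" for i and \<sigma> \<sigma>' :: "nat \<Rightarrow> nat" by (simp add: agree_def)
  have 1: "ev_wf init_marks" unfolding ev_wf_def init_marks_def
    by (intro exI[of _ 0] exI[of _ 2]) (auto simp: agree_def)
  have 2: "ev_wf rewind" unfolding rewind_def
    by (intro ev_wf_intros(2) ev_wf_intros(4)[OF _ nonzero_agree] ev_wf_basic ev_wf_mv) auto
  have "wf_com k s (Act sim_act)" if k: "k \<ge> m + 3" and s: "s \<ge> num_syms M + num_states M + 6" for k s
  proof -
    have "sim_act \<sigma> i = sim_act \<sigma>' i" if "agree k \<sigma> \<sigma>'" "i < k" for \<sigma> \<sigma>' i
    proof -
      have "map (\<lambda>j. \<sigma> (Suc j)) [0..<m] = map (\<lambda>j. \<sigma>' (Suc j)) [0..<m]" using that k by (simp add: agree_def)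
      moreover have "\<sigma> (m + 2) = \<sigma>' (m + 2)" "\<sigma> i = \<sigma>' i" using that k by (auto simp: agree_def)
      ultimately show ?thesis unfolding sim_act_def by (simp only:)
    qed
    moreover have "fst (sim_act \<sigma> i) < s \<and> snd (sim_act \<sigma> i) \<in> {-1, 0, 1}" if \<sigma>: "\<forall>i<k. \<sigma> i < s" and i: "i < k" for \<sigma> i
    proof (cases "\<sigma> (m + 2) < num_states M \<and> (\<forall>s\<in>set (map (\<lambda>j. \<sigma> (Suc j)) [0..<m]). s < num_syms M)")
      case True
      let ?ss = "map (\<lambda>j. \<sigma> (Suc j)) [0..<m]"
      obtain q' acts where d: "delta M (\<sigma> (m + 2)) ?ss = (q', acts)" by force
      have "case delta M (\<sigma> (m + 2)) ?ss of (q', acts) \<Rightarrow>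
           q' < num_states M \<and> length acts = m \<and> (\<forall>(s, d)\<in>set acts. s < num_syms M \<and> d \<in> {-1, 0, 1})"
        by (rule wf_delta) (use True in auto)
      then have q: "q' < num_states M" "length acts = m" and a: "\<And>j. j < m \<Longrightarrow> fst (acts ! j) < num_syms M \<and> snd (acts ! j) \<in> {-1, 0, 1}"
        using d by (auto simp: case_prod_beta)
      have "sim_act \<sigma> i = (if 1 \<le> i \<and> i \<le> m then acts ! (i - 1)
        else if i = m + 2 then (q', 0)
        else if i = m + 1 then (nat (snd (acts ! (m - 1)) + 2), 1)
        else (\<sigma> i, 0))" unfolding sim_act_def Let_def using True d by simp
      moreover have "nat (snd (acts ! (m - 1)) + 2) < 6" using a[of "m - 1"] m_pos by auto
      moreover have "fst (acts ! (i - 1)) < s \<and> snd (acts ! (i - 1)) \<in> {-1, 0, 1}" if "1 \<le> i" "i \<le> m"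
      proof -
        have "i - 1 < m" using that by linarith
        from a[OF this] show ?thesis using s by linarith
      qed
      ultimately show ?thesis using q s \<sigma> i by auto
    next
      case False
      then have "sim_act \<sigma> i = (\<sigma> i, 0)" unfolding sim_act_def by (simp only: Let_def if_False)
      then show ?thesis using \<sigma> i by simp
    qed
    ultimately show ?thesis by simp
  qed
  then have "ev_wf (Act sim_act)" unfolding ev_wf_def by blast
  then have 3: "ev_wf sim_loop" unfolding sim_loop_def
    by (rule ev_wf_intros(4)[where k = "Suc (m + 2)"]) (auto dest: ag)
  have 4: "ev_wf replay" unfolding replay_def
  proof (intro ev_wf_intros(2) ev_wf_mv ev_wf_intros(4)[where k = "Suc (m + 1)"])
    show "ev_wf (Act (\<lambda>\<sigma> i. (\<sigma> i, if i = m then (if \<sigma> (m + 1) \<in> {1, 2, 3} then 2 - int (\<sigma> (m + 1)) else 0)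
        else if i = m + 1 then -1 else 0)))"
      unfolding ev_wf_def
    proof (intro exI[of _ "m + 2"] exI[of _ 0] allI impI)
      fix k s assume k: "m + 2 \<le> k"
      let ?f = "\<lambda>\<sigma> i. (\<sigma> i, if i = m then (if \<sigma> (m + 1) \<in> {1, 2, 3} then 2 - int (\<sigma> (m + 1)) else 0)
        else if i = m + 1 then -1 else 0)"
      have "?f \<sigma> i = ?f \<sigma>' i" if "agree k \<sigma> \<sigma>'" "i < k" for \<sigma> \<sigma>' i
      proof -
        have "\<sigma> i = \<sigma>' i" "\<sigma> (m + 1) = \<sigma>' (m + 1)" using that k by (simp_all add: agree_def)
        then show ?thesis by (simp only:)
      qed
      moreover have "fst (?f \<sigma> i) < s \<and> snd (?f \<sigma> i) \<in> {-1, 0, 1}" if "\<forall>i<k. \<sigma> i < s" "i < k" for \<sigma> i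
        using that by auto
      ultimately show "wf_com k s (Act ?f)" unfolding wf_com.simps by blast
    qed
  qed (auto dest: ag)
  have 5: "ev_wf compare" unfolding compare_def
    by (intro ev_wf_intros(2) ev_wf_basic ev_wf_mv ev_wf_intros(4)[where k = "Suc (rb + 2)"])
      (auto simp: nonzero_def agree_def)
  have "ev_wf (Seq init_marks (Seq (comp_wexp (\<lambda>_. 1) 2 \<omega>) (Seq rewind (Seq sim_loop (Seq replay
     (Seq (comp_rexp (\<lambda>_. 1) 2 e) compare))))))"
    by (intro ev_wf_intros(2) 1 2 3 4 5 ev_wf_comp_wexp ev_wf_comp_rexp)
  then obtain K S where KS: "\<And>k s. k \<ge> K \<Longrightarrow> s \<ge> S \<Longrightarrow> wf_com k s (Seq init_marks (Seq (comp_wexp (\<lambda>_. 1) 2 \<omega>) (Seq rewind (Seq sim_loop (Seq replay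
     (Seq (comp_rexp (\<lambda>_. 1) 2 e) compare))))))" unfolding ev_wf_def by blast
  have "wf_com k s (answer out)" if "k \<ge> Suc m" "s \<ge> 3" for k s out
    using that by (auto simp: answer_def agree_def)
  then show ?thesis using KS unfolding machine_def wf_com.simps(3)
    by (intro exI[of _ "max K (Suc m)"] exI[of _ "max S 3"]) auto
qed

lemma run_machine:
  assumes w: "0 \<notin> set w" and \<omega>: "closed_wexp i \<omega>" and e: "closed_rexp k e" and x: "x = (\<lambda>_. 0)"
    and u: "u = weval \<omega> w x" "\<forall>s\<in>set u. s < 6"
    and halt: "halted_with ((step M ^^ t) (init_config M u)) v"
    and out: "out \<ge> rb + 3"
  shows "\<exists>ts'. run (machine \<omega> e out) (\<lambda>i. word_tape (if i = 0 then w else []))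
      (6 * wcost \<omega> w x + 6 * cost e w x + 6 * t + 20) ts' \<and>
      ts' out = (if length v \<le> eval e w x then ((\<lambda>i. if i = 0 then 2 else 0), 0) else reg 0)"
proof -
  let ?ts0 = "\<lambda>i. word_tape (if i = 0 then w else [])"
  define ts1 where "ts1 = (\<lambda>i. if i \<ge> rb then reg 0 else ?ts0 i)"
  have 1: "run init_marks ?ts0 1 ts1"
    unfolding init_marks_def
  proof (rule run_Act)
    have "(\<lambda>_. 0)(0 := 1) = (\<lambda>i::int. if i = 0 then 1 else (0::nat))" by auto
    then show "do_act (\<lambda>\<sigma> i. (if i \<ge> rb then 1 else \<sigma> i, 0)) ?ts0 = ts1"
      by (auto simp: do_act_def ts1_def fun_eq_iff reg_def word_tape_def)
  qed
  have wres1: "wres [] ts1 = ts1"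
    by (auto simp: wres_def ts1_def fun_eq_iff otape_Nil)
  have "wready (\<lambda>_. 1) i 2 x w ts1" by (auto simp: wready_def ready_def ts1_def x)
  from run_comp_wexp[OF \<omega> this w, of "[]"]
  have 2: "run (comp_wexp (\<lambda>_. 1) 2 \<omega>) ts1 (wcost \<omega> w x) (wres u ts1)"
    unfolding wres1 by (simp add: u(1))
  define ts2 where "ts2 = (wres u ts1)(rb := reg 0, 1 := word_tape u)"
  have 3: "run rewind (wres u ts1) (5 * length u + 1) ts2"
    unfolding ts2_def by (rule run_rewind_output) (auto simp: wres_def)
  \<comment> \<open>The hypothesis supplies some time at which the machine has halted, whereas the
    simulating loop stops at the earliest one.\<close>
  define t0 where "t0 = (LEAST t. fst (cfg u t) = 1)"
  have "fst (cfg u t) = 1" using halt by (simp add: halted_with_def cfg_def)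
  then have t0: "fst (cfg u t0) = 1" "t0 \<le> t" "\<And>i. i < t0 \<Longrightarrow> fst (cfg u i) \<noteq> 1"
    unfolding t0_def by (auto intro: LeastI Least_le dest: not_less_Least)
  have halt0: "halted_with (cfg u t0) v"
    using halt cfg_halted[OF t0(2,1)] by (simp add: cfg_def)
  have st: "sim_tapes ts2 (cfg u 0) [] = ts2"
  proof
    fix i
    show "sim_tapes ts2 (cfg u 0) [] i = ts2 i"
    proof (cases "1 \<le> i \<and> i \<le> m")
      case True
      have "ts2 i = (if i = 1 then word_tape u else word_tape [])"
        using True by (auto simp: ts2_def wres_def ts1_def)
      moreover have "snd (cfg u 0) ! (i - 1) = (if i = 1 then word_tape u else word_tape [])"
        using True by (auto simp: cfg_def init_config_def nth_Cons split: nat.splits)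
      ultimately show ?thesis using True by (simp add: sim_tapes_def)
    next
      case False
      have *: "ts2 (m + 1) = word_tape []" "ts2 (m + 2) = word_tape []"
        using m_pos by (auto simp: ts2_def wres_def ts1_def)
      have "(\<lambda>z::int. if z = 0 then fst (cfg u 0) else 0) = (\<lambda>_. 0)" by (auto simp: cfg_def init_config_def)
      then show ?thesis using False * by (auto simp: sim_tapes_def otape_Nil word_tape_def)
    qed
  qed
  let ?ts3 = "sim_tapes ts2 (cfg u t0) (hist u t0)"
  have 4: "run sim_loop ts2 (3 * t0 + 1) ?ts3"
    using run_sim_loop[OF u(2) t0(3,1), of ts2] st by simp
  have len: "length (snd (cfg u t0)) = m" using good_cfg[OF u(2)] by (simp add: good_def)
  then have lst: "last (snd (cfg u t0)) = snd (cfg u t0) ! (m - 1)"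
    using m_pos by (subst last_conv_nth) auto
  define c where "c = fst (last (snd (cfg u t0)))"
  have tm: "?ts3 m = (c, out_pos (cfg u t0))"
    using m_pos lst by (simp add: sim_tapes_def c_def out_pos_def)
  define ts4 where "ts4 = ?ts3(m + 1 := (fst (otape (hist u t0)), -1), m := (c, 0))"
  have 5: "run replay ?ts3 (3 * t0 + 3) ts4"
    unfolding ts4_def by (rule run_replay[where u = u and t = t0]) (use u(2) t0(3) tm in \<open>simp_all add: sim_tapes_def\<close>)
  have "ready (\<lambda>_. 1) k 2 x w ts4"
    using m_pos by (auto simp: x ready_def ts4_def sim_tapes_def ts2_def wres_def ts1_def)
  from run_comp_rexp[OF e this w]
  have 6: "run (comp_rexp (\<lambda>_. 1) 2 e) ts4 (cost e w x) (ts4(rb + 2 := reg (eval e w x)))" .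
  let ?ts5 = "ts4(rb + 2 := reg (eval e w x))"
  have "?ts5 m = (c, 0)" by (simp add: ts4_def)
  then obtain n where 7: "run compare ?ts5 (5 * eval e w x + 1) (?ts5(rb + 2 := reg (eval e w x - n), m := (c, int n)))"
    and n: "c (int n) = 0 \<longleftrightarrow> length v \<le> eval e w x"
    using run_compare[of ?ts5 "eval e w x" c v] halt0 by (auto simp: halted_with_def c_def)
  let ?ts6 = "?ts5(rb + 2 := reg (eval e w x - n), m := (c, int n))"
  have outreg: "?ts6 out = reg 0"
    using out m_pos by (auto simp: ts4_def sim_tapes_def ts2_def wres_def ts1_def)
  define ts7 where "ts7 = (if length v \<le> eval e w x then ?ts6(out := ((\<lambda>i. if i = 0 then 2 else 0), 0)) else ?ts6)"
  have 8: "run (answer out) ?ts6 (1 + 1) ts7"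
    unfolding answer_def
  proof (rule run_Cond)
    assume "scan ?ts6 m = 0"
    then have "length v \<le> eval e w x" using n by simp
    moreover have "do_act (\<lambda>\<sigma> i. (if i = out then 2 else \<sigma> i, 0)) ?ts6 = ?ts6(out := ((\<lambda>i. if i = 0 then 2 else 0), 0))"
    proof
      fix i
      have "act (2, 0) (reg 0) = ((\<lambda>i. if i = 0 then 2 else 0), 0)" by (auto simp: reg_def fun_eq_iff)
      then show "do_act (\<lambda>\<sigma> i. (if i = out then 2 else \<sigma> i, 0)) ?ts6 i = (?ts6(out := ((\<lambda>i. if i = 0 then 2 else 0), 0))) i"
        using outreg unfolding do_act_def by (cases "i = out") simp_all
    qed
    ultimately show "run (Act (\<lambda>\<sigma> i. (if i = out then 2 else \<sigma> i, 0))) ?ts6 1 ts7"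
      unfolding ts7_def by (intro run_Act) simp
  next
    assume "scan ?ts6 m \<noteq> 0"
    then have "\<not> length v \<le> eval e w x" using n by simp
    then show "run Skip ?ts6 1 ts7" unfolding ts7_def using run_Skip by simp
  qed
  have "run (machine \<omega> e out) ?ts0 (6 * wcost \<omega> w x + 6 * cost e w x + 6 * t + 20) ts7"
    unfolding machine_def
    by (rule run_mono[OF run_Seq[OF run_Seq[OF 1 run_Seq[OF 2 run_Seq[OF 3 run_Seq[OF 4 run_Seq[OF 5 run_Seq[OF 6 7]]]]]] 8]])
      (use t0(2) length_weval_le_wcost[of \<omega> w x] eval_le_cost[of e w x] u(1) in auto)
  moreover have "ts7 out = (if length v \<le> eval e w x then ((\<lambda>i. if i = 0 then 2 else 0), 0) else reg 0)"
    using outreg by (simp add: ts7_def)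
  ultimately show ?thesis by blast
qed

theorem machine_composition:
  assumes \<omega>: "closed_wexp i \<omega>" and e: "closed_rexp j e"
  shows "\<exists>M'. wf_tm M' \<and> (\<forall>w v t. 0 \<notin> set w \<and> (\<forall>s\<in>set (weval \<omega> w (\<lambda>_. 0)). s < 6) \<and>
     halted_with ((step M ^^ t) (init_config M (weval \<omega> w (\<lambda>_. 0)))) v \<longrightarrow>
     outputs_within M' w (if length v \<le> eval e w (\<lambda>_. 0) then [2] else [1])
       (real (6 * wcost \<omega> w (\<lambda>_. 0) + 6 * cost e w (\<lambda>_. 0) + 6 * t + 20)))"
proof -
  obtain K S where KS: "\<forall>k\<ge>K. \<forall>s\<ge>S. \<forall>out. wf_com k s (machine \<omega> e out)"
    using ev_wf_machine by blast
  \<comment> \<open>The last tape becomes a register from number 3 on. It is 0 at the end, and it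
    differs from register 0, which counts the output, and from register 2, which holds the
    threshold.\<close>
  define k where "k = max K (rb + 4)"
  define s where "s = max S 6"
  have wf: "wf_com k s (machine \<omega> e (k - 1))" using KS by (simp add: k_def s_def)
  have out: "k - 1 \<ge> rb + 3" by (simp add: k_def)
  have ks: "k \<ge> 1" "s \<ge> 6" "machine \<omega> e (k - 1) \<noteq> Skip" by (auto simp: k_def s_def machine_def)
  obtain M' where M': "wf_tm M'" and run': "\<And>w t ts' v.
     exec (machine \<omega> e (k - 1)) (\<lambda>i. word_tape (if i = 0 then w else [])) t ts' \<Longrightarrow> 0 \<notin> set v \<Longrightarrow>
     (\<forall>i<length v. fst (ts' (k - 1)) (int i) = v ! i) \<Longrightarrow> fst (ts' (k - 1)) (int (length v)) = 0 \<Longrightarrow>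
     outputs_within M' w v (real t)"
    using com_compilation[OF wf ks] by blast
  define x where "x = (\<lambda>_::nat. 0::nat)"
  have "outputs_within M' w (if length v \<le> eval e w x then [2] else [1])
       (real (6 * wcost \<omega> w x + 6 * cost e w x + 6 * t + 20))"
    if h: "0 \<notin> set w" "\<forall>s\<in>set (weval \<omega> w x). s < 6"
      "halted_with ((step M ^^ t) (init_config M (weval \<omega> w x))) v" for w v t
  proof -
    obtain ts' T where ts': "T \<le> 6 * wcost \<omega> w x + 6 * cost e w x + 6 * t + 20"
      "exec (machine \<omega> e (k - 1)) (\<lambda>i. word_tape (if i = 0 then w else [])) T ts'"
      "ts' (k - 1) = (if length v \<le> eval e w x then ((\<lambda>i. if i = 0 then 2 else 0), 0) else reg 0)"
      using run_machine[OF h(1) \<omega> e x_def refl h(2,3) out] unfolding run_def by blast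
    have "outputs_within M' w (if length v \<le> eval e w x then [2] else [1]) (real T)"
      by (rule run'[OF ts'(2)]) (auto simp: ts'(3)[unfolded One_nat_def] reg_def)
    then show ?thesis using ts'(1) unfolding outputs_within_def by (meson of_nat_le_iff order_trans)
  qed
  then show ?thesis using M' unfolding x_def by blast
qed

end


section \<open>Functions of polynomial cost\<close>

fun ren :: "(nat \<Rightarrow> nat) \<Rightarrow> rexp \<Rightarrow> rexp" where
  "ren \<pi> (RVar i) = RVar (\<pi> i)"
| "ren \<pi> RZero = RZero"
| "ren \<pi> (RSuc e) = RSuc (ren \<pi> e)"
| "ren \<pi> (RIn c e) = RIn c (ren \<pi> e)"
| "ren \<pi> RLen = RLen"
| "ren \<pi> (RRec n a b) = RRec (ren \<pi> n) (ren \<pi> a) (ren (push 0 (push 1 (\<lambda>i. \<pi> i + 2))) b)"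

lemma push_ren:
  "(\<lambda>j. push i (push r x) (push 0 (push (Suc 0) (\<lambda>i. Suc (Suc (\<pi> i)))) j)) = push i (push r (\<lambda>j. x (\<pi> j)))"
  by (rule ext) (auto split: nat.splits)

lemma eval_ren: "eval (ren \<pi> e) w x = eval e w (\<lambda>i. x (\<pi> i))"
  by (induction e arbitrary: \<pi> x) (simp_all add: push_ren)

lemma cost_ren: "cost (ren \<pi> e) w x = cost e w (\<lambda>i. x (\<pi> i))"
  by (induction e arbitrary: \<pi> x) (simp_all add: push_ren eval_ren)

lemma closed_ren: "closed_rexp m e \<Longrightarrow> (\<And>i. i < m \<Longrightarrow> \<pi> i < m') \<Longrightarrow> closed_rexp m' (ren \<pi> e)"
proof (induction e arbitrary: \<pi> m m')
  case (RRec n a b)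
  have "closed_rexp (m' + 2) (ren (push 0 (push 1 (\<lambda>i. \<pi> i + 2))) b)"
    by (rule RRec.IH(3)[of "m + 2"]) (use RRec.prems in \<open>auto split: nat.splits\<close>)
  then show ?case using RRec.IH(1,2)[of m \<pi> m'] RRec.prems by simp
qed auto

lemma closed_mono: "closed_rexp m e \<Longrightarrow> m \<le> m' \<Longrightarrow> closed_rexp m' e"
proof (induction e arbitrary: m m')
  case (RRec n a b)
  then show ?case using RRec.IH(1,2)[of m m'] RRec.IH(3)[of "m + 2" "m' + 2"] by simp
qed auto

lemma closed_wexp_mono: "closed_wexp m e \<Longrightarrow> m \<le> m' \<Longrightarrow> closed_wexp m' e"
proof (induction e arbitrary: m m')
  case (WFor n e)
  then show ?case using WFor.IH[of "m + 1" "m' + 1"] closed_mono[of m n m'] by simp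
qed auto

lemma sum_push_le: "(\<Sum>j<c. push i x j) \<le> i + (\<Sum>j<c. x j)"
proof (cases c)
  case (Suc k)
  have "(\<Sum>j<Suc k. push i x j) = i + (\<Sum>j<k. x j)"
    by (simp add: sum.lessThan_Suc_shift del: sum.lessThan_Suc)
  then show ?thesis using Suc by simp
qed simp

text \<open>\<open>W\<close> contains the inputs that matter, and \<open>\<beta>\<close> takes the
  place of the input length as the size in which costs are measured.\<close>

locale bounded_computation =
  fixes W :: "nat list set" and \<beta> :: "nat list \<Rightarrow> nat"
  assumes \<beta>_ge: "w \<in> W \<Longrightarrow> \<beta> w \<ge> 2" and length_le: "w \<in> W \<Longrightarrow> length w \<le> \<beta> w"
begin

text \<open>A single constant gives both the number of variables and the exponent, so the bounds
  form a chain and any two of them have a common upper bound.\<close>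

definition bd :: "nat \<Rightarrow> nat list \<Rightarrow> (nat \<Rightarrow> nat) \<Rightarrow> nat" where
  "bd c w x = (\<beta> w + (\<Sum>i<c. x i)) ^ c"

text \<open>The arguments, which the machine holds in unary, enter polynomially.\<close>
definition pb :: "(nat list \<Rightarrow> (nat \<Rightarrow> nat) \<Rightarrow> nat) \<Rightarrow> bool" where
  "pb G \<longleftrightarrow> (\<exists>c. \<forall>w\<in>W. \<forall>x. G w x \<le> bd c w x)"

lemma bd_mono: "w \<in> W \<Longrightarrow> c \<le> c' \<Longrightarrow> bd c w x \<le> bd c' w x"
proof -
  assume a: "w \<in> W" "c \<le> c'"
  have "(\<Sum>i<c. x i) \<le> (\<Sum>i<c'. x i)" by (rule sum_mono2) (use a in auto)
  then have "bd c w x \<le> (\<beta> w + (\<Sum>i<c'. x i)) ^ c" unfolding bd_def by (intro power_mono) auto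
  also have "\<dots> \<le> bd c' w x" unfolding bd_def using \<beta>_ge[OF a(1)] a by (intro power_increasing) auto
  finally show ?thesis .
qed

lemma pb_mono: "pb G \<Longrightarrow> (\<And>w x. w \<in> W \<Longrightarrow> H w x \<le> G w x) \<Longrightarrow> pb H"
  unfolding pb_def by (meson order_trans)

lemma pb_var: "pb (\<lambda>w x. x i)"
  unfolding pb_def
proof (intro exI[of _ "Suc i"] ballI allI)
  fix w x assume w: "w \<in> W"
  have "x i \<le> \<beta> w + (\<Sum>j<Suc i. x j)" by simp
  also have "\<dots> \<le> bd (Suc i) w x" unfolding bd_def by (rule self_le_power) (use \<beta>_ge[OF w] in auto)
  finally show "x i \<le> bd (Suc i) w x" .
qed

lemma pb_beta: "pb (\<lambda>w x. \<beta> w)"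
  unfolding pb_def by (intro exI[of _ 1]) (auto simp: bd_def)

lemma pb_const: "pb (\<lambda>w x. k)"
  unfolding pb_def
proof (intro exI[of _ k] ballI allI)
  fix w x assume w: "w \<in> W"
  have "k \<le> 2 ^ k" using less_exp[of k] by simp
  also have "\<dots> \<le> bd k w x" unfolding bd_def by (rule power_mono) (use \<beta>_ge[OF w] in auto)
  finally show "k \<le> bd k w x" .
qed

lemma pb_mult: "pb G \<Longrightarrow> pb H \<Longrightarrow> pb (\<lambda>w x. G w x * H w x)"
proof -
  assume "pb G" "pb H"
  then obtain c c' where c: "\<And>w x. w \<in> W \<Longrightarrow> G w x \<le> bd c w x" "\<And>w x. w \<in> W \<Longrightarrow> H w x \<le> bd c' w x"
    unfolding pb_def by blast
  have "G w x * H w x \<le> bd (c + c') w x" if w: "w \<in> W" for w x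
  proof -
    have "(\<Sum>i<c. x i) \<le> (\<Sum>i<c + c'. x i)" "(\<Sum>i<c'. x i) \<le> (\<Sum>i<c + c'. x i)" by (rule sum_mono2; auto)+
    then have "bd c w x \<le> (\<beta> w + (\<Sum>i<c + c'. x i)) ^ c" "bd c' w x \<le> (\<beta> w + (\<Sum>i<c + c'. x i)) ^ c'"
      unfolding bd_def by (simp_all add: power_mono)
    then have "G w x * H w x \<le> (\<beta> w + (\<Sum>i<c + c'. x i)) ^ c * (\<beta> w + (\<Sum>i<c + c'. x i)) ^ c'"
      using c[OF w, of x] by (meson mult_le_mono order_trans)
    then show ?thesis by (simp add: bd_def power_add)
  qed
  then show ?thesis unfolding pb_def by blast
qed

lemma pb_add: "pb G \<Longrightarrow> pb H \<Longrightarrow> pb (\<lambda>w x. G w x + H w x)"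
proof -
  assume "pb G" "pb H"
  then obtain c c' where c: "\<And>w x. w \<in> W \<Longrightarrow> G w x \<le> bd c w x" "\<And>w x. w \<in> W \<Longrightarrow> H w x \<le> bd c' w x"
    unfolding pb_def by blast
  have "pb (\<lambda>w x. 2 * bd (max c c') w x)"
    using pb_mult[OF pb_const, of "bd (max c c')" 2] unfolding pb_def by blast
  then show ?thesis
  proof (rule pb_mono)
    fix w x assume w: "w \<in> W"
    have "G w x \<le> bd (max c c') w x" "H w x \<le> bd (max c c') w x"
      using c[OF w, of x] bd_mono[OF w, of c "max c c'" x] bd_mono[OF w, of c' "max c c'" x] by (auto intro: order_trans)
    then show "G w x + H w x \<le> 2 * bd (max c c') w x" by simp
  qed
qed

lemma pb_sum_vars: "pb (\<lambda>w x. \<Sum>i<(c::nat). x (\<pi> i))"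
  by (induction c) (simp_all add: pb_const pb_add pb_var)

lemma pb_power: "pb G \<Longrightarrow> pb (\<lambda>w x. G w x ^ c)"
  by (induction c) (simp_all add: pb_const[of 1, simplified] pb_const pb_mult)

text \<open>The index of a loop lies below a polynomial bound itself, so it can be added to the base
  of the power while the exponent stays the same.\<close>

lemma pb_push:
  assumes "pb G" "pb n"
  shows "\<exists>H. pb H \<and> (\<forall>w\<in>W. \<forall>x i. i \<le> n w x \<longrightarrow> G w (push i x) \<le> H w x)"
proof -
  obtain c where c: "\<And>w x. w \<in> W \<Longrightarrow> G w x \<le> bd c w x" using assms(1) unfolding pb_def by blast
  let ?H = "\<lambda>w x. (\<beta> w + n w x + (\<Sum>i<c. x i)) ^ c"
  have "pb ?H" by (intro pb_power pb_add pb_beta assms(2) pb_sum_vars)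
  moreover have "G w (push i x) \<le> ?H w x" if w: "w \<in> W" "i \<le> n w x" for w x i
  proof -
    have "(\<Sum>j<c. push i x j) \<le> i + (\<Sum>j<c. x j)" by (rule sum_push_le)
    then have "bd c w (push i x) \<le> ?H w x" unfolding bd_def using w(2) by (intro power_mono) auto
    then show ?thesis using c[OF w(1), of "push i x"] by linarith
  qed
  ultimately show ?thesis by blast
qed

lemma pb_push2:
  assumes "pb G" "pb n" "pb \<rho>"
  shows "\<exists>H. pb H \<and> (\<forall>w\<in>W. \<forall>x i r. i \<le> n w x \<longrightarrow> r \<le> \<rho> w x \<longrightarrow> G w (push i (push r x)) \<le> H w x)"
proof -
  obtain c where c: "\<And>w x. w \<in> W \<Longrightarrow> G w x \<le> bd c w x" using assms(1) unfolding pb_def by blast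
  let ?H = "\<lambda>w x. (\<beta> w + n w x + \<rho> w x + (\<Sum>i<c. x i)) ^ c"
  have "pb ?H" by (intro pb_power pb_add pb_beta assms pb_sum_vars)
  moreover have "G w (push i (push r x)) \<le> ?H w x" if w: "w \<in> W" "i \<le> n w x" "r \<le> \<rho> w x" for w x i r
  proof -
    have "(\<Sum>j<c. push i (push r x) j) \<le> i + (r + (\<Sum>j<c. x j))"
      using sum_push_le[of i "push r x" c] sum_push_le[of r x c] by linarith
    then have "bd c w (push i (push r x)) \<le> ?H w x" unfolding bd_def using w(2,3) by (intro power_mono) auto
    then show ?thesis using c[OF w(1), of "push i (push r x)"] by linarith
  qed
  ultimately show ?thesis by blast
qed

text \<open>The expression is hidden behind the quantifier, so that a program and its cost bound
  arise together from introduction rules that follow the shape of a formula.\<close>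

definition feasible :: "(nat list \<Rightarrow> (nat \<Rightarrow> nat) \<Rightarrow> nat) \<Rightarrow> bool" where
  "feasible F \<longleftrightarrow> (\<exists>e m. closed_rexp m e \<and> (\<forall>w\<in>W. \<forall>x. eval e w x = F w x) \<and> pb (cost e))"

lemma feasible_pb: "feasible F \<Longrightarrow> pb F"
proof -
  assume "feasible F"
  then obtain e where e: "\<And>w x. w \<in> W \<Longrightarrow> eval e w x = F w x" "pb (cost e)" unfolding feasible_def by blast
  show "pb F" by (rule pb_mono[OF e(2)]) (use e(1) eval_le_cost in metis)
qed

lemma feasible_cong: "feasible F \<Longrightarrow> (\<And>w x. w \<in> W \<Longrightarrow> F w x = G w x) \<Longrightarrow> feasible G"
  unfolding feasible_def by metis

lemma feasible_ren:
  assumes "feasible F"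
  shows "feasible (\<lambda>w x. F w (\<lambda>i. x (\<pi> i)))"
proof -
  obtain e m where e: "closed_rexp m e" "\<And>w x. w \<in> W \<Longrightarrow> eval e w x = F w x" "pb (cost e)"
    using assms unfolding feasible_def by blast
  obtain c where c: "\<And>w x. w \<in> W \<Longrightarrow> cost e w x \<le> bd c w x" using e(3) unfolding pb_def by blast
  have "closed_rexp (Suc (\<Sum>i<m. \<pi> i)) (ren \<pi> e)"
    by (rule closed_ren[OF e(1)]) (auto intro: le_imp_less_Suc member_le_sum)
  moreover have "pb (cost (ren \<pi> e))"
  proof (rule pb_mono)
    show "pb (\<lambda>w x. (\<beta> w + (\<Sum>i<c. x (\<pi> i))) ^ c)" by (intro pb_power pb_add pb_beta pb_sum_vars)
    show "cost (ren \<pi> e) w x \<le> (\<beta> w + (\<Sum>i<c. x (\<pi> i))) ^ c" if "w \<in> W" for w x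
      using c[OF that, of "\<lambda>i. x (\<pi> i)"] by (simp add: cost_ren bd_def)
  qed
  ultimately show ?thesis unfolding feasible_def using e(2) eval_ren by metis
qed

lemma feasible_var: "feasible (\<lambda>w x. x i)"
proof -
  have "pb (cost (RVar i))" unfolding cost.simps[abs_def] by (intro pb_add pb_mult pb_var pb_const)
  then show ?thesis unfolding feasible_def by (intro exI[of _ "RVar i"] exI[of _ "Suc i"]) auto
qed

lemma feasible_zero: "feasible (\<lambda>w x. 0)"
proof -
  have "pb (cost RZero)" unfolding cost.simps[abs_def] by (rule pb_const)
  then show ?thesis unfolding feasible_def by (intro exI[of _ RZero] exI[of _ 0]) auto
qed

lemma feasible_Suc: "feasible F \<Longrightarrow> feasible (\<lambda>w x. Suc (F w x))"
proof -
  assume "feasible F"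
  then obtain e m where e: "closed_rexp m e" "\<And>w x. w \<in> W \<Longrightarrow> eval e w x = F w x" "pb (cost e)"
    unfolding feasible_def by blast
  have "pb (cost (RSuc e))" unfolding cost.simps[abs_def] by (intro pb_add pb_const e)
  then show ?thesis unfolding feasible_def using e by (intro exI[of _ "RSuc e"] exI[of _ m]) auto
qed

lemma feasible_const: "feasible (\<lambda>w x. k)"
  by (induction k) (simp_all add: feasible_zero feasible_Suc)

lemma feasible_sym: "feasible F \<Longrightarrow> feasible (\<lambda>w x. of_bool (symbol_at w (F w x) = k))"
proof -
  assume "feasible F"
  then obtain e m where e: "closed_rexp m e" "\<And>w x. w \<in> W \<Longrightarrow> eval e w x = F w x" "pb (cost e)"
    unfolding feasible_def by blast
  have "pb (eval e)" by (rule pb_mono[OF e(3) eval_le_cost])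
  then have "pb (cost (RIn k e))" unfolding cost.simps[abs_def] by (intro pb_add pb_mult pb_const e)
  then show ?thesis unfolding feasible_def using e by (intro exI[of _ "RIn k e"] exI[of _ m]) auto
qed

lemma feasible_length: "feasible (\<lambda>w x. length w)"
proof -
  have "pb (\<lambda>w x. length w)" by (rule pb_mono[OF pb_beta]) (rule length_le)
  then have "pb (cost RLen)" unfolding cost.simps[abs_def] by (intro pb_add pb_mult pb_const)
  then show ?thesis unfolding feasible_def by (intro exI[of _ RLen] exI[of _ 0]) auto
qed

text \<open>Iterating a polynomially bounded step can produce exponentially large values; the bound
  \<open>\<rho>\<close> on all intermediate values excludes this.\<close>

lemma feasible_rec:
  assumes n: "feasible n" and a: "feasible a" and b: "feasible (\<lambda>w y. b w (\<lambda>i. y (Suc (Suc i))) (y 0) (y (Suc 0)))"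
    and \<rho>: "pb \<rho>" "\<And>w x k. w \<in> W \<Longrightarrow> k \<le> n w x \<Longrightarrow> rec_nat (a w x) (b w x) k \<le> \<rho> w x"
  shows "feasible (\<lambda>w x. rec_nat (a w x) (b w x) (n w x))"
proof -
  obtain en mn where en: "closed_rexp mn en" "\<And>w x. w \<in> W \<Longrightarrow> eval en w x = n w x" "pb (cost en)"
    using n unfolding feasible_def by blast
  obtain ea ma where ea: "closed_rexp ma ea" "\<And>w x. w \<in> W \<Longrightarrow> eval ea w x = a w x" "pb (cost ea)"
    using a unfolding feasible_def by blast
  obtain eb mb where eb: "closed_rexp mb eb" "\<And>w x. w \<in> W \<Longrightarrow> eval eb w x = b w (\<lambda>i. x (Suc (Suc i))) (x 0) (x (Suc 0))" "pb (cost eb)"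
    using b unfolding feasible_def by blast
  let ?e = "RRec en ea eb"
  have rec: "rec_nat (eval ea w x) (\<lambda>i r. eval eb w (push i (push r x))) = rec_nat (a w x) (b w x)" if "w \<in> W" for w x
    using ea(2)[OF that] eb(2)[OF that] by simp
  have pn: "pb n" by (rule feasible_pb[OF n])
  obtain H where H: "pb H" "\<And>w x i r. w \<in> W \<Longrightarrow> i \<le> n w x \<Longrightarrow> r \<le> \<rho> w x \<Longrightarrow> cost eb w (push i (push r x)) \<le> H w x"
    using pb_push2[OF eb(3) pn \<rho>(1)] by blast
  have "pb (cost ?e)"
  proof (rule pb_mono)
    show "pb (\<lambda>w x. cost ea w x + cost en w x + n w x * (H w x + 3 * \<rho> w x + 5 * \<rho> w x + 12) + 3 * n w x + 6)"
      by (intro pb_add pb_mult pb_const ea en pn H \<rho>)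
    show "cost ?e w x \<le> cost ea w x + cost en w x + n w x * (H w x + 3 * \<rho> w x + 5 * \<rho> w x + 12) + 3 * n w x + 6"
      if w: "w \<in> W" for w x
    proof -
      let ?r = "rec_nat (a w x) (b w x)"
      have "(\<Sum>i<n w x. cost eb w (push i (push (?r i) x)) + 3 * ?r i + 5 * ?r (Suc i) + 12)
          \<le> (\<Sum>i<n w x. H w x + 3 * \<rho> w x + 5 * \<rho> w x + 12)"
      proof (rule sum_mono)
        fix i assume "i \<in> {..<n w x}"
        then have i: "i \<le> n w x" "Suc i \<le> n w x" by auto
        show "cost eb w (push i (push (?r i) x)) + 3 * ?r i + 5 * ?r (Suc i) + 12 \<le> H w x + 3 * \<rho> w x + 5 * \<rho> w x + 12"
          using H(2)[OF w i(1) \<rho>(2)[OF w i(1)]] \<rho>(2)[OF w i(1)] \<rho>(2)[OF w i(2)] by linarith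
      qed
      then show ?thesis unfolding cost.simps rec[OF w] en(2)[OF w] Let_def by simp
    qed
  qed
  moreover have "closed_rexp (mn + ma + mb) ?e"
    using en(1) ea(1) eb(1) by (auto intro: closed_mono)
  moreover have "eval ?e w x = rec_nat (a w x) (b w x) (n w x)" if "w \<in> W" for w x
    unfolding eval.simps rec[OF that] en(2)[OF that] by simp
  ultimately show ?thesis unfolding feasible_def by blast
qed

lemma feasible_shift: "feasible a \<Longrightarrow> feasible (\<lambda>w y. a w (\<lambda>i. y (Suc i)))"
  by (rule feasible_ren)

section \<open>Arithmetic of feasible functions\<close>

lemma feasible_add: assumes "feasible a" "feasible n" shows "feasible (\<lambda>w x. a w x + n w x)"
proof -
  have r: "rec_nat k (\<lambda>i r. Suc r) m = k + m" for k m :: nat by (induction m) auto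
  have "feasible (\<lambda>w x. rec_nat (a w x) (\<lambda>i r. Suc r) (n w x))"
    by (rule feasible_rec[where b = "\<lambda>w x i r. Suc r" and \<rho> = "\<lambda>w x. a w x + n w x"])
      (use assms in \<open>auto intro!: feasible_Suc feasible_var pb_add intro: feasible_pb simp: r\<close>)
  then show ?thesis by (simp add: r)
qed

text \<open>The recursion ignores its accumulator and returns the index of its last step.\<close>

lemma feasible_pred: assumes "feasible n" shows "feasible (\<lambda>w x. n w x - 1)"
proof -
  have r: "rec_nat 0 (\<lambda>i r. i) m = m - 1" for m :: nat by (cases m) auto
  have "feasible (\<lambda>w x. rec_nat 0 (\<lambda>i r. i) (n w x))"
    by (rule feasible_rec[where b = "\<lambda>w x i r. i" and \<rho> = n])
      (auto intro!: assms feasible_var feasible_zero pb_add feasible_pb simp: r)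
  then show ?thesis by (simp add: r)
qed

lemma feasible_diff: assumes "feasible a" "feasible n" shows "feasible (\<lambda>w x. a w x - n w x)"
proof -
  have r: "rec_nat k (\<lambda>i r. r - 1) m = k - m" for k m :: nat by (induction m) auto
  have "feasible (\<lambda>w x. rec_nat (a w x) (\<lambda>i r. r - 1) (n w x))"
  proof (rule feasible_rec[where b = "\<lambda>w x i r. r - 1" and \<rho> = a])
    show "feasible (\<lambda>w y. y (Suc 0) - 1)" by (rule feasible_pred[OF feasible_var])
    show "rec_nat (a w x) (\<lambda>i r. r - 1) k \<le> a w x" for w x k unfolding r by simp
  qed (use assms feasible_pb in auto)
  then show ?thesis unfolding r .
qed

lemma feasible_sum:
  assumes n: "feasible n" and f: "feasible (\<lambda>w y. f w (\<lambda>i. y (Suc i)) (y 0))"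
  shows "feasible (\<lambda>w x. \<Sum>i<n w x. f w x i)"
proof -
  have r: "rec_nat 0 (\<lambda>i r. r + g i) m = (\<Sum>i<m. g i)" for g :: "nat \<Rightarrow> nat" and m by (induction m) auto
  have body: "feasible (\<lambda>w y. y (Suc 0) + f w (\<lambda>i. y (Suc (Suc i))) (y 0))"
    using feasible_add[OF feasible_var[of "Suc 0"] feasible_ren[OF f, of "push 0 (\<lambda>i. Suc (Suc i))"]] by simp
  obtain H where H: "pb H" "\<And>w x i. w \<in> W \<Longrightarrow> i \<le> n w x \<Longrightarrow> f w x i \<le> H w x"
    using pb_push[OF feasible_pb[OF f] feasible_pb[OF n]] by auto
  have "feasible (\<lambda>w x. rec_nat 0 (\<lambda>i r. r + f w x i) (n w x))"
  proof (rule feasible_rec[where b = "\<lambda>w x i r. r + f w x i" and \<rho> = "\<lambda>w x. n w x * H w x"])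
    show "pb (\<lambda>w x. n w x * H w x)" by (intro pb_mult feasible_pb n H)
    fix w x k assume w: "w \<in> W" "k \<le> n w x"
    have "(\<Sum>i<k. f w x i) \<le> (\<Sum>i<k. H w x)" by (rule sum_mono) (use H(2)[OF w(1)] w(2) in auto)
    also have "\<dots> \<le> n w x * H w x" using w(2) by simp
    finally show "rec_nat 0 (\<lambda>i r. r + f w x i) k \<le> n w x * H w x" by (simp add: r)
  qed (use n feasible_zero body in auto)
  then show ?thesis by (simp add: r)
qed

lemma feasible_mult: assumes "feasible a" "feasible n" shows "feasible (\<lambda>w x. a w x * n w x)"
proof -
  have "feasible (\<lambda>w x. \<Sum>i<n w x. a w x)" by (rule feasible_sum[OF assms(2) feasible_shift[OF assms(1)]])
  then show ?thesis by (simp add: mult.commute)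
qed

lemma feasible_min: assumes "feasible a" "feasible b" shows "feasible (\<lambda>w x. min (a w x) (b w x))"
proof -
  have "feasible (\<lambda>w x. a w x - (a w x - b w x))" by (intro feasible_diff assms)
  then show ?thesis by (rule feasible_cong) auto
qed

text \<open>Capping after every multiplication gives the same result as capping at the end, and it
  keeps all intermediate values below the cap.\<close>

lemma feasible_capped_power:
  assumes "feasible c" "feasible a" "feasible n" shows "feasible (\<lambda>w x. min (c w x) (a w x ^ n w x))"
proof -
  have m: "min (C::nat) (min C B * A) = min C (A * B)" for A B C
  proof (cases "A = 0 \<or> B \<le> C")
    case False
    then have "C \<le> C * A" "C \<le> A * B" using mult_le_mono[of 1 A C B] by auto
    then show ?thesis using False by (simp add: min_def)
  qed (auto simp: mult.commute)
  have r: "rec_nat (min C 1) (\<lambda>i r. min C (r * A)) m = min C (A ^ m)" for C A m :: nat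
    by (induction m) (simp_all add: m)
  have "feasible (\<lambda>w x. rec_nat (min (c w x) 1) (\<lambda>i r. min (c w x) (r * a w x)) (n w x))"
  proof (rule feasible_rec[where b = "\<lambda>w x i r. min (c w x) (r * a w x)" and \<rho> = c])
    show "feasible (\<lambda>w y. min (c w (\<lambda>i. y (Suc (Suc i)))) (y (Suc 0) * a w (\<lambda>i. y (Suc (Suc i)))))"
      by (intro feasible_min feasible_mult feasible_var feasible_ren[OF assms(1)] feasible_ren[OF assms(2)])
    show "rec_nat (min (c w x) 1) (\<lambda>i r. min (c w x) (r * a w x)) k \<le> c w x" for w x k
      unfolding r by simp
  qed (use assms feasible_min[OF assms(1) feasible_const[of 1]] feasible_pb[OF assms(1)] in auto)
  then show ?thesis by (simp only: r)
qed

section \<open>Feasible predicates and bounded quantifiers\<close>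

definition feasible_pred :: "(nat list \<Rightarrow> (nat \<Rightarrow> nat) \<Rightarrow> bool) \<Rightarrow> bool" where
  "feasible_pred P \<longleftrightarrow> feasible (\<lambda>w x. of_bool (P w x))"

lemma feasible_pred_cong: "feasible_pred P \<Longrightarrow> (\<And>w x. w \<in> W \<Longrightarrow> P w x = Q w x) \<Longrightarrow> feasible_pred Q"
  unfolding feasible_pred_def by (erule feasible_cong) simp

lemma feasible_pred_feasible: "feasible_pred P \<Longrightarrow> feasible (\<lambda>w x. of_bool (P w x))"
  by (simp add: feasible_pred_def)

lemma feasible_pred_sym: "feasible F \<Longrightarrow> feasible_pred (\<lambda>w x. symbol_at w (F w x) = k)"
  unfolding feasible_pred_def by (rule feasible_sym)

lemma feasible_pred_le: assumes "feasible a" "feasible b" shows "feasible_pred (\<lambda>w x. a w x \<le> b w x)"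
proof -
  have "feasible (\<lambda>w x. 1 - (a w x - b w x))" by (intro feasible_diff feasible_const assms)
  then show ?thesis unfolding feasible_pred_def by (rule feasible_cong) auto
qed

lemma feasible_pred_not: assumes "feasible_pred P" shows "feasible_pred (\<lambda>w x. \<not> P w x)"
proof -
  have "feasible (\<lambda>w x. 1 - of_bool (P w x))" by (intro feasible_diff feasible_const assms[unfolded feasible_pred_def])
  then show ?thesis unfolding feasible_pred_def by (rule feasible_cong) auto
qed

lemma feasible_pred_conj: assumes "feasible_pred P" "feasible_pred Q" shows "feasible_pred (\<lambda>w x. P w x \<and> Q w x)"
proof -
  have "feasible (\<lambda>w x. of_bool (P w x) * of_bool (Q w x))" by (intro feasible_mult assms[unfolded feasible_pred_def])
  then show ?thesis unfolding feasible_pred_def by (rule feasible_cong) auto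
qed

lemma feasible_pred_disj: assumes "feasible_pred P" "feasible_pred Q" shows "feasible_pred (\<lambda>w x. P w x \<or> Q w x)"
  using feasible_pred_not[OF feasible_pred_conj[OF feasible_pred_not[OF assms(1)] feasible_pred_not[OF assms(2)]]] by simp

lemma feasible_pred_imp: assumes "feasible_pred P" "feasible_pred Q" shows "feasible_pred (\<lambda>w x. P w x \<longrightarrow> Q w x)"
  using feasible_pred_not[OF feasible_pred_conj[OF assms(1) feasible_pred_not[OF assms(2)]]] by simp

lemma feasible_pred_less: assumes "feasible a" "feasible b" shows "feasible_pred (\<lambda>w x. a w x < b w x)"
  using feasible_pred_not[OF feasible_pred_le[OF assms(2,1)]] by (simp add: not_le)

lemma feasible_pred_eq: assumes "feasible a" "feasible b" shows "feasible_pred (\<lambda>w x. a w x = b w x)"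
  using feasible_pred_conj[OF feasible_pred_le[OF assms] feasible_pred_le[OF assms(2,1)]] by (simp add: eq_iff)

lemma feasible_pred_ex:
  assumes "feasible n" "feasible_pred (\<lambda>w y. P w (\<lambda>i. y (Suc i)) (y 0))"
  shows "feasible_pred (\<lambda>w x. \<exists>i<n w x. P w x i)"
proof -
  have "feasible_pred (\<lambda>w x. (0::nat) < (\<Sum>i<n w x. of_bool (P w x i)))"
    by (intro feasible_pred_less feasible_const feasible_sum[where f = "\<lambda>w x i. of_bool (P w x i)"] assms(1) assms(2)[unfolded feasible_pred_def])
  then show ?thesis by (rule feasible_pred_cong) (auto simp: sum_eq_0_iff[symmetric] simp flip: neq0_conv)
qed

lemma feasible_pred_all:
  assumes "feasible n" "feasible_pred (\<lambda>w y. P w (\<lambda>i. y (Suc i)) (y 0))"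
  shows "feasible_pred (\<lambda>w x. \<forall>i<n w x. P w x i)"
  using feasible_pred_not[OF feasible_pred_ex[OF assms(1) feasible_pred_not[OF assms(2)]]] by simp

lemma feasible_div: assumes "feasible a" "feasible b" shows "feasible (\<lambda>w x. a w x div b w x)"
proof -
  \<comment> \<open>The quotient counts the positive multiples of \<open>b\<close> up to
    \<open>a\<close>; the conjunct \<open>0 < b\<close> matches the convention that division by 0
    yields 0.\<close>
  have eq: "(\<Sum>i<a. of_bool (Suc i * b \<le> a \<and> 0 < b)) = a div b" for a b :: nat
  proof (cases "b = 0")
    case False
    have "{i\<in>{..<a}. Suc i * b \<le> a} = {..<a div b}"
    proof (intro set_eqI iffI)
      have *: "Suc i * b \<le> a \<longleftrightarrow> Suc i \<le> a div b" for i
        using False less_eq_div_iff_mult_less_eq[of b "Suc i" a] by simp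
      show "i \<in> {..<a div b}" if "i \<in> {i\<in>{..<a}. Suc i * b \<le> a}" for i using that * by auto
      show "i \<in> {i\<in>{..<a}. Suc i * b \<le> a}" if "i \<in> {..<a div b}" for i
      proof -
        have "i < a" using that div_le_dividend[of a b] by (simp del: div_le_dividend)
        then show ?thesis using that *[of i] by auto
      qed
    qed
    then show ?thesis using False by (simp add: of_bool_def sum.If_cases Int_def)
  qed simp
  have "feasible (\<lambda>w x. \<Sum>i<a w x. of_bool (Suc i * b w x \<le> a w x \<and> 0 < b w x))"
    by (rule feasible_sum[OF assms(1)]) (intro feasible_pred_feasible feasible_pred_conj feasible_pred_le feasible_pred_less feasible_mult feasible_Suc feasible_var feasible_const feasible_shift assms)
  then show ?thesis by (simp only: eq)
qed

lemma feasible_mod: assumes "feasible a" "feasible b" shows "feasible (\<lambda>w x. a w x mod b w x)"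
proof -
  have "feasible (\<lambda>w x. a w x - a w x div b w x * b w x)" by (intro feasible_diff feasible_mult feasible_div assms)
  then show ?thesis by (rule feasible_cong) (simp add: minus_div_mult_eq_mod)
qed

section \<open>Feasible output words\<close>

definition feasible_word :: "(nat list \<Rightarrow> (nat \<Rightarrow> nat) \<Rightarrow> nat list) \<Rightarrow> bool" where
  "feasible_word F \<longleftrightarrow> (\<exists>e m. closed_wexp m e \<and> (\<forall>w\<in>W. \<forall>x. weval e w x = F w x) \<and> pb (wcost e))"

lemma feasible_word_cong: "feasible_word F \<Longrightarrow> (\<And>w x. w \<in> W \<Longrightarrow> F w x = G w x) \<Longrightarrow> feasible_word G"
  unfolding feasible_word_def by metis

lemma feasible_word_Nil: "feasible_word (\<lambda>w x. [])"
proof -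
  have "pb (wcost WNil)" unfolding wcost.simps[abs_def] by (rule pb_const)
  then show ?thesis unfolding feasible_word_def by (intro exI[of _ WNil] exI[of _ 0]) auto
qed

lemma feasible_word_single: "feasible_word (\<lambda>w x. [c])"
proof -
  have "pb (wcost (WSym c))" unfolding wcost.simps[abs_def] by (rule pb_const)
  then show ?thesis unfolding feasible_word_def by (intro exI[of _ "WSym c"] exI[of _ 0]) auto
qed

lemma feasible_word_append: "feasible_word F \<Longrightarrow> feasible_word G \<Longrightarrow> feasible_word (\<lambda>w x. F w x @ G w x)"
proof -
  assume "feasible_word F" "feasible_word G"
  then obtain e m f m' where e: "closed_wexp m e" "\<And>w x. w \<in> W \<Longrightarrow> weval e w x = F w x" "pb (wcost e)"
    and f: "closed_wexp m' f" "\<And>w x. w \<in> W \<Longrightarrow> weval f w x = G w x" "pb (wcost f)"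
    unfolding feasible_word_def by blast
  have "pb (wcost (WSeq e f))" unfolding wcost.simps[abs_def] by (intro pb_add pb_const e f)
  moreover have "closed_wexp (m + m') (WSeq e f)" using e(1) f(1) by (auto intro: closed_wexp_mono)
  ultimately show ?thesis unfolding feasible_word_def using e(2) f(2) by (intro exI[of _ "WSeq e f"] exI[of _ "m + m'"]) auto
qed

lemma feasible_word_Cons: "feasible_word F \<Longrightarrow> feasible_word (\<lambda>w x. c # F w x)"
  using feasible_word_append[OF feasible_word_single[of c]] by simp

lemma feasible_word_concat:
  assumes n: "feasible n" and f: "feasible_word (\<lambda>w y. f w (\<lambda>i. y (Suc i)) (y 0))"
  shows "feasible_word (\<lambda>w x. concat (map (\<lambda>i. f w x i) [0..<n w x]))"
proof -
  obtain en mn where en: "closed_rexp mn en" "\<And>w x. w \<in> W \<Longrightarrow> eval en w x = n w x" "pb (cost en)"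
    using n unfolding feasible_def by blast
  obtain e m where e: "closed_wexp m e" "\<And>w x. w \<in> W \<Longrightarrow> weval e w x = f w (\<lambda>i. x (Suc i)) (x 0)" "pb (wcost e)"
    using f unfolding feasible_word_def by blast
  have pn: "pb n" by (rule feasible_pb[OF n])
  obtain H where H: "pb H" "\<And>w x i. w \<in> W \<Longrightarrow> i \<le> n w x \<Longrightarrow> wcost e w (push i x) \<le> H w x"
    using pb_push[OF e(3) pn] by blast
  have "pb (wcost (WFor en e))"
  proof (rule pb_mono)
    show "pb (\<lambda>w x. cost en w x + n w x * (H w x + 6) + 3 * n w x + 4)"
      by (intro pb_add pb_mult pb_const en pn H)
    show "wcost (WFor en e) w x \<le> cost en w x + n w x * (H w x + 6) + 3 * n w x + 4" if w: "w \<in> W" for w x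
    proof -
      have "(\<Sum>i<n w x. wcost e w (push i x) + 6) \<le> (\<Sum>i<n w x. H w x + 6)"
        by (rule sum_mono) (use H(2)[OF w] in auto)
      then show ?thesis unfolding wcost.simps en(2)[OF w] by simp
    qed
  qed
  moreover have "closed_wexp (mn + m) (WFor en e)"
    using en(1) e(1) by (auto intro: closed_mono closed_wexp_mono)
  moreover have "weval (WFor en e) w x = concat (map (\<lambda>i. f w x i) [0..<n w x])" if "w \<in> W" for w x
    using en(2)[OF that] e(2)[OF that] by simp
  ultimately show ?thesis unfolding feasible_word_def by blast
qed

lemma feasible_word_when:
  assumes "feasible_pred P" and "feasible_word (\<lambda>w y. F w (\<lambda>i. y (Suc i)))"
  shows "feasible_word (\<lambda>w x. if P w x then F w x else [])"
proof -
  have "feasible_word (\<lambda>w x. concat (map (\<lambda>i. F w x) [0..<of_bool (P w x)]))"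
    by (rule feasible_word_concat[OF feasible_pred_feasible[OF assms(1)] assms(2)])
  then show ?thesis by (rule feasible_word_cong) auto
qed

end


section \<open>Reading encoded formulas\<close>

text \<open>Position \<open>i\<close> carries the sign of a literal, and the numeral of its variable
  follows. The condition on \<open>j\<close> detects the end of the numeral, so that all bits beyond
  it count as 0.\<close>

definition bit_at :: "nat list \<Rightarrow> nat \<Rightarrow> nat \<Rightarrow> bool" where
  "bit_at w i k \<longleftrightarrow> symbol_at w (i + 1 + k) = 2 \<and> (\<forall>j<k. symbol_at w (i + 1 + j) = 1 \<or> symbol_at w (i + 1 + j) = 2)"

text \<open>With \<open>q\<close> the position of the 5 that opens a clause, \<open>i\<close> is the
  beginning of a literal of the same clause as long as no further 5 intervenes.\<close>

definition lit_of :: "nat list \<Rightarrow> nat \<Rightarrow> nat \<Rightarrow> bool" where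
  "lit_of w q i \<longleftrightarrow> q < i \<and> (symbol_at w i = 3 \<or> symbol_at w i = 4) \<and> (\<forall>j<Suc i. q < j \<longrightarrow> symbol_at w j \<noteq> 5)"

definition represents :: "nat list \<Rightarrow> nat \<Rightarrow> literal \<Rightarrow> bool" where
  "represents w i L \<longleftrightarrow> symbol_at w i = (case L of Pos _ \<Rightarrow> 3 | Neg _ \<Rightarrow> 4) \<and>
     (\<forall>k. bit_at w i k = odd (lit_var L div 2 ^ k))"

text \<open>The symbols before the first 5 are the numeral of the number of variables. The
  parameters of the reduction depend only on its length, so the number itself is never
  decoded.\<close>

definition header_length :: "nat list \<Rightarrow> nat" where
  "header_length w = (\<Sum>i<length w. of_bool (\<forall>j<Suc i. symbol_at w j \<noteq> 5))"

lemma set_bin: "set (bin n) \<subseteq> {1, 2}"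
proof (induction n rule: bin.induct)
  case (1 n)
  show ?case by (subst bin.simps) (use 1 in auto)
qed

lemma bin_0: "bin 0 = []"
  by (subst bin.simps) simp

lemma bin_less: "n < 2 ^ length (bin n)"
proof (induction n rule: bin.induct)
  case (1 n)
  show ?case
  proof (cases "n = 0")
    case False
    then have "n div 2 < 2 ^ length (bin (n div 2))" using 1 by simp
    then have "n < 2 * 2 ^ length (bin (n div 2))" by linarith
    then show ?thesis using False by (subst bin.simps) simp
  qed simp
qed

lemma bin_nth: "k < length (bin n) \<Longrightarrow> bin n ! k = 2 \<longleftrightarrow> odd (n div 2 ^ k)"
proof (induction n arbitrary: k rule: bin.induct)
  case (1 n)
  then have n: "n \<noteq> 0" using bin_0 by (metis list.size(3) not_less_zero)
  have b: "bin n = (if odd n then 2 else 1) # bin (n div 2)" using n by (subst bin.simps) simp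
  show ?case
  proof (cases k)
    case 0 then show ?thesis using b by simp
  next
    case (Suc k')
    then have "k' < length (bin (n div 2))" using 1(2) b by simp
    then show ?thesis using 1(1)[OF n, of k'] Suc b by (simp add: div_mult2_eq)
  qed
qed

lemma length_bin_le_iff: "length (bin v) \<le> e \<longleftrightarrow> v < 2 ^ e"
proof (induction v arbitrary: e rule: bin.induct)
  case (1 v)
  show ?case
  proof (cases "v = 0")
    case True then show ?thesis by (simp add: bin.simps)
  next
    case False
    have b: "length (bin v) = Suc (length (bin (v div 2)))" using False by (subst bin.simps) simp
    show ?thesis
    proof (cases e)
      case 0 then show ?thesis using b False by simp
    next
      case (Suc e')
      have "length (bin v) \<le> e \<longleftrightarrow> v div 2 < 2 ^ e'" using b 1[OF False, of e'] Suc by simp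
      also have "\<dots> \<longleftrightarrow> v < 2 ^ e" using Suc by auto
      finally show ?thesis .
    qed
  qed
qed

lemma sym_append: "symbol_at (u @ v) i = (if i < length u then u ! i else symbol_at v (i - length u))"
  by (auto simp: symbol_at_def nth_append)

lemma sym_Cons: "symbol_at (a # v) i = (if i = 0 then a else symbol_at v (i - 1))"
  by (cases i) (auto simp: symbol_at_def)

lemma bit_at_bin:
  assumes w: "w = pre @ s # bin v @ post" "symbol_at post 0 \<noteq> 1" "symbol_at post 0 \<noteq> 2"
  shows "bit_at w (length pre) k = odd (v div 2 ^ k)"
proof -
  have sy: "symbol_at w (length pre + 1 + j) = (if j < length (bin v) then bin v ! j else symbol_at post (j - length (bin v)))" for j
    unfolding w(1) by (simp add: sym_append sym_Cons)
  show ?thesis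
  proof (cases "k < length (bin v)")
    case True
    have "bin v ! j = 1 \<or> bin v ! j = 2" if "j < length (bin v)" for j using set_bin[of v] that nth_mem by blast
    then show ?thesis unfolding bit_at_def sy using True bin_nth[OF True] by auto
  next
    case False
    then have "(2::nat) ^ length (bin v) \<le> 2 ^ k" by (intro power_increasing) auto
    then have "v div 2 ^ k = 0" using bin_less[of v] by (intro div_less) linarith
    moreover have "\<not> bit_at w (length pre) k"
    proof (cases "k = length (bin v)")
      case True then show ?thesis unfolding bit_at_def sy using w(3) by simp
    next
      case False
      then have k: "length (bin v) < k" using \<open>\<not> k < length (bin v)\<close> by simp
      have "\<not> (symbol_at w (length pre + 1 + length (bin v)) = 1 \<or> symbol_at w (length pre + 1 + length (bin v)) = 2)"
        unfolding sy using w(2,3) by simp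
      then show ?thesis unfolding bit_at_def using k by blast
    qed
    ultimately show ?thesis by simp
  qed
qed

definition enc_body :: "clause \<Rightarrow> nat list" where
  "enc_body C = concat (map enc_lit C)"

definition enc_clauses :: "cnf \<Rightarrow> nat list" where
  "enc_clauses \<phi> = concat (map (\<lambda>C. 5 # enc_body C) \<phi>)"

lemma enc_cnf_eq: "enc_cnf n \<phi> = bin n @ enc_clauses \<phi>"
  by (simp add: enc_cnf_def enc_clauses_def enc_body_def)

lemma enc_lit_eq: "enc_lit L = (case L of Pos _ \<Rightarrow> 3 | Neg _ \<Rightarrow> 4) # bin (lit_var L)"
  by (cases L) auto

lemma set_enc_body: "set (enc_body C) \<subseteq> {1, 2, 3, 4}"
proof (induction C)
  case (Cons L C)
  have "set (enc_lit L) \<subseteq> {1, 2, 3, 4}" using set_bin[of "lit_var L"] by (cases L) auto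
  then show ?case using Cons by (simp add: enc_body_def)
qed (simp add: enc_body_def)

lemma set_enc_cnf: "set (enc_cnf n \<phi>) \<subseteq> {1, 2, 3, 4, 5}"
proof -
  have "set (enc_clauses \<phi>) \<subseteq> {1, 2, 3, 4, 5}"
  proof (induction \<phi>)
    case (Cons C \<phi>)
    then show ?case using set_enc_body[of C] by (auto simp: enc_clauses_def)
  qed (simp add: enc_clauses_def)
  then show ?thesis using set_bin[of n] by (auto simp: enc_cnf_eq)
qed

lemma sym_enc_clauses_0: "symbol_at (enc_clauses \<phi>) 0 \<in> {0, 5}"
  by (cases \<phi>) (auto simp: enc_clauses_def symbol_at_def)

lemma sym_enc_body_0: "symbol_at (enc_body C @ enc_clauses \<phi>) 0 \<notin> {1, 2}"
  using sym_enc_clauses_0[of \<phi>] by (cases C) (auto simp: enc_body_def enc_lit_eq sym_append symbol_at_def split: literal.splits)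

lemma enc_body_literal:
  assumes "r < length (enc_body C)" "enc_body C ! r \<in> {3, 4}"
  shows "\<exists>C1 L C2. C = C1 @ L # C2 \<and> r = length (enc_body C1)"
  using assms
proof (induction C arbitrary: r)
  case (Cons L C)
  have eb: "enc_body (L # C) = enc_lit L @ enc_body C" by (simp add: enc_body_def)
  show ?case
  proof (cases "r < length (enc_lit L)")
    case True
    have "r = 0"
    proof (rule ccontr)
      assume "r \<noteq> 0"
      then obtain r' where r': "r = Suc r'" by (cases r) auto
      then have "enc_body (L # C) ! r \<in> set (bin (lit_var L))"
        using True unfolding eb by (simp add: nth_append enc_lit_eq)
      then show False using set_bin[of "lit_var L"] Cons.prems(2) by fastforce
    qed
    then show ?thesis by (intro exI[of _ "[]"] exI[of _ L] exI[of _ C]) (simp add: enc_body_def)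
  next
    case False
    then have "r - length (enc_lit L) < length (enc_body C)" "enc_body C ! (r - length (enc_lit L)) \<in> {3, 4}"
      using Cons.prems unfolding eb by (auto simp: nth_append)
    then obtain C1 L' C2 where "C = C1 @ L' # C2" "r - length (enc_lit L) = length (enc_body C1)"
      using Cons.IH by blast
    then show ?thesis using False
      by (intro exI[of _ "L # C1"] exI[of _ L'] exI[of _ C2]) (simp add: enc_body_def)
  qed
qed (simp add: enc_body_def)

lemma represents_at:
  assumes w: "w = pre @ 5 # enc_body (C1 @ L # C2) @ enc_clauses \<phi>"
  shows "represents w (length pre + 1 + length (enc_body C1)) L"
    and "lit_of w (length pre) (length pre + 1 + length (enc_body C1))"
proof -
  let ?pre = "pre @ 5 # enc_body C1"
  let ?s = "case L of Pos _ \<Rightarrow> 3 | Neg _ \<Rightarrow> (4::nat)"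
  have w': "w = ?pre @ ?s # bin (lit_var L) @ (enc_body C2 @ enc_clauses \<phi>)"
    unfolding w by (simp add: enc_body_def enc_lit_eq)
  have len: "length ?pre = length pre + 1 + length (enc_body C1)" by simp
  have s: "symbol_at w (length ?pre) = ?s" unfolding w' by (simp only: sym_append) (simp add: symbol_at_def)
  show "represents w (length pre + 1 + length (enc_body C1)) L"
    unfolding represents_def len[symmetric]
    using s bit_at_bin[OF w'] sym_enc_body_0[of C2 \<phi>] by simp
  have "symbol_at w j \<noteq> 5" if "length pre < j" "j < Suc (length ?pre)" for j
  proof (cases "j = length ?pre")
    case True then show ?thesis using s by (cases L) auto
  next
    case False
    then have j: "j < length ?pre" using that by simp
    then have "symbol_at w j = ?pre ! j" unfolding w' by (simp only: sym_append if_True)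
    also have "\<dots> = enc_body C1 ! (j - length pre - 1)" using that j by (simp add: nth_append nth_Cons')
    also have "\<dots> \<in> set (enc_body C1)" using that j by (intro nth_mem) auto
    finally show ?thesis using set_enc_body[of C1] by auto
  qed
  then show "lit_of w (length pre) (length pre + 1 + length (enc_body C1))"
    unfolding lit_of_def len[symmetric] using s by (cases L) auto
qed

lemma lit_of_represents:
  assumes w: "w = pre @ 5 # enc_body C @ enc_clauses \<phi>" and i: "lit_of w (length pre) i"
  shows "\<exists>L\<in>set C. represents w i L"
proof -
  have sy: "symbol_at w (length pre + 1 + j) = (if j < length (enc_body C) then enc_body C ! j else symbol_at (enc_clauses \<phi>) (j - length (enc_body C)))" for j
    unfolding w by (simp add: sym_append sym_Cons)
  define r where "r = i - length pre - 1"
  have i': "i = length pre + 1 + r" using i by (auto simp: lit_of_def r_def)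
  have r: "r < length (enc_body C)"
  proof (rule ccontr)
    assume *: "\<not> r < length (enc_body C)"
    have si: "symbol_at w i \<in> {3, 4}" using i by (auto simp: lit_of_def)
    then have "enc_clauses \<phi> \<noteq> []" using sy[of r] * i' by (auto simp: symbol_at_def)
    then have "symbol_at (enc_clauses \<phi>) 0 = 5" using sym_enc_clauses_0[of \<phi>] by (cases \<phi>) (auto simp: enc_clauses_def symbol_at_def)
    then have "symbol_at w (length pre + 1 + length (enc_body C)) = 5" using sy[of "length (enc_body C)"] by simp
    then show False using i * i' unfolding lit_of_def by auto
  qed
  have "enc_body C ! r \<in> {3, 4}" using i r sy[of r] i' by (auto simp: lit_of_def)
  then obtain C1 L C2 where C: "C = C1 @ L # C2" "r = length (enc_body C1)" using enc_body_literal[OF r] by blast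
  then show ?thesis using represents_at(1)[of w pre C1 L C2 \<phi>] w i' by auto
qed

text \<open>For the step from a consistent \<open>G\<close> to a satisfying assignment: a clause
  that fails yields a position at which every literal read belongs to this clause.\<close>

lemma clause_position:
  assumes "C \<in> set \<phi>"
  shows "\<exists>q<length (enc_cnf n \<phi>). symbol_at (enc_cnf n \<phi>) q = 5 \<and> (\<forall>i. lit_of (enc_cnf n \<phi>) q i \<longrightarrow> (\<exists>L\<in>set C. represents (enc_cnf n \<phi>) i L))"
proof -
  obtain \<phi>1 \<phi>2 where \<phi>: "\<phi> = \<phi>1 @ C # \<phi>2" using assms split_list by metis
  have w: "enc_cnf n \<phi> = (bin n @ enc_clauses \<phi>1) @ 5 # enc_body C @ enc_clauses \<phi>2"
    unfolding enc_cnf_eq \<phi> by (simp add: enc_clauses_def)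
  let ?pre = "bin n @ enc_clauses \<phi>1"
  have "length ?pre < length (enc_cnf n \<phi>)" unfolding w by simp
  moreover have "symbol_at (enc_cnf n \<phi>) (length ?pre) = 5" unfolding w by (simp only: sym_append) (simp add: symbol_at_def)
  ultimately show ?thesis using lit_of_represents[OF w] by blast
qed

text \<open>For the step from a satisfying assignment to consistency: every position of a 5 belongs
  to some clause, and each literal of this clause, in particular a true one, can be found
  there.\<close>

lemma position_clause:
  assumes q: "symbol_at (enc_cnf n \<phi>) q = 5"
  shows "\<exists>C\<in>set \<phi>. \<forall>L\<in>set C. \<exists>i. i < length (enc_cnf n \<phi>) \<and> lit_of (enc_cnf n \<phi>) q i \<and> represents (enc_cnf n \<phi>) i L"
proof -
  have pos: "\<exists>\<phi>1 C \<phi>2. \<phi> = \<phi>1 @ C # \<phi>2 \<and> q = length (enc_clauses \<phi>1)" if "symbol_at (enc_clauses \<phi>) q = 5" for \<phi> q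
    using that
  proof (induction \<phi> arbitrary: q)
    case (Cons C \<phi>)
    have ec: "enc_clauses (C # \<phi>) = (5 # enc_body C) @ enc_clauses \<phi>" by (simp add: enc_clauses_def)
    show ?case
    proof (cases "q < length (5 # enc_body C)")
      case True
      have "q = 0"
      proof (rule ccontr)
        assume "q \<noteq> 0"
        then have "symbol_at (enc_clauses (C # \<phi>)) q \<in> set (enc_body C)"
          unfolding ec using True by (cases q) (auto simp: sym_append sym_Cons)
        then show False using Cons.prems set_enc_body[of C] by auto
      qed
      then show ?thesis by (intro exI[of _ "[]"] exI[of _ C] exI[of _ \<phi>]) (simp add: enc_clauses_def)
    next
      case False
      then have "symbol_at (enc_clauses \<phi>) (q - length (5 # enc_body C)) = 5"
        using Cons.prems unfolding ec by (simp add: sym_append sym_Cons split: if_splits)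
      from Cons.IH[OF this] obtain \<phi>1 C' \<phi>2 where "\<phi> = \<phi>1 @ C' # \<phi>2" "q - length (5 # enc_body C) = length (enc_clauses \<phi>1)" by blast
      then show ?thesis using False
        by (intro exI[of _ "C # \<phi>1"] exI[of _ C'] exI[of _ \<phi>2]) (simp add: enc_clauses_def)
    qed
  qed (simp add: enc_clauses_def symbol_at_def)
  have "\<not> q < length (bin n)"
  proof
    assume "q < length (bin n)"
    then have "symbol_at (enc_cnf n \<phi>) q \<in> set (bin n)" by (simp add: enc_cnf_eq sym_append)
    then show False using q set_bin[of n] by (auto simp: subset_iff)
  qed
  then have "symbol_at (enc_clauses \<phi>) (q - length (bin n)) = 5" using q by (simp add: enc_cnf_eq sym_append)
  from pos[OF this] obtain \<phi>1 C \<phi>2 where \<phi>: "\<phi> = \<phi>1 @ C # \<phi>2" "q - length (bin n) = length (enc_clauses \<phi>1)" by blast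
  let ?pre = "bin n @ enc_clauses \<phi>1"
  have q': "q = length ?pre" using \<phi>(2) \<open>\<not> q < length (bin n)\<close> by simp
  have "\<exists>i. i < length (enc_cnf n \<phi>) \<and> lit_of (enc_cnf n \<phi>) q i \<and> represents (enc_cnf n \<phi>) i L" if LC: "L \<in> set C" for L
  proof -
    obtain C1 C2 where C: "C = C1 @ L # C2" using split_list[OF LC] by blast
    have w: "enc_cnf n \<phi> = ?pre @ 5 # enc_body (C1 @ L # C2) @ enc_clauses \<phi>2"
      unfolding enc_cnf_eq \<phi>(1) C by (simp add: enc_clauses_def)
    have "length ?pre + 1 + length (enc_body C1) < length (enc_cnf n \<phi>)" unfolding w by (simp add: enc_body_def enc_lit_eq)
    then show ?thesis using represents_at[OF w] unfolding q' by blast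
  qed
  then show ?thesis using \<phi>(1) by auto
qed

lemma header_length_enc: "header_length (enc_cnf n \<phi>) = length (bin n)"
proof -
  let ?w = "enc_cnf n \<phi>"
  have lt: "symbol_at ?w j \<noteq> 5" if "j < length (bin n)" for j
  proof -
    have "symbol_at ?w j \<in> set (bin n)" using that by (simp add: enc_cnf_eq sym_append)
    then show ?thesis using set_bin[of n] by auto
  qed
  have "{i \<in> {..<length ?w}. \<forall>j<Suc i. symbol_at ?w j \<noteq> 5} = {..<length (bin n)}"
  proof (intro set_eqI iffI)
    fix i assume i: "i \<in> {i \<in> {..<length ?w}. \<forall>j<Suc i. symbol_at ?w j \<noteq> 5}"
    show "i \<in> {..<length (bin n)}"
    proof (rule ccontr)
      assume "i \<notin> {..<length (bin n)}"
      then have ge: "length (bin n) \<le> i" by simp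
      then have "enc_clauses \<phi> \<noteq> []" using i by (auto simp: enc_cnf_eq)
      then have "symbol_at (enc_clauses \<phi>) 0 = 5" using sym_enc_clauses_0[of \<phi>] by (cases \<phi>) (auto simp: enc_clauses_def symbol_at_def)
      then have "symbol_at ?w (length (bin n)) = 5" by (simp add: enc_cnf_eq sym_append)
      then show False using i ge by auto
    qed
  next
    fix i assume "i \<in> {..<length (bin n)}"
    then show "i \<in> {i \<in> {..<length ?w}. \<forall>j<Suc i. symbol_at ?w j \<noteq> 5}" using lt by (auto simp: enc_cnf_eq)
  qed
  then show ?thesis unfolding header_length_def by (simp add: of_bool_def sum.If_cases Int_def)
qed


section \<open>Cost of the circuit\<close>

text \<open>Powers are capped because a machine holds all values in unary. In the reduction the cap is
  never reached.\<close>
definition pw :: "nat \<Rightarrow> nat \<Rightarrow> nat \<Rightarrow> nat" where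
  "pw B a n = min B (a ^ n)"

definition cdig :: "nat \<Rightarrow> nat \<Rightarrow> nat \<Rightarrow> nat \<Rightarrow> nat" where
  "cdig B p x k = x div pw B p k mod p"

definition cpt :: "nat \<Rightarrow> nat \<Rightarrow> nat \<Rightarrow> nat \<Rightarrow> nat \<Rightarrow> nat \<Rightarrow> nat \<Rightarrow> nat \<Rightarrow> nat \<Rightarrow> nat \<Rightarrow> nat" where
  "cpt B p l y a b c s t u = (\<Sum>k<l. pw B p k * ((cdig B p y k * (1 + 3 * p - s - t - u) + s * cdig B p a k +
     t * cdig B p b k + u * cdig B p c k) mod p))"

definition cfev :: "nat \<Rightarrow> nat \<Rightarrow> nat \<Rightarrow> nat \<Rightarrow> nat \<Rightarrow> nat \<Rightarrow> nat \<Rightarrow> nat" where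
  "cfev B p l f s t u = (\<Sum>i<Suc l. \<Sum>j<Suc l. \<Sum>k<Suc l.
     cdig B p f (i + Suc l * (j + Suc l * k)) * (pw B s i * (pw B t j * pw B u k))) mod p"

definition cptj :: "nat \<Rightarrow> nat \<Rightarrow> nat \<Rightarrow> nat \<Rightarrow> nat \<Rightarrow> nat \<Rightarrow> nat \<Rightarrow> nat" where
  "cptj B p l X y \<theta> j = cpt B p l y (\<theta> mod X) (\<theta> div X mod X) (\<theta> div X div X mod X)
     (j mod p) (j div p mod p) (j div p div p mod p)"

definition cfj :: "nat \<Rightarrow> nat \<Rightarrow> nat \<Rightarrow> nat \<Rightarrow> nat \<Rightarrow> nat" where
  "cfj B p l f j = cfev B p l f (j mod p) (j div p mod p) (j div p div p mod p)"

definition clpt :: "nat \<Rightarrow> nat \<Rightarrow> nat \<Rightarrow> nat list \<Rightarrow> nat \<Rightarrow> nat" where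
  "clpt B p l w i = (\<Sum>k<l. pw B p k * of_bool (bit_at w i k))"

text \<open>The value 1 stands for true and every other residue for false.\<close>

definition falsified :: "nat \<Rightarrow> nat \<Rightarrow> nat \<Rightarrow> nat list \<Rightarrow> nat \<Rightarrow> nat \<Rightarrow> nat \<Rightarrow> bool" where
  "falsified B p l w i a v \<longleftrightarrow> clpt B p l w i = a \<and> (symbol_at w i = 3 \<longrightarrow> v \<noteq> 1) \<and> (symbol_at w i \<noteq> 3 \<longrightarrow> v = 1)"

text \<open>A literal located at none of the three points is not falsified, so a triple is held
  responsible only for clauses whose variables it covers. An empty clause has no literal positions
  and makes every triple inconsistent.\<close>

definition consistent :: "nat \<Rightarrow> nat \<Rightarrow> nat \<Rightarrow> nat list \<Rightarrow> nat \<Rightarrow> nat \<Rightarrow> nat \<Rightarrow> nat \<Rightarrow> nat \<Rightarrow> nat \<Rightarrow> bool" where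
  "consistent B p l w a b c va vb vc \<longleftrightarrow> \<not> (\<exists>q<length w. symbol_at w q = 5 \<and> (\<forall>i<length w. lit_of w q i \<longrightarrow>
     falsified B p l w i a va \<or> falsified B p l w i b vb \<or> falsified B p l w i c vc))"

definition cokc :: "nat \<Rightarrow> nat \<Rightarrow> nat \<Rightarrow> nat \<Rightarrow> nat list \<Rightarrow> nat \<Rightarrow> nat \<Rightarrow> bool" where
  "cokc B p l X w f \<theta> \<longleftrightarrow> consistent B p l w (\<theta> mod X) (\<theta> div X mod X) (\<theta> div X div X mod X)
     (cfev B p l f 1 0 0) (cfev B p l f 0 1 0) (cfev B p l f 0 0 1)"

lemma bin_eq_map: "bin v = map (\<lambda>i. if odd (v div 2 ^ i) then 2 else 1) [0..<length (bin v)]"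
proof (rule nth_equalityI)
  fix i assume i: "i < length (bin v)"
  have "bin v ! i \<in> {1, 2}" using set_bin[of v] nth_mem[OF i] by blast
  then show "bin v ! i = map (\<lambda>i. if odd (v div 2 ^ i) then 2 else 1) [0..<length (bin v)] ! i"
    using bin_nth[OF i] i by auto
qed simp

lemma length_bin_le: "length (bin v) \<le> v"
  using length_bin_le_iff[of v v] less_exp[of v] by blast

lemma concat_map_if: "n \<le> m \<Longrightarrow> concat (map (\<lambda>i. if i < n then [g i] else []) [0..<m]) = map g [0..<n]"
proof (induction m)
  case (Suc m)
  show ?case
  proof (cases "n = Suc m")
    case True
    then have "concat (map (\<lambda>i. if i < n then [g i] else []) [0..<Suc m]) = concat (map (\<lambda>i. [g i]) [0..<Suc m])"
      by (intro arg_cong[of _ _ concat] map_cong) auto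
    also have "\<dots> = map g [0..<n]" using True by (simp add: concat_map_singleton)
    finally show ?thesis .
  next
    case False
    then show ?thesis using Suc by simp
  qed
qed simp

text \<open>The numeral as a loop with bound \<open>v\<close>, which a word expression can produce.
  The cap \<open>Suc v\<close> does not affect the test, and whenever the test succeeds the power is
  exact.\<close>

lemma bin_eq_concat:
  "bin v = concat (map (\<lambda>i. if pw (Suc v) 2 i \<le> v then
     (if v div pw (Suc v) 2 i mod 2 = 1 then [2] else []) @ (if v div pw (Suc v) 2 i mod 2 = 0 then [1] else []) else []) [0..<v])"
proof -
  have pwi: "pw (Suc v) 2 i \<le> v \<longleftrightarrow> i < length (bin v)" for i
    using length_bin_le_iff[of v i] by (auto simp: pw_def min_def not_le[symmetric])
  have "bin v = concat (map (\<lambda>i. if i < length (bin v) then [if odd (v div 2 ^ i) then 2 else 1] else []) [0..<v])"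
    by (subst concat_map_if[OF length_bin_le]) (rule bin_eq_map)
  also have "\<dots> = concat (map (\<lambda>i. if pw (Suc v) 2 i \<le> v then
     (if v div pw (Suc v) 2 i mod 2 = 1 then [2] else []) @ (if v div pw (Suc v) 2 i mod 2 = 0 then [1] else []) else []) [0..<v])"
  proof (intro arg_cong[of _ _ concat] map_cong refl)
    fix i
    show "(if i < length (bin v) then [if odd (v div 2 ^ i) then 2 else 1] else []) =
      (if pw (Suc v) 2 i \<le> v then (if v div pw (Suc v) 2 i mod 2 = 1 then [2] else []) @ (if v div pw (Suc v) 2 i mod 2 = 0 then [1] else []) else [])"
    proof (cases "i < length (bin v)")
      case True
      then have "(2::nat) ^ i \<le> v" using length_bin_le_iff[of v i] by auto
      then have "pw (Suc v) 2 i = 2 ^ i" by (simp add: pw_def)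
      then show ?thesis using True pwi[of i] by (auto simp: odd_iff_mod_2_eq_one)
    qed (simp add: pwi)
  qed
  finally show ?thesis .
qed

context bounded_computation begin

lemma feasible_pw: "feasible B \<Longrightarrow> feasible a \<Longrightarrow> feasible n \<Longrightarrow> feasible (\<lambda>w x. pw (B w x) (a w x) (n w x))"
  unfolding pw_def by (rule feasible_capped_power)

lemma feasible_power: "feasible a \<Longrightarrow> feasible (\<lambda>w x. a w x ^ n)"
  by (induction n) (simp_all add: feasible_const[of "Suc 0"] feasible_mult)

lemma feasible_one: "feasible (\<lambda>w x. 1)" by (rule feasible_const)

lemmas feasible_arith = feasible_zero feasible_one feasible_var feasible_Suc feasible_sum feasible_add feasible_mult feasible_diff feasible_div feasible_mod feasible_pw feasible_pred_feasible

lemmas feasible_pred_logic = feasible_pred_conj feasible_pred_disj feasible_pred_imp feasible_pred_not feasible_pred_sym feasible_pred_ex feasible_pred_all feasible_pred_le feasible_pred_less feasible_pred_eq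

lemma feasible_cdig:
  assumes "feasible B" "feasible p" "feasible x" "feasible k"
  shows "feasible (\<lambda>w z. cdig (B w z) (p w z) (x w z) (k w z))"
  unfolding cdig_def by (intro feasible_arith assms)

lemma feasible_cpt:
  assumes "feasible B" "feasible p" "feasible l" "feasible y" "feasible a" "feasible b" "feasible c" "feasible s" "feasible t" "feasible u"
  shows "feasible (\<lambda>w z. cpt (B w z) (p w z) (l w z) (y w z) (a w z) (b w z) (c w z) (s w z) (t w z) (u w z))"
  unfolding cpt_def by (intro feasible_arith feasible_cdig feasible_const assms(3) assms[THEN feasible_ren])

lemma feasible_cfev:
  assumes "feasible B" "feasible p" "feasible l" "feasible f" "feasible s" "feasible t" "feasible u"
  shows "feasible (\<lambda>w z. cfev (B w z) (p w z) (l w z) (f w z) (s w z) (t w z) (u w z))"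
  unfolding cfev_def by (intro feasible_arith feasible_cdig assms(2,3) assms[THEN feasible_ren])

lemma feasible_cptj:
  assumes "feasible B" "feasible p" "feasible l" "feasible X" "feasible y" "feasible \<theta>" "feasible j"
  shows "feasible (\<lambda>w z. cptj (B w z) (p w z) (l w z) (X w z) (y w z) (\<theta> w z) (j w z))"
  unfolding cptj_def by (intro feasible_cpt feasible_arith assms)

lemma feasible_cfj:
  assumes "feasible B" "feasible p" "feasible l" "feasible f" "feasible j"
  shows "feasible (\<lambda>w z. cfj (B w z) (p w z) (l w z) (f w z) (j w z))"
  unfolding cfj_def by (intro feasible_cfev feasible_arith assms)

lemma feasible_pred_bit_at:
  assumes "feasible i" "feasible k"
  shows "feasible_pred (\<lambda>w x. bit_at w (i w x) (k w x))"
  unfolding bit_at_def by (intro feasible_pred_logic feasible_arith assms assms[THEN feasible_ren])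

lemma feasible_pred_lit_of:
  assumes "feasible q" "feasible i"
  shows "feasible_pred (\<lambda>w x. lit_of w (q w x) (i w x))"
  unfolding lit_of_def by (intro feasible_pred_logic feasible_arith assms assms[THEN feasible_ren])

lemma feasible_clpt:
  assumes "feasible B" "feasible p" "feasible l" "feasible i"
  shows "feasible (\<lambda>w x. clpt (B w x) (p w x) (l w x) w (i w x))"
  unfolding clpt_def by (intro feasible_arith feasible_pred_bit_at assms(3) assms[THEN feasible_ren])

lemma feasible_pred_falsified:
  assumes "feasible B" "feasible p" "feasible l" "feasible i" "feasible a" "feasible v"
  shows "feasible_pred (\<lambda>w x. falsified (B w x) (p w x) (l w x) w (i w x) (a w x) (v w x))"
  unfolding falsified_def by (intro feasible_pred_logic feasible_clpt feasible_one assms)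

lemma feasible_pred_consistent:
  assumes "feasible B" "feasible p" "feasible l" "feasible a" "feasible b" "feasible c" "feasible va" "feasible vb" "feasible vc"
  shows "feasible_pred (\<lambda>w x. consistent (B w x) (p w x) (l w x) w (a w x) (b w x) (c w x) (va w x) (vb w x) (vc w x))"
  unfolding consistent_def
  by (intro feasible_pred_logic feasible_pred_falsified feasible_pred_lit_of feasible_length feasible_var assms[THEN feasible_ren])

lemma feasible_pred_cokc:
  assumes "feasible B" "feasible p" "feasible l" "feasible X" "feasible f" "feasible \<theta>"
  shows "feasible_pred (\<lambda>w x. cokc (B w x) (p w x) (l w x) (X w x) w (f w x) (\<theta> w x))"
  unfolding cokc_def by (intro feasible_pred_consistent feasible_cfev feasible_arith assms)

lemma feasible_node_P: "feasible s \<Longrightarrow> feasible (\<lambda>w x. node_P (s w x))"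
  unfolding node_P_def by (intro feasible_mult feasible_const)

lemma feasible_node_D:
  assumes "feasible Q" "feasible s" "feasible y" "feasible v" "feasible \<tau>"
  shows "feasible (\<lambda>w x. node_D (Q w x) (s w x) (y w x) (v w x) (\<tau> w x))"
  unfolding node_D_def by (intro feasible_add feasible_mult feasible_const assms)

lemma feasible_node_A:
  assumes "feasible Q" "feasible s" "feasible t" "feasible y" "feasible \<theta>" "feasible f" "feasible j"
  shows "feasible (\<lambda>w x. node_A (Q w x) (s w x) (t w x) (y w x) (\<theta> w x) (f w x) (j w x))"
  unfolding node_A_def by (intro feasible_add feasible_mult assms) (rule feasible_const)+

lemma feasible_header_length: "feasible (\<lambda>w x. header_length w)"
  unfolding header_length_def by (intro feasible_sum feasible_length feasible_pred_feasible feasible_pred_logic feasible_Suc feasible_var)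

lemma feasible_length_bin: "feasible v \<Longrightarrow> feasible (\<lambda>w x. length (bin (v w x)))"
proof -
  assume v: "feasible v"
  have "(\<Sum>i<u. of_bool (pw (Suc u) 2 i \<le> u)) = length (bin u)" for u
  proof -
    have pwi: "pw (Suc u) 2 i \<le> u \<longleftrightarrow> i < length (bin u)" for i
      using length_bin_le_iff[of u i] by (auto simp: pw_def min_def not_le[symmetric])
    have "{i \<in> {..<u}. i < length (bin u)} = {..<length (bin u)}" using length_bin_le[of u] by auto
    then show ?thesis unfolding pwi by (simp add: of_bool_def sum.If_cases Int_def)
  qed
  moreover have "feasible (\<lambda>w x. \<Sum>i<v w x. of_bool (pw (Suc (v w x)) 2 i \<le> v w x))"
    by (intro feasible_sum feasible_pred_feasible feasible_pred_le feasible_pw feasible_Suc feasible_var v v[THEN feasible_ren]) (rule feasible_const)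
  ultimately show ?thesis by simp
qed

lemma feasible_word_bin: "feasible v \<Longrightarrow> feasible_word (\<lambda>w x. bin (v w x))"
proof -
  assume v: "feasible v"
  have two: "feasible (\<lambda>w x. 2)" by (rule feasible_const)
  have "feasible_word (\<lambda>w x. concat (map (\<lambda>i. if pw (Suc (v w x)) 2 i \<le> v w x then
     (if v w x div pw (Suc (v w x)) 2 i mod 2 = 1 then [2] else []) @
     (if v w x div pw (Suc (v w x)) 2 i mod 2 = 0 then [1] else []) else []) [0..<v w x]))"
    by (intro feasible_word_concat feasible_word_when feasible_word_append feasible_word_single feasible_pred_le feasible_pred_eq feasible_one feasible_zero feasible_mod feasible_div feasible_pw feasible_Suc feasible_var two v v[THEN feasible_ren])
  then show ?thesis by (simp only: bin_eq_concat[symmetric])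
qed

end


section \<open>The reduction\<close>

lemma concat_map_concat_map: "concat (map g (concat (map f xs))) = concat (map (\<lambda>x. concat (map g (f x))) xs)"
  by (induction xs) auto

definition is_prime_above :: "nat \<Rightarrow> nat \<Rightarrow> bool" where
  "is_prime_above a z \<longleftrightarrow> 1 < z \<and> (\<forall>c<z. \<forall>d<z. c * d \<noteq> z) \<and> a < z"

lemma is_prime_above_iff: "is_prime_above a z \<longleftrightarrow> prime z \<and> a < z"
proof -
  have "(1 < z \<and> (\<forall>c<z. \<forall>d<z. c * d \<noteq> z)) \<longleftrightarrow> prime z"
  proof
    assume a: "1 < z \<and> (\<forall>c<z. \<forall>d<z. c * d \<noteq> z)"
    show "prime z"
    proof (rule prime_nat_iff[THEN iffD2], intro conjI allI impI)
      show "1 < z" using a by simp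
      fix m assume "m dvd z"
      then obtain k where k: "z = m * k" by (elim dvdE)
      have "m \<noteq> 0" using a k by (intro notI) simp
      have "k \<noteq> 0" using a k by (intro notI) simp
      have "m \<le> z" "k \<le> z" using k \<open>m \<noteq> 0\<close> \<open>k \<noteq> 0\<close> by auto
      then have "m = z \<or> k = z" using a k by (metis le_neq_implies_less)
      then show "m = 1 \<or> m = z" using k \<open>k \<noteq> 0\<close> by auto
    qed
  next
    assume p: "prime z"
    have "c * d \<noteq> z" if "c < z" "d < z" for c d
    proof
      assume eq: "c * d = z"
      then have "c = 1 \<or> c = z" using p by (metis dvd_triv_left prime_nat_iff)
      then show False using that eq by auto
    qed
    then show "1 < z \<and> (\<forall>c<z. \<forall>d<z. c * d \<noteq> z)" using p prime_gt_1_nat by blast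
  qed
  then show ?thesis unfolding is_prime_above_def by blast
qed

text \<open>Counting the numbers below the least prime above \<open>a\<close> yields that prime, provided that it is
  at most \<open>b\<close>.\<close>
definition next_prime :: "nat \<Rightarrow> nat \<Rightarrow> nat" where
  "next_prime a b = (\<Sum>y<Suc b. of_bool (\<forall>z<Suc y. \<not> is_prime_above a z))"

lemma next_prime:
  assumes "\<exists>q. prime q \<and> a < q \<and> q \<le> b"
  shows "prime (next_prime a b)" "a < next_prime a b" "next_prime a b \<le> b"
proof -
  define q where "q = (LEAST q. is_prime_above a q)"
  have ex: "\<exists>q. is_prime_above a q" using assms by (auto simp: is_prime_above_iff)
  have q: "is_prime_above a q" unfolding q_def using ex by (rule LeastI_ex)
  have least: "q \<le> z" if "is_prime_above a z" for z unfolding q_def by (rule Least_le[of "is_prime_above a", OF that])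
  have "q \<le> b" using assms least by (auto simp: is_prime_above_iff intro: order_trans)
  have "{y \<in> {..<Suc b}. \<forall>z<Suc y. \<not> is_prime_above a z} = {..<q}"
  proof (intro equalityI subsetI)
    fix y assume y: "y \<in> {y \<in> {..<Suc b}. \<forall>z<Suc y. \<not> is_prime_above a z}"
    show "y \<in> {..<q}"
    proof (rule ccontr)
      assume "y \<notin> {..<q}"
      then have "q < Suc y" by simp
      then show False using y q by blast
    qed
  next
    fix y assume "y \<in> {..<q}"
    then show "y \<in> {y \<in> {..<Suc b}. \<forall>z<Suc y. \<not> is_prime_above a z}"
      using least \<open>q \<le> b\<close> by (auto simp: not_le[symmetric] dest!: least)
  qed
  then have "next_prime a b = q" unfolding next_prime_def by (simp add: of_bool_def sum.If_cases Int_def del: sum.lessThan_Suc)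
  then show "prime (next_prime a b)" "a < next_prime a b" "next_prime a b \<le> b"
    using q \<open>q \<le> b\<close> by (auto simp: is_prime_above_iff)
qed

text \<open>The offset \<open>l0\<close> makes the asymptotic estimates hold for every input:
  \<open>l0_power\<close> ensures that no cap is reached, \<open>l0_length\<close> that the input is
  no longer than the size parameter \<open>wB\<close>.\<close>

locale reduction =
  fixes l0 :: nat
  assumes l0_ge: "l0 \<ge> 6"
    and l0_power: "l \<ge> l0 \<Longrightarrow> (l ^ 26) ^ (Suc l ^ 3) \<le> 2 ^ (l ^ 4)"
    and l0_length: "cnf_on n \<phi> \<Longrightarrow> is_kcnf 3 \<phi> \<Longrightarrow> length (enc_cnf n \<phi>) \<le> 2 ^ ((l0 + length (bin n)) ^ 5)"
begin

definition W :: "nat list set" where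
  "W = {enc_cnf n \<phi> | n \<phi>. cnf_on n \<phi> \<and> is_kcnf 3 \<phi>}"

definition wl :: "nat list \<Rightarrow> nat" where "wl w = l0 + header_length w"
text \<open>At once the cap for powers, a bound on the input length and the unit of polynomial cost.
  It is still 2 ^ polylog in the number of variables.\<close>

definition wB :: "nat list \<Rightarrow> nat" where "wB w = 2 ^ (wl w ^ 5)"
text \<open>The exponent 5 is larger than the 4 in \<open>log N \<le> 15 * l ^ 4\<close>, so the gap
  outgrows every factor O(log N).\<close>

definition wA :: "nat list \<Rightarrow> nat" where "wA w = wl w ^ 5"
text \<open>The separation argument asks for a prime above about \<open>12 * l ^ 11\<close>, whence
  the lower end \<open>l ^ 13\<close>; the upper end is its square, below which
  \<open>prime_between_square\<close> provides a prime.\<close>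

definition wp :: "nat list \<Rightarrow> nat" where "wp w = next_prime (wl w ^ 13) (wl w ^ 26)"
definition wX :: "nat list \<Rightarrow> nat" where "wX w = pw (wB w) (wp w) (wl w)"
definition wE :: "nat list \<Rightarrow> nat" where "wE w = wX w * wX w * wX w"
definition wR :: "nat list \<Rightarrow> nat" where "wR w = 2 * wA w + 3"
definition wQ :: "nat list \<Rightarrow> nat" where "wQ w = pw (wB w) (wp w) (Suc (wl w) ^ 3)"
definition wD :: "nat list \<Rightarrow> nat" where "wD w = wQ w ^ 7"
text \<open>With this many selectors the \<open>6 * wD w ^ 2\<close> literals allowed for the rules
  equal \<open>6 * wr w\<close>, which the upper bound \<open>8 * (wr w * wX w)\<close>
  absorbs.\<close>

definition wr :: "nat list \<Rightarrow> nat" where "wr w = wD w * wD w"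

definition wrule :: "nat list \<Rightarrow> nat \<Rightarrow> nat \<Rightarrow> nat \<Rightarrow> bool" where
  "wrule w = rule_of (wp w) (wX w) (wE w) (wR w) (wQ w) (\<lambda>y \<theta> j. cptj (wB w) (wp w) (wl w) (wX w) y \<theta> j)
     (\<lambda>f j. cfj (wB w) (wp w) (wl w) f j) (\<lambda>f \<theta>. cokc (wB w) (wp w) (wl w) (wX w) w f \<theta>)"

definition wPs :: "nat list \<Rightarrow> nat set" where
  "wPs w = {u. \<exists>s<wp w * wX w. u = node_P s}"

definition wcnf :: "nat list \<Rightarrow> cnf" where
  "wcnf w = horn_cnf (wD w) (wr w) (wrule w) (wPs w)"

definition wN :: "nat list \<Rightarrow> nat" where "wN w = wD w + wr w"

text \<open>The binary logarithm, rounded down, of the lower bound for unsatisfiable inputs. A power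
  of 2 as threshold reduces the comparison to the length of the output numeral.\<close>

definition wthr :: "nat list \<Rightarrow> nat" where
  "wthr w = length (bin (wr w * (wA w * wX w))) - 1"

sublocale bounded_computation W wB
proof
  fix w assume "w \<in> W"
  then obtain n \<phi> where w: "w = enc_cnf n \<phi>" "cnf_on n \<phi>" "is_kcnf 3 \<phi>" by (auto simp: W_def)
  have "wl w = l0 + length (bin n)" by (simp add: wl_def w(1) header_length_enc)
  then show "length w \<le> wB w" using l0_length[OF w(2,3)] w(1) by (simp add: wB_def)
  have "wl w ^ 5 \<ge> 1" using l0_ge by (simp add: wl_def)
  then have "(2::nat) ^ 1 \<le> 2 ^ (wl w ^ 5)" by (intro power_increasing) auto
  then show "2 \<le> wB w" by (simp add: wB_def)
qed

section \<open>Feasibility of the parameters and of the output\<close>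

lemma feasible_wl: "feasible (\<lambda>w x. wl w)"
  unfolding wl_def by (intro feasible_add feasible_const feasible_header_length)

lemma feasible_wB: "feasible (\<lambda>w x. wB w)"
proof -
  have r: "rec_nat 1 (\<lambda>i r. r + r) m = (2::nat) ^ m" for m by (induction m) auto
  have "feasible (\<lambda>w x. rec_nat 1 (\<lambda>i r. r + r) (wl w ^ 5))"
  proof (rule feasible_rec[where b = "\<lambda>w x i r. r + r" and \<rho> = "\<lambda>w x. wB w"])
    show "rec_nat 1 (\<lambda>i r. r + r) k \<le> wB w" if "k \<le> wl w ^ 5" for w k
      unfolding r wB_def using that by (intro power_increasing) auto
  qed (auto intro!: feasible_power feasible_wl feasible_const feasible_add feasible_var pb_beta)
  then show ?thesis by (simp only: r wB_def[symmetric])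
qed

lemma feasible_wA: "feasible (\<lambda>w x. wA w)" unfolding wA_def by (intro feasible_power feasible_wl)

lemma feasible_wp: "feasible (\<lambda>w x. wp w)"
  unfolding wp_def next_prime_def is_prime_above_def
  by (intro feasible_sum feasible_pred_feasible feasible_pred_logic feasible_Suc feasible_power feasible_wl feasible_mult feasible_var feasible_one)

lemma feasible_wX: "feasible (\<lambda>w x. wX w)" unfolding wX_def by (intro feasible_pw feasible_wB feasible_wp feasible_wl)
lemma feasible_wE: "feasible (\<lambda>w x. wE w)" unfolding wE_def by (intro feasible_mult feasible_wX)
lemma feasible_wR: "feasible (\<lambda>w x. wR w)" unfolding wR_def by (intro feasible_add feasible_mult feasible_wA feasible_const)
lemma feasible_wQ: "feasible (\<lambda>w x. wQ w)" unfolding wQ_def by (intro feasible_pw feasible_wB feasible_wp feasible_wl feasible_power feasible_Suc)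
lemma feasible_wD: "feasible (\<lambda>w x. wD w)" unfolding wD_def by (intro feasible_power feasible_wQ)
lemma feasible_wr: "feasible (\<lambda>w x. wr w)" unfolding wr_def by (intro feasible_mult feasible_wD)
lemma feasible_wthr: "feasible (\<lambda>w x. wthr w)"
  unfolding wthr_def by (intro feasible_diff feasible_length_bin feasible_mult feasible_wr feasible_wA feasible_wX feasible_const)

lemmas feasible_params = feasible_wl feasible_wB feasible_wA feasible_wp feasible_wX feasible_wE feasible_wR feasible_wQ feasible_wD feasible_wr

lemma feasible_pred_wrule:
  assumes "feasible b" "feasible c" "feasible h"
  shows "feasible_pred (\<lambda>w x. wrule w (b w x) (c w x) (h w x))"
  unfolding wrule_def rule_of_def
  by (intro feasible_pred_disj feasible_pred_ex feasible_pred_conj feasible_pred_eq feasible_pred_cokc feasible_node_P feasible_node_D feasible_node_A feasible_cptj feasible_cfj feasible_zero feasible_var feasible_params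
      feasible_mult feasible_add feasible_Suc feasible_diff feasible_one assms[THEN feasible_ren])

lemma feasible_pred_wPs:
  assumes "feasible u"
  shows "feasible_pred (\<lambda>w x. u w x \<in> wPs w)"
  unfolding wPs_def mem_Collect_eq
  by (intro feasible_pred_ex feasible_pred_eq feasible_node_P feasible_var feasible_params feasible_mult feasible_ren[OF assms])

lemma enc_horn:
  "enc_cnf (D + r) (horn_cnf D r R S) = bin (D + r) @
    concat (map (\<lambda>b. concat (map (\<lambda>c. concat (map (\<lambda>h. if R b c h then
       5 # 4 # bin b @ (if b \<noteq> c then 4 # bin c else []) @ 3 # bin h else []) [0..<D])) [0..<D])) [0..<D]) @
    concat (map (\<lambda>k. concat (map (\<lambda>u. if u \<in> S then 5 # 4 # bin (D + k) @ 3 # bin u else []) [0..<D])) [0..<r])"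
proof -
  let ?e = "\<lambda>C. 5 # concat (map enc_lit C)"
  have 1: "concat (map ?e (if R b c h then [rule_clause b c h] else [])) =
     (if R b c h then 5 # 4 # bin b @ (if b \<noteq> c then 4 # bin c else []) @ 3 # bin h else [])" for b c h
    by (simp add: rule_clause_def)
  have 2: "concat (map ?e (if u \<in> S then [[Neg (D + k), Pos u]] else [])) =
     (if u \<in> S then 5 # 4 # bin (D + k) @ 3 # bin u else [])" for u k by simp
  show ?thesis
    unfolding enc_cnf_def horn_cnf_def rules_cnf_def selectors_cnf_def map_append concat_append
      concat_map_concat_map 1 2 ..
qed

lemma feasible_word_output: "feasible_word (\<lambda>w x. enc_cnf (wN w) (wcnf w))"
  unfolding wN_def wcnf_def enc_horn
  by (intro feasible_word_append feasible_word_bin feasible_word_concat feasible_word_when feasible_word_Cons feasible_pred_wrule feasible_pred_wPs feasible_pred_not feasible_pred_eq feasible_add feasible_var feasible_params feasible_word_Nil)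

end


section \<open>Correctness of the reduction\<close>

lemma pw_eq: "a ^ k \<le> B \<Longrightarrow> pw B a k = a ^ k"
  by (simp add: pw_def)

context prime_digits begin

lemma pt_vertex:
  assumes "a < p ^ l" "b < p ^ l" "c < p ^ l"
  shows "pt y a b c 1 0 0 = a" "pt y a b c 0 1 0 = b" "pt y a b c 0 0 1 = c"
proof -
  \<comment> \<open>At these three parameter values the weight of \<open>y\<close> is
    \<open>3 * p\<close>, which vanishes modulo \<open>p\<close>.\<close>
  have m: "(d * (3 * p) + e) mod p = e mod p" for d e :: nat
    using mod_mult_self1[of e "d * 3" p] by (simp add: ac_simps)
  have eq: "dig p x k mod p = dig p x k" for x k by (simp add: dig_def)
  show "pt y a b c 1 0 0 = a" by (rule dig_eqI[OF pt_less assms(1)]) (simp add: dig_pt m eq)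
  show "pt y a b c 0 1 0 = b" by (rule dig_eqI[OF pt_less assms(2)]) (simp add: dig_pt m eq)
  show "pt y a b c 0 0 1 = c" by (rule dig_eqI[OF pt_less assms(3)]) (simp add: dig_pt m eq)
qed

end

locale reduction_instance = reduction +
  fixes n :: nat and \<phi> :: cnf
  assumes cnf_\<phi>: "cnf_on n \<phi>" and kcnf_\<phi>: "is_kcnf 3 \<phi>"
begin

abbreviation "w \<equiv> enc_cnf n \<phi>"
abbreviation "l \<equiv> wl w"
abbreviation "p \<equiv> wp w"
abbreviation "B \<equiv> wB w"

lemma w_in: "w \<in> W" using cnf_\<phi> kcnf_\<phi> by (auto simp: W_def)

lemma l_eq: "l = l0 + length (bin n)" by (simp add: wl_def header_length_enc)

lemma l_ge: "6 \<le> l" "l0 \<le> l" using l0_ge by (auto simp: wl_def)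

lemma n_less: "n < 2 ^ l"
proof -
  have "n < 2 ^ length (bin n)" by (rule bin_less)
  also have "\<dots> \<le> 2 ^ l" by (intro power_increasing) (auto simp: l_eq)
  finally show ?thesis .
qed

lemma p_bounds: "prime p" "l ^ 13 < p" "p \<le> l ^ 26"
proof -
  have "(6::nat) ^ 2 \<le> l ^ 2" using l_ge by (intro power_mono) auto
  also have "\<dots> \<le> l ^ 13" using l_ge by (intro power_increasing) auto
  finally have "16 \<le> l ^ 13" by simp
  then have "\<exists>q. prime q \<and> l ^ 13 < q \<and> q \<le> (l ^ 13) ^ 2" by (rule prime_between_square)
  then have "\<exists>q. prime q \<and> l ^ 13 < q \<and> q \<le> l ^ 26" by (simp add: power_mult[symmetric])
  from next_prime[OF this] show "prime p" "l ^ 13 < p" "p \<le> l ^ 26" by (auto simp: wp_def)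
qed

lemma p_gt_1: "1 < p" using p_bounds(1) prime_gt_1_nat by blast

lemma power_p_le: "k \<le> Suc l ^ 3 \<Longrightarrow> p ^ k \<le> 2 ^ (l ^ 4)"
proof -
  assume "k \<le> Suc l ^ 3"
  then have "p ^ k \<le> p ^ (Suc l ^ 3)" using p_gt_1 by (intro power_increasing) auto
  also have "\<dots> \<le> (l ^ 26) ^ (Suc l ^ 3)" using p_bounds by (intro power_mono) auto
  also have "\<dots> \<le> 2 ^ (l ^ 4)" by (rule l0_power[OF l_ge(2)])
  finally show ?thesis .
qed

lemma power_p_le_B: "k \<le> Suc l ^ 3 \<Longrightarrow> p ^ k \<le> B"
proof -
  assume "k \<le> Suc l ^ 3"
  then have "p ^ k \<le> 2 ^ (l ^ 4)" by (rule power_p_le)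
  also have "\<dots> \<le> B" unfolding wB_def using l_ge by (intro power_increasing) auto
  finally show ?thesis .
qed

lemma l_le: "3 * l + 1 \<le> Suc l ^ 3"
proof -
  have "Suc l ^ 3 = l ^ 3 + 3 * l ^ 2 + (3 * l + 1)" by (simp add: power3_eq_cube power2_eq_square algebra_simps)
  then show ?thesis by simp
qed

sublocale C: circuit p l "wA w" "consistent B p l w"
proof
  show "prime p" by (rule p_bounds)
  have l5: "1 \<le> l ^ 5" using l_ge by simp
  have "(2 * l ^ 5 + 1) ^ 2 \<le> (3 * l ^ 5) ^ 2" using l5 by (intro power_mono) auto
  also have "\<dots> = 9 * l ^ 10" by (simp add: power_mult_distrib power_mult[symmetric])
  finally have "3 * l * (2 * l ^ 5 + 1) ^ 2 \<le> 3 * l * (9 * l ^ 10)" by (intro mult_left_mono) auto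
  also have "\<dots> = 27 * l ^ 11" using power_Suc[of l 10] by simp
  finally have a: "3 * l * (2 * l ^ 5 + 1) ^ 2 + 1 \<le> 36 * l ^ 11"
    using one_le_power[of l 11] l_ge by linarith
  \<comment> \<open>The lower bound 6 for \<open>l\<close> absorbs the constant 36 into two powers
    of \<open>l\<close>, which gives the exponent 13.\<close>
  have "6 * 6 \<le> l * l" using l_ge by (intro mult_mono) auto
  then have "36 * l ^ 11 \<le> l * l * l ^ 11" by (intro mult_right_mono) auto
  also have "\<dots> = l ^ 13" by (simp add: power_add[symmetric] mult.assoc power_Suc[symmetric] del: power_Suc)
  finally have b: "36 * l ^ 11 \<le> l ^ 13" .
  show "3 * l * (2 * wA w + 1)\<^sup>2 + 1 < p" using a b p_bounds(2) by (simp add: wA_def)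
  have "l ^ 5 \<le> l ^ 11" using l_ge by (intro power_increasing) auto
  then have A: "2 * wA w + 3 < p" using b l5 p_bounds(2) unfolding wA_def by linarith
  then show "wA w < p" by simp
  have "(2 * wA w + 3) * (p ^ l * p ^ l * p ^ l) < p * (p ^ l * p ^ l * p ^ l)"
    using A p_gt_1 by (intro mult_strict_right_mono) auto
  also have "\<dots> = p ^ (3 * l + 1)" by (simp add: power_add mult_2 numeral_3_eq_3)
  also have "\<dots> \<le> p ^ (Suc l ^ 3)" using l_le p_gt_1 by (intro power_increasing) auto
  finally show "(2 * wA w + 3) * (p ^ l * p ^ l * p ^ l) < p ^ Suc l ^ 3" .
  have "p ^ (l + 1) \<le> p ^ (Suc l ^ 3)" using l_le p_gt_1 by (intro power_increasing) auto
  then show "p * p ^ l \<le> p ^ Suc l ^ 3" by simp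
  have "p ^ 3 \<le> p ^ (Suc l ^ 3)" using l_le l_ge p_gt_1 by (intro power_increasing) auto
  then show "p * p * p \<le> p ^ Suc l ^ 3" by (simp add: power3_eq_cube)
qed

lemma wX_eq: "wX w = C.X"
  using l_le by (simp add: wX_def C.X_def pw_eq power_p_le_B)

lemma wQ_eq: "wQ w = C.fnum"
  by (simp add: wQ_def C.fnum_def pw_eq power_p_le_B)

lemma wE_eq: "wE w = C.E" by (simp add: wE_def C.E_def wX_eq)
lemma wR_eq: "wR w = C.R" by (simp add: wR_def C.R_def)

lemma cdig_eq: "k \<le> Suc l ^ 3 \<Longrightarrow> cdig B p x k = dig p x k"
  by (simp add: cdig_def dig_def pw_eq power_p_le_B)

lemma pw_small: "s < p \<Longrightarrow> i \<le> l \<Longrightarrow> pw B s i = s ^ i"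
proof -
  assume "s < p" "i \<le> l"
  then have "s ^ i \<le> p ^ i" by (intro power_mono) auto
  also have "\<dots> \<le> B" using l_le \<open>i \<le> l\<close> by (intro power_p_le_B) linarith
  finally show ?thesis by (rule pw_eq)
qed

lemma cpt_eq: "cpt B p l y a b c s t u = C.pt y a b c s t u"
  unfolding cpt_def C.pt_def
proof (intro sum.cong refl)
  fix k assume "k \<in> {..<l}"
  then have "k \<le> Suc l ^ 3" using l_le by auto
  then show "pw B p k * ((cdig B p y k * (1 + 3 * p - s - t - u) + s * cdig B p a k + t * cdig B p b k + u * cdig B p c k) mod p) =
      p ^ k * ((dig p y k * (1 + 3 * p - s - t - u) + s * dig p a k + t * dig p b k + u * dig p c k) mod p)"
    by (simp add: cdig_eq pw_eq power_p_le_B)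
qed

lemma cfev_eq:
  assumes "s < p" "t < p" "u < p"
  shows "cfev B p l f s t u = C.fev f s t u"
  unfolding cfev_def C.fev_def
proof (intro arg_cong[of _ _ "\<lambda>x. x mod p"] sum.cong refl)
  fix i j k assume "i \<in> {..<Suc l}" "j \<in> {..<Suc l}" "k \<in> {..<Suc l}"
  then have *: "i < Suc l" "j < Suc l" "k < Suc l" by auto
  have "i + Suc l * (j + Suc l * k) < Suc l * (Suc l * Suc l)" by (intro mixed_radix_less *)
  then have "i + Suc l * (j + Suc l * k) \<le> Suc l ^ 3" by (simp only: power3_eq_cube mult.assoc less_imp_le)
  then show "cdig B p f (i + Suc l * (j + Suc l * k)) * (pw B s i * (pw B t j * pw B u k)) =
      dig p f (i + Suc l * (j + Suc l * k)) * (s ^ i * (t ^ j * u ^ k))"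
    using * assms by (simp only: cdig_eq pw_small less_Suc_eq_le)
qed

lemma wrule_eq: "wrule w = C.Rule"
proof -
  have "cptj B p l (wX w) = C.ptj"
    by (intro ext) (simp only: cptj_def C.ptj_def cpt_eq wX_eq)
  moreover have "cfj B p l = C.fj"
    by (intro ext) (use p_gt_1 in \<open>simp add: cfj_def C.fj_def cfev_eq\<close>)
  moreover have "cokc B p l (wX w) w = C.okc"
    by (intro ext) (use p_gt_1 in \<open>simp add: cokc_def C.okc_def cfev_eq wX_eq\<close>)
  ultimately show ?thesis by (simp add: wrule_def wX_eq wE_eq wR_eq wQ_eq)
qed

lemma wPs_eq: "wPs w = C.Ps"
  by (auto simp: wPs_def C.Ps_def wX_eq)

lemma wcnf_eq: "wcnf w = horn_cnf (C.fnum ^ 7) (wr w) C.Rule C.Ps"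
  by (simp only: wcnf_def wD_def wQ_eq wrule_eq wPs_eq)

lemma wN_eq: "wN w = C.fnum ^ 7 + wr w"
  by (simp only: wN_def wD_def wQ_eq)

lemma clpt_eq: "represents w i L \<Longrightarrow> clpt B p l w i = C.vpt (lit_var L)"
  unfolding clpt_def C.vpt_def
proof (intro sum.cong refl)
  fix k assume r: "represents w i L" and "k \<in> {..<l}"
  then have "k \<le> Suc l ^ 3" using l_le by auto
  then show "pw B p k * of_bool (bit_at w i k) = p ^ k * of_bool (odd (lit_var L div 2 ^ k))"
    using r by (simp add: pw_eq power_p_le_B represents_def)
qed

lemma falsified_iff: "represents w i L \<Longrightarrow>
    falsified B p l w i a v \<longleftrightarrow> C.vpt (lit_var L) = a \<and> \<not> lit_true (\<lambda>_. v = 1) L"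
  unfolding falsified_def clpt_eq by (cases L) (auto simp: represents_def)

lemma lit_var_less: "C \<in> set \<phi> \<Longrightarrow> L \<in> set C \<Longrightarrow> lit_var L < 2 ^ l"
  using cnf_\<phi> order.strict_trans[OF _ n_less] unfolding cnf_on_def by blast

lemma lit_true_at: "lit_true \<alpha> L \<longleftrightarrow> lit_true (\<lambda>_. \<alpha> (lit_var L)) L"
  by (cases L) auto

text \<open>At the vertex of a variable the extension returns its truth value, so a true literal of
  a clause cannot be falsified at any of the three points.\<close>

lemma consistent_mext:
  assumes sat: "cnf_fun \<phi> \<alpha>"
  shows "consistent B p l w a b c (C.mext \<alpha> a) (C.mext \<alpha> b) (C.mext \<alpha> c)"
  unfolding consistent_def
proof
  assume "\<exists>q<length w. symbol_at w q = 5 \<and> (\<forall>i<length w. lit_of w q i \<longrightarrow>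
     falsified B p l w i a (C.mext \<alpha> a) \<or> falsified B p l w i b (C.mext \<alpha> b) \<or> falsified B p l w i c (C.mext \<alpha> c))"
  then obtain q where q: "symbol_at w q = 5" and *: "\<forall>i<length w. lit_of w q i \<longrightarrow>
     falsified B p l w i a (C.mext \<alpha> a) \<or> falsified B p l w i b (C.mext \<alpha> b) \<or> falsified B p l w i c (C.mext \<alpha> c)"
    by (elim exE conjE)
  have all: "\<exists>x. falsified B p l w i x (C.mext \<alpha> x)" if "i < length w" "lit_of w q i" for i
    using *[rule_format, OF that] by (elim disjE) (erule exI)+
  obtain C where C: "C \<in> set \<phi>" "\<And>L. L \<in> set C \<Longrightarrow> \<exists>i. i < length w \<and> lit_of w q i \<and> represents w i L"
    using position_clause[OF q] by blast
  obtain L where L: "L \<in> set C" "lit_true \<alpha> L" using sat C(1) by (auto simp: cnf_fun_def)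
  obtain i where i: "i < length w" "lit_of w q i" "represents w i L" using C(2)[OF L(1)] by blast
  obtain x where x: "falsified B p l w i x (C.mext \<alpha> x)" using all[OF i(1,2)] by blast
  then have "C.vpt (lit_var L) = x" "\<not> lit_true (\<lambda>_. C.mext \<alpha> x = 1) L" by (simp_all add: falsified_iff[OF i(3)])
  moreover have "C.mext \<alpha> (C.vpt (lit_var L)) = of_bool (\<alpha> (lit_var L))"
    by (rule C.mext_vpt[OF lit_var_less[OF C(1) L(1)]])
  ultimately have "\<not> lit_true (\<lambda>_. \<alpha> (lit_var L)) L"
    by (cases "\<alpha> (lit_var L)") simp_all
  then show False using L(2) lit_true_at by blast
qed

lemma satisfiable_generating_set:
  assumes "satisfiable \<phi>"
  shows "\<exists>S\<subseteq>C.Ps. C.Ps \<subseteq> closure_of C.Rule S \<and> card S \<le> C.X"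
proof -
  obtain \<alpha> where \<alpha>: "cnf_fun \<phi> \<alpha>" using assms by (auto simp: satisfiable_def)
  show ?thesis
  proof (rule C.generating_set[of "C.mext \<alpha>"])
    fix y \<theta> assume "y < C.X" "\<theta> < C.E"
    define a where "a = \<theta> mod C.X"
    define b where "b = \<theta> div C.X mod C.X"
    define c where "c = \<theta> div C.X div C.X mod C.X"
    have abc: "a < p ^ l" "b < p ^ l" "c < p ^ l"
      using p_gt_1 by (simp_all add: a_def b_def c_def C.X_def)
    obtain f where f: "f < C.fnum" "\<And>s t u. s < p \<Longrightarrow> t < p \<Longrightarrow> u < p \<Longrightarrow> C.fev f s t u = C.mext \<alpha> (C.pt y a b c s t u)"
      using C.mext_pt[of \<alpha> y a b c] by (auto simp: C.Fs_def)
    have p0: "0 < p" "1 < p" using p_gt_1 by auto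
    have "C.okc f \<theta>"
      unfolding C.okc_def a_def[symmetric] b_def[symmetric] c_def[symmetric] f(2)[OF p0(2) p0(1) p0(1)]
        f(2)[OF p0(1) p0(2) p0(1)] f(2)[OF p0(1) p0(1) p0(2)] C.pt_vertex[OF abc]
      by (rule consistent_mext[OF \<alpha>])
    moreover have "C.fj f j = C.mext \<alpha> (C.ptj y \<theta> j)" for j
      using p0 by (simp add: C.fj_def C.ptj_def f(2) a_def b_def c_def)
    ultimately show "\<exists>f<C.fnum. C.okc f \<theta> \<and> (\<forall>j<p * p * p. C.fj f j = C.mext \<alpha> (C.ptj y \<theta> j))"
      using f(1) by blast
  qed (rule C.mext_less)
qed

lemma three_slots: "length (xs :: 'a list) \<le> 3 \<Longrightarrow> xs \<noteq> [] \<Longrightarrow> \<exists>a\<in>set xs. \<exists>b\<in>set xs. \<exists>c\<in>set xs. set xs \<subseteq> {a, b, c}"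
  by (cases xs; cases "tl xs"; cases "tl (tl xs)") (auto simp: numeral_3_eq_3)

text \<open>A clause has at most three literals, so some triple covers all its variables, with
  points repeated or arbitrary if there are fewer. If the assignment read off \<open>G\<close>
  falsified the clause, this triple would be inconsistent.\<close>

lemma satisfiable_from_consistent:
  assumes G: "\<forall>a<C.X. \<forall>b<C.X. \<forall>c<C.X. consistent B p l w a b c (G a) (G b) (G c)"
  shows "satisfiable \<phi>"
proof -
  define \<alpha> where "\<alpha> v \<longleftrightarrow> G (C.vpt v) = 1" for v
  have "\<exists>L\<in>set C. lit_true \<alpha> L" if C: "C \<in> set \<phi>" for C
  proof (rule ccontr)
    assume no: "\<not> (\<exists>L\<in>set C. lit_true \<alpha> L)"
    obtain q where q: "q < length w" "symbol_at w q = 5" "\<And>i. lit_of w q i \<Longrightarrow> \<exists>L\<in>set C. represents w i L"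
      using clause_position[OF C] by blast
    have len: "length (map (\<lambda>L. C.vpt (lit_var L)) C) \<le> 3" using kcnf_\<phi> C by (simp add: is_kcnf_def)
    have "\<exists>a<C.X. \<exists>b<C.X. \<exists>c<C.X. (\<lambda>L. C.vpt (lit_var L)) ` set C \<subseteq> {a, b, c}"
    proof (cases "C = []")
      case True
      then show ?thesis using C.X_pos by auto
    next
      case False
      have "C.vpt (lit_var L) < C.X" for L using C.vpt_less by (simp add: C.X_def)
      then show ?thesis using three_slots[OF len] False by auto
    qed
    then obtain a b c where abc: "a < C.X" "b < C.X" "c < C.X" "(\<lambda>L. C.vpt (lit_var L)) ` set C \<subseteq> {a, b, c}" by blast
    have "falsified B p l w i a (G a) \<or> falsified B p l w i b (G b) \<or> falsified B p l w i c (G c)" if i: "lit_of w q i" for i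
    proof -
      obtain L where L: "L \<in> set C" "represents w i L" using q(3)[OF i] by blast
      have "\<not> lit_true (\<lambda>_. G (C.vpt (lit_var L)) = 1) L"
        using no L(1) lit_true_at[of \<alpha> L] by (auto simp: \<alpha>_def)
      then have "falsified B p l w i (C.vpt (lit_var L)) (G (C.vpt (lit_var L)))"
        by (simp add: falsified_iff[OF L(2)])
      moreover have "C.vpt (lit_var L) \<in> {a, b, c}" using abc(4) L(1) by blast
      ultimately show ?thesis by auto
    qed
    then have "\<not> consistent B p l w a b c (G a) (G b) (G c)" unfolding consistent_def using q(1,2) by blast
    then show False using G abc by blast
  qed
  then show ?thesis by (auto simp: satisfiable_def cnf_fun_def)
qed

lemma wr_eq: "wr w = (C.fnum ^ 7) ^ 2"
  by (simp add: wr_def wD_def wQ_eq power2_eq_square)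

lemma satisfiable_upper_bound:
  assumes "satisfiable \<phi>" and QN: "\<Q> \<in> {UNIV, {\<psi>. is_kcnf 3 \<psi>}}" "\<N> \<in> {num_clauses, num_literals}"
  shows "min_pure_horn \<Q> \<N> (wN w) (cnf_fun (wcnf w)) \<le> 8 * (wr w * wX w)"
proof -
  obtain S where S: "S \<subseteq> C.Ps" "C.Ps \<subseteq> closure_of C.Rule S" "card S \<le> C.X"
    using satisfiable_generating_set[OF assms(1)] by blast
  have "min_pure_horn \<Q> \<N> (wN w) (cnf_fun (wcnf w)) \<le> 6 * wr w + 2 * (wr w * card S)"
    unfolding wN_eq wcnf_eq using C.min_pure_horn_upper_bound[OF S(1,2) QN, of "wr w"] wr_eq by simp
  \<comment> \<open>As \<open>wX w\<close> is positive, the part of the rules is absorbed, which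
    leads to the constant 8.\<close>
  also have "\<dots> \<le> 6 * (wr w * wX w) + 2 * (wr w * wX w)"
    using S(3) C.X_pos unfolding wX_eq by (intro add_mono mult_left_mono) auto
  also have "\<dots> = 8 * (wr w * wX w)" by simp
  finally show ?thesis .
qed

lemma unsatisfiable_lower_bound:
  assumes "\<not> satisfiable \<phi>" and QN: "\<Q> \<in> {UNIV, {\<psi>. is_kcnf 3 \<psi>}}" "\<N> \<in> {num_clauses, num_literals}"
  shows "wr w * (wA w * wX w) \<le> min_pure_horn \<Q> \<N> (wN w) (cnf_fun (wcnf w))"
  unfolding wN_eq wcnf_eq wX_eq
proof (rule C.min_pure_horn_lower_bound[OF _ QN])
  fix Y assume Y: "Y \<subseteq> {..<C.fnum ^ 7}" "C.Ps \<subseteq> closure_of C.Rule Y"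
  show "wA w * C.X \<le> card Y"
  proof (rule ccontr)
    assume "\<not> wA w * C.X \<le> card Y"
    then have "card Y \<le> wA w * C.X" by simp
    then have "\<exists>G. \<forall>a<C.X. \<forall>b<C.X. \<forall>c<C.X. consistent B p l w a b c (G a) (G b) (G c)"
      using Y C.generating_set_large[of Y] finite_subset[OF Y(1)] by blast
    then show False using satisfiable_from_consistent assms(1) by blast
  qed
qed

text \<open>The constant 3 is 2 for the rules, which number at most \<open>2 * D ^ 2\<close>, plus 1
  for the selector clauses, whose number is a product of two quantities bounded by the number of
  variables.\<close>

lemma wcnf_input: "horn_3cnf_input 3 (wN w) (wcnf w)"
proof -
  have "num_clauses (wcnf w) \<le> 2 * (C.fnum ^ 7) ^ 2 + wr w * card C.Ps"
    unfolding wcnf_eq by (rule C.num_clauses_horn_cnf) simp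
  also have "card C.Ps \<le> card {..<C.fnum ^ 7}" by (rule card_mono) (auto simp: C.P_less[THEN subsetD, simplified])
  also have "2 * (C.fnum ^ 7) ^ 2 + wr w * card {..<C.fnum ^ 7} \<le> 2 * (wN w) ^ 2 + wN w * wN w"
    by (intro add_mono mult_mono power_mono mult_left_mono) (auto simp: wN_eq)
  also have "\<dots> = 3 * wN w ^ 2" by (simp add: power2_eq_square)
  finally have "num_clauses (wcnf w) \<le> 3 * wN w ^ 2" by simp
  then have "real (num_clauses (wcnf w)) \<le> real (3 * wN w ^ 2)" by (rule of_nat_mono)
  then show ?thesis
    unfolding horn_3cnf_input_def using C.cnf_on_horn_cnf[of C.Ps "wr w"] C.pure_horn_horn_cnf[of C.Ps "wr w"]
      C.is_3cnf_horn_cnf[of C.Ps "wr w"] by (simp add: wcnf_eq wN_eq)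
qed

lemma wthr: "2 ^ wthr w \<le> wr w * (wA w * wX w)" "wr w * (wA w * wX w) < 2 * 2 ^ wthr w"
proof -
  let ?m = "wr w * (wA w * wX w)"
  have "0 < ?m" using C.X_pos C.Q_gt(8) l_ge by (simp add: wr_eq wX_eq wA_def)
  then have "length (bin ?m) > 0" using length_bin_le_iff[of ?m 0] by simp
  then have s: "length (bin ?m) = Suc (wthr w)" by (simp add: wthr_def)
  show "2 ^ wthr w \<le> ?m" using length_bin_le_iff[of ?m "wthr w"] s by simp
  show "?m < 2 * 2 ^ wthr w" using length_bin_le_iff[of ?m "Suc (wthr w)"] s by simp
qed

text \<open>The selectors are \<open>C.fnum ^ 14\<close> in number and dominate. The lower bound by
  \<open>l\<close> allows asymptotic estimates in the number of variables to be used as soon as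
  \<open>l\<close> is large.\<close>

lemma wN_bounds: "l \<le> wN w" "wN w \<le> 2 ^ (15 * l ^ 4)"
proof -
  have "l < 2 ^ l" by (rule less_exp)
  also have "\<dots> \<le> p ^ l" using p_gt_1 by (intro power_mono) auto
  also have "\<dots> \<le> C.fnum" using C.Q_gt(4) by (simp add: C.X_def)
  also have "\<dots> \<le> C.fnum ^ 7" by (rule self_le_power) (use C.Q_gt(8) in auto)
  finally show "l \<le> wN w" by (simp add: wN_eq)
  have "C.fnum ^ 7 \<le> C.fnum ^ 14" using C.Q_gt(8) by (intro power_increasing) auto
  then have "wN w \<le> 2 * C.fnum ^ 14" by (simp add: wN_eq wr_eq power_mult[symmetric])
  also have "C.fnum ^ 14 \<le> (2 ^ (l ^ 4)) ^ 14"
    unfolding C.fnum_def by (intro power_mono power_p_le) auto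
  also have "2 * (2 ^ (l ^ 4)) ^ 14 = (2::nat) ^ (l ^ 4 * 14 + 1)" by (simp add: power_mult)
  also have "\<dots> \<le> 2 ^ (15 * l ^ 4)" using l_ge by (intro power_increasing) (auto simp: Suc_le_eq)
  finally show "wN w \<le> 2 ^ (15 * l ^ 4)" by simp
qed

end


section \<open>Growth rates\<close>

text \<open>On the scale of exponents \<open>(log n) powr (1 / 10)\<close> is compared with
  \<open>log n\<close> divided by a power of \<open>log (log n)\<close>, and the latter
  wins.\<close>

lemma mu_in_smallo:
  assumes "T \<in> mu 10" "C \<ge> 1"
  shows "T \<in> o(\<lambda>n. 2 powr (real n powr (1 / (log 2 (log 2 (real n)) powr C))))"
proof -
  let ?g = "\<lambda>n::nat. (2 powr (log 2 (real n) powr (1 / 10)) / 8) powr (1 / 2)"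
  let ?h = "\<lambda>n::nat. real n powr (1 / (log 2 (log 2 (real n)) powr C))"
  obtain \<tau> where T: "T = (\<lambda>n. 2 powr \<tau> n)" and \<tau>: "\<tau> \<in> o(?g)" using assms(1) by (auto simp: mu_def)
  have "eventually (\<lambda>n. norm (\<tau> n) \<le> 1 * norm (?g n)) sequentially"
    by (rule landau_o.smallD[OF \<tau>]) simp
  then have 1: "eventually (\<lambda>n. T n \<le> 2 powr ?g n) sequentially"
    by eventually_elim (auto simp: T intro!: powr_mono)
  have 2: "(\<lambda>n. 2 powr ?g n) \<in> o(\<lambda>n. 2 powr ?h n)"
    using assms(2) by real_asymp
  have "T \<in> O(\<lambda>n. 2 powr ?g n)"
    by (rule landau_o.big_mono) (use 1 in \<open>auto simp: T elim: eventually_mono\<close>)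
  then show ?thesis using 2 by (rule landau_o.big_small_trans)
qed

lemma polylog_exponent_bigo:
  assumes "\<delta> > 0" "c > 0"
  shows "(\<lambda>n. 2 powr (c * (L + log 2 (real n)) ^ 5)) \<in> O(\<lambda>n. 2 powr (\<delta> * real n))"
  using assms by real_asymp

lemma sqrt_exponent_bigo:
  assumes "\<delta> > 0"
  shows "(\<lambda>n. 2 powr (2 powr sqrt (L + log 2 (real n)))) \<in> O(\<lambda>n. 2 powr (\<delta> * real n))"
  using assms by real_asymp

lemma const_bigo:
  assumes "\<delta> > 0"
  shows "(\<lambda>n. 1) \<in> O(\<lambda>n. 2 powr (\<delta> * real n))"
  using assms by real_asymp

text \<open>After taking logarithms this is \<open>26 * (l + 1) ^ 3 * log 2 l \<le> l ^ 4\<close>.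
  For a prime up to \<open>l ^ 26\<close> it bounds the number of polynomials on a flat by
  \<open>2 ^ (l ^ 4)\<close>.\<close>

lemma eventually_power_le: "eventually (\<lambda>l. (l ^ 26) ^ (Suc l ^ 3) \<le> (2::nat) ^ (l ^ 4)) sequentially"
proof -
  have "eventually (\<lambda>l. 26 * (real l + 1) ^ 3 * log 2 (real l) \<le> real l ^ 4) sequentially"
    by real_asymp
  then show ?thesis using eventually_gt_at_top[of 0]
  proof eventually_elim
    case (elim l)
    have "real ((l ^ 26) ^ (Suc l ^ 3)) = 2 powr log 2 ((real l ^ 26) ^ (Suc l ^ 3))" using elim by simp
    also have "log 2 ((real l ^ 26) ^ (Suc l ^ 3)) = real (Suc l ^ 3) * (26 * log 2 (real l))"
      using elim by (simp add: log_nat_power)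
    also have "\<dots> = 26 * (real l + 1) ^ 3 * log 2 (real l)" by (simp add: add.commute)
    also have "2 powr \<dots> \<le> 2 powr (real (l ^ 4))" using elim by (intro powr_mono) auto
    also have "\<dots> = real (2 ^ (l ^ 4))" by (subst powr_realpow) auto
    finally show ?case by (simp only: of_nat_le_iff)
  qed
qed


section \<open>Refuting the hypothesis\<close>

lemma length_concat_le: "(\<And>x. x \<in> set xs \<Longrightarrow> length (g x) \<le> b) \<Longrightarrow> length (concat (map g xs)) \<le> length xs * b"
  by (induction xs) (auto simp: add_mono)

text \<open>The clauses differ pairwise as sets, so there are at most as many as lists of length up
  to 3 over \<open>2 * n\<close> literals.\<close>

lemma length_3cnf:
  assumes "cnf_on n \<phi>" "is_kcnf 3 \<phi>"
  shows "length \<phi> \<le> 4 * (2 * n + 1) ^ 3"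
proof -
  define V where "V = Pos ` {..<n} \<union> Neg ` {..<n}"
  have finV: "finite V" by (simp add: V_def)
  have cV: "card V \<le> 2 * n"
  proof -
    have "card V \<le> card (Pos ` {..<n}) + card (Neg ` {..<n})" unfolding V_def by (rule card_Un_le)
    also have "\<dots> \<le> n + n" by (intro add_mono) (metis card_image_le card_lessThan finite_lessThan)+
    finally show ?thesis by simp
  qed
  have "set C \<subseteq> V \<and> length C \<le> 3" if "C \<in> set \<phi>" for C
  proof -
    have "L \<in> V" if "L \<in> set C" for L
      using assms(1) \<open>C \<in> set \<phi>\<close> that by (cases L) (force simp: cnf_on_def V_def)+
    then show ?thesis using assms(2) that by (auto simp: is_kcnf_def)
  qed
  then have sub: "set (map set \<phi>) \<subseteq> set ` {C. set C \<subseteq> V \<and> length C \<le> 3}" by auto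
  have "length \<phi> = card (set (map set \<phi>))" using assms(1) by (metis cnf_on_def distinct_card length_map)
  also have "\<dots> \<le> card (set ` {C. set C \<subseteq> V \<and> length C \<le> 3})"
    by (intro card_mono sub finite_imageI finite_lists_length_le finV)
  also have "\<dots> \<le> card {C. set C \<subseteq> V \<and> length C \<le> 3}"
    by (intro card_image_le finite_lists_length_le finV)
  also have "\<dots> = (\<Sum>i\<le>3. card V ^ i)" by (rule card_lists_length_le[OF finV])
  also have "\<dots> \<le> (\<Sum>i\<le>(3::nat). (2 * n + 1) ^ 3)"
  proof (rule sum_mono)
    fix i :: nat assume "i \<in> {..3}"
    have "card V ^ i \<le> (2 * n + 1) ^ i" using cV by (intro power_mono) auto
    also have "\<dots> \<le> (2 * n + 1) ^ 3" using \<open>i \<in> {..3}\<close> by (intro power_increasing) auto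
    finally show "card V ^ i \<le> (2 * n + 1) ^ 3" .
  qed
  finally show ?thesis by simp
qed

lemma length_bin_mono: "a \<le> b \<Longrightarrow> length (bin a) \<le> length (bin b)"
  using length_bin_le_iff[of a "length (bin b)"] bin_less[of b] by simp

lemma length_enc_3cnf:
  assumes "cnf_on n \<phi>" "is_kcnf 3 \<phi>"
  shows "length (enc_cnf n \<phi>) \<le> 2 ^ ((6 + length (bin n)) ^ 5)"
proof -
  define k where "k = length (bin n)"
  have n: "n < 2 ^ k" unfolding k_def by (rule bin_less)
  have L: "length (enc_lit L) \<le> 1 + k" if "C \<in> set \<phi>" "L \<in> set C" for C L
  proof -
    have "lit_var L < n" using assms(1) that by (auto simp: cnf_on_def)
    then have "length (bin (lit_var L)) \<le> k" unfolding k_def by (intro length_bin_mono) simp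
    then show ?thesis by (cases L) auto
  qed
  have C: "length (5 # concat (map enc_lit C)) \<le> 4 + 3 * k" if C: "C \<in> set \<phi>" for C
  proof -
    have "length (concat (map enc_lit C)) \<le> length C * (1 + k)" by (rule length_concat_le) (rule L[OF C])
    also have "\<dots> \<le> 3 * (1 + k)" using assms(2) C by (intro mult_right_mono) (auto simp: is_kcnf_def)
    finally show ?thesis by simp
  qed
  have "length (concat (map (\<lambda>C. 5 # concat (map enc_lit C)) \<phi>)) \<le> length \<phi> * (4 + 3 * k)"
    by (rule length_concat_le) (rule C)
  also have "\<dots> \<le> 4 * (2 * n + 1) ^ 3 * (4 + 3 * k)" by (intro mult_right_mono length_3cnf assms) simp
  also have "\<dots> \<le> 4 * (2 * 2 ^ k) ^ 3 * (4 * 2 ^ k)"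
  proof (intro mult_mono power_mono)
    show "2 * n + 1 \<le> 2 * 2 ^ k" using n by linarith
    have "k < 2 ^ k" by (rule less_exp)
    then show "4 + 3 * k \<le> 4 * 2 ^ k" by linarith
  qed auto
  also have "\<dots> = 2 ^ (4 * k + 7)" by (simp add: power_mult_distrib power_add power_mult[symmetric] mult.commute)
    (simp add: power_add[symmetric])
  finally have "length (enc_cnf n \<phi>) \<le> k + 2 ^ (4 * k + 7)" by (simp add: enc_cnf_def k_def)
  also have "\<dots> \<le> 2 ^ (4 * k + 7) + 2 ^ (4 * k + 7)"
    using less_exp[of "4 * k + 7"] by linarith
  also have "\<dots> = 2 ^ (4 * k + 8)" by (simp add: power_add)
  also have "\<dots> \<le> 2 ^ ((6 + k) ^ 5)"
  proof (intro power_increasing)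
    have "4 * k + 8 \<le> (6 + k) * 6" by simp
    also have "\<dots> \<le> (6 + k) * (6 + k) ^ 4"
      by (intro mult_left_mono order_trans[OF _ self_le_power]) auto
    also have "\<dots> = (6 + k) ^ 5" using power_Suc[of "6 + k" 4] by simp
    finally show "4 * k + 8 \<le> (6 + k) ^ 5" .
  qed simp
  finally show ?thesis by (simp add: k_def)
qed

lemma log_growth:
  assumes "real N \<le> 2 ^ (15 * l ^ 4)" "1 \<le> N"
  shows "log 2 (real N) \<le> 15 * real l ^ 4"
proof -
  have "log 2 (real N) \<le> log 2 (2 ^ (15 * l ^ 4))" using assms by (subst log_le_cancel_iff) auto
  also have "\<dots> = real (15 * l ^ 4)" by (subst log_pow_cancel) auto
  finally show ?thesis by simp
qed

text \<open>From \<open>log N \<le> 15 * l ^ 4 \<le> l ^ 5\<close> the exponent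
  \<open>1 / 10\<close> leaves \<open>sqrt l\<close>; the division by 8 and the outer square root
  are simply dropped.\<close>

lemma mu_bound:
  assumes T: "T \<in> mu 10"
  shows "\<exists>m. \<forall>N l. m \<le> N \<and> 15 \<le> l \<and> N \<le> 2 ^ (15 * l ^ 4) \<longrightarrow> T N \<le> 2 powr (2 powr sqrt (real l))"
proof -
  let ?g = "\<lambda>n::nat. (2 powr (log 2 (real n) powr (1 / 10)) / 8) powr (1 / 2)"
  obtain \<tau> where T: "T = (\<lambda>n. 2 powr \<tau> n)" and \<tau>: "\<tau> \<in> o(?g)" using assms(1) by (auto simp: mu_def)
  have "eventually (\<lambda>n. norm (\<tau> n) \<le> 1 * norm (?g n)) sequentially"
    by (rule landau_o.smallD[OF \<tau>]) simp
  then obtain m where m: "\<And>n. n \<ge> m \<Longrightarrow> norm (\<tau> n) \<le> 1 * norm (?g n)" by (auto simp: eventually_sequentially)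
  have "T N \<le> 2 powr (2 powr sqrt (real l))" if h: "max m 1 \<le> N" "15 \<le> l" "N \<le> 2 ^ (15 * l ^ 4)" for N l
  proof -
    have "real N \<le> 2 ^ (15 * l ^ 4)" using h(3) by (metis of_nat_le_iff of_nat_numeral of_nat_power)
    then have "log 2 (real N) \<le> 15 * real l ^ 4" using h(1) by (intro log_growth) auto
    also have "\<dots> \<le> real l * real l ^ 4" using h(2) by (intro mult_right_mono) auto
    also have "\<dots> = real l powr 5" using h(2) by (subst powr_numeral) (auto simp: eval_nat_numeral)
    finally have "log 2 (real N) powr (1 / 10) \<le> (real l powr 5) powr (1 / 10)"
      using h(1) by (intro powr_mono2) auto
    also have "\<dots> = sqrt (real l)" unfolding powr_powr by (simp add: powr_half_sqrt)
    finally have "2 powr (log 2 (real N) powr (1 / 10)) / 8 \<le> 2 powr sqrt (real l) / 8" by simp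
    also have "\<dots> \<le> 2 powr sqrt (real l)" by simp
    finally have "?g N \<le> (2 powr sqrt (real l)) powr (1 / 2)" by (intro powr_mono2) auto
    also have "\<dots> \<le> (2 powr sqrt (real l)) powr 1" by (intro powr_mono) (auto simp: ge_one_powr_ge_zero)
    finally have "\<tau> N \<le> 2 powr sqrt (real l)" using m[of N] h(1) by simp
    then show ?thesis by (simp add: T)
  qed
  then show ?thesis by (intro exI[of _ "max m 1"]) blast
qed

lemma log_factor_bound:
  assumes f: "f \<in> O(\<lambda>n. log 2 (real n))"
  shows "\<exists>m. \<forall>N l. m \<le> N \<and> m \<le> l \<and> N \<le> 2 ^ (15 * l ^ 4) \<longrightarrow> 16 * f N \<le> real l ^ 5"
proof -
  obtain c where c: "c > 0" "eventually (\<lambda>n. norm (f n) \<le> c * norm (log 2 (real n))) sequentially"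
    using landau_o.bigE[OF f] by blast
  then obtain m where m: "\<And>n. n \<ge> m \<Longrightarrow> \<bar>f n\<bar> \<le> c * \<bar>log 2 (real n)\<bar>" by (auto simp: eventually_sequentially)
  \<comment> \<open>The number 240 is 16 times the 15 from
    \<open>log N \<le> 15 * l ^ 4\<close>.\<close>
  define k where "k = max (max m 1) (nat \<lceil>240 * c\<rceil>)"
  have "16 * f N \<le> real l ^ 5" if h: "k \<le> N" "k \<le> l" "N \<le> 2 ^ (15 * l ^ 4)" for N l
  proof -
    have N: "m \<le> N" "1 \<le> N" "240 * c \<le> real l" using h(1,2) by (auto simp: k_def nat_le_iff ceiling_le_iff)
    have "real N \<le> 2 ^ (15 * l ^ 4)" using h(3) by (metis of_nat_le_iff of_nat_numeral of_nat_power)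
    then have lg: "log 2 (real N) \<le> 15 * real l ^ 4" using N(2) by (intro log_growth) auto
    have "f N \<le> c * log 2 (real N)" using m[OF N(1)] N(2) by simp
    also have "\<dots> \<le> c * (15 * real l ^ 4)" using lg c(1) by (intro mult_left_mono) auto
    finally have "16 * f N \<le> 240 * c * real l ^ 4" by simp
    also have "\<dots> \<le> real l * real l ^ 4" using N(3) by (intro mult_right_mono) auto
    finally show ?thesis by (simp add: eval_nat_numeral)
  qed
  then show ?thesis by (intro exI[of _ k]) blast
qed

lemma length_bin_le_log: "1 \<le> n \<Longrightarrow> real (length (bin n)) \<le> 1 + log 2 (real n)"
proof -
  assume n: "1 \<le> n"
  then have "\<not> length (bin n) \<le> length (bin n) - 1" using length_bin_le_iff[of n 0] by (auto simp: not_le)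
  then have "2 ^ (length (bin n) - 1) \<le> n" using length_bin_le_iff[of n "length (bin n) - 1"] by simp
  then have "real (length (bin n) - 1) \<le> log 2 (real n)" by (intro le_log2_of_power)
  then show ?thesis by linarith
qed

lemma total_time_bigo:
  fixes c l0 :: nat
  assumes "\<delta> > 0"
  shows "(\<lambda>n. 12 * real ((2 ^ ((l0 + length (bin n)) ^ 5)) ^ c) +
     6 * 2 powr (2 powr sqrt (real (l0 + length (bin n)))) + 20) \<in> O(\<lambda>n. 2 powr (\<delta> * real n))"
proof -
  let ?O = "O(\<lambda>n. 2 powr (\<delta> * real n)) :: (nat \<Rightarrow> real) set"
  let ?L = "real l0 + 1"
  have ev: "eventually (\<lambda>n::nat. n \<ge> 1) sequentially" by (rule eventually_ge_at_top)
  have le: "real (l0 + length (bin n)) \<le> ?L + log 2 (real n)" if "n \<ge> 1" for n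
    using length_bin_le_log[OF that] by simp
  have "(\<lambda>n. real ((2 ^ ((l0 + length (bin n)) ^ 5)) ^ c)) \<in> O(\<lambda>n. 2 powr (real (Suc c) * (?L + log 2 (real n)) ^ 5))"
  proof (rule landau_o.big_mono, rule eventually_mono[OF ev])
    fix n :: nat assume n: "1 \<le> n"
    have "real ((2 ^ ((l0 + length (bin n)) ^ 5)) ^ c) = 2 powr real ((l0 + length (bin n)) ^ 5 * c)"
      by (subst powr_realpow) (auto simp: power_mult)
    also have "\<dots> \<le> 2 powr (real (Suc c) * (?L + log 2 (real n)) ^ 5)"
    proof (rule powr_mono)
      have "real (l0 + length (bin n)) ^ 5 \<le> (?L + log 2 (real n)) ^ 5" by (rule power_mono[OF le[OF n]]) simp
      then have "real c * real (l0 + length (bin n)) ^ 5 \<le> real (Suc c) * (?L + log 2 (real n)) ^ 5"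
        by (intro mult_mono) auto
      then show "real ((l0 + length (bin n)) ^ 5 * c) \<le> real (Suc c) * (?L + log 2 (real n)) ^ 5"
        by (simp add: mult.commute)
    qed simp
    finally show "norm (real ((2 ^ ((l0 + length (bin n)) ^ 5)) ^ c)) \<le> norm (2 powr (real (Suc c) * (?L + log 2 (real n)) ^ 5))"
      by simp
  qed
  then have 1: "(\<lambda>n. real ((2 ^ ((l0 + length (bin n)) ^ 5)) ^ c)) \<in> ?O"
    by (rule landau_o.big_trans) (rule polylog_exponent_bigo, use assms in auto)
  have "(\<lambda>n. 2 powr (2 powr sqrt (real (l0 + length (bin n))))) \<in> O(\<lambda>n. 2 powr (2 powr sqrt (?L + log 2 (real n))))"
    by (rule landau_o.big_mono, rule eventually_mono[OF ev]) (use le in \<open>auto intro!: powr_mono real_sqrt_le_mono\<close>)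
  then have 2: "(\<lambda>n. 2 powr (2 powr sqrt (real (l0 + length (bin n))))) \<in> ?O"
    by (rule landau_o.big_trans) (rule sqrt_exponent_bigo[OF assms])
  have 3: "(\<lambda>n. 20 * 1) \<in> ?O" by (subst landau_o.big.cmult_in_iff) (use const_bigo[OF assms] in auto)
  show ?thesis using 1 2 3 by (intro sum_in_bigo) auto
qed

context reduction_instance begin

text \<open>The two cases are a factor of \<open>l ^ 5 / 8\<close> apart, and rounding the threshold
  to a power of 2 loses another factor 2; this accounts for the 16.\<close>

lemma threshold_decides:
  assumes QN: "\<Q> \<in> {UNIV, {\<psi>. is_kcnf 3 \<psi>}}" "\<N> \<in> {num_clauses, num_literals}"
    and v: "min_pure_horn \<Q> \<N> (wN w) (cnf_fun (wcnf w)) \<le> v"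
      "real v \<le> \<rho> * real (min_pure_horn \<Q> \<N> (wN w) (cnf_fun (wcnf w)))"
    and \<rho>: "16 * \<rho> \<le> real l ^ 5"
  shows "length (bin v) \<le> wthr w \<longleftrightarrow> satisfiable \<phi>"
proof (cases "satisfiable \<phi>")
  case True
  let ?m = "real (wr w * wX w)"
  let ?opt = "real (min_pure_horn \<Q> \<N> (wN w) (cnf_fun (wcnf w)))"
  have o: "?opt \<le> 8 * ?m" using satisfiable_upper_bound[OF True QN] by linarith
  have "16 * real v \<le> 16 * \<rho> * ?opt" using v(2) by simp
  also have "\<dots> \<le> real l ^ 5 * ?opt" using \<rho> by (intro mult_right_mono) auto
  also have "\<dots> \<le> real l ^ 5 * (8 * ?m)" using o by (intro mult_left_mono) auto
  also have "\<dots> = 8 * real (wr w * (wA w * wX w))" by (simp add: wA_def)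
  also have "\<dots> < 8 * real (2 * 2 ^ wthr w)" using wthr(2) by (simp only: of_nat_less_iff mult_less_cancel_left_pos zero_less_numeral)
  finally have "real v < real (2 ^ wthr w)" by simp
  then have "v < 2 ^ wthr w" by (simp only: of_nat_less_iff)
  then show ?thesis using True length_bin_le_iff by blast
next
  case False
  have "2 ^ wthr w \<le> v" using wthr(1) unsatisfiable_lower_bound[OF False QN] v(1) by linarith
  then show ?thesis using False length_bin_le_iff[of v "wthr w"] by simp
qed

end

text \<open>The composed machine prints the Horn formula, runs the assumed algorithm on it and
  compares the length of the answer with the threshold. Its time is polynomial in \<open>wB\<close>,
  plus a multiple of the time of the algorithm on \<open>wN\<close> variables, and both parts are
  subexponential.\<close>

lemma approximation_refutes_ETH:
  assumes "wf_tm M" and T: "T \<in> mu 10" and f: "f \<in> O(\<lambda>n. log 2 (real n))"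
    and QN: "\<Q> \<in> {UNIV, {\<psi>. is_kcnf 3 \<psi>}}" "\<N> \<in> {num_clauses, num_literals}"
    and M: "approximates_in M (horn_3cnf_input 3) (\<lambda>n \<phi>. min_pure_horn \<Q> \<N> n (cnf_fun \<phi>)) f T"
    and "\<delta> > 0"
  shows "\<exists>M' T'. wf_tm M' \<and> T' \<in> O(\<lambda>n. 2 powr (\<delta> * real n)) \<and> decides_ksat_in M' 3 T'"
proof -
  obtain m1 where m1: "\<And>l. m1 \<le> l \<Longrightarrow> (l ^ 26) ^ (Suc l ^ 3) \<le> (2::nat) ^ (l ^ 4)"
    using eventually_power_le by (auto simp: eventually_sequentially)
  obtain m2 where m2: "\<And>N l. m2 \<le> N \<Longrightarrow> 15 \<le> l \<Longrightarrow> N \<le> 2 ^ (15 * l ^ 4) \<Longrightarrow> T N \<le> 2 powr (2 powr sqrt (real l))"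
    using mu_bound[OF T] by blast
  obtain m3 where m3: "\<And>N l. m3 \<le> N \<Longrightarrow> m3 \<le> l \<Longrightarrow> N \<le> 2 ^ (15 * l ^ 4) \<Longrightarrow> 16 * f N \<le> real l ^ 5"
    using log_factor_bound[OF f] by blast
  \<comment> \<open>Since \<open>l \<ge> l0\<close> for every input, however small, and
    \<open>wN w \<ge> l\<close>, all asymptotic estimates apply from the outset and no finite set of
    exceptions remains.\<close>
  define l0 where "l0 = m1 + m2 + m3 + 15"
  have l0: "6 \<le> l0" "m1 \<le> l0" "m2 \<le> l0" "m3 \<le> l0" "15 \<le> l0" by (auto simp: l0_def)
  interpret reduction l0
  proof
    show "6 \<le> l0" by (rule l0)
    show "(l ^ 26) ^ (Suc l ^ 3) \<le> 2 ^ (l ^ 4)" if "l0 \<le> l" for l using m1[of l] l0 that by linarith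
    fix n \<phi> assume "cnf_on n \<phi>" "is_kcnf 3 \<phi>"
    then have "length (enc_cnf n \<phi>) \<le> 2 ^ ((6 + length (bin n)) ^ 5)" by (rule length_enc_3cnf)
    also have "\<dots> \<le> 2 ^ ((l0 + length (bin n)) ^ 5)" using l0 by (intro power_increasing power_mono) auto
    finally show "length (enc_cnf n \<phi>) \<le> 2 ^ ((l0 + length (bin n)) ^ 5)" .
  qed
  interpret S: simulation M by standard (rule assms(1))
  obtain \<omega> i c1 where \<omega>: "closed_wexp i \<omega>" "\<And>w x. w \<in> W \<Longrightarrow> weval \<omega> w x = enc_cnf (wN w) (wcnf w)"
    "\<And>w x. w \<in> W \<Longrightarrow> wcost \<omega> w x \<le> bd c1 w x"
    using feasible_word_output unfolding feasible_word_def pb_def by blast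
  obtain e j c2 where e: "closed_rexp j e" "\<And>w x. w \<in> W \<Longrightarrow> eval e w x = wthr w"
    "\<And>w x. w \<in> W \<Longrightarrow> cost e w x \<le> bd c2 w x"
    using feasible_wthr unfolding feasible_def pb_def by blast
  obtain M' where M': "wf_tm M'" "\<And>w v t. 0 \<notin> set w \<Longrightarrow> (\<forall>s\<in>set (weval \<omega> w (\<lambda>_. 0)). s < 6) \<Longrightarrow>
     halted_with ((step M ^^ t) (init_config M (weval \<omega> w (\<lambda>_. 0)))) v \<Longrightarrow>
     outputs_within M' w (if length v \<le> eval e w (\<lambda>_. 0) then [2] else [1])
       (real (6 * wcost \<omega> w (\<lambda>_. 0) + 6 * cost e w (\<lambda>_. 0) + 6 * t + 20))"
    using S.machine_composition[OF \<omega>(1) e(1)] by blast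
  define c where "c = max c1 c2"
  define T' where "T' n = 12 * real ((2 ^ ((l0 + length (bin n)) ^ 5)) ^ c) +
     6 * 2 powr (2 powr sqrt (real (l0 + length (bin n)))) + 20" for n
  have "decides_ksat_in M' 3 T'"
    unfolding decides_ksat_in_def
  proof (intro allI impI, elim conjE)
    fix n \<phi> assume \<phi>: "cnf_on n \<phi>" "is_kcnf 3 \<phi>"
    interpret I: reduction_instance l0 n \<phi> by standard (rule \<phi>)+
    let ?w = "enc_cnf n \<phi>"
    have l: "l0 \<le> wl ?w" "wl ?w \<le> wN ?w" using I.l_ge(2) I.wN_bounds(1) by simp_all
    obtain v t where v: "real t \<le> T (wN ?w)" "halted_with ((step M ^^ t) (init_config M (enc_cnf (wN ?w) (wcnf ?w)))) (bin v)"
       "min_pure_horn \<Q> \<N> (wN ?w) (cnf_fun (wcnf ?w)) \<le> v"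
       "real v \<le> f (wN ?w) * real (min_pure_horn \<Q> \<N> (wN ?w) (cnf_fun (wcnf ?w)))"
      using M I.wcnf_input unfolding approximates_in_def outputs_within_def by blast
    have "16 * f (wN ?w) \<le> real (wl ?w) ^ 5" using l l0 by (intro m3 I.wN_bounds(2)) linarith+
    then have dec: "length (bin v) \<le> wthr ?w \<longleftrightarrow> satisfiable \<phi>" by (rule I.threshold_decides[OF QN v(3,4)])
    have s1: "0 \<notin> set ?w" using set_enc_cnf[of n \<phi>] by auto
    have s2: "\<forall>s\<in>set (enc_cnf (wN ?w) (wcnf ?w)). s < 6" using set_enc_cnf[of "wN ?w" "wcnf ?w"] by auto
    have "outputs_within M' ?w (if satisfiable \<phi> then [2] else [1])
       (real (6 * wcost \<omega> ?w (\<lambda>_. 0) + 6 * cost e ?w (\<lambda>_. 0) + 6 * t + 20))"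
      using M'(2)[OF s1, of t "bin v"] s2 v(2) dec by (simp add: \<omega>(2)[OF I.w_in] e(2)[OF I.w_in])
    moreover have "real (6 * wcost \<omega> ?w (\<lambda>_. 0) + 6 * cost e ?w (\<lambda>_. 0) + 6 * t + 20) \<le> T' n"
    proof -
      have b: "bd c' ?w (\<lambda>_. 0) \<le> (2 ^ ((l0 + length (bin n)) ^ 5)) ^ c" if "c' \<le> c" for c'
        using bd_mono[OF I.w_in that, of "\<lambda>_. 0"] I.l_eq by (simp add: bd_def wB_def)
      have "wcost \<omega> ?w (\<lambda>_. 0) \<le> (2 ^ ((l0 + length (bin n)) ^ 5)) ^ c"
        using order_trans[OF \<omega>(3)[OF I.w_in] b[of c1]] by (simp add: c_def)
      moreover have "cost e ?w (\<lambda>_. 0) \<le> (2 ^ ((l0 + length (bin n)) ^ 5)) ^ c"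
        using order_trans[OF e(3)[OF I.w_in] b[of c2]] by (simp add: c_def)
      ultimately have "6 * wcost \<omega> ?w (\<lambda>_. 0) + 6 * cost e ?w (\<lambda>_. 0) \<le> 12 * (2 ^ ((l0 + length (bin n)) ^ 5)) ^ c"
        by linarith
      then have "real (6 * wcost \<omega> ?w (\<lambda>_. 0) + 6 * cost e ?w (\<lambda>_. 0)) \<le> real (12 * (2 ^ ((l0 + length (bin n)) ^ 5)) ^ c)"
        by (rule of_nat_mono)
      moreover have "T (wN ?w) \<le> 2 powr (2 powr sqrt (real (wl ?w)))"
        using l l0 by (intro m2 I.wN_bounds(2)) linarith+
      ultimately show ?thesis using v(1) unfolding T'_def I.l_eq by simp
    qed
    ultimately show "outputs_within M' ?w (if satisfiable \<phi> then [2] else [1]) (T' n)"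
      unfolding outputs_within_def by (meson order_trans)
  qed
  moreover have "T' \<in> O(\<lambda>n. 2 powr (\<delta> * real n))"
    unfolding T'_def by (rule total_time_bigo[OF \<open>\<delta> > 0\<close>])
  ultimately show ?thesis using M'(1) by blast
qed

theorem theorem6:
  assumes "ETH"
  shows "\<exists>\<alpha>::real. \<alpha> > 1 \<and>
    (\<forall>T\<in>mu \<alpha>. \<forall>C::real. C \<ge> 1 \<longrightarrow>
       T \<in> o(\<lambda>n. 2 powr (real n powr (1 / (log 2 (log 2 (real n)) powr C))))) \<and>
    (\<exists>K::real. \<forall>T\<in>mu \<alpha>. \<forall>f\<in>O(\<lambda>n. log 2 (real n)).
       \<forall>R\<in>{UNIV, {\<psi>. is_kcnf 3 \<psi>}}. \<forall>N\<in>{num_clauses, num_literals}.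
         \<not> (\<exists>M. wf_tm M \<and>
               approximates_in M (horn_3cnf_input K)
                 (\<lambda>n \<phi>. min_pure_horn R N n (cnf_fun \<phi>)) f T))"
proof (rule exI[of _ 10], intro conjI)
  show "\<forall>T\<in>mu 10. \<forall>C::real. C \<ge> 1 \<longrightarrow>
       T \<in> o(\<lambda>n. 2 powr (real n powr (1 / (log 2 (log 2 (real n)) powr C))))"
    using mu_in_smallo by blast
  show "\<exists>K::real. \<forall>T\<in>mu 10. \<forall>f\<in>O(\<lambda>n. log 2 (real n)).
       \<forall>R\<in>{UNIV, {\<psi>. is_kcnf 3 \<psi>}}. \<forall>N\<in>{num_clauses, num_literals}.
         \<not> (\<exists>M. wf_tm M \<and>
               approximates_in M (horn_3cnf_input K)
                 (\<lambda>n \<phi>. min_pure_horn R N n (cnf_fun \<phi>)) f T)"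
  proof (intro exI[of _ 3] ballI notI, elim exE conjE)
    fix T f Q N M
    assume a: "T \<in> mu 10" "f \<in> O(\<lambda>n. log 2 (real n))" "Q \<in> {UNIV, {\<psi>. is_kcnf 3 \<psi>}}"
      "N \<in> {num_clauses, num_literals}" "wf_tm M"
      "approximates_in M (horn_3cnf_input 3) (\<lambda>n \<phi>. min_pure_horn Q N n (cnf_fun \<phi>)) f T"
    \<comment> \<open>Every positive exponent is attained for 3-SAT, so the infimum is at most 0,
      against the hypothesis for \<open>k = 3\<close>.\<close>
    have "sat_exponent 3 \<le> ereal \<delta>" if "\<delta> > 0" for \<delta>
      unfolding sat_exponent_def
      by (rule INF_lower) (use approximation_refutes_ETH[OF a(5,1,2,3,4,6) that] in blast)
    then have "sat_exponent 3 \<le> 0"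
      by (metis ereal_le_epsilon2 add_0 zero_ereal_def)
    then show False using assms by (auto simp: ETH_def not_le[symmetric])
  qed
qed simp

end
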